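(* Let $L$ be a Dirac structure on a smooth manifold $M$. Then every $x\in M$ has an open neighborhood $U$ on which $$L|_U=\mathcal{R}_{\mathrm{d}\alpha}\,p^!\,\mathrm{Gr}(\pi),$$ where $p:U\to N$ is a surjective submersion with connected fibres onto a smooth manifold $N$, $\pi$ is a Poisson structure on $N$, and $\alpha$ is a one-form on $U$.
   Context: Let $\mathbb{T}M=TM\oplus T^*M$ with the pairing $\langle u+\xi,v+\eta\rangle=\xi(v)+\eta(u)$ and the Dorfman bracket $[u+\xi,v+\eta]=[u,v]+\mathscr{L}_u\eta-\iota_v\mathrm{d}\xi$. A Dirac structure is a vector subbundle $L\subset\mathbb{T}M$ with $L=L^\perp$ and $[\Gamma(L),\Gamma(L)]\subset\Gamma(L)$. For a bivector $\pi$, $\mathrm{Gr}(\pi)=\{\pi^\sharp(\xi)+\xi\}$, with $\pi^\sharp(\xi)=\iota_\xi\pi$. For a smooth map $p:U\to N$ and a Lagrangian subbundle $R\subset\mathbb{T}N$, the pullback is $p^!(R)_x=\{u+p^*\eta\mid u\in T_xU,\ \eta\in T^*_{p(x)}N,\ p_*u+\eta\in R_{p(x)}\}$. For a two-form $\omega$, the gauge transformation is $\mathcal{R}_\omega(u+\xi)=u+\xi+\iota_u\omega$, and $\mathcal{R}_\omega(L)$ denotes the image of $L$. *)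

theory Defs
  imports "HOL-Analysis.Analysis"
begin

section \<open>Smooth functions on open subsets of Euclidean space\<close>

text \<open>
  Euclidean \<open>n\<close>-space is \<^const>\<open>Euclidean_space\<close>\<open> n\<close>, i.e. the functions \<open>nat \<Rightarrow> real\<close>
  vanishing from index \<open>n\<close> on, so that the dimension is a term and manifolds of different
  dimensions can be related within one formula.
\<close>

definition partial_deriv :: "nat \<Rightarrow> ((nat \<Rightarrow> real) \<Rightarrow> real) \<Rightarrow> (nat \<Rightarrow> real) \<Rightarrow> real" where
  "partial_deriv i f x = deriv (\<lambda>t. f (x(i := t))) (x i)"

primrec Ck_on :: "nat \<Rightarrow> nat \<Rightarrow> (nat \<Rightarrow> real) set \<Rightarrow> ((nat \<Rightarrow> real) \<Rightarrow> real) \<Rightarrow> bool" where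
  "Ck_on n 0 W f \<longleftrightarrow> continuous_map (subtopology (Euclidean_space n) W) euclideanreal f"
| "Ck_on n (Suc k) W f \<longleftrightarrow>
     continuous_map (subtopology (Euclidean_space n) W) euclideanreal f \<and>
     (\<forall>i<n. (\<forall>x\<in>W. (\<lambda>t. f (x(i := t))) differentiable (at (x i))) \<and>
             Ck_on n k W (partial_deriv i f))"

definition Cinf_on :: "nat \<Rightarrow> (nat \<Rightarrow> real) set \<Rightarrow> ((nat \<Rightarrow> real) \<Rightarrow> real) \<Rightarrow> bool" where
  "Cinf_on n W f \<longleftrightarrow> (\<forall>k. Ck_on n k W f)"


section \<open>Smooth manifolds\<close>

text \<open>
  A manifold is given by its topological space, its dimension and a smooth atlas (not required
  to be maximal). A chart is a pair of its domain and its coordinate map.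
  The carrier is the topological space, not the whole type; any manifold onto which \<open>M\<close> (or an
  open subset of it) maps surjectively therefore has a diffeomorphic copy over the type of \<open>M\<close>.
\<close>

record 'a manifold =
  mtop :: "'a topology"
  mdim :: nat
  charts :: "('a set \<times> ('a \<Rightarrow> nat \<Rightarrow> real)) set"

definition smooth_manifold :: "'a manifold \<Rightarrow> bool" where
  "smooth_manifold M \<longleftrightarrow>
     Hausdorff_space (mtop M) \<and> second_countable (mtop M) \<and>
     (\<forall>(D, \<phi>) \<in> charts M.
        openin (mtop M) D \<and> openin (Euclidean_space (mdim M)) (\<phi> ` D) \<and>
        homeomorphic_map (subtopology (mtop M) D)
          (subtopology (Euclidean_space (mdim M)) (\<phi> ` D)) \<phi>) \<and>
     (\<Union>(D, \<phi>) \<in> charts M. D) = topspace (mtop M) \<and>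
     (\<forall>(D, \<phi>) \<in> charts M. \<forall>(E, \<psi>) \<in> charts M. \<forall>i<mdim M.
        Cinf_on (mdim M) (\<phi> ` (D \<inter> E)) (\<lambda>z. \<psi> (inv_into D \<phi> z) i))"

definition smooth_on :: "'a manifold \<Rightarrow> 'a set \<Rightarrow> ('a \<Rightarrow> real) \<Rightarrow> bool" where
  "smooth_on M V f \<longleftrightarrow>
     openin (mtop M) V \<and>
     (\<forall>(D, \<phi>) \<in> charts M. Cinf_on (mdim M) (\<phi> ` (D \<inter> V)) (\<lambda>z. f (inv_into D \<phi> z)))"

text \<open>Smoothness on some neighbourhood of the point.\<close>

definition smooth_at :: "'a manifold \<Rightarrow> 'a \<Rightarrow> ('a \<Rightarrow> real) \<Rightarrow> bool" where
  "smooth_at M x f \<longleftrightarrow> (\<exists>V. x \<in> V \<and> smooth_on M V f)"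

definition smooth_map_on :: "'a manifold \<Rightarrow> 'a set \<Rightarrow> 'b manifold \<Rightarrow> ('a \<Rightarrow> 'b) \<Rightarrow> bool" where
  "smooth_map_on M U N p \<longleftrightarrow>
     openin (mtop M) U \<and> continuous_map (subtopology (mtop M) U) (mtop N) p \<and>
     (\<forall>(D, \<phi>) \<in> charts M. \<forall>(E, \<psi>) \<in> charts N. \<forall>i<mdim N.
        Cinf_on (mdim M) (\<phi> ` {x \<in> D \<inter> U. p x \<in> E}) (\<lambda>z. \<psi> (p (inv_into D \<phi> z)) i))"


section \<open>Tangent and cotangent spaces\<close>

text \<open>
  A tangent vector at \<open>x\<close> is a derivation on the functions that are smooth near \<open>x\<close>, extended
  by \<open>0\<close> to all other functions. Derivations depend only on germs, hence the tangent spaces of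
  an open submanifold are literally those of the ambient manifold. Covectors are extended by
  \<open>0\<close> outside the tangent space. Linear operations are pointwise.
\<close>

type_synonym 'a tvec = "('a \<Rightarrow> real) \<Rightarrow> real"
type_synonym 'a covec = "'a tvec \<Rightarrow> real"

definition tangent_space :: "'a manifold \<Rightarrow> 'a \<Rightarrow> 'a tvec set" where
  "tangent_space M x = {v.
     (\<forall>f g a b. smooth_at M x f \<longrightarrow> smooth_at M x g \<longrightarrow>
        v (\<lambda>y. a * f y + b * g y) = a * v f + b * v g) \<and>
     (\<forall>f g. smooth_at M x f \<longrightarrow> smooth_at M x g \<longrightarrow>
        v (\<lambda>y. f y * g y) = f x * v g + g x * v f) \<and>
     (\<forall>f. \<not> smooth_at M x f \<longrightarrow> v f = 0)}"

definition cotangent_space :: "'a manifold \<Rightarrow> 'a \<Rightarrow> 'a covec set" where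
  "cotangent_space M x = {\<xi>.
     (\<forall>v \<in> tangent_space M x. \<forall>w \<in> tangent_space M x. \<forall>a b.
        \<xi> (\<lambda>f. a * v f + b * w f) = a * \<xi> v + b * \<xi> w) \<and>
     (\<forall>v. v \<notin> tangent_space M x \<longrightarrow> \<xi> v = 0)}"

definition differential :: "'a manifold \<Rightarrow> ('a \<Rightarrow> real) \<Rightarrow> 'a \<Rightarrow> 'a covec" where
  "differential M f x = (\<lambda>v. if v \<in> tangent_space M x then v f else 0)"

text \<open>\<open>push_vec N p x\<close> is the map \<open>p\<^sub>*\<close> from the tangent space at \<open>x\<close> to the tangent space of
  \<open>N\<close> at \<open>p x\<close>, and \<open>pull_covec M N p x\<close> is its transpose.\<close>

definition push_vec :: "'b manifold \<Rightarrow> ('a \<Rightarrow> 'b) \<Rightarrow> 'a \<Rightarrow> 'a tvec \<Rightarrow> 'b tvec" where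
  "push_vec N p x v = (\<lambda>g. if smooth_at N (p x) g then v (\<lambda>y. g (p y)) else 0)"

definition pull_covec ::
  "'a manifold \<Rightarrow> 'b manifold \<Rightarrow> ('a \<Rightarrow> 'b) \<Rightarrow> 'a \<Rightarrow> 'b covec \<Rightarrow> 'a covec" where
  "pull_covec M N p x \<eta> = (\<lambda>v. if v \<in> tangent_space M x then \<eta> (push_vec N p x v) else 0)"

definition surjective_submersion ::
  "'a manifold \<Rightarrow> 'a set \<Rightarrow> 'b manifold \<Rightarrow> ('a \<Rightarrow> 'b) \<Rightarrow> bool" where
  "surjective_submersion M U N p \<longleftrightarrow>
     smooth_map_on M U N p \<and> p ` U = topspace (mtop N) \<and>
     (\<forall>x\<in>U. push_vec N p x ` tangent_space M x = tangent_space N (p x))"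


section \<open>Vector fields and differential forms on an open subset\<close>

definition vector_field :: "'a manifold \<Rightarrow> 'a set \<Rightarrow> ('a \<Rightarrow> 'a tvec) \<Rightarrow> bool" where
  "vector_field M U u \<longleftrightarrow>
     openin (mtop M) U \<and> (\<forall>x\<in>U. u x \<in> tangent_space M x) \<and>
     (\<forall>V f. V \<subseteq> U \<longrightarrow> smooth_on M V f \<longrightarrow> smooth_on M V (\<lambda>x. u x f))"

definition one_form :: "'a manifold \<Rightarrow> 'a set \<Rightarrow> ('a \<Rightarrow> 'a covec) \<Rightarrow> bool" where
  "one_form M U \<alpha> \<longleftrightarrow>
     openin (mtop M) U \<and> (\<forall>x\<in>U. \<alpha> x \<in> cotangent_space M x) \<and>
     (\<forall>V w. V \<subseteq> U \<longrightarrow> vector_field M V w \<longrightarrow> smooth_on M V (\<lambda>x. \<alpha> x (w x)))"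

definition extends_vec :: "'a manifold \<Rightarrow> 'a \<Rightarrow> 'a tvec \<Rightarrow> ('a \<Rightarrow> 'a tvec) \<Rightarrow> bool" where
  "extends_vec M x v X \<longleftrightarrow> (\<exists>V. x \<in> V \<and> vector_field M V X) \<and> X x = v"

definition lie_bracket ::
  "'a manifold \<Rightarrow> ('a \<Rightarrow> 'a tvec) \<Rightarrow> ('a \<Rightarrow> 'a tvec) \<Rightarrow> 'a \<Rightarrow> 'a tvec" where
  "lie_bracket M u v x =
     (\<lambda>f. if smooth_at M x f then u x (\<lambda>y. v y f) - v x (\<lambda>y. u y f) else 0)"

text \<open>
  The Lie derivative and the exterior derivative of a one-form are given by
  \<open>(L\<^sub>u \<eta>)(W) = u(\<eta>(W)) - \<eta>([u,W])\<close> and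
  \<open>(d\<alpha>)(X,Y) = X(\<alpha>(Y)) - Y(\<alpha>(X)) - \<alpha>([X,Y])\<close>. These expressions are tensorial in \<open>W\<close>
  and in \<open>X, Y\<close>; their value on tangent vectors at \<open>x\<close> is the common value over all vector
  fields near \<open>x\<close> that extend the given vectors.
\<close>

definition lie_deriv ::
  "'a manifold \<Rightarrow> ('a \<Rightarrow> 'a tvec) \<Rightarrow> ('a \<Rightarrow> 'a covec) \<Rightarrow> 'a \<Rightarrow> 'a covec" where
  "lie_deriv M u \<eta> x = (\<lambda>w. if w \<in> tangent_space M x
     then (THE r. \<forall>W. extends_vec M x w W \<longrightarrow>
             r = u x (\<lambda>y. \<eta> y (W y)) - \<eta> x (lie_bracket M u W x))
     else 0)"

definition ext_deriv ::
  "'a manifold \<Rightarrow> ('a \<Rightarrow> 'a covec) \<Rightarrow> 'a \<Rightarrow> 'a tvec \<Rightarrow> 'a tvec \<Rightarrow> real" where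
  "ext_deriv M \<alpha> x v w = (if v \<in> tangent_space M x \<and> w \<in> tangent_space M x
     then (THE r. \<forall>X Y. extends_vec M x v X \<longrightarrow> extends_vec M x w Y \<longrightarrow>
             r = X x (\<lambda>y. \<alpha> y (Y y)) - Y x (\<lambda>y. \<alpha> y (X y)) - \<alpha> x (lie_bracket M X Y x))
     else 0)"


section \<open>Dirac structures\<close>

text \<open>Elements \<open>u + \<xi>\<close> of the double tangent bundle are represented as pairs \<open>(u, \<xi>)\<close>.\<close>

type_synonym 'a dvec = "'a tvec \<times> 'a covec"

definition double_space :: "'a manifold \<Rightarrow> 'a \<Rightarrow> 'a dvec set" where
  "double_space M x = tangent_space M x \<times> cotangent_space M x"

definition pairing :: "'a dvec \<Rightarrow> 'a dvec \<Rightarrow> real" where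
  "pairing a b = snd a (fst b) + snd b (fst a)"

definition double_section ::
  "'a manifold \<Rightarrow> 'a set \<Rightarrow> ('a \<Rightarrow> 'a dvec) \<Rightarrow> bool" where
  "double_section M U s \<longleftrightarrow> vector_field M U (\<lambda>x. fst (s x)) \<and> one_form M U (\<lambda>x. snd (s x))"

definition dorfman ::
  "'a manifold \<Rightarrow> ('a \<Rightarrow> 'a dvec) \<Rightarrow> ('a \<Rightarrow> 'a dvec) \<Rightarrow> 'a \<Rightarrow> 'a dvec" where
  "dorfman M s t = (let u = (\<lambda>x. fst (s x)); \<xi> = (\<lambda>x. snd (s x));
                        v = (\<lambda>x. fst (t x)); \<eta> = (\<lambda>x. snd (t x)) in
     (\<lambda>x. (lie_bracket M u v x, \<lambda>w. lie_deriv M u \<eta> x w - ext_deriv M \<xi> x (v x) w)))"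

definition lin_comb :: "nat \<Rightarrow> (nat \<Rightarrow> real) \<Rightarrow> (nat \<Rightarrow> 'a dvec) \<Rightarrow> 'a dvec" where
  "lin_comb r c e = (\<lambda>f. \<Sum>i<r. c i * fst (e i) f, \<lambda>v. \<Sum>i<r. c i * snd (e i) v)"

text \<open>A family of subspaces is a vector subbundle if it has smooth local frames.\<close>

definition subbundle :: "'a manifold \<Rightarrow> ('a \<Rightarrow> 'a dvec set) \<Rightarrow> bool" where
  "subbundle M L \<longleftrightarrow>
     (\<forall>x \<in> topspace (mtop M). \<exists>V r s. x \<in> V \<and> openin (mtop M) V \<and>
        (\<forall>i<r. double_section M V (s i)) \<and>
        (\<forall>y\<in>V. L y = range (\<lambda>c. lin_comb r c (\<lambda>i. s i y)) \<and>
                (\<forall>c. lin_comb r c (\<lambda>i. s i y) = (\<lambda>_. 0, \<lambda>_. 0) \<longrightarrow> (\<forall>i<r. c i = 0))))"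

definition orthogonal_space :: "'a manifold \<Rightarrow> 'a \<Rightarrow> 'a dvec set \<Rightarrow> 'a dvec set" where
  "orthogonal_space M x S = {a \<in> double_space M x. \<forall>b\<in>S. pairing a b = 0}"

definition sections :: "'a manifold \<Rightarrow> ('a \<Rightarrow> 'a dvec set) \<Rightarrow> ('a \<Rightarrow> 'a dvec) set" where
  "sections M L = {s. double_section M (topspace (mtop M)) s \<and>
                      (\<forall>x \<in> topspace (mtop M). s x \<in> L x)}"

definition dirac_structure :: "'a manifold \<Rightarrow> ('a \<Rightarrow> 'a dvec set) \<Rightarrow> bool" where
  "dirac_structure M L \<longleftrightarrow>
     subbundle M L \<and>
     (\<forall>x \<in> topspace (mtop M). L x = orthogonal_space M x (L x)) \<and>
     (\<forall>s \<in> sections M L. \<forall>t \<in> sections M L. dorfman M s t \<in> sections M L)"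

definition pullback ::
  "'a manifold \<Rightarrow> 'b manifold \<Rightarrow> ('a \<Rightarrow> 'b) \<Rightarrow> ('b \<Rightarrow> 'b dvec set) \<Rightarrow> 'a \<Rightarrow> 'a dvec set" where
  "pullback M N p R x = {(u, pull_covec M N p x \<eta>) | u \<eta>.
     u \<in> tangent_space M x \<and> \<eta> \<in> cotangent_space N (p x) \<and> (push_vec N p x u, \<eta>) \<in> R (p x)}"

definition gauge_transform :: "('a \<Rightarrow> 'a tvec \<Rightarrow> 'a tvec \<Rightarrow> real) \<Rightarrow> 'a \<Rightarrow> 'a dvec \<Rightarrow> 'a dvec" where
  "gauge_transform \<omega> x = (\<lambda>(u, \<xi>). (u, \<lambda>v. \<xi> v + \<omega> x u v))"


section \<open>Poisson structures\<close>

text \<open>A bivector at \<open>x\<close> is regarded as a skew bilinear form on the cotangent space.\<close>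

definition bivector_field ::
  "'a manifold \<Rightarrow> ('a \<Rightarrow> 'a covec \<Rightarrow> 'a covec \<Rightarrow> real) \<Rightarrow> bool" where
  "bivector_field M \<pi> \<longleftrightarrow>
     (\<forall>x \<in> topspace (mtop M).
        \<forall>\<xi> \<in> cotangent_space M x. \<forall>\<zeta> \<in> cotangent_space M x. \<forall>\<eta> \<in> cotangent_space M x.
          (\<forall>a b. \<pi> x (\<lambda>v. a * \<xi> v + b * \<zeta> v) \<eta> = a * \<pi> x \<xi> \<eta> + b * \<pi> x \<zeta> \<eta>) \<and>
          \<pi> x \<xi> \<eta> = - \<pi> x \<eta> \<xi>) \<and>
     (\<forall>V \<xi> \<eta>. one_form M V \<xi> \<longrightarrow> one_form M V \<eta> \<longrightarrow> smooth_on M V (\<lambda>x. \<pi> x (\<xi> x) (\<eta> x)))"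

definition poisson_bracket ::
  "'a manifold \<Rightarrow> ('a \<Rightarrow> 'a covec \<Rightarrow> 'a covec \<Rightarrow> real) \<Rightarrow> ('a \<Rightarrow> real) \<Rightarrow> ('a \<Rightarrow> real) \<Rightarrow> 'a \<Rightarrow> real" where
  "poisson_bracket M \<pi> f g x = \<pi> x (differential M f x) (differential M g x)"

definition poisson_structure ::
  "'a manifold \<Rightarrow> ('a \<Rightarrow> 'a covec \<Rightarrow> 'a covec \<Rightarrow> real) \<Rightarrow> bool" where
  "poisson_structure M \<pi> \<longleftrightarrow>
     bivector_field M \<pi> \<and>
     (\<forall>f g h. smooth_on M (topspace (mtop M)) f \<longrightarrow> smooth_on M (topspace (mtop M)) g \<longrightarrow>
        smooth_on M (topspace (mtop M)) h \<longrightarrow>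
        (\<forall>x \<in> topspace (mtop M).
           poisson_bracket M \<pi> f (poisson_bracket M \<pi> g h) x +
           poisson_bracket M \<pi> g (poisson_bracket M \<pi> h f) x +
           poisson_bracket M \<pi> h (poisson_bracket M \<pi> f g) x = 0))"

text \<open>\<open>\<pi>\<^sup>\<sharp> \<xi> = \<pi>(\<xi>, \<cdot>)\<close> as a derivation: it maps \<open>f\<close> to \<open>\<pi>(\<xi>, df)\<close>.\<close>

definition sharp ::
  "'a manifold \<Rightarrow> ('a \<Rightarrow> 'a covec \<Rightarrow> 'a covec \<Rightarrow> real) \<Rightarrow> 'a \<Rightarrow> 'a covec \<Rightarrow> 'a tvec" where
  "sharp M \<pi> x \<xi> = (\<lambda>f. if smooth_at M x f then \<pi> x \<xi> (differential M f x) else 0)"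

definition graph ::
  "'a manifold \<Rightarrow> ('a \<Rightarrow> 'a covec \<Rightarrow> 'a covec \<Rightarrow> real) \<Rightarrow> 'a \<Rightarrow> 'a dvec set" where
  "graph M \<pi> x = (\<lambda>\<xi>. (sharp M \<pi> x \<xi>, \<xi>)) ` cotangent_space M x"

end

theory Submission
  imports Defs "HOL-Probability.Discrete_Topology"
begin

text \<open>
  A Dirac structure whose intersection with the tangent bundle has constant rank is, locally, the pullback
  of a Poisson structure from the leaf space of that intersection. A general \<open>L\<close> does not
  have this property, but near a given point \<open>x\<close> it acquires it after a gauge transformation
  by a closed two-form, and there are exact two-forms that do this.

  Fix coordinates near \<open>x\<close>. For a skew matrix \<open>B\<close>, regarded as a two-form with
  constant coefficients, the gauge transformation of \<open>L\<close> by \<open>-B\<close> meets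
  \<open>T\<^sub>xM\<close> in \<open>{u. u + \<iota>\<^sub>uB \<in> L\<^sub>x}\<close>. If this space has
  dimension at least two, adding a suitable \<open>d\<psi>\<^sub>i \<and> d\<psi>\<^sub>j\<close> to
  \<open>B\<close> makes it smaller, because \<open>L\<^sub>x\<close> is isotropic; so some
  \<open>B\<close> leaves at most a line (\<open>minimal_kernel\<close>). A form with constant
  coefficients has an explicit potential \<open>\<alpha>\<close> (\<open>ext_deriv_const_pot\<close>), and
  gauge transformations by closed forms preserve the Dorfman bracket (\<open>dorfman_ungauge\<close>). It
  remains to treat a Dirac structure, again called \<open>L\<close>, for which \<open>L\<^sub>x \<inter>
  T\<^sub>xM\<close> is zero or a line.

  If \<open>L\<^sub>x \<inter> T\<^sub>xM = 0\<close>, then \<open>L\<close> is a graph over the cotangent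
  bundle near \<open>x\<close>, and the quotient map is the identity (\<open>dirac_chart_graph\<close>).
  If it is a line, choose coordinates so that \<open>L\<^sub>x\<close> is transverse to the Lagrangian
  subspace spanned by \<open>\<partial>\<^sub>a\<close> for \<open>a < n - 1\<close> and
  \<open>d\<psi>\<^sub>n\<^sub>-\<^sub>1\<close>, where the indices run from \<open>0\<close> to \<open>n
  - 1\<close>, and take the local frame of \<open>L\<close> that is dual to this basis. Its last member
  pairs to zero with itself; this forces its covector part to vanish. Hence the line does not disappear in
  nearby points: it is spanned by a vector field without zeros, which a flow box turns into the last
  coordinate field (\<open>dirac_chart_line\<close>).

  In both cases there is a coordinate cube and a number \<open>m\<close> such that \<open>L\<close> has
  the frame \<open>\<Sum>\<^sub>b \<pi>\<^sub>a\<^sub>b \<partial>\<^sub>b + d\<psi>\<^sub>a\<close>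
  (\<open>a, b < m\<close>), \<open>\<partial>\<^sub>b\<close> (\<open>m \<le> b\<close>); this is the
  locale \<open>dirac_chart\<close>. Involutivity, tested on the frame, says that
  \<open>\<pi>\<^sub>a\<^sub>b\<close> does not depend on the coordinates from \<open>m\<close> on
  (\<open>pi_coeff_basic\<close>) and satisfies the Jacobi identity (\<open>pi_coeff_jacobi\<close>). So
  \<open>\<pi>\<close> lives on the \<open>m\<close>-dimensional cube, and \<open>L\<close> is the
  pullback of its graph under the projection (\<open>L_pullback\<close>). The base is realised as the
  slice of the cube where the last coordinates vanish, so its points have the same type as those of
  \<open>M\<close>; the fibres are cubes, hence connected.

  Tangent vectors are derivations, so their coordinate expression rests on Hadamard's lemma
  (\<open>tan_expand\<close>), and integrability is stated for global sections, so it is localised by bump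
  functions (\<open>dirac_involutive_local\<close>). The flow box needs local flows that are smooth in
  time and initial value together. Solutions are fixed points of a contraction on bounded continuous
  functions of time and parameter (\<open>ode_exists\<close>). Their divided differences in a parameter
  solve a linear equation with continuous coefficients, which gives one derivative
  (\<open>flow_difference_quotient\<close>, \<open>flow_variation\<close>); applying this to the flow
  together with its derivative gives all of them (\<open>flow_family_variation\<close>,
  \<open>flow_smooth\<close>).
\<close>

section \<open>Open sets of Euclidean space\<close>

definition euclid :: "nat \<Rightarrow> (nat \<Rightarrow> real) set" where
  "euclid n = {x. \<forall>i\<ge>n. x i = 0}"

definition cube :: "nat \<Rightarrow> (nat \<Rightarrow> real) \<Rightarrow> real \<Rightarrow> (nat \<Rightarrow> real) set" where
  "cube n z r = {y \<in> euclid n. \<forall>i<n. \<bar>y i - z i\<bar> < r}"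

lemma euclidD: "x \<in> euclid n \<Longrightarrow> i \<ge> n \<Longrightarrow> x i = 0"
  by (simp add: euclid_def)

lemma euclid_eqI: "x \<in> euclid n \<Longrightarrow> y \<in> euclid n \<Longrightarrow> (\<And>i. i < n \<Longrightarrow> x i = y i) \<Longrightarrow> x = y"
  by (rule ext) (metis euclidD not_less)

lemma Euclidean_space_eq: "Euclidean_space n = top_of_set (euclid n)"
  by (simp add: Euclidean_space_def euclid_def euclidean_product_topology)

lemma openin_E_subset: "openin (Euclidean_space n) W \<Longrightarrow> W \<subseteq> euclid n"
  by (metis Euclidean_space_eq openin_imp_subset)

lemma continuous_map_E:
  "W \<subseteq> euclid n \<Longrightarrow>
   continuous_map (subtopology (Euclidean_space n) W) euclideanreal f \<longleftrightarrow> continuous_on W f"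
  by (simp add: Euclidean_space_eq subtopology_subtopology Int_absorb1)

lemma continuous_on_coord: "continuous_on S (\<lambda>x::nat \<Rightarrow> real. x i)"
  using continuous_on_product_coordinates by (rule continuous_on_subset) simp

lemma continuous_on_apply:
  fixes g :: "'b::topological_space \<Rightarrow> nat \<Rightarrow> real"
  shows "continuous_on S g \<Longrightarrow> continuous_on S (\<lambda>p. g p i)"
  by (rule continuous_on_product_then_coordinatewise)

lemma openin_cube: "openin (Euclidean_space n) (cube n z r)"
proof -
  have "open (\<Inter>i<n. {y::nat\<Rightarrow>real. \<bar>y i - z i\<bar> < r})"
    by (intro open_INT ballI) (auto intro!: open_Collect_less continuous_intros continuous_on_coord)
  moreover have "cube n z r = euclid n \<inter> (\<Inter>i<n. {y. \<bar>y i - z i\<bar> < r})"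
    by (auto simp: cube_def)
  ultimately show ?thesis
    unfolding Euclidean_space_eq openin_open by blast
qed

lemma openin_E_cube:
  assumes "openin (Euclidean_space n) W" and z: "z \<in> W"
  obtains r where "r > 0" "cube n z r \<subseteq> W"
proof -
  obtain T where T: "open T" and W: "W = euclid n \<inter> T"
    using assms(1) unfolding Euclidean_space_eq openin_open by blast
  have "openin (product_topology (\<lambda>i::nat. euclideanreal) UNIV) T"
    using T by (simp add: euclidean_product_topology)
  then obtain X where X: "z \<in> (\<Pi>\<^sub>E i\<in>UNIV. X i)" "\<And>i. openin euclideanreal (X i)"
      "finite {i. X i \<noteq> topspace euclideanreal}" "(\<Pi>\<^sub>E i\<in>UNIV. X i) \<subseteq> T"
    using product_topology_open_contains_basis[of "\<lambda>i. euclideanreal" UNIV T z] z W by blast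
  have "\<exists>r>0. \<forall>t. \<bar>t - z i\<bar> < r \<longrightarrow> t \<in> X i" for i
  proof -
    have "open (X i)" "z i \<in> X i" using X by auto
    then show ?thesis by (metis open_dist dist_real_def)
  qed
  then obtain \<rho> where \<rho>: "\<And>i. \<rho> i > 0" "\<And>i t. \<bar>t - z i\<bar> < \<rho> i \<Longrightarrow> t \<in> X i" by metis
  define r where "r = Min (insert 1 (\<rho> ` {..<n}))"
  have r: "r > 0" "\<And>i. i < n \<Longrightarrow> r \<le> \<rho> i"
    using \<rho> by (auto simp: r_def)
  have "cube n z r \<subseteq> W"
  proof
    fix y assume y: "y \<in> cube n z r"
    have "y i \<in> X i" for i
    proof (cases "i < n")
      case True
      then show ?thesis using y r(2)[of i] \<rho>(2)[of "y i" i] by (auto simp: cube_def)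
    next
      case False
      then have "y i = z i" using y z W by (auto simp: cube_def euclid_def)
      then show ?thesis using \<rho>(2)[of "z i" i] \<rho>(1) by simp
    qed
    then show "y \<in> W" using X(4) y W by (auto simp: cube_def)
  qed
  then show thesis using that r(1) by blast
qed

lemma cube_self: "z \<in> euclid n \<Longrightarrow> r > 0 \<Longrightarrow> z \<in> cube n z r"
  by (simp add: cube_def)

lemma cube_mono: "r \<le> s \<Longrightarrow> cube n z r \<subseteq> cube n z s"
  by (force simp: cube_def)

lemma openin_E_iff:
  "openin (Euclidean_space n) W \<longleftrightarrow> W \<subseteq> euclid n \<and> (\<forall>z\<in>W. \<exists>r>0. cube n z r \<subseteq> W)"
proof
  assume "openin (Euclidean_space n) W"
  then show "W \<subseteq> euclid n \<and> (\<forall>z\<in>W. \<exists>r>0. cube n z r \<subseteq> W)"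
    by (meson openin_E_subset openin_E_cube)
next
  assume *: "W \<subseteq> euclid n \<and> (\<forall>z\<in>W. \<exists>r>0. cube n z r \<subseteq> W)"
  show "openin (Euclidean_space n) W"
  proof (subst openin_subopen, intro ballI)
    fix z assume "z \<in> W"
    then obtain r where "r > 0" "cube n z r \<subseteq> W" "z \<in> euclid n" using * by blast
    then show "\<exists>T. openin (Euclidean_space n) T \<and> z \<in> T \<and> T \<subseteq> W"
      using openin_cube cube_self by meson
  qed
qed

lemma tendsto_fun:
  fixes g :: "'b \<Rightarrow> nat \<Rightarrow> real"
  assumes "\<And>i. ((\<lambda>t. g t i) \<longlongrightarrow> l i) F"
  shows "(g \<longlongrightarrow> l) F"
proof -
  have "limitin (product_topology (\<lambda>i::nat. euclideanreal) UNIV) g l F"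
    using assms by (simp add: limitin_componentwise)
  then show ?thesis by (simp add: euclidean_product_topology)
qed

lemma eventually_slice:
  assumes "openin (Euclidean_space n) W" "x \<in> W" "i < n"
  shows "\<forall>\<^sub>F t in nhds (x i). x(i := t) \<in> W"
proof -
  obtain r where r: "r > 0" "cube n x r \<subseteq> W" using openin_E_cube assms by blast
  have "\<forall>\<^sub>F t in nhds (x i). dist t (x i) < r"
    using r(1) eventually_nhds_metric by blast
  then show ?thesis
  proof (rule eventually_mono)
    fix t assume "dist t (x i) < r"
    then have "x(i := t) \<in> cube n x r"
      using assms openin_E_subset[OF assms(1)] r(1)
      by (auto simp: cube_def euclid_def dist_real_def)
    then show "x(i := t) \<in> W" using r by blast
  qed
qed

section \<open>\<open>C\<^sup>k\<close> functions\<close>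

lemma Ck_0: "openin (Euclidean_space n) W \<Longrightarrow> Ck_on n 0 W f \<longleftrightarrow> continuous_on W f"
  by (simp add: continuous_map_E openin_E_subset)

lemma Ck_continuous: "openin (Euclidean_space n) W \<Longrightarrow> Ck_on n k W f \<Longrightarrow> continuous_on W f"
  by (cases k) (auto simp: continuous_map_E openin_E_subset)

lemma Ck_on_cong:
  assumes "openin (Euclidean_space n) W" "\<And>x. x \<in> W \<Longrightarrow> f x = g x"
  shows "Ck_on n k W f \<longleftrightarrow> Ck_on n k W g"
  using assms(2)
proof (induction k arbitrary: f g)
  case 0
  then show ?case by (simp add: Ck_0 assms(1) del: Ck_on.simps cong: continuous_on_cong)
next
  case (Suc k)
  have ev: "\<forall>\<^sub>F t in nhds (x i). f (x(i := t)) = g (x(i := t))" if "x \<in> W" "i < n" for x i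
    using eventually_slice[OF assms(1) that] by eventually_elim (use Suc.prems in blast)
  have d: "(\<lambda>t. f (x(i := t))) differentiable (at (x i)) \<longleftrightarrow>
        (\<lambda>t. g (x(i := t))) differentiable (at (x i))" if "x \<in> W" "i < n" for x i
    using DERIV_cong_ev[OF refl ev[OF that] refl]
    by (simp add: real_differentiable_def)
  have p: "partial_deriv i f x = partial_deriv i g x" if "x \<in> W" "i < n" for x i
    unfolding partial_deriv_def by (rule deriv_cong_ev[OF ev[OF that] refl])
  have "continuous_on W f \<longleftrightarrow> continuous_on W g"
    using Suc.prems by (simp cong: continuous_on_cong)
  moreover have "Ck_on n k W (partial_deriv i f) \<longleftrightarrow> Ck_on n k W (partial_deriv i g)" if "i < n" for i
    by (rule Suc.IH) (use p that in blast)
  ultimately show ?case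
    using d by (simp add: continuous_map_E openin_E_subset[OF assms(1)])
qed

lemma Ck_SucI:
  assumes W: "openin (Euclidean_space n) W" and "continuous_on W f"
    and d: "\<And>i x. i < n \<Longrightarrow> x \<in> W \<Longrightarrow> ((\<lambda>t. f (x(i := t))) has_real_derivative g i x) (at (x i))"
    and g: "\<And>i. i < n \<Longrightarrow> Ck_on n k W (g i)"
  shows "Ck_on n (Suc k) W f"
proof -
  have "partial_deriv i f x = g i x" if "i < n" "x \<in> W" for i x
    unfolding partial_deriv_def using d[OF that] by (rule DERIV_imp_deriv)
  then have "Ck_on n k W (partial_deriv i f)" if "i < n" for i
    using Ck_on_cong[OF W, of "partial_deriv i f" "g i"] g that by blast
  then show ?thesis
    using assms by (auto simp: continuous_map_E openin_E_subset real_differentiable_def)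
qed

lemma Ck_SucD:
  assumes "openin (Euclidean_space n) W" "Ck_on n (Suc k) W f" "i < n"
  shows "x \<in> W \<Longrightarrow> ((\<lambda>t. f (x(i := t))) has_real_derivative partial_deriv i f x) (at (x i))"
    and "Ck_on n k W (partial_deriv i f)"
  using assms by (auto simp: partial_deriv_def DERIV_deriv_iff_real_differentiable)

lemma Ck_Suc_imp: "Ck_on n (Suc k) W f \<Longrightarrow> Ck_on n k W f"
  by (induction k arbitrary: f) auto

lemma Ck_on_subset: "Ck_on n k W f \<Longrightarrow> W' \<subseteq> W \<Longrightarrow> Ck_on n k W' f"
proof (induction k arbitrary: f)
  case 0
  then show ?case by (auto intro: continuous_map_from_subtopology_mono)
next
  case (Suc k)
  then show ?case by (auto intro: continuous_map_from_subtopology_mono)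
qed

text \<open>The domains are sets of functions vanishing from index \<open>n\<close> on, hence not open in the
  product topology; continuity is therefore glued by hand from relatively open pieces.\<close>

lemma Ck_local:
  assumes W: "openin (Euclidean_space n) W"
    and loc: "\<And>x. x \<in> W \<Longrightarrow> \<exists>W'. x \<in> W' \<and> openin (Euclidean_space n) W' \<and> Ck_on n k W' f"
  shows "Ck_on n k W f"
  using loc
proof (induction k arbitrary: f)
  have cont: "continuous_on W f"
    if loc: "\<And>x. x \<in> W \<Longrightarrow> \<exists>W'. x \<in> W' \<and> openin (Euclidean_space n) W' \<and> continuous_on W' f"
    for f :: "(nat \<Rightarrow> real) \<Rightarrow> real"
    unfolding continuous_on_topological
  proof (intro ballI allI impI)
    fix x B assume x: "x \<in> W" and B: "open B" "f x \<in> B"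
    obtain W' where W': "x \<in> W'" "openin (Euclidean_space n) W'" "continuous_on W' f"
      using loc x by blast
    obtain T where T: "open T" "W' = euclid n \<inter> T"
      using W'(2) unfolding Euclidean_space_eq openin_open by blast
    obtain A where "open A" "x \<in> A" "\<forall>y\<in>W'. y \<in> A \<longrightarrow> f y \<in> B"
      using W'(3) W'(1) B unfolding continuous_on_topological by blast
    then show "\<exists>A. open A \<and> x \<in> A \<and> (\<forall>y\<in>W. y \<in> A \<longrightarrow> f y \<in> B)"
      using T W'(1) openin_E_subset[OF W] by (intro exI[of _ "A \<inter> T"]) auto
  qed
  {
    case 0
    then show ?case using cont[of f] by (metis Ck_0 W)
  next
    case (Suc k)
    have "continuous_on W f" using Suc.prems by (intro cont) (meson Ck_continuous)
    moreover have "(\<lambda>t. f (x(i := t))) differentiable (at (x i))" if "i < n" "x \<in> W" for i x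
      using Suc.prems[OF that(2)] that(1) by auto
    moreover have "Ck_on n k W (partial_deriv i f)" if "i < n" for i
      by (rule Suc.IH) (use Suc.prems that in fastforce)
    ultimately show ?case by (simp add: continuous_map_E openin_E_subset[OF W])
  }
qed

context
  fixes n W assumes W: "openin (Euclidean_space n) W"
begin

lemma Ck_const: "Ck_on n k W (\<lambda>_. c)"
proof (induction k arbitrary: c)
  case 0 show ?case by (simp add: Ck_0 W del: Ck_on.simps)
next
  case (Suc k)
  show ?case by (rule Ck_SucI[OF W _ _ Suc[of 0]]) auto
qed

lemma Ck_coord: "Ck_on n k W (\<lambda>x. x j)"
proof (cases k)
  case 0 then show ?thesis by (simp add: Ck_0 W continuous_on_coord del: Ck_on.simps)
next
  case (Suc k')
  show ?thesis unfolding Suc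
    by (rule Ck_SucI[OF W, where g = "\<lambda>i _. if i = j then 1 else 0"])
       (auto intro!: derivative_eq_intros continuous_on_coord Ck_const)
qed

lemma Ck_add: "Ck_on n k W f \<Longrightarrow> Ck_on n k W g \<Longrightarrow> Ck_on n k W (\<lambda>x. f x + g x)"
proof (induction k arbitrary: f g)
  case 0 then show ?case by (simp add: Ck_0 W continuous_on_add del: Ck_on.simps)
next
  case (Suc k)
  show ?case
  proof (rule Ck_SucI[OF W])
    show "continuous_on W (\<lambda>x. f x + g x)"
      using Suc.prems by (intro continuous_on_add Ck_continuous[OF W])
    show "((\<lambda>t. f (x(i := t)) + g (x(i := t))) has_real_derivative
        partial_deriv i f x + partial_deriv i g x) (at (x i))" if "i < n" "x \<in> W" for i x
      using Suc.prems that by (intro DERIV_add Ck_SucD(1)[OF W])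
    show "Ck_on n k W (\<lambda>x. partial_deriv i f x + partial_deriv i g x)" if "i < n" for i
      using Suc.prems that by (intro Suc.IH Ck_SucD(2)[OF W])
  qed
qed

lemma Ck_mult: "Ck_on n k W f \<Longrightarrow> Ck_on n k W g \<Longrightarrow> Ck_on n k W (\<lambda>x. f x * g x)"
proof (induction k arbitrary: f g)
  case 0 then show ?case by (simp add: Ck_0 W continuous_on_mult del: Ck_on.simps)
next
  case (Suc k)
  show ?case
  proof (rule Ck_SucI[OF W])
    show "continuous_on W (\<lambda>x. f x * g x)"
      using Suc.prems by (intro continuous_on_mult Ck_continuous[OF W])
    show "((\<lambda>t. f (x(i := t)) * g (x(i := t))) has_real_derivative
        partial_deriv i f x * g x + partial_deriv i g x * f x) (at (x i))" if "i < n" "x \<in> W" for i x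
      by (rule DERIV_cong[OF DERIV_mult[OF Ck_SucD(1)[OF W Suc.prems(1) that]
            Ck_SucD(1)[OF W Suc.prems(2) that]]]) simp
    show "Ck_on n k W (\<lambda>x. partial_deriv i f x * g x + partial_deriv i g x * f x)" if "i < n" for i
      by (intro Ck_add Suc.IH Ck_SucD(2)[OF W Suc.prems(1) that] Ck_SucD(2)[OF W Suc.prems(2) that]
          Ck_Suc_imp[OF Suc.prems(1)] Ck_Suc_imp[OF Suc.prems(2)])
  qed
qed

lemma Ck_inverse: "Ck_on n k W f \<Longrightarrow> (\<And>x. x \<in> W \<Longrightarrow> f x \<noteq> 0) \<Longrightarrow> Ck_on n k W (\<lambda>x. inverse (f x))"
proof (induction k)
  case 0 then show ?case by (simp add: Ck_0 W continuous_on_inverse del: Ck_on.simps)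
next
  case (Suc k)
  show ?case
  proof (rule Ck_SucI[OF W])
    show "continuous_on W (\<lambda>x. inverse (f x))"
      using continuous_on_inverse[OF Ck_continuous[OF W Suc.prems(1)]] Suc.prems(2) by blast
    show "((\<lambda>t. inverse (f (x(i := t)))) has_real_derivative
        (- 1) * (inverse (f x) * (inverse (f x) * partial_deriv i f x))) (at (x i))" if "i < n" "x \<in> W" for i x
      by (rule DERIV_cong[OF DERIV_inverse_fun[OF Ck_SucD(1)[OF W Suc.prems(1) that]]])
        (use Suc.prems(2)[OF that(2)] in \<open>simp_all add: power2_eq_square\<close>)
    show "Ck_on n k W (\<lambda>x. (- 1) * (inverse (f x) * (inverse (f x) * partial_deriv i f x)))" if "i < n" for i
      by (intro Ck_mult Ck_const Suc.IH[OF Ck_Suc_imp[OF Suc.prems(1)] Suc.prems(2)]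
          Ck_SucD(2)[OF W Suc.prems(1) that])
  qed
qed

lemma Ck_sum: "(\<And>a. a \<in> A \<Longrightarrow> Ck_on n k W (f a)) \<Longrightarrow> Ck_on n k W (\<lambda>x. \<Sum>a\<in>A. f a x)"
  by (induction A rule: infinite_finite_induct) (auto intro: Ck_const Ck_add)

end

section \<open>Hadamard quotients and the chain rule\<close>

text \<open>The \<open>j\<close>-th edge of the axis-parallel path from \<open>x\<close> to \<open>y\<close> that
  changes one coordinate at a time. Along it a function is differentiated by its partial derivatives, one
  at a time.\<close>

definition staircase :: "nat \<Rightarrow> (nat \<Rightarrow> real) \<Rightarrow> (nat \<Rightarrow> real) \<Rightarrow> real \<Rightarrow> nat \<Rightarrow> real" where
  "staircase j x y s = (\<lambda>i. if i < j then y i else if i = j then x j + s * (y j - x j) else x i)"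

text \<open>The coefficient of \<open>y\<^sub>j - x\<^sub>j\<close> in the decomposition of \<open>f y - f x\<close>
  (\<open>hadamard_formula\<close>): a continuous substitute for the divided difference of
  \<open>f\<close> in direction \<open>j\<close>, equal to the partial derivative on the diagonal.\<close>

definition hadamard :: "((nat \<Rightarrow> real) \<Rightarrow> real) \<Rightarrow> nat \<Rightarrow> (nat \<Rightarrow> real) \<Rightarrow> (nat \<Rightarrow> real) \<Rightarrow> real" where
  "hadamard f j x y = integral {0..1} (\<lambda>s. partial_deriv j f (staircase j x y s))"

text \<open>Domains that contain the box spanned by any two of their points, so that the axis-parallel path stays
  inside.\<close>

definition box_convex :: "nat \<Rightarrow> (nat \<Rightarrow> real) set \<Rightarrow> bool" where
  "box_convex n V \<longleftrightarrow> (\<forall>x\<in>V. \<forall>y\<in>V. \<forall>z\<in>euclid n.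
     (\<forall>i<n. min (x i) (y i) \<le> z i \<and> z i \<le> max (x i) (y i)) \<longrightarrow> z \<in> V)"

lemma box_convexD:
  "box_convex n V \<Longrightarrow> x \<in> V \<Longrightarrow> y \<in> V \<Longrightarrow> z \<in> euclid n \<Longrightarrow>
   (\<And>i. i < n \<Longrightarrow> min (x i) (y i) \<le> z i \<and> z i \<le> max (x i) (y i)) \<Longrightarrow> z \<in> V"
  unfolding box_convex_def by blast

lemma box_convex_cube: "box_convex n (cube n z r)"
  unfolding box_convex_def
proof (intro ballI impI)
  fix x y w assume "x \<in> cube n z r" "y \<in> cube n z r" "w \<in> euclid n"
    and *: "\<forall>i<n. min (x i) (y i) \<le> w i \<and> w i \<le> max (x i) (y i)"
  then have "\<bar>w i - z i\<bar> < r" if "i < n" for i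
  proof -
    have "\<bar>x i - z i\<bar> < r" "\<bar>y i - z i\<bar> < r" "min (x i) (y i) \<le> w i \<and> w i \<le> max (x i) (y i)"
      using \<open>x \<in> _\<close> \<open>y \<in> _\<close> * that by (auto simp: cube_def)
    then show ?thesis by linarith
  qed
  then show "w \<in> cube n z r" using \<open>w \<in> _\<close> by (simp add: cube_def)
qed

lemma convex_comb_between:
  fixes a b s :: real assumes "0 \<le> s" "s \<le> 1"
  shows "min a b \<le> a + s * (b - a) \<and> a + s * (b - a) \<le> max a b"
proof (cases "a \<le> b")
  case True
  have "0 \<le> s * (b - a)" "s * (b - a) \<le> 1 * (b - a)"
    using assms True mult_right_mono[of s 1 "b - a"] by auto
  then show ?thesis using True by auto
next
  case False
  have "0 \<le> s * (a - b)" "s * (a - b) \<le> 1 * (a - b)"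
    using assms False mult_right_mono[of s 1 "a - b"] by auto
  then show ?thesis using False by (auto simp: algebra_simps)
qed

lemma staircase_in:
  assumes "box_convex n V" "V \<subseteq> euclid n" "x \<in> V" "y \<in> V" "j < n" "s \<in> {0..1}"
  shows "staircase j x y s \<in> V"
proof (rule box_convexD[OF assms(1,3,4)])
  show "staircase j x y s \<in> euclid n"
    using assms by (auto simp: staircase_def euclid_def subset_eq)
  show "min (x i) (y i) \<le> staircase j x y s i \<and> staircase j x y s i \<le> max (x i) (y i)" for i
    using convex_comb_between[of s "x i" "y i"] assms by (auto simp: staircase_def)
qed

lemma continuous_on_staircase:
  "continuous_on S (\<lambda>((x, y), s). staircase j x y s)"
  unfolding case_prod_beta staircase_def
proof (rule continuous_on_coordinatewise_then_product)
  fix i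
  have *: "continuous_on S (\<lambda>p. fst (fst p) k)" "continuous_on S (\<lambda>p. snd (fst p) k)" for k
    by (rule continuous_on_apply, intro continuous_intros)+
  show "continuous_on S (\<lambda>p. if i < j then snd (fst p) i else if i = j
     then fst (fst p) j + snd p * (snd (fst p) j - fst (fst p) j) else fst (fst p) i)"
    by (cases "i < j"; cases "i = j") (auto intro!: continuous_intros *)
qed

lemma hadamard_diag: "hadamard f j x x = partial_deriv j f x"
proof -
  have "staircase j x x s = x" for s by (auto simp: staircase_def)
  then show ?thesis by (simp add: hadamard_def)
qed

lemma continuous_on_hadamard:
  assumes V: "openin (Euclidean_space n) V" "box_convex n V" and f: "Ck_on n (Suc k) V f" and j: "j < n"
  shows "continuous_on (V \<times> V) (\<lambda>(x, y). hadamard f j x y)"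
proof -
  have "continuous_on ((V \<times> V) \<times> cbox 0 1) (\<lambda>(p, s). partial_deriv j f (staircase j (fst p) (snd p) s))"
    unfolding case_prod_beta
  proof (rule continuous_on_compose2[OF Ck_continuous[OF V(1) Ck_SucD(2)[OF V(1) f j]]])
    show "continuous_on ((V \<times> V) \<times> cbox 0 1) (\<lambda>p. staircase j (fst (fst p)) (snd (fst p)) (snd p))"
      using continuous_on_staircase[of _ j] by (simp add: case_prod_beta)
    show "(\<lambda>p. staircase j (fst (fst p)) (snd (fst p)) (snd p)) ` ((V \<times> V) \<times> cbox 0 1) \<subseteq> V"
      using staircase_in[OF V(2) openin_E_subset[OF V(1)] _ _ j] by auto
  qed
  from integral_continuous_on_param[OF this] show ?thesis
    by (simp add: hadamard_def case_prod_beta)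
qed

text \<open>Telescoping along the corners of the axis-parallel path; on each edge the fundamental theorem of
  calculus in one variable applies.\<close>

lemma hadamard_formula:
  assumes V: "openin (Euclidean_space n) V" "box_convex n V" and f: "Ck_on n (Suc k) V f"
    and x: "x \<in> V" and y: "y \<in> V"
  shows "f y - f x = (\<Sum>j<n. (y j - x j) * hadamard f j x y)"
proof -
  \<comment> \<open>corners of the axis-parallel path from \<open>x\<close> to \<open>y\<close>\<close>
  define p where "p j = (\<lambda>i. if i < j then y i else x i)" for j :: nat
  have E: "x \<in> euclid n" "y \<in> euclid n" using x y openin_E_subset[OF V(1)] by auto
  have "p 0 = x" "p n = y"
    using E by (auto simp: p_def euclid_def fun_eq_iff)
  then have "f y - f x = (\<Sum>j<n. f (p (Suc j)) - f (p j))"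
    using sum_lessThan_telescope[of "\<lambda>j. f (p j)" n] by simp
  also have "\<dots> = (\<Sum>j<n. (y j - x j) * hadamard f j x y)"
  proof (rule sum.cong[OF refl])
    fix j assume "j \<in> {..<n}"
    then have j: "j < n" by simp
    have t: "staircase j x y s = (p j)(j := x j + s * (y j - x j))" for s
      by (auto simp: staircase_def p_def)
    have "((\<lambda>s. f (staircase j x y s)) has_real_derivative partial_deriv j f (staircase j x y s) * (y j - x j)) (at s)"
      if s: "s \<in> {0..1}" for s
    proof -
      have "staircase j x y s \<in> V" using staircase_in[OF V(2) openin_E_subset[OF V(1)] x y j s] .
      from Ck_SucD(1)[OF V(1) f j this]
      have "((\<lambda>t. f ((p j)(j := t))) has_real_derivative partial_deriv j f (staircase j x y s))
          (at (x j + s * (y j - x j)))"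
        by (simp add: t)
      then show ?thesis unfolding t
        by (rule DERIV_chain2) (auto intro!: derivative_eq_intros)
    qed
    then have "((\<lambda>s. partial_deriv j f (staircase j x y s) * (y j - x j)) has_integral
       (f (staircase j x y 1) - f (staircase j x y 0))) {0..1}"
      by (intro fundamental_theorem_of_calculus)
        (auto simp: has_real_derivative_iff_has_vector_derivative[symmetric] intro: has_field_derivative_at_within)
    moreover have "staircase j x y 1 = p (Suc j)" "staircase j x y 0 = p j"
      by (auto simp: staircase_def p_def less_Suc_eq fun_eq_iff)
    ultimately show "f (p (Suc j)) - f (p j) = (y j - x j) * hadamard f j x y"
      by (simp add: hadamard_def mult.commute integral_unique integral_mult_right[symmetric] del: integral_mult_right)
  qed
  finally show ?thesis .
qed

text \<open>Divide Hadamard's decomposition of \<open>f (\<gamma> t) - f (\<gamma> t\<^sub>0)\<close> by \<open>t -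
  t\<^sub>0\<close>: the coefficients are jointly continuous, so they tend to the partial derivatives.\<close>

lemma chain_rule_curve:
  assumes V: "openin (Euclidean_space m) V" and f: "Ck_on m (Suc k) V f"
    and g0: "\<gamma> t0 \<in> V" and ev: "\<forall>\<^sub>F t in at t0. \<gamma> t \<in> euclid m"
    and d: "\<And>j. j < m \<Longrightarrow> ((\<lambda>t. \<gamma> t j) has_real_derivative \<gamma>' j) (at t0)"
  shows "((\<lambda>t. f (\<gamma> t)) has_real_derivative (\<Sum>j<m. partial_deriv j f (\<gamma> t0) * \<gamma>' j)) (at t0)"
proof -
  obtain r where r: "r > 0" "cube m (\<gamma> t0) r \<subseteq> V" using openin_E_cube[OF V g0] by blast
  let ?C = "cube m (\<gamma> t0) r"
  have C0: "\<gamma> t0 \<in> ?C" using cube_self r g0 openin_E_subset[OF V] by blast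
  have lim: "((\<lambda>t. \<gamma> t j) \<longlongrightarrow> \<gamma> t0 j) (at t0)" for j
  proof (cases "j < m")
    case True
    then show ?thesis using d DERIV_isCont isCont_def by blast
  next
    case False
    have "\<forall>\<^sub>F t in at t0. \<gamma> t j = \<gamma> t0 j"
      using ev by eventually_elim (use False g0 openin_E_subset[OF V] in \<open>force simp: euclid_def\<close>)
    then show ?thesis by (rule tendsto_eventually)
  qed
  have "\<forall>\<^sub>F t in at t0. \<forall>j\<in>{..<m}. \<bar>\<gamma> t j - \<gamma> t0 j\<bar> < r"
    using tendstoD[OF lim r(1)] by (intro eventually_ball_finite) (auto simp: dist_real_def)
  with ev have evC: "\<forall>\<^sub>F t in at t0. \<gamma> t \<in> ?C"
    by eventually_elim (auto simp: cube_def)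
  have fC: "Ck_on m (Suc k) ?C f" using Ck_on_subset f r by blast
  have "((\<lambda>t. \<Sum>j<m. ((\<gamma> t j - \<gamma> t0 j) / (t - t0)) * hadamard f j (\<gamma> t0) (\<gamma> t)) \<longlongrightarrow>
      (\<Sum>j<m. \<gamma>' j * hadamard f j (\<gamma> t0) (\<gamma> t0))) (at t0)"
  proof (intro tendsto_sum tendsto_mult)
    fix j assume "j \<in> {..<m}"
    then have j: "j < m" by simp
    show "((\<lambda>t. (\<gamma> t j - \<gamma> t0 j) / (t - t0)) \<longlongrightarrow> \<gamma>' j) (at t0)"
      using d[OF j] by (simp add: has_field_derivative_iff)
    have "((\<lambda>t. (\<gamma> t0, \<gamma> t)) \<longlongrightarrow> (\<gamma> t0, \<gamma> t0)) (at t0)"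
      by (intro tendsto_Pair tendsto_const tendsto_fun lim)
    from continuous_on_tendsto_compose[OF continuous_on_hadamard[OF openin_cube box_convex_cube fC j] this]
    show "((\<lambda>t. hadamard f j (\<gamma> t0) (\<gamma> t)) \<longlongrightarrow> hadamard f j (\<gamma> t0) (\<gamma> t0)) (at t0)"
      using C0 evC by (auto elim: eventually_mono)
  qed
  moreover have "\<forall>\<^sub>F t in at t0. (\<Sum>j<m. ((\<gamma> t j - \<gamma> t0 j) / (t - t0)) * hadamard f j (\<gamma> t0) (\<gamma> t)) =
      (f (\<gamma> t) - f (\<gamma> t0)) / (t - t0)"
    using evC
    by eventually_elim
      (simp add: hadamard_formula[OF openin_cube box_convex_cube fC C0] sum_divide_distrib)
  ultimately show ?thesis
    unfolding has_field_derivative_iff hadamard_diag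
    by (auto simp: mult.commute elim: Lim_transform_eventually)
qed

lemma Ck_compose:
  assumes W: "openin (Euclidean_space n) W" and V: "openin (Euclidean_space m) V"
    and gV: "\<And>z. z \<in> W \<Longrightarrow> g z \<in> V"
  shows "(\<And>j. j < m \<Longrightarrow> Ck_on n k W (\<lambda>z. g z j)) \<Longrightarrow> Ck_on m k V f \<Longrightarrow> Ck_on n k W (\<lambda>z. f (g z))"
proof (induction k arbitrary: f)
  have cont: "continuous_on W (\<lambda>z. f (g z))"
    if g: "\<And>j. j < m \<Longrightarrow> Ck_on n k W (\<lambda>z. g z j)" and f: "Ck_on m k V f" for k f
  proof (rule continuous_on_compose2[OF Ck_continuous[OF V f]])
    show "g ` W \<subseteq> V" using gV by blast
    show "continuous_on W g"
    proof (rule continuous_on_coordinatewise_then_product)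
      fix i show "continuous_on W (\<lambda>z. g z i)"
      proof (cases "i < m")
        case True then show ?thesis using Ck_continuous[OF W g] by blast
      next
        case False
        then have "g z i = 0" if "z \<in> W" for z
          using gV[OF that] openin_E_subset[OF V] by (auto simp: euclid_def)
        then show ?thesis using continuous_on_const[of W "0::real"] by (simp cong: continuous_on_cong)
      qed
    qed
  qed
  {
    case 0
    then show ?case using cont[of 0 f] by (simp add: Ck_0 W del: Ck_on.simps)
  next
    case (Suc k)
    show ?case
    proof (rule Ck_SucI[OF W cont[OF Suc.prems]])
      show "((\<lambda>t. f (g (x(i := t)))) has_real_derivative
         (\<Sum>j<m. partial_deriv j f (g x) * partial_deriv i (\<lambda>z. g z j) x)) (at (x i))"
        if "i < n" "x \<in> W" for i x
      proof -
        have "\<forall>\<^sub>F t in at (x i). x(i := t) \<in> W"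
          using eventually_slice[OF W that(2,1)] by (simp add: eventually_nhds_conv_at)
        then have "\<forall>\<^sub>F t in at (x i). g (x(i := t)) \<in> euclid m"
          by eventually_elim (use gV openin_E_subset[OF V] in blast)
        from chain_rule_curve[OF V Suc.prems(2) _ this, of "\<lambda>j. partial_deriv i (\<lambda>z. g z j) x"]
        show ?thesis
          using gV[OF that(2)] Ck_SucD(1)[OF W Suc.prems(1) that] by simp
      qed
      show "Ck_on n k W (\<lambda>x. \<Sum>j<m. partial_deriv j f (g x) * partial_deriv i (\<lambda>z. g z j) x)"
        if "i < n" for i
      proof (intro Ck_sum[OF W] Ck_mult[OF W])
        fix j assume "j \<in> {..<m}"
        then have j: "j < m" by simp
        show "Ck_on n k W (\<lambda>x. partial_deriv j f (g x))"
          by (rule Suc.IH[OF Ck_Suc_imp[OF Suc.prems(1)] Ck_SucD(2)[OF V Suc.prems(2) j]])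
        show "Ck_on n k W (partial_deriv i (\<lambda>z. g z j))"
          by (rule Ck_SucD(2)[OF W Suc.prems(1)[OF j] that])
      qed
    qed
  }
qed

text \<open>Differentiation under the integral sign, in the form needed for Hadamard coefficients with a fixed first
  argument: each coordinate moves from \<open>z0\<close> towards \<open>z\<close>, and
  \<open>w\<^sub>j\<close> says which fraction of the way it has gone. The weight \<open>c\<close> is
  there because each differentiation contributes a further factor \<open>w\<^sub>i\<close>.\<close>

lemma Ck_integral:
  fixes w :: "nat \<Rightarrow> real \<Rightarrow> real"
  assumes V: "openin (Euclidean_space n) V"
    and in_V: "\<And>z s. z \<in> V \<Longrightarrow> s \<in> {0..1} \<Longrightarrow> (\<lambda>j. z0 j + w j s * (z j - z0 j)) \<in> V"
    and w: "\<And>j. continuous_on {0..1} (w j)"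
  shows "Ck_on n k V F \<Longrightarrow> continuous_on {0..1} c \<Longrightarrow>
     Ck_on n k V (\<lambda>z. integral {0..1} (\<lambda>s. c s * F (\<lambda>j. z0 j + w j s * (z j - z0 j))))"
proof (induction k arbitrary: F c)
  define \<gamma> where "\<gamma> s z = (\<lambda>j. z0 j + w j s * (z j - z0 j))" for s and z :: "nat \<Rightarrow> real"
  have \<gamma>V: "\<gamma> s z \<in> V" if "z \<in> V" "s \<in> {0..1}" for s z using in_V[OF that] by (simp add: \<gamma>_def)
  have c\<gamma>: "continuous_on (V \<times> {0..1}) (\<lambda>p. \<gamma> (snd p) (fst p))"
    unfolding \<gamma>_def
    by (intro continuous_on_coordinatewise_then_product continuous_on_add continuous_on_mult
        continuous_on_diff continuous_on_const continuous_on_compose2[OF w]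
        continuous_on_apply[OF continuous_on_fst] continuous_on_snd continuous_on_id) auto
  have cF: "continuous_on (V \<times> {0..1}) (\<lambda>p. c (snd p) * F (\<gamma> (snd p) (fst p)))"
    if "continuous_on V F" "continuous_on {0..1} c" for F c :: "_ \<Rightarrow> real"
  proof (rule continuous_on_mult)
    show "continuous_on (V \<times> {0..1}) (\<lambda>p. c (snd p))"
      by (rule continuous_on_compose2[OF that(2)]) (auto intro: continuous_intros)
    show "continuous_on (V \<times> {0..1}) (\<lambda>p. F (\<gamma> (snd p) (fst p)))"
      by (rule continuous_on_compose2[OF that(1) c\<gamma>]) (auto simp: \<gamma>V)
  qed
  have cont: "continuous_on V (\<lambda>z. integral {0..1} (\<lambda>s. c s * F (\<gamma> s z)))"
    if "continuous_on V F" "continuous_on {0..1} c" for F c :: "_ \<Rightarrow> real"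
    using integral_continuous_on_param[of V 0 1 "\<lambda>z s. c s * F (\<gamma> s z)"] cF[OF that]
    by (simp add: case_prod_beta)
  {
    case 0
    then show ?case using cont[of F c] by (simp add: Ck_0 V \<gamma>_def del: Ck_on.simps)
  next
    case (Suc k)
    have F: "continuous_on V F" using Ck_continuous[OF V Suc.prems(1)] .
    show ?case unfolding \<gamma>_def[symmetric]
    proof (rule Ck_SucI[OF V cont[OF F Suc.prems(2)]])
      fix i assume i: "i < n"
      have p: "Ck_on n k V (partial_deriv i F)" using Ck_SucD(2)[OF V Suc.prems(1) i] .
      have cw: "continuous_on {0..1} (\<lambda>s. c s * w i s)"
        using Suc.prems(2) w by (intro continuous_intros)
      show "Ck_on n k V (\<lambda>z. integral {0..1} (\<lambda>s. (c s * w i s) * partial_deriv i F (\<gamma> s z)))"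
        unfolding \<gamma>_def by (rule Suc.IH[OF p cw])
      fix x assume x: "x \<in> V"
      obtain r where r: "r > 0" "cube n x r \<subseteq> V" using openin_E_cube[OF V x] by blast
      let ?U = "{x i - r/2 .. x i + r/2}"
      have xU: "x(i := t) \<in> V" if "t \<in> ?U" for t
      proof -
        have "x(i := t) \<in> cube n x r"
          using x openin_E_subset[OF V] i that r(1) by (auto simp: cube_def euclid_def abs_if)
        then show ?thesis using r(2) by blast
      qed
      have upd: "continuous_on (?U \<times> {0..1}) (\<lambda>p. (x(i := fst p), snd p))"
      proof (intro continuous_intros continuous_on_coordinatewise_then_product)
        fix j show "continuous_on (?U \<times> {0..1}) (\<lambda>p. (x(i := fst p)) j)"
          by (cases "j = i") (auto intro!: continuous_intros)
      qed
      have "((\<lambda>t. integral (cbox 0 1) (\<lambda>s. c s * F (\<gamma> s (x(i := t))))) has_real_derivative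
         integral (cbox 0 1) (\<lambda>s. (c s * w i s) * partial_deriv i F (\<gamma> s (x(i := x i))))) (at (x i) within ?U)"
      proof (rule leibniz_rule_field_derivative[where fx = "\<lambda>t s. (c s * w i s) * partial_deriv i F (\<gamma> s (x(i := t)))"])
        show "x i \<in> ?U" "convex ?U" using r(1) by auto
        show "(\<lambda>s. c s * F (\<gamma> s (x(i := t)))) integrable_on cbox 0 1" if t: "t \<in> ?U" for t
        proof (rule integrable_continuous)
          have "continuous_on (cbox 0 1) (\<lambda>s. (\<lambda>p. c (snd p) * F (\<gamma> (snd p) (fst p))) (x(i := t), s))"
            by (rule continuous_on_compose2[OF cF[OF F Suc.prems(2)]])
              (use xU[OF t] in \<open>auto intro!: continuous_intros\<close>)
          then show "continuous_on (cbox 0 1) (\<lambda>s. c s * F (\<gamma> s (x(i := t))))" by simp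
        qed
        show "continuous_on (?U \<times> cbox 0 1) (\<lambda>(t, s). (c s * w i s) * partial_deriv i F (\<gamma> s (x(i := t))))"
          using continuous_on_compose2[OF cF[OF Ck_continuous[OF V p] cw] upd] xU
          by (auto simp: case_prod_beta image_subset_iff)
        fix t s assume t: "t \<in> ?U" and "s \<in> cbox (0::real) 1"
        then have s: "s \<in> {0..1}" by simp
        define y where "y = \<gamma> s (x(i := t))"
        have y: "y \<in> V" unfolding y_def by (rule \<gamma>V[OF xU[OF t] s])
        have yi: "y i = z0 i + w i s * (t - z0 i)" by (simp add: y_def \<gamma>_def)
        have e: "\<gamma> s (x(i := \<tau>)) = y(i := z0 i + w i s * (\<tau> - z0 i))" for \<tau>
          by (auto simp: y_def \<gamma>_def)
        have "((\<lambda>\<tau>. F (y(i := z0 i + w i s * (\<tau> - z0 i)))) has_real_derivative partial_deriv i F y * w i s) (at t)"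
        proof (rule DERIV_chain2[where f = "\<lambda>u. F (y(i := u))"])
          show "((\<lambda>u. F (y(i := u))) has_real_derivative partial_deriv i F y) (at (z0 i + w i s * (t - z0 i)))"
            using Ck_SucD(1)[OF V Suc.prems(1) i y] unfolding yi .
          show "((\<lambda>x. z0 i + w i s * (x - z0 i)) has_real_derivative w i s) (at t)"
            by (auto intro!: derivative_eq_intros)
        qed
        then have "((\<lambda>\<tau>. c s * F (\<gamma> s (x(i := \<tau>)))) has_real_derivative c s * (partial_deriv i F y * w i s)) (at t)"
          unfolding e by (rule DERIV_cmult)
        then show "((\<lambda>t. c s * F (\<gamma> s (x(i := t)))) has_real_derivative
            c s * w i s * partial_deriv i F (\<gamma> s (x(i := t)))) (at t within ?U)"
          by (simp add: y_def[symmetric] mult_ac has_field_derivative_at_within)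
      qed
      moreover have "at (x i) within ?U = at (x i)"
        by (rule at_within_interior) (use r in \<open>auto simp: interior_atLeastAtMost_real\<close>)
      ultimately show "((\<lambda>t. integral {0..1} (\<lambda>s. c s * F (\<gamma> s (x(i := t))))) has_real_derivative
         integral {0..1} (\<lambda>s. c s * w i s * partial_deriv i F (\<gamma> s x))) (at (x i))"
        by simp
    qed
  }
qed

lemma Cinf_partial: "Cinf_on n W f \<Longrightarrow> i < n \<Longrightarrow> Cinf_on n W (partial_deriv i f)"
  unfolding Cinf_on_def using Ck_on.simps(2) by blast

lemma Cinf_hadamard:
  assumes f: "Cinf_on n (cube n z0 r) f" and z0: "z0 \<in> euclid n" and r: "r > 0" and j: "j < n"
  shows "Cinf_on n (cube n z0 r) (hadamard f j z0)"
proof -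
  define w :: "nat \<Rightarrow> real \<Rightarrow> real" where
    "w i s = (if i < j then 1 else if i = j then s else 0)" for i s
  have t: "staircase j z0 z s = (\<lambda>i. z0 i + w i s * (z i - z0 i))" for z s
    by (auto simp: staircase_def w_def)
  have cw: "continuous_on {0..1} (w i)" for i
    by (cases "i < j"; cases "i = j") (auto simp: w_def[abs_def])
  have "Ck_on n k (cube n z0 r) (\<lambda>z. integral {0..1} (\<lambda>s. 1 * partial_deriv j f (\<lambda>i. z0 i + w i s * (z i - z0 i))))" for k
  proof (rule Ck_integral[OF openin_cube _ cw])
    show "(\<lambda>i. z0 i + w i s * (z i - z0 i)) \<in> cube n z0 r" if "z \<in> cube n z0 r" "s \<in> {0..1}" for z s
      unfolding t[symmetric]
      by (rule staircase_in[OF box_convex_cube openin_E_subset[OF openin_cube]]) (use that j z0 r cube_self in auto)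
    show "Ck_on n k (cube n z0 r) (partial_deriv j f)"
      using Cinf_partial[OF f j] by (simp add: Cinf_on_def)
  qed auto
  then show ?thesis by (simp add: Cinf_on_def hadamard_def[abs_def] t)
qed

section \<open>Ordinary differential equations\<close>

text \<open>The component index of a system will be one more argument of a bounded continuous function; giving it
  the discrete topology adds no continuity condition.\<close>

lemma continuous_on_discrete_Times:
  fixes f :: "'c discrete \<times> 'b::topological_space \<Rightarrow> 'd::topological_space"
  assumes "\<And>i. continuous_on UNIV (\<lambda>p. f (i, p))"
  shows "continuous_on UNIV f"
proof -
  have "continuous_on (\<Union>i\<in>UNIV. {i} \<times> UNIV) f"
  proof (rule continuous_on_open_UN)
    fix i :: "'c discrete"
    show "open ({i} \<times> (UNIV :: 'b set))" by (intro open_Times Discrete_Topology.open_discrete open_UNIV)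
    have "continuous_on ({i} \<times> UNIV) (\<lambda>q. f (i, snd q))"
      by (rule continuous_on_compose2[OF assms]) (auto intro: continuous_intros)
    then show "continuous_on ({i} \<times> UNIV) f"
      by (rule continuous_on_eq) auto
  qed
  moreover have "(\<Union>i\<in>UNIV. {i} \<times> UNIV) = (UNIV :: ('c discrete \<times> 'b) set)" by auto
  ultimately show ?thesis by simp
qed

text \<open>The primitive of \<open>F\<close> vanishing at \<open>0\<close>, written over the fixed interval
  \<open>[0, 1]\<close>. In this form positive and negative times are treated alike, and continuity in
  parameters is a statement about integrals over a fixed domain.\<close>

lemma scaled_integral_deriv:
  fixes F :: "real \<Rightarrow> real"
  assumes F: "continuous_on UNIV F"
  shows "((\<lambda>t. t * integral {0..1} (\<lambda>s. F (t * s))) has_real_derivative F t) (at t)"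
proof -
  define b where "b = \<bar>t\<bar> + 1"
  define G where "G u = integral {-b..u} F" for u
  have G: "(G has_real_derivative F u) (at u)" if "\<bar>u\<bar> < b" for u
    using integral_has_real_derivative[OF continuous_on_subset[OF F subset_UNIV], of u "-b" b] that
    by (simp add: G_def[abs_def] at_within_Icc_at abs_less_iff)
  have eq: "u * integral {0..1} (\<lambda>s. F (u * s)) = G u - G 0" if u: "\<bar>u\<bar> < b" for u
  proof -
    have "((\<lambda>s. G (u * s)) has_real_derivative F (u * s) * u) (at s)" if "s \<in> {0..1}" for s
    proof (rule DERIV_chain2[OF G])
      have "\<bar>u\<bar> * s \<le> \<bar>u\<bar> * 1" using that by (intro mult_left_mono) auto
      then show "\<bar>u * s\<bar> < b" using u that by (simp add: abs_mult)
    qed (auto intro!: derivative_eq_intros)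
    then have "((\<lambda>s. F (u * s) * u) has_integral (G (u * 1) - G (u * 0))) {0..1}"
      by (intro fundamental_theorem_of_calculus)
        (auto simp: has_real_derivative_iff_has_vector_derivative[symmetric] intro: has_field_derivative_at_within)
    then show ?thesis
      by (simp add: integral_unique mult.commute integral_mult_right[symmetric] del: integral_mult_right)
  qed
  have "((\<lambda>u. G u - G 0) has_real_derivative F t) (at t)"
    using G[of t] by (auto intro!: derivative_eq_intros simp: b_def)
  then show ?thesis
  proof (rule has_field_derivative_transform_within_open[where S = "{-b<..<b}"])
    show "t \<in> {-b<..<b}" by (auto simp: b_def)
  qed (auto simp: eq abs_less_iff)
qed

text \<open>The integral of \<open>exp (C \<bar>\<tau>\<bar>)\<close> over the interval between \<open>0\<close> and
  \<open>t\<close> is at most \<open>exp (C \<bar>t\<bar>) / C\<close>. So integration gains the factor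
  \<open>1 / C\<close> in the weighted norm, which makes the Picard operator a contraction on an interval
  of any length.\<close>

lemma weighted_integral_bound:
  fixes h :: "real \<Rightarrow> real"
  assumes C: "C > 0" and a: "a \<ge> 0" and b: "b \<ge> 0"
    and h: "continuous_on {0..1} h"
    and hb: "\<And>s. s \<in> {0..1} \<Longrightarrow> \<bar>h s\<bar> \<le> b + a * exp (C * \<bar>t\<bar> * s)"
  shows "\<bar>exp (- (C * \<bar>t\<bar>)) * (t * integral {0..1} h)\<bar> \<le> \<bar>t\<bar> * b + a / C"
proof -
  have ci: "(\<lambda>s. b + a * exp (C * \<bar>t\<bar> * s)) integrable_on {0..1}"
    by (intro integrable_continuous_real continuous_intros)
  have "\<bar>integral {0..1} h\<bar> \<le> integral {0..1} (\<lambda>s. b + a * exp (C * \<bar>t\<bar> * s))"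
    using integral_norm_bound_integral[OF integrable_continuous_real[OF h] ci] hb by simp
  then have "\<bar>t\<bar> * \<bar>integral {0..1} h\<bar> \<le> \<bar>t\<bar> * integral {0..1} (\<lambda>s. b + a * exp (C * \<bar>t\<bar> * s))"
    by (intro mult_left_mono) auto
  also have "\<dots> = integral {0..1} (\<lambda>s. \<bar>t\<bar> * (b + a * exp (C * \<bar>t\<bar> * s)))" by simp
  also have "\<dots> = (\<bar>t\<bar> * b * 1 + a / C * exp (C * \<bar>t\<bar> * 1)) - (\<bar>t\<bar> * b * 0 + a / C * exp (C * \<bar>t\<bar> * 0))"
  proof (rule integral_unique, rule fundamental_theorem_of_calculus)
    fix s :: real assume "s \<in> {0..1}"
    have "((\<lambda>s. \<bar>t\<bar> * b * s + a / C * exp (C * \<bar>t\<bar> * s)) has_real_derivative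
        \<bar>t\<bar> * (b + a * exp (C * \<bar>t\<bar> * s))) (at s within {0..1})"
      using C by (auto intro!: derivative_eq_intros simp: field_simps)
    then show "((\<lambda>s. \<bar>t\<bar> * b * s + a / C * exp (C * \<bar>t\<bar> * s)) has_vector_derivative
        \<bar>t\<bar> * (b + a * exp (C * \<bar>t\<bar> * s))) (at s within {0..1})"
      by (simp add: has_real_derivative_iff_has_vector_derivative)
  qed simp
  also have "\<dots> \<le> \<bar>t\<bar> * b + a / C * exp (C * \<bar>t\<bar>)" using a C by simp
  finally have "\<bar>t * integral {0..1} h\<bar> \<le> \<bar>t\<bar> * b + a / C * exp (C * \<bar>t\<bar>)" by (simp add: abs_mult)
  then have "exp (- (C * \<bar>t\<bar>)) * \<bar>t * integral {0..1} h\<bar> \<le> exp (- (C * \<bar>t\<bar>)) * (\<bar>t\<bar> * b + a / C * exp (C * \<bar>t\<bar>))"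
    by (intro mult_left_mono) auto
  also have "\<dots> = exp (- (C * \<bar>t\<bar>)) * (\<bar>t\<bar> * b) + a / C"
    by (simp add: algebra_simps exp_minus)
  also have "exp (- (C * \<bar>t\<bar>)) * (\<bar>t\<bar> * b) \<le> 1 * (\<bar>t\<bar> * b)"
    using C b by (intro mult_right_mono) auto
  finally show ?thesis by (simp add: abs_mult)
qed

text \<open>Picard's theorem with a parameter \<open>p\<close>, for the initial value \<open>0\<close> and a
  globally Lipschitz right-hand side. The contraction principle is applied to bounded continuous functions
  of component, time and parameter at once, so continuity in the parameter comes for free. Such a function
  \<open>g\<close> stands for \<open>X\<^sub>i(t, p) = exp (C \<bar>t\<bar>) g(i, t, p)\<close>; the
  factor turns the supremum norm into the weighted norm in which the Picard operator contracts. There is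
  no bound on the number of components, but only the first \<open>n\<close> of them influence the
  right-hand side.\<close>

lemma ode_exists:
  fixes f :: "nat \<Rightarrow> real \<Rightarrow> (nat \<Rightarrow> real) \<Rightarrow> (nat \<Rightarrow> real) \<Rightarrow> real" and e L M :: real
  assumes e: "e > 0" and L: "L \<ge> 0"
    and cont: "\<And>i. continuous_on UNIV (\<lambda>q. f i (fst q) (fst (snd q)) (snd (snd q)))"
    and bnd: "\<And>i t p. \<bar>f i t p (\<lambda>_. 0)\<bar> \<le> M"
    and lip: "\<And>i t p x y. \<bar>f i t p x - f i t p y\<bar> \<le> L * (\<Sum>j<n. \<bar>x j - y j\<bar>)"
  obtains X :: "nat \<Rightarrow> real \<Rightarrow> (nat \<Rightarrow> real) \<Rightarrow> real" where
    "\<And>i. continuous_on UNIV (\<lambda>q. X i (fst q) (snd q))"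
    "\<And>i p. X i 0 p = 0"
    "\<And>i t p. \<bar>t\<bar> < e \<Longrightarrow> ((\<lambda>t. X i t p) has_real_derivative f i t p (\<lambda>j. X j t p)) (at t)"
proof -
  \<comment> \<open>times beyond \<open>e\<close> are clamped, so that the Picard operator preserves boundedness\<close>
  define cl where "cl t = max (- e) (min e t)" for t
  have cl: "\<bar>cl t\<bar> \<le> e" "\<bar>t\<bar> \<le> e \<Longrightarrow> cl t = t" for t using e by (auto simp: cl_def)
  have ccl: "continuous_on S (\<lambda>x. cl (g x))" if "continuous_on S g" for g :: "'z::topological_space \<Rightarrow> real" and S
    unfolding cl_def by (intro continuous_intros that)
  \<comment> \<open>makes the contraction factor \<open>L n / C\<close> at most \<open>1 / 2\<close>\<close>
  define C where "C = 2 * L * real n + 1"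
  have C: "C > 0" using L by (simp add: C_def add_nonneg_pos)
  have LC: "L * real n / C \<le> 1 / 2" using L C by (simp add: C_def field_simps)
  have M: "M \<ge> 0" using bnd[of 0 0 "\<lambda>_. 0"] by linarith
  \<comment> \<open>\<open>h\<close> is the integrand and \<open>S\<close> the Picard operator in terms of \<open>g = exp (- C \<bar>t\<bar>) X\<close>\<close>
  define h where "h g i t p s = f i (t * s) p (\<lambda>j. exp (C * \<bar>t * s\<bar>) * apply_bcontfun g (discrete j, t * s, p))"
    for g :: "(nat discrete \<times> real \<times> (nat \<Rightarrow> real)) \<Rightarrow>\<^sub>C real" and i t p s
  define S where "S g = (\<lambda>(i, t, p). exp (- (C * \<bar>cl t\<bar>)) * (cl t * integral {0..1} (h g (of_discrete i) (cl t) p)))" for g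
  have ch: "continuous_on UNIV (\<lambda>q. h g i (cl (fst (fst q))) (snd (fst q)) (snd q))" for g i
    unfolding h_def
  proof (rule continuous_on_compose2[OF cont[of i], where f = "\<lambda>q. (cl (fst (fst q)) * snd q, snd (fst q),
      \<lambda>j. exp (C * \<bar>cl (fst (fst q)) * snd q\<bar>) * apply_bcontfun g (discrete j, cl (fst (fst q)) * snd q, snd (fst q)))", simplified])
    show "continuous_on UNIV (\<lambda>q. (cl (fst (fst q)) * snd q, snd (fst q),
      \<lambda>j. exp (C * \<bar>cl (fst (fst q)) * snd q\<bar>) * apply_bcontfun g (discrete j, cl (fst (fst q)) * snd q, snd (fst q))))"
      by (intro continuous_intros ccl continuous_on_coordinatewise_then_product
          continuous_on_compose2[OF continuous_on_apply_bcontfun[of UNIV g]]) auto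
  qed
  have chs: "continuous_on {0..1} (h g i (cl t) p)" for g i t p
  proof -
    have "continuous_on {0..1} (\<lambda>s::real. ((t, p), s))"
      by (intro continuous_on_Pair continuous_on_const continuous_on_id)
    from continuous_on_compose2[OF ch[of g i] this] show ?thesis by simp
  qed
  have cS: "continuous_on UNIV (S g)" for g
  proof (rule continuous_on_discrete_Times)
    fix i
    have "continuous_on UNIV (\<lambda>q. integral (cbox 0 1) (h g (of_discrete i) (cl (fst q)) (snd q)))"
      by (rule integral_continuous_on_param) (use ch[of g "of_discrete i"] in \<open>simp add: case_prod_beta continuous_on_subset[OF _ subset_UNIV]\<close>)
    then show "continuous_on UNIV (\<lambda>p. S g (i, p))"
      unfolding S_def case_prod_beta by (auto intro!: continuous_intros ccl)
  qed
  have absexp: "exp (C * \<bar>t * s\<bar>) = exp (C * \<bar>t\<bar> * s)" if "s \<in> {0..1}" for t s :: real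
    using that by (simp add: abs_mult mult.assoc)
  have diff: "\<bar>S g q - S g' q\<bar> \<le> (1/2) * dist g g'" for g g' q
  proof -
    obtain i t p where q: "q = (discrete i, t, p)" by (metis of_discrete_inverse prod_cases3)
    have "S g q - S g' q = exp (- (C * \<bar>cl t\<bar>)) * (cl t * integral {0..1} (\<lambda>s. h g i (cl t) p s - h g' i (cl t) p s))"
      unfolding integral_diff[OF integrable_continuous_real[OF chs[of g i t p]] integrable_continuous_real[OF chs[of g' i t p]]]
      by (simp add: S_def q right_diff_distrib discrete_inverse)
    also have "\<bar>\<dots>\<bar> \<le> \<bar>cl t\<bar> * 0 + (L * real n * dist g g') / C"
    proof (rule weighted_integral_bound[OF C])
      show "continuous_on {0..1} (\<lambda>s. h g i (cl t) p s - h g' i (cl t) p s)"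
        by (intro continuous_intros chs)
      show "0 \<le> L * real n * dist g g'" using L by simp
      fix s :: real assume s: "s \<in> {0..1}"
      have "\<bar>h g i (cl t) p s - h g' i (cl t) p s\<bar> \<le>
        L * (\<Sum>j<n. \<bar>exp (C * \<bar>cl t * s\<bar>) * apply_bcontfun g (discrete j, cl t * s, p) - exp (C * \<bar>cl t * s\<bar>) * apply_bcontfun g' (discrete j, cl t * s, p)\<bar>)"
        unfolding h_def by (rule lip)
      also have "\<dots> \<le> L * (\<Sum>j<n. exp (C * \<bar>cl t * s\<bar>) * dist g g')"
      proof (intro mult_left_mono sum_mono L)
        fix j
        have "\<bar>apply_bcontfun g (discrete j, cl t * s, p) - apply_bcontfun g' (discrete j, cl t * s, p)\<bar> \<le> dist g g'"
          using dist_bounded[of g "(discrete j, cl t * s, p)" g'] by (simp add: dist_real_def)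
        then show "\<bar>exp (C * \<bar>cl t * s\<bar>) * apply_bcontfun g (discrete j, cl t * s, p) - exp (C * \<bar>cl t * s\<bar>) * apply_bcontfun g' (discrete j, cl t * s, p)\<bar>
           \<le> exp (C * \<bar>cl t * s\<bar>) * dist g g'"
          by (simp add: right_diff_distrib[symmetric] abs_mult)
      qed
      also have "\<dots> = 0 + L * real n * dist g g' * exp (C * \<bar>cl t\<bar> * s)"
        unfolding absexp[OF s] by simp
      finally show "\<bar>h g i (cl t) p s - h g' i (cl t) p s\<bar> \<le> 0 + L * real n * dist g g' * exp (C * \<bar>cl t\<bar> * s)" .
    qed simp
    also have "\<dots> = (L * real n / C) * dist g g'" by simp
    also have "\<dots> \<le> (1/2) * dist g g'" by (rule mult_right_mono[OF LC]) simp
    finally show ?thesis .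
  qed
  have bS0: "\<bar>S 0 q\<bar> \<le> e * M" for q
  proof -
    obtain i t p where q: "q = (discrete i, t, p)" by (metis of_discrete_inverse prod_cases3)
    have "\<bar>S 0 q\<bar> \<le> \<bar>cl t\<bar> * M + 0 / C"
      unfolding S_def q case_prod_conv
      by (rule weighted_integral_bound[OF C _ M chs]) (use bnd in \<open>simp_all add: h_def\<close>)
    also have "\<dots> \<le> e * M + 0" using cl(1)[of t] M by (intro add_mono mult_right_mono) auto
    finally show ?thesis by simp
  qed
  have bS: "\<bar>S g q\<bar> \<le> e * M + (1/2) * dist g 0" for g q
  proof -
    have "\<bar>S g q\<bar> \<le> \<bar>S 0 q\<bar> + \<bar>S g q - S 0 q\<bar>" by linarith
    also have "\<dots> \<le> e * M + (1/2) * dist g 0" by (intro add_mono diff bS0)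
    finally show ?thesis .
  qed
  define T where "T g = Bcontfun (S g)" for g
  have T: "apply_bcontfun (T g) = S g" for g
    unfolding T_def by (rule Bcontfun_inverse) (use bS[of g] in \<open>auto intro!: bcontfun_normI[OF cS]\<close>)
  have "\<forall>g g'. dist (T g) (T g') \<le> (1/2) * dist g g'"
    by (intro allI dist_bound) (use diff in \<open>simp only: T dist_real_def\<close>)
  then obtain g where g: "T g = g" using banach_fix_type[of "1/2" T] by auto
  define X where "X i t p = exp (C * \<bar>cl t\<bar>) * apply_bcontfun g (discrete i, t, p)" for i t p
  show thesis
  proof
    show cX: "continuous_on UNIV (\<lambda>q. X i (fst q) (snd q))" for i
      unfolding X_def by (intro continuous_intros ccl
          continuous_on_compose2[OF continuous_on_apply_bcontfun[of UNIV g]]) auto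
    have gS: "apply_bcontfun g = S g" using T[of g] g by simp
    have Xeq: "X i t p = t * integral {0..1} (\<lambda>s. f i (cl (t * s)) p (\<lambda>j. X j (cl (t * s)) p))"
      if "\<bar>t\<bar> \<le> e" for i t p
    proof -
      have ts: "\<bar>t * s\<bar> \<le> e" if "s \<in> {0..1}" for s
      proof -
        have "\<bar>t\<bar> * \<bar>s\<bar> \<le> e * 1" using that \<open>\<bar>t\<bar> \<le> e\<close> e by (intro mult_mono) auto
        then show ?thesis by (simp add: abs_mult)
      qed
      have "X i t p = t * integral {0..1} (h g i t p)"
        by (simp add: X_def gS S_def cl(2)[OF that] exp_minus discrete_inverse)
      also have "integral {0..1} (h g i t p) = integral {0..1} (\<lambda>s. f i (cl (t * s)) p (\<lambda>j. X j (cl (t * s)) p))"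
        by (rule integral_cong) (simp add: h_def X_def cl(2)[OF ts])
      finally show ?thesis .
    qed
    show "X i 0 p = 0" for i p using Xeq[of 0 i p] e by simp
    fix i t p assume t: "\<bar>t\<bar> < e"
    have cF: "continuous_on UNIV (\<lambda>u. f i (cl u) p (\<lambda>j. X j (cl u) p))"
      by (rule continuous_on_compose2[OF cont[of i], where f = "\<lambda>u. (cl u, p, \<lambda>j. X j (cl u) p)", simplified])
        (intro continuous_intros ccl continuous_on_coordinatewise_then_product
          continuous_on_compose2[OF cX, where f = "\<lambda>u. (cl u, p)", simplified])
    have "((\<lambda>t. t * integral {0..1} (\<lambda>s. f i (cl (t * s)) p (\<lambda>j. X j (cl (t * s)) p))) has_real_derivative
        f i (cl t) p (\<lambda>j. X j (cl t) p)) (at t)"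
      by (rule scaled_integral_deriv[OF cF])
    then have "((\<lambda>t. X i t p) has_real_derivative f i (cl t) p (\<lambda>j. X j (cl t) p)) (at t)"
      by (rule has_field_derivative_transform_within_open[where S = "{-e<..<e}"])
        (use t in \<open>auto simp: Xeq\<close>)
    then show "((\<lambda>t. X i t p) has_real_derivative f i t p (\<lambda>j. X j t p)) (at t)"
      using t by (simp add: cl(2))
  qed
qed

text \<open>Gronwall's argument for uniqueness: \<open>F = \<Sum>\<^sub>i D\<^sub>i\<^sup>2\<close> satisfies
  \<open>\<bar>F'\<bar> \<le> c F\<close>, so \<open>F exp (- c t)\<close> decreases for positive times
  and \<open>F exp (c t)\<close> increases for negative times.\<close>

lemma ode_zero:
  fixes D D' :: "nat \<Rightarrow> real \<Rightarrow> real"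
  assumes d: "\<And>i s. i < n \<Longrightarrow> \<bar>s\<bar> < e \<Longrightarrow> (D i has_real_derivative D' i s) (at s)"
    and b: "\<And>i s. i < n \<Longrightarrow> \<bar>s\<bar> < e \<Longrightarrow> \<bar>D' i s\<bar> \<le> L * (\<Sum>j<n. \<bar>D j s\<bar>)"
    and L: "L \<ge> 0" and D0: "\<And>i. i < n \<Longrightarrow> D i 0 = 0" and t: "\<bar>t\<bar> < e" and i: "i < n"
  shows "D i t = 0"
proof -
  define F where "F s = (\<Sum>i<n. (D i s)\<^sup>2)" for s
  define F' where "F' s = (\<Sum>i<n. 2 * D i s * D' i s)" for s
  define c where "c = 2 * L * real n"
  have F: "(F has_real_derivative F' s) (at s)" if "\<bar>s\<bar> < e" for s
    unfolding F_def[abs_def] F'_def using that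
    by (auto intro!: derivative_eq_intros d sum.cong simp: power2_eq_square)
  have bF: "\<bar>F' s\<bar> \<le> c * F s" if s: "\<bar>s\<bar> < e" for s
  proof -
    have "\<bar>F' s\<bar> \<le> (\<Sum>i<n. \<bar>2 * D i s * D' i s\<bar>)" unfolding F'_def by (rule sum_abs)
    also have "\<dots> \<le> (\<Sum>i<n. \<Sum>j<n. L * ((D i s)\<^sup>2 + (D j s)\<^sup>2))"
    proof (rule sum_mono)
      fix i assume "i \<in> {..<n}"
      then have "\<bar>2 * D i s * D' i s\<bar> \<le> 2 * \<bar>D i s\<bar> * (L * (\<Sum>j<n. \<bar>D j s\<bar>))"
        using b s by (auto simp: abs_mult intro!: mult_left_mono)
      also have "\<dots> = (\<Sum>j<n. L * (2 * \<bar>D i s\<bar> * \<bar>D j s\<bar>))"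
        by (simp add: sum_distrib_left mult_ac)
      also have "\<dots> \<le> (\<Sum>j<n. L * ((D i s)\<^sup>2 + (D j s)\<^sup>2))"
      proof (intro sum_mono mult_left_mono L)
        fix j show "2 * \<bar>D i s\<bar> * \<bar>D j s\<bar> \<le> (D i s)\<^sup>2 + (D j s)\<^sup>2"
          using sum_squares_bound[of "\<bar>D i s\<bar>" "\<bar>D j s\<bar>"] by simp
      qed
      finally show "\<bar>2 * D i s * D' i s\<bar> \<le> (\<Sum>j<n. L * ((D i s)\<^sup>2 + (D j s)\<^sup>2))" .
    qed
    also have "\<dots> = c * F s"
      by (simp add: F_def c_def sum_distrib_left[symmetric] sum.distrib algebra_simps)
    finally show ?thesis .
  qed
  have F0: "F 0 = 0" by (simp add: F_def D0)
  have "F t \<le> 0"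
  proof (cases "t \<ge> 0")
    case True
    have "F t * exp (- c * t) \<le> F 0 * exp (- c * 0)"
    proof (rule DERIV_nonpos_imp_nonincreasing[OF True])
      fix s assume s: "0 \<le> s" "s \<le> t"
      then have "\<bar>s\<bar> < e" using t by auto
      then have "((\<lambda>s. F s * exp (- c * s)) has_real_derivative (F' s - c * F s) * exp (- c * s)) (at s)"
        by (auto intro!: derivative_eq_intros F simp: algebra_simps)
      moreover have "(F' s - c * F s) * exp (- c * s) \<le> 0"
        using bF[OF \<open>\<bar>s\<bar> < e\<close>] by (intro mult_nonpos_nonneg) auto
      ultimately show "\<exists>y. ((\<lambda>s. F s * exp (- c * s)) has_real_derivative y) (at s) \<and> y \<le> 0" by blast
    qed
    then show ?thesis by (simp add: F0 mult_le_0_iff)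
  next
    case False
    then have "t \<le> 0" by simp
    have "F t * exp (c * t) \<le> F 0 * exp (c * 0)"
    proof (rule DERIV_nonneg_imp_nondecreasing[OF \<open>t \<le> 0\<close>])
      fix s assume s: "t \<le> s" "s \<le> 0"
      then have "\<bar>s\<bar> < e" using t by auto
      then have "((\<lambda>s. F s * exp (c * s)) has_real_derivative (F' s + c * F s) * exp (c * s)) (at s)"
        by (auto intro!: derivative_eq_intros F simp: algebra_simps)
      moreover have "(F' s + c * F s) * exp (c * s) \<ge> 0"
        using bF[OF \<open>\<bar>s\<bar> < e\<close>] by (intro mult_nonneg_nonneg) auto
      ultimately show "\<exists>y. ((\<lambda>s. F s * exp (c * s)) has_real_derivative y) (at s) \<and> y \<ge> 0" by blast
    qed
    then show ?thesis by (simp add: F0 mult_le_0_iff)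
  qed
  then have "F t = 0" using sum_nonneg[of "{..<n}" "\<lambda>i. (D i t)\<^sup>2"] by (simp add: F_def)
  then have "(D i t)\<^sup>2 = 0" using i by (simp add: F_def sum_nonneg_eq_0_iff)
  then show ?thesis by simp
qed

section \<open>Smooth dependence on parameters\<close>

lemma continuous_on_local:
  assumes "\<And>x. x \<in> S \<Longrightarrow> \<exists>T. open T \<and> x \<in> T \<and> continuous_on (S \<inter> T) f"
  shows "continuous_on S f"
  unfolding continuous_on_topological
proof (intro ballI allI impI)
  fix x B assume x: "x \<in> S" and B: "open B" "f x \<in> B"
  obtain T where T: "open T" "x \<in> T" "continuous_on (S \<inter> T) f" using assms[OF x] by blast
  obtain A where "open A" "x \<in> A" "\<forall>y\<in>S \<inter> T. y \<in> A \<longrightarrow> f y \<in> B"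
    using T x B unfolding continuous_on_topological by blast
  then show "\<exists>A. open A \<and> x \<in> A \<and> (\<forall>y\<in>S. y \<in> A \<longrightarrow> f y \<in> B)"
    using T by (intro exI[of _ "A \<inter> T"]) auto
qed

lemma continuous_on_upd:
  fixes g :: "'b::topological_space \<Rightarrow> nat \<Rightarrow> real"
  assumes "continuous_on S g" "continuous_on S f"
  shows "continuous_on S (\<lambda>z. (g z)(i := f z))"
proof (rule continuous_on_coordinatewise_then_product)
  fix j show "continuous_on S (\<lambda>z. ((g z)(i := f z)) j)"
    using assms continuous_on_apply[OF assms(1), of j] by (cases "j = i") simp_all
qed

text \<open>Tychonoff's theorem; compact subsets of Euclidean \<open>n\<close>-space arise with \<open>{0}\<close>
  as factor from index \<open>n\<close> on.\<close>

lemma compact_fun_box: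
  fixes A :: "nat \<Rightarrow> real set"
  assumes "\<And>i. compact (A i)"
  shows "compact {x. \<forall>i. x i \<in> A i}"
proof -
  have "compactin (product_topology (\<lambda>i::nat. euclideanreal) UNIV) (PiE UNIV A)"
    using assms by (simp add: compactin_PiE)
  moreover have "PiE UNIV A = {x. \<forall>i. x i \<in> A i}" by (auto simp: PiE_def)
  ultimately show ?thesis by (simp add: euclidean_product_topology)
qed

lemma compact_bounded_real:
  fixes f :: "'a::topological_space \<Rightarrow> real"
  assumes "compact S" "continuous_on S f"
  shows "\<exists>b\<ge>0. \<forall>x\<in>S. \<bar>f x\<bar> \<le> b"
proof -
  have "bounded (f ` S)" using assms compact_continuous_image compact_imp_bounded by blast
  then obtain b where "\<And>x. x \<in> S \<Longrightarrow> \<bar>f x\<bar> \<le> b" unfolding bounded_iff by auto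
  then have "\<bar>b\<bar> \<ge> 0" "\<And>x. x \<in> S \<Longrightarrow> \<bar>f x\<bar> \<le> \<bar>b\<bar>" by force+
  then show ?thesis by blast
qed

lemma common_bound:
  fixes F :: "'a \<Rightarrow> 'b \<Rightarrow> real"
  assumes "finite A" "\<And>a. a \<in> A \<Longrightarrow> \<exists>b. \<forall>z. \<bar>F a z\<bar> \<le> b"
  shows "\<exists>b\<ge>0. \<forall>a\<in>A. \<forall>z. \<bar>F a z\<bar> \<le> b"
proof -
  obtain c where c: "\<And>a z. a \<in> A \<Longrightarrow> \<bar>F a z\<bar> \<le> c a" using assms(2) by metis
  show ?thesis
  proof (intro exI[of _ "\<Sum>a\<in>A. \<bar>c a\<bar>"] conjI ballI allI)
    show "0 \<le> (\<Sum>a\<in>A. \<bar>c a\<bar>)" by (simp add: sum_nonneg)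
    fix a z assume a: "a \<in> A"
    have "\<bar>F a z\<bar> \<le> \<bar>c a\<bar>" using c[OF a, of z] by linarith
    also have "\<dots> \<le> (\<Sum>a\<in>A. \<bar>c a\<bar>)" using a assms(1) by (intro member_le_sum) auto
    finally show "\<bar>F a z\<bar> \<le> (\<Sum>a\<in>A. \<bar>c a\<bar>)" .
  qed
qed

text \<open>Retraction of the line onto an interval. Composing a vector field with it turns local bounds into global
  ones without changing solutions that stay in the interval.\<close>

definition clamp1 :: "real \<Rightarrow> real \<Rightarrow> real \<Rightarrow> real" where
  "clamp1 c r t = max (c - r) (min (c + r) t)"

lemma clamp1_in: "r \<ge> 0 \<Longrightarrow> clamp1 c r t \<in> {c - r..c + r}"
  by (auto simp: clamp1_def)

lemma clamp1_id: "\<bar>t - c\<bar> \<le> r \<Longrightarrow> clamp1 c r t = t"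
  by (auto simp: clamp1_def)

lemma clamp1_lip: "\<bar>clamp1 c r s - clamp1 c r t\<bar> \<le> \<bar>s - t\<bar>"
  by (auto simp: clamp1_def)

lemma continuous_on_clamp1: "continuous_on S g \<Longrightarrow> continuous_on S (\<lambda>x. clamp1 c r (g x))"
  unfolding clamp1_def by (intro continuous_intros)

text \<open>\<open>\<Phi> t p\<close> is the solution at time \<open>t\<close> of \<open>x' = K x\<close> with
  initial value \<open>c p\<close>, as a continuous function of time and of the parameter
  \<open>p\<close>. Parameters are kept apart from initial values because the variational system has more
  unknowns but the same parameters.\<close>

definition flow_family ::
  "nat \<Rightarrow> nat \<Rightarrow> (nat \<Rightarrow> real) set \<Rightarrow> (nat \<Rightarrow> (nat \<Rightarrow> real) \<Rightarrow> real) \<Rightarrow> (nat \<Rightarrow> real) set \<Rightarrow> real \<Rightarrow>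
   (nat \<Rightarrow> (nat \<Rightarrow> real) \<Rightarrow> real) \<Rightarrow> (real \<Rightarrow> (nat \<Rightarrow> real) \<Rightarrow> nat \<Rightarrow> real) \<Rightarrow> bool" where
  "flow_family n q V K W e c \<Phi> \<longleftrightarrow>
     openin (Euclidean_space n) V \<and> box_convex n V \<and> (\<forall>i<n. Cinf_on n V (K i)) \<and>
     openin (Euclidean_space q) W \<and> (\<forall>i<n. Cinf_on q W (c i)) \<and> e > 0 \<and>
     (\<forall>t p. \<bar>t\<bar> < e \<longrightarrow> p \<in> W \<longrightarrow> \<Phi> t p \<in> V) \<and>
     (\<forall>i<n. continuous_on ({-e<..<e} \<times> W) (\<lambda>z. \<Phi> (fst z) (snd z) i)) \<and>
     (\<forall>i<n. \<forall>p\<in>W. \<Phi> 0 p i = c i p) \<and>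
     (\<forall>i<n. \<forall>p\<in>W. \<forall>t. \<bar>t\<bar> < e \<longrightarrow> ((\<lambda>t. \<Phi> t p i) has_real_derivative K i (\<Phi> t p)) (at t))"

text \<open>The divided difference \<open>Q\<close> of \<open>\<Phi>\<close> in the \<open>l\<close>-th parameter,
  continuous up to increment \<open>0\<close>. By Hadamard's decomposition the difference of two solutions
  solves the linear equation \<open>D\<^sub>i' = \<Sum>\<^sub>j H\<^sub>i\<^sub>j D\<^sub>j\<close> whose
  coefficients \<open>H\<^sub>i\<^sub>j\<close> are Hadamard coefficients of \<open>K\<close> along the
  two solutions. Solve this linear equation with the divided difference of the initial values as initial
  value; by uniqueness the solution \<open>Q\<close>, multiplied by the increment, is the difference of
  the two solutions. It also makes sense for increment \<open>0\<close>, where \<open>H\<close> becomes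
  the derivative of \<open>K\<close>. The increment is stored as coordinate \<open>q\<close> of the
  parameter, which is otherwise \<open>0\<close>.\<close>

lemma flow_difference_quotient:
  assumes ff: "flow_family n q V K W e c \<Phi>" and l: "l < q" and p0: "p0 \<in> W"
    and e': "0 < e'" "e' < e"
  obtains r Q where "r > 0" "cube q p0 r \<subseteq> W"
    "\<And>i. i < n \<Longrightarrow> continuous_on UNIV (\<lambda>z. Q i (fst z) (snd z))"
    "\<And>i t p d. i < n \<Longrightarrow> \<bar>t\<bar> < e' \<Longrightarrow> p \<in> cube q p0 r \<Longrightarrow> \<bar>d\<bar> \<le> r \<Longrightarrow>
       \<Phi> t (p(l := p l + d)) i - \<Phi> t p i = d * Q i t (p(q := d))"
    "\<And>i t p. i < n \<Longrightarrow> \<bar>t\<bar> < e' \<Longrightarrow> p \<in> cube q p0 r \<Longrightarrow>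
       ((\<lambda>t. Q i t p) has_real_derivative (\<Sum>j<n. partial_deriv j (K i) (\<Phi> t p) * Q j t p)) (at t)"
proof -
  note ff' = ff[unfolded flow_family_def]
  have V: "openin (Euclidean_space n) V" "box_convex n V" and K: "\<And>i. i < n \<Longrightarrow> Ck_on n (Suc 0) V (K i)"
    and W: "openin (Euclidean_space q) W" and c: "\<And>i. i < n \<Longrightarrow> Ck_on q (Suc 0) W (c i)"
    and PhiV: "\<And>t p. \<bar>t\<bar> < e \<Longrightarrow> p \<in> W \<Longrightarrow> \<Phi> t p \<in> V"
    and Phic: "\<And>i. i < n \<Longrightarrow> continuous_on ({-e<..<e} \<times> W) (\<lambda>z. \<Phi> (fst z) (snd z) i)"
    and Phi0: "\<And>i p. i < n \<Longrightarrow> p \<in> W \<Longrightarrow> \<Phi> 0 p i = c i p"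
    and Phid: "\<And>i p t. i < n \<Longrightarrow> p \<in> W \<Longrightarrow> \<bar>t\<bar> < e \<Longrightarrow> ((\<lambda>t. \<Phi> t p i) has_real_derivative K i (\<Phi> t p)) (at t)"
    using ff' by (simp_all add: Cinf_on_def del: Ck_on.simps)
  have p0E: "p0 \<in> euclid q" using p0 openin_E_subset[OF W] by blast
  obtain R where R: "R > 0" "cube q p0 R \<subseteq> W" using openin_E_cube[OF W p0] by blast
  define r where "r = R / 4"
  have r: "r > 0" using R by (simp add: r_def)
  define Bx where "Bx = {x. \<forall>i. x i \<in> (if i < q then {p0 i - r..p0 i + r} else {0})}"
  have "compact Bx" unfolding Bx_def by (rule compact_fun_box) auto
  define Z where "Z = {-e'..e'} \<times> Bx \<times> {-r..r}"
  have Z: "compact Z" unfolding Z_def by (intro compact_Times \<open>compact Bx\<close> compact_Icc)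
  \<comment> \<open>all triples of time, parameter and increment range over the compact set \<open>Z\<close>, on which the coefficients \<open>H\<close> and \<open>G\<close> are bounded\<close>
  define sh where "sh p d = p(l := p l + d)" for p :: "nat \<Rightarrow> real" and d
  have BxR: "p \<in> cube q p0 R" "sh p d \<in> cube q p0 R" if "p \<in> Bx" "d \<in> {-r..r}" for p d
  proof -
    have all: "p i \<in> (if i < q then {p0 i - r..p0 i + r} else {0})" for i
      using \<open>p \<in> Bx\<close> by (simp only: Bx_def mem_Collect_eq)
    have *: "\<bar>p i - p0 i\<bar> \<le> r" if "i < q" for i
      using all[of i] that by (simp add: abs_le_iff)
    have z: "p i = 0" if "i \<ge> q" for i using all[of i] that by simp
    have "r < R" "r + r < R" using R by (auto simp: r_def)
    show "p \<in> cube q p0 R" using * z \<open>r < R\<close> by (force simp: cube_def euclid_def)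
    have "\<bar>sh p d i - p0 i\<bar> < R" if "i < q" for i
      using *[OF that] \<open>r + r < R\<close> \<open>d \<in> _\<close> r by (auto simp: sh_def)
    then show "sh p d \<in> cube q p0 R" using z l by (auto simp: cube_def euclid_def sh_def)
  qed
  then have BxW: "p \<in> W" "sh p d \<in> W" if "p \<in> Bx" "d \<in> {-r..r}" for p d
    using R(2) that by blast+
  have csh: "continuous_on S (\<lambda>z. sh (fst (snd z)) (snd (snd z)))" for S :: "('b::topological_space \<times> _) set"
    unfolding sh_def
    by (intro continuous_on_upd continuous_on_add continuous_on_fst continuous_on_snd continuous_on_id
        continuous_on_apply[OF continuous_on_fst[OF continuous_on_snd[OF continuous_on_id]]])
  have cPhi: "continuous_on S (\<lambda>z. \<Phi> (f z) (g z))"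
    if "continuous_on S f" "continuous_on S g" "\<And>z. z \<in> S \<Longrightarrow> \<bar>f z\<bar> < e \<and> g z \<in> W"
    for S :: "'b::topological_space set" and f g
  proof (rule continuous_on_coordinatewise_then_product)
    fix i
    show "continuous_on S (\<lambda>z. \<Phi> (f z) (g z) i)"
    proof (cases "i < n")
      case True
      have "continuous_on S (\<lambda>z. (f z, g z))" by (intro continuous_on_Pair that)
      moreover have "(f z, g z) \<in> {-e<..<e} \<times> W" if "z \<in> S" for z
        using \<open>\<And>z. z \<in> S \<Longrightarrow> _\<close>[OF that] by auto
      then have "(\<lambda>z. (f z, g z)) ` S \<subseteq> {-e<..<e} \<times> W" by blast
      ultimately show ?thesis
        using continuous_on_compose2[OF Phic[OF True], of S "\<lambda>z. (f z, g z)"] by simp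
    next
      case False
      then have "\<Phi> (f z) (g z) i = 0" if "z \<in> S" for z
        using PhiV \<open>\<And>z. z \<in> S \<Longrightarrow> _\<close> that openin_E_subset[OF V(1)] by (force simp: euclid_def)
      then show ?thesis using continuous_on_const[of S "0::real"] by (simp cong: continuous_on_cong)
    qed
  qed
  define H where "H i j = (\<lambda>z. hadamard (K i) j (\<Phi> (fst z) (fst (snd z))) (\<Phi> (fst z) (sh (fst (snd z)) (snd (snd z)))))" for i j
  define G where "G i = (\<lambda>z :: real \<times> (nat \<Rightarrow> real) \<times> real. hadamard (c i) l (fst (snd z)) (sh (fst (snd z)) (snd (snd z))))" for i
  have Ze: "\<bar>fst z\<bar> < e" "fst (snd z) \<in> Bx" "snd (snd z) \<in> {-r..r}" if "z \<in> Z" for z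
    using that e' by (auto simp: Z_def)
  have ZW: "\<bar>fst z\<bar> < e \<and> fst (snd z) \<in> W" "\<bar>fst z\<bar> < e \<and> sh (fst (snd z)) (snd (snd z)) \<in> W"
    if "z \<in> Z" for z
    using Ze[OF that] BxW by blast+
  have cfst: "continuous_on S fst" "continuous_on S (\<lambda>z. fst (snd z))"
    for S :: "(real \<times> (nat \<Rightarrow> real) \<times> real) set"
    by (intro continuous_on_fst continuous_on_snd continuous_on_id)+
  have cH: "continuous_on Z (H i j)" if "i < n" "j < n" for i j
  proof -
    have A: "continuous_on Z (\<lambda>z. (\<Phi> (fst z) (fst (snd z)), \<Phi> (fst z) (sh (fst (snd z)) (snd (snd z)))))"
      by (rule continuous_on_Pair[OF cPhi[OF cfst ZW(1)] cPhi[OF cfst(1) csh ZW(2)]])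
    have B: "(\<lambda>z. (\<Phi> (fst z) (fst (snd z)), \<Phi> (fst z) (sh (fst (snd z)) (snd (snd z))))) ` Z \<subseteq> V \<times> V"
      using ZW PhiV by blast
    show ?thesis
      using continuous_on_compose2[OF continuous_on_hadamard[OF V K[OF that(1)] that(2)] A B]
      unfolding H_def by (simp add: case_prod_beta)
  qed
  have cG: "continuous_on Z (G i)" if "i < n" for i
  proof -
    have A: "continuous_on Z (\<lambda>z. (fst (snd z), sh (fst (snd z)) (snd (snd z))))"
      by (rule continuous_on_Pair[OF cfst(2) csh])
    have B: "(\<lambda>z. (fst (snd z), sh (fst (snd z)) (snd (snd z)))) ` Z \<subseteq> cube q p0 R \<times> cube q p0 R"
      using Ze(2,3) BxR by blast
    show ?thesis
      using continuous_on_compose2[OF continuous_on_hadamard[OF openin_cube box_convex_cube Ck_on_subset[OF c[OF that] R(2)] l] A B]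
      unfolding G_def by (simp add: case_prod_beta)
  qed
  \<comment> \<open>retraction of all times and parameters onto \<open>Z\<close>, the increment being read off from coordinate \<open>q\<close>\<close>
  define pc where "pc p = (\<lambda>i. if i < q then clamp1 (p0 i) r (p i) else 0)" for p :: "nat \<Rightarrow> real"
  define cz where "cz = (\<lambda>(t, p). (clamp1 0 e' t, pc p, clamp1 0 r (p q)))"
  have czZ: "cz tp \<in> Z" for tp
    using r e' clamp1_in[of r] clamp1_in[of e' 0] clamp1_in[of r 0]
    by (auto simp: cz_def Z_def pc_def Bx_def split: prod.split)
  have ccz: "continuous_on UNIV cz"
    unfolding cz_def pc_def case_prod_beta
  proof (intro continuous_on_Pair continuous_on_clamp1 continuous_on_coordinatewise_then_product)
    fix i show "continuous_on UNIV (\<lambda>x::real \<times> (nat \<Rightarrow> real). if i < q then clamp1 (p0 i) r (snd x i) else 0)"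
      using continuous_on_clamp1[OF continuous_on_apply[OF continuous_on_snd[OF continuous_on_id]]]
      by (cases "i < q") simp_all
  qed (intro continuous_on_apply[OF continuous_on_snd] continuous_on_fst continuous_on_id)+
  have cz_eq: "cz (t, p(q := d)) = (t, p, d)" if "\<bar>t\<bar> < e'" "p \<in> cube q p0 r" "\<bar>d\<bar> \<le> r" for t p d
  proof -
    have "pc (p(q := d)) = p"
      using that(2) by (auto simp: pc_def cube_def fun_eq_iff clamp1_id euclid_def less_imp_le)
    then show ?thesis using that by (simp add: cz_def clamp1_id)
  qed
  have "\<exists>b. \<forall>tp. \<bar>H (fst a) (snd a) (cz tp)\<bar> \<le> b" if "a \<in> {..<n} \<times> {..<n}" for a
  proof -
    have "fst a < n" "snd a < n" using that by auto
    from compact_bounded_real[OF Z cH[OF this]] show ?thesis using czZ by blast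
  qed
  from common_bound[of "{..<n} \<times> {..<n}" "\<lambda>a tp. H (fst a) (snd a) (cz tp)", OF _ this]
  obtain bH where bH0: "bH \<ge> 0" "\<forall>a\<in>{..<n} \<times> {..<n}. \<forall>tp. \<bar>H (fst a) (snd a) (cz tp)\<bar> \<le> bH"
    by auto
  have bH: "bH \<ge> 0" "\<And>i j tp. i < n \<Longrightarrow> j < n \<Longrightarrow> \<bar>H i j (cz tp)\<bar> \<le> bH"
    using bH0(1) bH0(2)[rule_format, of "(i, j)" for i j] by auto
  have "\<exists>b. \<forall>tp. \<bar>G i (cz tp)\<bar> \<le> b" if "i \<in> {..<n}" for i
  proof -
    have "i < n" using that by auto
    from compact_bounded_real[OF Z cG[OF this]] show ?thesis using czZ by blast
  qed
  from common_bound[of "{..<n}" "\<lambda>i tp. G i (cz tp)", OF _ this]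
  obtain bG where bG: "bG \<ge> 0" "\<And>i tp. i < n \<Longrightarrow> \<bar>G i (cz tp)\<bar> \<le> bG"
    by auto
  have cHz: "continuous_on S (\<lambda>z. H i j (cz (g z)))" if "i < n" "j < n" "continuous_on S g"
    for i j S and g :: "'b::topological_space \<Rightarrow> real \<times> (nat \<Rightarrow> real)"
    by (rule continuous_on_compose2[OF cH[OF that(1,2)] continuous_on_compose2[OF ccz that(3)]])
      (simp, unfold image_subset_iff, blast intro: czZ)
  have cGz: "continuous_on S (\<lambda>z. G i (cz (g z)))" if "i < n" "continuous_on S g"
    for i S and g :: "'b::topological_space \<Rightarrow> real \<times> (nat \<Rightarrow> real)"
    by (rule continuous_on_compose2[OF cG[OF that(1)] continuous_on_compose2[OF ccz that(2)]])
      (simp, unfold image_subset_iff, blast intro: czZ)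
  \<comment> \<open>the unknown is \<open>Q\<close> minus its initial value \<open>G\<close>, so that it starts at \<open>0\<close>\<close>
  define f where "f i t p x = (if i < n then \<Sum>j<n. H i j (cz (t, p)) * (G j (cz (0, p)) + x j) else 0)"
    for i t p and x :: "nat \<Rightarrow> real"
  obtain X where X: "\<And>i. continuous_on UNIV (\<lambda>z. X i (fst z) (snd z))" "\<And>i p. X i 0 p = 0"
      "\<And>i t p. \<bar>t\<bar> < e' \<Longrightarrow> ((\<lambda>t. X i t p) has_real_derivative f i t p (\<lambda>j. X j t p)) (at t)"
  proof (rule ode_exists[of e' bH f "real n * (bH * bG)" n])
    show "continuous_on UNIV (\<lambda>q. f i (fst q) (fst (snd q)) (snd (snd q)))" for i
    proof (cases "i < n")
      case True
      have "continuous_on UNIV (\<lambda>q. \<Sum>j<n. H i j (cz (fst q, fst (snd q))) * (G j (cz (0, fst (snd q))) + snd (snd q) j))"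
      proof (intro continuous_on_sum continuous_on_mult continuous_on_add cHz cGz True)
        fix j show "continuous_on UNIV (\<lambda>q::real \<times> (nat \<Rightarrow> real) \<times> (nat \<Rightarrow> real). snd (snd q) j)"
          by (intro continuous_on_apply continuous_on_snd continuous_on_id)
      qed (simp | intro continuous_on_Pair continuous_on_fst continuous_on_snd continuous_on_const continuous_on_id)+
      then show ?thesis using True by (simp add: f_def)
    qed (simp add: f_def)
    show "\<bar>f i t p (\<lambda>_. 0)\<bar> \<le> real n * (bH * bG)" for i t p
    proof (cases "i < n")
      case True
      have "\<bar>f i t p (\<lambda>_. 0)\<bar> \<le> (\<Sum>j<n. \<bar>H i j (cz (t, p)) * G j (cz (0, p))\<bar>)"
        using True by (simp add: f_def sum_abs)
      also have "\<dots> \<le> (\<Sum>j<n. bH * bG)"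
        using True bH bG by (intro sum_mono) (auto simp: abs_mult intro!: mult_mono)
      finally show ?thesis by simp
    qed (use bH bG in \<open>simp add: f_def\<close>)
    show "\<bar>f i t p x - f i t p y\<bar> \<le> bH * (\<Sum>j<n. \<bar>x j - y j\<bar>)" for i t p x y
    proof (cases "i < n")
      case True
      have "f i t p x - f i t p y = (\<Sum>j<n. H i j (cz (t, p)) * (x j - y j))"
        using True by (simp add: f_def sum_subtractf[symmetric] algebra_simps)
      also have "\<bar>\<dots>\<bar> \<le> (\<Sum>j<n. \<bar>H i j (cz (t, p)) * (x j - y j)\<bar>)" by (rule sum_abs)
      also have "\<dots> \<le> (\<Sum>j<n. bH * \<bar>x j - y j\<bar>)"
        using True bH by (intro sum_mono) (auto simp: abs_mult intro!: mult_right_mono)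
      finally show ?thesis by (simp add: sum_distrib_left)
    qed (use bH in \<open>simp add: f_def sum_nonneg\<close>)
  qed (use e' bH in auto)
  define Q where "Q i t p = G i (cz (0, p)) + X i t p" for i t p
  have Qd: "((\<lambda>t. Q i t p) has_real_derivative (\<Sum>j<n. H i j (cz (t, p)) * Q j t p)) (at t)"
    if "i < n" "\<bar>t\<bar> < e'" for i t p
    using X(3)[OF that(2), of i p] that(1) unfolding Q_def by (auto intro!: derivative_eq_intros simp: f_def)
  show thesis
  proof (rule that[OF r])
    have "r \<le> R" using R(1) by (simp add: r_def)
    then show "cube q p0 r \<subseteq> W" using R(2) cube_mono by blast
    then have cW: "p \<in> W" if "p \<in> cube q p0 r" for p using that by blast
    show "continuous_on UNIV (\<lambda>z. Q i (fst z) (snd z))" if "i < n" for i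
      unfolding Q_def by (intro continuous_on_add cGz that X(1) continuous_on_Pair continuous_on_const continuous_on_snd continuous_on_id)
    fix i t p assume i: "i < n" and t: "\<bar>t\<bar> < e'" and p: "p \<in> cube q p0 r"
    have pq: "p(q := 0) = p" using p by (auto simp: cube_def euclid_def)
    show "((\<lambda>t. Q i t p) has_real_derivative (\<Sum>j<n. partial_deriv j (K i) (\<Phi> t p) * Q j t p)) (at t)"
    proof -
      have "H i j (cz (t, p)) = partial_deriv j (K i) (\<Phi> t p)" for j
        using cz_eq[OF t p, of 0] r by (simp add: pq H_def sh_def hadamard_diag)
      then show ?thesis using Qd[OF i t, of p] by simp
    qed
    fix d assume d: "\<bar>d\<bar> \<le> r"
    define p' where "p' = p(q := d)"
    have shW: "sh p d \<in> W" and shR: "sh p d \<in> cube q p0 R" and pR: "p \<in> cube q p0 R"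
    proof -
      have "p i \<in> (if i < q then {p0 i - r..p0 i + r} else {0})" for i
      proof (cases "i < q")
        case True
        then have "\<bar>p i - p0 i\<bar> < r" using p by (simp add: cube_def)
        then show ?thesis using True by auto
      qed (use p in \<open>simp add: cube_def euclid_def\<close>)
      then have "p \<in> Bx" unfolding Bx_def by blast
      moreover have "d \<in> {-r..r}" using d by auto
      ultimately show "sh p d \<in> W" "sh p d \<in> cube q p0 R" "p \<in> cube q p0 R" using BxW BxR by blast+
    qed
    \<comment> \<open>the difference of the two solutions and \<open>d Q\<close> solve the same linear equation with the same initial value\<close>
    define D where "D i s = \<Phi> s (sh p d) i - \<Phi> s p i - d * Q i s p'" for i s
    have "D i t = 0"
    proof (rule ode_zero[where D = D and t = t and i = i and n = n and e = e' and L = bH and D' = "\<lambda>i s. \<Sum>j<n. H i j (cz (s, p')) * D j s"])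
      show "((D i) has_real_derivative (\<Sum>j<n. H i j (cz (s, p')) * D j s)) (at s)" if i: "i < n" and s: "\<bar>s\<bar> < e'" for i s
      proof -
        have se: "\<bar>s\<bar> < e" using s e' by linarith
        have "K i (\<Phi> s (sh p d)) - K i (\<Phi> s p) = (\<Sum>j<n. (\<Phi> s (sh p d) j - \<Phi> s p j) * H i j (cz (s, p')))"
          using hadamard_formula[OF V K[OF i] PhiV[OF se cW[OF p]] PhiV[OF se shW]]
          by (simp add: H_def cz_eq[OF s p d] p'_def)
        moreover have "(\<Sum>j<n. H i j (cz (s, p')) * D j s) =
           (\<Sum>j<n. (\<Phi> s (sh p d) j - \<Phi> s p j) * H i j (cz (s, p'))) - d * (\<Sum>j<n. H i j (cz (s, p')) * Q j s p')"
          by (simp add: D_def sum_subtractf[symmetric] sum_distrib_left algebra_simps)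
        ultimately show ?thesis unfolding D_def
          using Phid[OF i shW se] Phid[OF i cW[OF p] se] Qd[OF i s, of p']
          by (auto intro!: derivative_eq_intros)
      qed
      show "\<bar>\<Sum>j<n. H i j (cz (s, p')) * D j s\<bar> \<le> bH * (\<Sum>j<n. \<bar>D j s\<bar>)" if "i < n" for i s
      proof -
        have "\<bar>\<Sum>j<n. H i j (cz (s, p')) * D j s\<bar> \<le> (\<Sum>j<n. \<bar>H i j (cz (s, p')) * D j s\<bar>)" by (rule sum_abs)
        also have "\<dots> \<le> (\<Sum>j<n. bH * \<bar>D j s\<bar>)"
          using that bH by (intro sum_mono) (auto simp: abs_mult intro!: mult_right_mono)
        finally show ?thesis by (simp add: sum_distrib_left)
      qed
      show "D i 0 = 0" if i: "i < n" for i
      proof -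
        have "c i (sh p d) - c i p = (\<Sum>j<q. (sh p d j - p j) * hadamard (c i) j p (sh p d))"
          by (rule hadamard_formula[OF openin_cube box_convex_cube Ck_on_subset[OF c[OF i] R(2)] pR shR])
        also have "\<dots> = (\<Sum>j<q. if j = l then d * hadamard (c i) l p (sh p d) else 0)"
          by (rule sum.cong) (auto simp: sh_def)
        also have "\<dots> = d * hadamard (c i) l p (sh p d)" using l by simp
        finally show ?thesis
          using cz_eq[of 0 p d] e' p d
          by (simp add: D_def Q_def X(2) Phi0[OF i shW] Phi0[OF i cW[OF p]] G_def p'_def)
      qed
    qed (use bH t i in auto)
    then show "\<Phi> t (p(l := p l + d)) i - \<Phi> t p i = d * Q i t (p(q := d))"
      by (simp add: D_def sh_def p'_def)
  qed
qed

text \<open>The parameter derivative is the value of the continuous divided difference at increment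
  \<open>0\<close>, so it exists, is jointly continuous and solves the linearised equation.\<close>

lemma flow_variation:
  assumes ff: "flow_family n q V K W e c \<Phi>" and l: "l < q"
  defines "\<Psi> \<equiv> \<lambda>t p i. partial_deriv l (\<lambda>p. \<Phi> t p i) p"
  shows "\<And>i t p. i < n \<Longrightarrow> \<bar>t\<bar> < e \<Longrightarrow> p \<in> W \<Longrightarrow>
      ((\<lambda>\<tau>. \<Phi> t (p(l := \<tau>)) i) has_real_derivative \<Psi> t p i) (at (p l))"
    and "\<And>i. i < n \<Longrightarrow> continuous_on ({-e<..<e} \<times> W) (\<lambda>z. \<Psi> (fst z) (snd z) i)"
    and "\<And>i t p. i < n \<Longrightarrow> \<bar>t\<bar> < e \<Longrightarrow> p \<in> W \<Longrightarrow>
      ((\<lambda>t. \<Psi> t p i) has_real_derivative (\<Sum>j<n. partial_deriv j (K i) (\<Phi> t p) * \<Psi> t p j)) (at t)"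
proof -
  have W: "openin (Euclidean_space q) W" using ff by (simp add: flow_family_def)
  have loc: "\<exists>r Q. r > 0 \<and> cube q p0 r \<subseteq> W \<and> (\<forall>i<n. continuous_on UNIV (\<lambda>z. Q i (fst z) (snd z))) \<and>
     (\<forall>i<n. \<forall>t p. \<bar>t\<bar> < e' \<longrightarrow> p \<in> cube q p0 r \<longrightarrow>
        ((\<lambda>\<tau>. \<Phi> t (p(l := \<tau>)) i) has_real_derivative \<Psi> t p i) (at (p l)) \<and> \<Psi> t p i = Q i t p \<and>
       ((\<lambda>t. Q i t p) has_real_derivative (\<Sum>j<n. partial_deriv j (K i) (\<Phi> t p) * Q j t p)) (at t))"
    if p0: "p0 \<in> W" and e': "0 < e'" "e' < e" for p0 e'
  proof -
    obtain r Q where r: "r > 0" "cube q p0 r \<subseteq> W"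
      and Qc: "\<And>i. i < n \<Longrightarrow> continuous_on UNIV (\<lambda>z. Q i (fst z) (snd z))"
      and Qq: "\<And>i t p d. i < n \<Longrightarrow> \<bar>t\<bar> < e' \<Longrightarrow> p \<in> cube q p0 r \<Longrightarrow> \<bar>d\<bar> \<le> r \<Longrightarrow>
       \<Phi> t (p(l := p l + d)) i - \<Phi> t p i = d * Q i t (p(q := d))"
      and Qd: "\<And>i t p. i < n \<Longrightarrow> \<bar>t\<bar> < e' \<Longrightarrow> p \<in> cube q p0 r \<Longrightarrow>
       ((\<lambda>t. Q i t p) has_real_derivative (\<Sum>j<n. partial_deriv j (K i) (\<Phi> t p) * Q j t p)) (at t)"
      using flow_difference_quotient[OF ff l p0 e'] by blast
    have d: "((\<lambda>\<tau>. \<Phi> t (p(l := \<tau>)) i) has_real_derivative Q i t p) (at (p l))"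
      if i: "i < n" and t: "\<bar>t\<bar> < e'" and p: "p \<in> cube q p0 r" for i t p
    proof -
      have pq: "p(q := 0) = p" using p by (auto simp: cube_def euclid_def)
      have cont: "continuous_on UNIV (\<lambda>\<tau>. (t, p(q := \<tau> - p l)))"
        by (intro continuous_on_Pair continuous_on_const continuous_on_upd continuous_on_diff continuous_on_id)
      have "continuous_on UNIV (\<lambda>\<tau>. Q i t (p(q := \<tau> - p l)))"
        using continuous_on_compose2[OF Qc[OF i] cont] by simp
      then have "((\<lambda>\<tau>. Q i t (p(q := \<tau> - p l))) \<longlongrightarrow> Q i t (p(q := p l - p l))) (at (p l))"
        by (metis UNIV_I continuous_on_def)
      then have lim: "((\<lambda>\<tau>. Q i t (p(q := \<tau> - p l))) \<longlongrightarrow> Q i t p) (at (p l))" by (simp only: diff_self pq)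
      have "\<forall>\<^sub>F \<tau> in at (p l). dist \<tau> (p l) < r" using r(1) eventually_at by blast
      then have "\<forall>\<^sub>F \<tau> in at (p l). Q i t (p(q := \<tau> - p l)) = (\<Phi> t (p(l := \<tau>)) i - \<Phi> t (p(l := p l)) i) / (\<tau> - p l)"
        using eventually_neq_at_within[of "p l" "p l" UNIV]
      proof eventually_elim
        case (elim \<tau>)
        then show ?case using Qq[OF i t p, of "\<tau> - p l"] by (simp add: dist_real_def field_simps)
      qed
      then show ?thesis
        unfolding has_field_derivative_iff using lim by (rule Lim_transform_eventually[rotated])
    qed
    have "\<Psi> t p i = Q i t p" if "i < n" "\<bar>t\<bar> < e'" "p \<in> cube q p0 r" for i t p
      unfolding \<Psi>_def partial_deriv_def by (rule DERIV_imp_deriv[OF d[OF that]])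
    then show ?thesis using r Qc d Qd by (intro exI[of _ r] exI[of _ Q]) simp
  qed
  have ee: "\<exists>e'. 0 < e' \<and> e' < e \<and> \<bar>t\<bar> < e'" if "\<bar>t\<bar> < e" for t
    using that by (intro exI[of _ "(\<bar>t\<bar> + e) / 2"]) auto
  have pc: "p \<in> cube q p r" if "p \<in> W" "r > 0" for p r
    using cube_self openin_E_subset[OF W] that by blast
  {
    fix i t p assume i: "i < n" and t: "\<bar>t\<bar> < e" and p: "p \<in> W"
    obtain e' where e': "0 < e'" "e' < e" "\<bar>t\<bar> < e'" using ee[OF t] by blast
    obtain r Q where rQ: "r > 0" "\<forall>i<n. \<forall>t p'. \<bar>t\<bar> < e' \<longrightarrow> p' \<in> cube q p r \<longrightarrow>
        ((\<lambda>\<tau>. \<Phi> t (p'(l := \<tau>)) i) has_real_derivative \<Psi> t p' i) (at (p' l)) \<and> \<Psi> t p' i = Q i t p' \<and>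
       ((\<lambda>t. Q i t p') has_real_derivative (\<Sum>j<n. partial_deriv j (K i) (\<Phi> t p') * Q j t p')) (at t)"
      using loc[OF p e'(1,2)] by blast
    show "((\<lambda>\<tau>. \<Phi> t (p(l := \<tau>)) i) has_real_derivative \<Psi> t p i) (at (p l))"
      using rQ i e'(3) pc[OF p rQ(1)] by blast
    have "((\<lambda>t. Q i t p) has_real_derivative (\<Sum>j<n. partial_deriv j (K i) (\<Phi> t p) * Q j t p)) (at t)"
      using rQ i e'(3) pc[OF p rQ(1)] by blast
    then have "((\<lambda>t. \<Psi> t p i) has_real_derivative (\<Sum>j<n. partial_deriv j (K i) (\<Phi> t p) * Q j t p)) (at t)"
    proof (rule has_field_derivative_transform_within_open[where S = "{-e'<..<e'}"])
      fix s assume "s \<in> {-e'<..<e'}"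
      then have "\<bar>s\<bar> < e'" by auto
      then show "Q i s p = \<Psi> s p i" using rQ(2) i pc[OF p rQ(1)] by simp
    qed (use e' in auto)
    moreover have "\<Psi> t p j = Q j t p" if "j < n" for j
      using rQ(2) that e'(3) pc[OF p rQ(1)] by blast
    ultimately show "((\<lambda>t. \<Psi> t p i) has_real_derivative (\<Sum>j<n. partial_deriv j (K i) (\<Phi> t p) * \<Psi> t p j)) (at t)"
      by simp
  }
  fix i assume i: "i < n"
  show "continuous_on ({-e<..<e} \<times> W) (\<lambda>z. \<Psi> (fst z) (snd z) i)"
  proof (rule continuous_on_local)
    fix z assume z: "z \<in> {-e<..<e} \<times> W"
    obtain t p where tp: "z = (t, p)" "\<bar>t\<bar> < e" "p \<in> W" using z by (cases z) auto
    obtain e' where e': "0 < e'" "e' < e" "\<bar>t\<bar> < e'" using ee[OF tp(2)] by blast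
    obtain r Q where r: "r > 0" and Qc: "\<forall>i<n. continuous_on UNIV (\<lambda>z. Q i (fst z) (snd z))"
      and Q: "\<forall>i<n. \<forall>t p'. \<bar>t\<bar> < e' \<longrightarrow> p' \<in> cube q p r \<longrightarrow> \<Psi> t p' i = Q i t p'"
      using loc[OF tp(3) e'(1,2)] by blast
    obtain T where T: "open T" "cube q p r = euclid q \<inter> T"
      using openin_cube unfolding Euclidean_space_eq openin_open by blast
    have "continuous_on (({-e<..<e} \<times> W) \<inter> ({-e'<..<e'} \<times> T)) (\<lambda>z. \<Psi> (fst z) (snd z) i)"
    proof (rule continuous_on_eq[OF continuous_on_subset[OF Qc[rule_format, OF i] subset_UNIV]])
      fix z assume z: "z \<in> ({-e<..<e} \<times> W) \<inter> ({-e'<..<e'} \<times> T)"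
      then have "\<bar>fst z\<bar> < e'" "snd z \<in> cube q p r"
        using openin_E_subset[OF W] T(2) by auto
      then show "Q i (fst z) (snd z) = \<Psi> (fst z) (snd z) i" using Q i by simp
    qed
    moreover have "z \<in> {-e'<..<e'} \<times> T" using tp e' pc[OF tp(3) r] T(2) by auto
    ultimately show "\<exists>T. open T \<and> z \<in> T \<and> continuous_on (({-e<..<e} \<times> W) \<inter> T) (\<lambda>z. \<Psi> (fst z) (snd z) i)"
      using T(1) by (intro exI[of _ "{-e'<..<e'} \<times> T"]) (auto intro: open_Times)
  qed
qed

lemma Cinf_Ck: "Cinf_on n W f \<Longrightarrow> Ck_on n k W f"
  by (simp add: Cinf_on_def)

lemma Cinf_on_subset: "Cinf_on n W f \<Longrightarrow> W' \<subseteq> W \<Longrightarrow> Cinf_on n W' f"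
  unfolding Cinf_on_def using Ck_on_subset by blast

lemma Cinf_on_cong:
  "openin (Euclidean_space n) W \<Longrightarrow> (\<And>x. x \<in> W \<Longrightarrow> f x = g x) \<Longrightarrow> Cinf_on n W f \<longleftrightarrow> Cinf_on n W g"
  unfolding Cinf_on_def using Ck_on_cong by blast

lemma Cinf_local:
  assumes "openin (Euclidean_space n) W"
    and "\<And>x. x \<in> W \<Longrightarrow> \<exists>W'. x \<in> W' \<and> openin (Euclidean_space n) W' \<and> Cinf_on n W' f"
  shows "Cinf_on n W f"
  unfolding Cinf_on_def
proof (intro allI Ck_local assms(1))
  fix k x assume "x \<in> W"
  then obtain W' where "x \<in> W'" "openin (Euclidean_space n) W'" "Cinf_on n W' f"
    using assms(2) by meson
  then show "\<exists>W'. x \<in> W' \<and> openin (Euclidean_space n) W' \<and> Ck_on n k W' f"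
    using Cinf_Ck[of n W' f k] by (intro exI conjI)
qed

context
  fixes n W assumes W: "openin (Euclidean_space n) W"
begin

lemma Cinf_const: "Cinf_on n W (\<lambda>_. c)"
  by (simp add: Cinf_on_def Ck_const[OF W])

lemma Cinf_coord: "Cinf_on n W (\<lambda>x. x j)"
  by (simp add: Cinf_on_def Ck_coord[OF W])

lemma Cinf_add: "Cinf_on n W f \<Longrightarrow> Cinf_on n W g \<Longrightarrow> Cinf_on n W (\<lambda>x. f x + g x)"
  by (simp add: Cinf_on_def Ck_add[OF W])

lemma Cinf_mult: "Cinf_on n W f \<Longrightarrow> Cinf_on n W g \<Longrightarrow> Cinf_on n W (\<lambda>x. f x * g x)"
  by (simp add: Cinf_on_def Ck_mult[OF W])

lemma Cinf_minus: "Cinf_on n W f \<Longrightarrow> Cinf_on n W (\<lambda>x. - f x)"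
  using Cinf_mult[OF Cinf_const[of "-1"]] by simp

lemma Cinf_inverse: "Cinf_on n W f \<Longrightarrow> (\<And>x. x \<in> W \<Longrightarrow> f x \<noteq> 0) \<Longrightarrow> Cinf_on n W (\<lambda>x. inverse (f x))"
  by (simp add: Cinf_on_def Ck_inverse[OF W])

lemma Cinf_sum: "(\<And>a. a \<in> A \<Longrightarrow> Cinf_on n W (f a)) \<Longrightarrow> Cinf_on n W (\<lambda>x. \<Sum>a\<in>A. f a x)"
  by (simp add: Cinf_on_def Ck_sum[OF W])

lemma Cinf_compose:
  assumes "openin (Euclidean_space m) V" "\<And>z. z \<in> W \<Longrightarrow> g z \<in> V"
    and "\<And>j. j < m \<Longrightarrow> Cinf_on n W (\<lambda>z. g z j)" "Cinf_on m V f"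
  shows "Cinf_on n W (\<lambda>z. f (g z))"
  unfolding Cinf_on_def
  by (intro allI) (rule Ck_compose[OF W assms(1,2) Cinf_Ck[OF assms(3)] Cinf_Ck[OF assms(4)]])

end

text \<open>Time is stored as the coordinate after the parameters, so that smoothness in time and parameters is
  smoothness in \<open>q + 1\<close> variables.\<close>

lemma openin_suspension:
  assumes W: "openin (Euclidean_space q) W"
  shows "openin (Euclidean_space (Suc q)) {z \<in> euclid (Suc q). z(q := 0) \<in> W \<and> \<bar>z q\<bar> < e}"
  unfolding openin_E_iff
proof (intro conjI ballI)
  fix z assume "z \<in> {z \<in> euclid (Suc q). z(q := 0) \<in> W \<and> \<bar>z q\<bar> < e}"
  then have z: "z(q := 0) \<in> W" "\<bar>z q\<bar> < e" by auto
  obtain r where r: "r > 0" "cube q (z(q := 0)) r \<subseteq> W" using openin_E_cube[OF W z(1)] by blast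
  define s where "s = min r (e - \<bar>z q\<bar>)"
  have "cube (Suc q) z s \<subseteq> {z \<in> euclid (Suc q). z(q := 0) \<in> W \<and> \<bar>z q\<bar> < e}"
  proof
    fix y assume y: "y \<in> cube (Suc q) z s"
    then have "y(q := 0) \<in> cube q (z(q := 0)) r"
      by (auto simp: cube_def euclid_def s_def)
    moreover have "\<bar>y q\<bar> < e"
    proof -
      have "\<bar>y q - z q\<bar> < e - \<bar>z q\<bar>" using y by (auto simp: cube_def s_def)
      then show ?thesis by linarith
    qed
    ultimately show "y \<in> {z \<in> euclid (Suc q). z(q := 0) \<in> W \<and> \<bar>z q\<bar> < e}"
      using y r(2) by (auto simp: cube_def)
  qed
  moreover have "s > 0" using r z by (simp add: s_def)
  ultimately show "\<exists>r>0. cube (Suc q) z r \<subseteq> {z \<in> euclid (Suc q). z(q := 0) \<in> W \<and> \<bar>z q\<bar> < e}" by blast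
qed auto

text \<open>The solution together with its derivative in one parameter solves the variational system, which is again
  autonomous and smooth. This turns one derivative into all derivatives. The first \<open>n\<close> of the
  \<open>2 n\<close> unknowns are the original ones.\<close>

lemma flow_family_variation:
  assumes ff: "flow_family n q V K W e c \<Phi>" and l: "l < q"
  defines "trunc \<equiv> \<lambda>z i. if i < n then z i else (0::real)"
  shows "flow_family (2 * n) q {z \<in> euclid (2 * n). trunc z \<in> V}
     (\<lambda>i z. if i < n then K i (trunc z) else \<Sum>j<n. partial_deriv j (K (i - n)) (trunc z) * z (n + j)) W e
     (\<lambda>i. if i < n then c i else partial_deriv l (c (i - n)))
     (\<lambda>t p i. if i < n then \<Phi> t p i else if i < 2 * n then partial_deriv l (\<lambda>p. \<Phi> t p (i - n)) p else 0)"
    (is "flow_family _ _ ?V ?K _ _ ?c ?\<Phi>")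
proof -
  note ff' = ff[unfolded flow_family_def]
  have V: "openin (Euclidean_space n) V" "box_convex n V" and K: "\<And>i. i < n \<Longrightarrow> Cinf_on n V (K i)"
    and W: "openin (Euclidean_space q) W" and c: "\<And>i. i < n \<Longrightarrow> Cinf_on q W (c i)"
    and PhiV: "\<And>t p. \<bar>t\<bar> < e \<Longrightarrow> p \<in> W \<Longrightarrow> \<Phi> t p \<in> V"
    and Phic: "\<And>i. i < n \<Longrightarrow> continuous_on ({-e<..<e} \<times> W) (\<lambda>z. \<Phi> (fst z) (snd z) i)"
    and Phi0: "\<And>i p. i < n \<Longrightarrow> p \<in> W \<Longrightarrow> \<Phi> 0 p i = c i p"
    and Phid: "\<And>i p t. i < n \<Longrightarrow> p \<in> W \<Longrightarrow> \<bar>t\<bar> < e \<Longrightarrow> ((\<lambda>t. \<Phi> t p i) has_real_derivative K i (\<Phi> t p)) (at t)"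
    and e: "e > 0"
    using ff' by simp_all
  note var = flow_variation[OF ff l]
  have trPhi: "trunc (?\<Phi> t p) = \<Phi> t p" if "\<bar>t\<bar> < e" "p \<in> W" for t p
    using PhiV[OF that] openin_E_subset[OF V(1)] by (force simp: trunc_def euclid_def fun_eq_iff)
  have VO: "openin (Euclidean_space (2 * n)) ?V"
    unfolding openin_E_iff
  proof (intro conjI ballI)
    fix z assume "z \<in> ?V"
    then have "trunc z \<in> V" by simp
    then obtain r where r: "r > 0" "cube n (trunc z) r \<subseteq> V" using openin_E_cube[OF V(1)] by blast
    have "trunc y \<in> cube n (trunc z) r" if "y \<in> cube (2 * n) z r" for y
      using that by (auto simp: cube_def euclid_def trunc_def)
    then have "cube (2 * n) z r \<subseteq> ?V" using r(2) by (auto simp: cube_def)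
    then show "\<exists>r>0. cube (2 * n) z r \<subseteq> ?V" using r(1) by blast
  qed auto
  have Vbox: "box_convex (2 * n) ?V"
    unfolding box_convex_def
  proof (intro ballI impI)
    fix x y z assume x: "x \<in> ?V" and y: "y \<in> ?V" and z: "z \<in> euclid (2 * n)"
      and b: "\<forall>i<2 * n. min (x i) (y i) \<le> z i \<and> z i \<le> max (x i) (y i)"
    have "trunc z \<in> V"
    proof (rule box_convexD[OF V(2)])
      show "trunc x \<in> V" "trunc y \<in> V" using x y by auto
      show "trunc z \<in> euclid n" by (auto simp: trunc_def euclid_def)
      show "min (trunc x i) (trunc y i) \<le> trunc z i \<and> trunc z i \<le> max (trunc x i) (trunc y i)" if "i < n" for i
        using b that by (simp add: trunc_def)
    qed
    then show "z \<in> ?V" using z by simp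
  qed
  have trc: "Cinf_on (2 * n) ?V (\<lambda>z. f (trunc z))" if "Cinf_on n V f" for f
  proof (rule Cinf_compose[OF VO V(1) _ _ that])
    show "Cinf_on (2 * n) ?V (\<lambda>z. trunc z j)" if "j < n" for j
      using Cinf_coord[OF VO, of j] that by (simp add: trunc_def)
  qed simp
  have cK: "Cinf_on (2 * n) ?V (?K i)" if i: "i < 2 * n" for i
  proof (cases "i < n")
    case True then show ?thesis using trc[OF K[OF True]] by simp
  next
    case False
    then have "i - n < n" using i by simp
    then have "Cinf_on (2 * n) ?V (\<lambda>z. \<Sum>j<n. partial_deriv j (K (i - n)) (trunc z) * z (n + j))"
      by (intro Cinf_sum[OF VO] Cinf_mult[OF VO] Cinf_coord[OF VO] trc Cinf_partial K) auto
    then show ?thesis using False by simp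
  qed
  have cc: "Cinf_on q W (?c i)" if "i < 2 * n" for i
    using that c l by (auto intro!: Cinf_partial)
  have PV: "?\<Phi> t p \<in> ?V" if "\<bar>t\<bar> < e" "p \<in> W" for t p
    using PhiV[OF that] trPhi[OF that] by (auto simp: euclid_def)
  have Pc: "continuous_on ({-e<..<e} \<times> W) (\<lambda>z. ?\<Phi> (fst z) (snd z) i)" if i: "i < 2 * n" for i
    using Phic[of i] var(2)[of "i - n"] i by (cases "i < n") auto
  have P0: "?\<Phi> 0 p i = ?c i p" if i: "i < 2 * n" and p: "p \<in> W" for i p
  proof (cases "i < n")
    case False
    then have i': "i - n < n" using i by simp
    have "\<forall>\<^sub>F t in nhds (p l). p(l := t) \<in> W" by (rule eventually_slice[OF W p l])
    then have "\<forall>\<^sub>F t in nhds (p l). \<Phi> 0 (p(l := t)) (i - n) = c (i - n) (p(l := t))"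
      by eventually_elim (rule Phi0[OF i'])
    then have "partial_deriv l (\<lambda>p. \<Phi> 0 p (i - n)) p = partial_deriv l (c (i - n)) p"
      unfolding partial_deriv_def by (rule deriv_cong_ev) simp
    then show ?thesis using False i by simp
  qed (simp add: Phi0[OF _ p])
  have Pd: "((\<lambda>t. ?\<Phi> t p i) has_real_derivative ?K i (?\<Phi> t p)) (at t)"
    if i: "i < 2 * n" and p: "p \<in> W" and t: "\<bar>t\<bar> < e" for i p t
  proof (cases "i < n")
    case True then show ?thesis using Phid[OF True p t] trPhi[OF t p] by simp
  next
    case False
    then have "i - n < n" using i by simp
    from var(3)[OF this t p] show ?thesis using False i trPhi[OF t p] by simp
  qed
  show ?thesis
    unfolding flow_family_def
    by (intro conjI allI impI ballI VO Vbox cK W cc e PV Pc P0 Pd)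
qed

text \<open>Induction on the order, for all flow families at once: a parameter derivative is a component of another
  flow family, and the time derivative is \<open>K\<close> composed with the flow.\<close>

lemma flow_smooth:
  "flow_family n q V K W e c \<Phi> \<Longrightarrow> i < n \<Longrightarrow>
   Ck_on (Suc q) k {z \<in> euclid (Suc q). z(q := 0) \<in> W \<and> \<bar>z q\<bar> < e} (\<lambda>z. \<Phi> (z q) (z(q := 0)) i)"
proof (induction k arbitrary: n V K c \<Phi> i)
  let ?S = "{z \<in> euclid (Suc q). z(q := 0) \<in> W \<and> \<bar>z q\<bar> < e}"
  have cont: "continuous_on ?S (\<lambda>z. \<Phi> (z q) (z(q := 0)) i)"
    if "flow_family n q V K W e c \<Phi>" "i < n" for n V K c i and \<Phi> :: "real \<Rightarrow> (nat \<Rightarrow> real) \<Rightarrow> nat \<Rightarrow> real"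
  proof -
    have c: "continuous_on ({-e<..<e} \<times> W) (\<lambda>z. \<Phi> (fst z) (snd z) i)"
      using that by (simp add: flow_family_def)
    have A: "continuous_on ?S (\<lambda>z. (z q, z(q := 0)))"
      by (intro continuous_on_Pair continuous_on_coord continuous_on_upd continuous_on_const continuous_on_id)
    have B: "(\<lambda>z. (z q, z(q := 0))) ` ?S \<subseteq> {-e<..<e} \<times> W" by (auto simp: abs_less_iff)
    show ?thesis using continuous_on_compose2[OF c A B] by simp
  qed
  {
    case 0
    then have "openin (Euclidean_space (Suc q)) ?S" using openin_suspension by (simp add: flow_family_def)
    then show ?case using cont[OF 0] by (simp only: Ck_0)
  next
    case (Suc k)
    note ff = Suc.prems(1) and i = Suc.prems(2)
    have V: "openin (Euclidean_space n) V" and K: "\<And>i. i < n \<Longrightarrow> Cinf_on n V (K i)"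
      and W: "openin (Euclidean_space q) W"
      and PhiV: "\<And>t p. \<bar>t\<bar> < e \<Longrightarrow> p \<in> W \<Longrightarrow> \<Phi> t p \<in> V"
      and Phid: "\<And>i p t. i < n \<Longrightarrow> p \<in> W \<Longrightarrow> \<bar>t\<bar> < e \<Longrightarrow> ((\<lambda>t. \<Phi> t p i) has_real_derivative K i (\<Phi> t p)) (at t)"
      using ff by (simp_all add: flow_family_def)
    have S: "openin (Euclidean_space (Suc q)) ?S" by (rule openin_suspension[OF W])
    define g where "g l z = (if l < q then partial_deriv l (\<lambda>p. \<Phi> (z q) p i) (z(q := 0))
      else K i (\<Phi> (z q) (z(q := 0))))" for l z
    show ?case
    proof (rule Ck_SucI[OF S cont[OF Suc.prems], where g = g])
      fix l z assume l: "l < Suc q" and z: "z \<in> ?S"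
      show "((\<lambda>t. \<Phi> ((z(l := t)) q) ((z(l := t))(q := 0)) i) has_real_derivative g l z) (at (z l))"
      proof (cases "l < q")
        case True
        have "((\<lambda>t. \<Phi> (z q) ((z(q := 0))(l := t)) i) has_real_derivative
           partial_deriv l (\<lambda>p. \<Phi> (z q) p i) (z(q := 0))) (at ((z(q := 0)) l))"
          using z by (intro flow_variation(1)[OF ff True i]) auto
        moreover have "(z(q := 0))(l := t) = (z(l := t))(q := 0)" for t using True by auto
        ultimately show ?thesis using True by (simp add: g_def del: fun_upd_apply) (simp add: fun_upd_other)
      next
        case False
        then have "l = q" using l by simp
        then show ?thesis using Phid[OF i, of "z(q := 0)" "z q"] z by (simp add: g_def)
      qed
    next
      fix l assume l: "l < Suc q"
      show "Ck_on (Suc q) k ?S (g l)"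
      proof (cases "l < q")
        case True
        have "n + i < 2 * n" using i by simp
        have eq: "g l = (\<lambda>z. if n + i < n then \<Phi> (z q) (z(q := 0)) (n + i) else if n + i < 2 * n
            then partial_deriv l (\<lambda>p. \<Phi> (z q) p (n + i - n)) (z(q := 0)) else 0)"
          by (rule ext) (use True i in \<open>simp add: g_def\<close>)
        show ?thesis unfolding eq
          by (rule Suc.IH[OF flow_family_variation[OF ff True] \<open>n + i < 2 * n\<close>])
      next
        case False
        have "Ck_on (Suc q) k ?S (\<lambda>z. K i (\<Phi> (z q) (z(q := 0))))"
        proof (rule Ck_compose[OF S V, where f = "K i" and g = "\<lambda>z. \<Phi> (z q) (z(q := 0))"])
          show "\<And>z. z \<in> ?S \<Longrightarrow> \<Phi> (z q) (z(q := 0)) \<in> V" using PhiV by blast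
          show "\<And>j. j < n \<Longrightarrow> Ck_on (Suc q) k ?S (\<lambda>z. \<Phi> (z q) (z(q := 0)) j)"
            by (rule Suc.IH[OF ff])
          show "Ck_on n k V (K i)" using Cinf_Ck[OF K[OF i]] .
        qed
        then show ?thesis using False by (simp add: g_def[abs_def])
      qed
    qed
  }
qed

section \<open>Local flows and flow boxes\<close>

lemma lipschitz_on_compact_box:
  assumes V: "openin (Euclidean_space n) V" "box_convex n V" and f: "Cinf_on n V f"
    and B: "compact B" "B \<subseteq> V"
  shows "\<exists>L\<ge>0. \<forall>x\<in>B. \<forall>y\<in>B. \<bar>f y - f x\<bar> \<le> L * (\<Sum>j<n. \<bar>y j - x j\<bar>)"
proof -
  have "\<exists>b\<ge>0. \<forall>z\<in>B \<times> B. \<bar>hadamard f j (fst z) (snd z)\<bar> \<le> b" if "j < n" for j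
    using continuous_on_subset[OF continuous_on_hadamard[OF V Cinf_Ck[OF f] that], of "B \<times> B"] B
    by (intro compact_bounded_real compact_Times) (auto simp: case_prod_beta)
  then obtain b where b: "\<And>j. j < n \<Longrightarrow> b j \<ge> 0"
    "\<And>j x y. j < n \<Longrightarrow> x \<in> B \<Longrightarrow> y \<in> B \<Longrightarrow> \<bar>hadamard f j x y\<bar> \<le> b j"
    by (metis SigmaI fst_conv snd_conv)
  define L where "L = (\<Sum>j<n. b j)"
  have bL: "b j \<le> L" if "j < n" for j
    unfolding L_def using that b(1) by (intro member_le_sum) auto
  have "\<bar>f y - f x\<bar> \<le> L * (\<Sum>j<n. \<bar>y j - x j\<bar>)" if "x \<in> B" "y \<in> B" for x y
  proof -
    have "\<bar>f y - f x\<bar> \<le> (\<Sum>j<n. \<bar>(y j - x j) * hadamard f j x y\<bar>)"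
      using hadamard_formula[OF V Cinf_Ck[OF f], of x y] B that by (simp add: subset_eq)
    also have "\<dots> \<le> (\<Sum>j<n. \<bar>y j - x j\<bar> * L)"
    proof (rule sum_mono)
      fix j assume "j \<in> {..<n}"
      then have j: "j < n" by simp
      have "\<bar>hadamard f j x y\<bar> \<le> L" using b(2)[OF j that] bL[OF j] by linarith
      then show "\<bar>(y j - x j) * hadamard f j x y\<bar> \<le> \<bar>y j - x j\<bar> * L"
        by (simp add: abs_mult mult_left_mono)
    qed
    finally show ?thesis by (simp add: sum_distrib_left mult.commute)
  qed
  moreover have "L \<ge> 0" unfolding L_def using b(1) by (intro sum_nonneg) auto
  ultimately show ?thesis by blast
qed

text \<open>The vector field is composed with a retraction onto a small box, on which it is bounded and Lipschitz.
  The flow of the resulting global field exists up to time \<open>3\<close>. For starting points near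
  \<open>z0\<close> and short times it stays in the box, where the two fields agree. The last but one
  property, that reversing time undoes the flow, therefore holds for all starting points.\<close>

lemma local_flow:
  assumes V: "openin (Euclidean_space n) V" and K: "\<And>i. i < n \<Longrightarrow> Cinf_on n V (K i)" and z0: "z0 \<in> V"
  obtains r e M \<phi> where "r > 0" "e > 0" "M \<ge> 0" "cube n z0 (2 * r) \<subseteq> V"
    "\<And>t z. \<phi> t z \<in> euclid n"
    "\<And>z. z \<in> euclid n \<Longrightarrow> \<phi> 0 z = z"
    "\<And>t z i. \<bar>t\<bar> < e \<Longrightarrow> z \<in> cube n z0 r \<Longrightarrow> i < n \<Longrightarrow> \<bar>\<phi> t z i - z i\<bar> \<le> M * \<bar>t\<bar>"
    "\<And>t z. \<bar>t\<bar> < e \<Longrightarrow> z \<in> cube n z0 r \<Longrightarrow> \<phi> t z \<in> cube n z0 (2 * r)"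
    "\<And>t z i. \<bar>t\<bar> < e \<Longrightarrow> z \<in> cube n z0 r \<Longrightarrow> i < n \<Longrightarrow>
        ((\<lambda>t. \<phi> t z i) has_real_derivative K i (\<phi> t z)) (at t)"
    "\<And>t z. \<bar>t\<bar> < e \<Longrightarrow> z \<in> euclid n \<Longrightarrow> \<phi> (- t) (\<phi> t z) = z"
    "\<And>i. i < n \<Longrightarrow> Cinf_on (Suc n) {z \<in> euclid (Suc n). z(n := 0) \<in> cube n z0 r \<and> \<bar>z n\<bar> < e}
        (\<lambda>z. \<phi> (z n) (z(n := 0)) i)"
proof -
  have z0E: "z0 \<in> euclid n" using z0 openin_E_subset[OF V] by blast
  obtain R where R: "R > 0" "cube n z0 R \<subseteq> V" using openin_E_cube[OF V z0] by blast
  define r where "r = R / 4"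
  have r: "r > 0" "2 * r < R" using R by (auto simp: r_def)
  define cl where "cl x = (\<lambda>i. if i < n then clamp1 (z0 i) (2 * r) (x i) else 0)" for x :: "nat \<Rightarrow> real"
  define B where "B = {x. \<forall>i. x i \<in> (if i < n then {z0 i - 2 * r..z0 i + 2 * r} else {0})}"
  have clB: "cl x \<in> B" for x
    using clamp1_in[of "2 * r"] r by (auto simp: B_def cl_def)
  have B: "compact B" unfolding B_def by (rule compact_fun_box) auto
  have BR: "B \<subseteq> cube n z0 R"
  proof
    fix x assume "x \<in> B"
    then have all: "x i \<in> (if i < n then {z0 i - 2 * r..z0 i + 2 * r} else {0})" for i
      by (simp only: B_def mem_Collect_eq)
    have "\<bar>x i - z0 i\<bar> < R" if "i < n" for i
    proof -
      have "z0 i - 2 * r \<le> x i" "x i \<le> z0 i + 2 * r" using all[of i] that by auto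
      then show ?thesis using r(2) by linarith
    qed
    moreover have "x i = 0" if "i \<ge> n" for i using all[of i] that by simp
    ultimately show "x \<in> cube n z0 R" by (auto simp: cube_def euclid_def)
  qed
  have cl_id: "cl x = x" if "x \<in> cube n z0 (2 * r)" for x
    using that by (auto simp: cl_def cube_def euclid_def fun_eq_iff clamp1_id less_imp_le)
  have KR: "Cinf_on n (cube n z0 R) (K i)" if "i < n" for i using Cinf_on_subset[OF K[OF that] R(2)] .
  have "\<exists>L\<ge>0. \<forall>x\<in>B. \<forall>y\<in>B. \<bar>K i y - K i x\<bar> \<le> L * (\<Sum>j<n. \<bar>y j - x j\<bar>)" if "i < n" for i
    by (rule lipschitz_on_compact_box[OF openin_cube box_convex_cube KR[OF that] B BR])
  then obtain L' where L': "\<And>i. i < n \<Longrightarrow> L' i \<ge> 0"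
    "\<And>i x y. i < n \<Longrightarrow> x \<in> B \<Longrightarrow> y \<in> B \<Longrightarrow> \<bar>K i y - K i x\<bar> \<le> L' i * (\<Sum>j<n. \<bar>y j - x j\<bar>)"
    by metis
  define L where "L = (\<Sum>i<n. L' i)"
  have L: "L \<ge> 0" "\<And>i. i < n \<Longrightarrow> L' i \<le> L"
    using L'(1) by (auto simp: L_def intro!: sum_nonneg member_le_sum)
  have Kc: "continuous_on B (K i)" if "i < n" for i
    using continuous_on_subset[OF Ck_continuous[OF openin_cube Cinf_Ck[OF KR[OF that]]] BR] .
  have "\<exists>b. \<forall>x. \<bar>K i (cl x)\<bar> \<le> b" if "i \<in> {..<n}" for i
    using compact_bounded_real[OF B Kc[of i]] that clB by (metis lessThan_iff)
  from common_bound[of "{..<n}" "\<lambda>i x. K i (cl x)", OF _ this]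
  obtain M where M: "M \<ge> 0" "\<And>i x. i < n \<Longrightarrow> \<bar>K i (cl x)\<bar> \<le> M" by auto
  \<comment> \<open>the unknown is the displacement from the starting point \<open>p\<close>\<close>
  define f where "f i t p x = (if i < n then K i (cl (\<lambda>j. p j + x j)) else 0)"
    for i and t :: real and p x
  have Klip: "\<bar>K i (cl x) - K i (cl y)\<bar> \<le> L * (\<Sum>j<n. \<bar>x j - y j\<bar>)" if i: "i < n" for i x y
  proof -
    have "\<bar>K i (cl x) - K i (cl y)\<bar> \<le> L' i * (\<Sum>j<n. \<bar>cl x j - cl y j\<bar>)" by (rule L'(2)[OF i clB clB])
    also have "\<dots> \<le> L * (\<Sum>j<n. \<bar>x j - y j\<bar>)"
      using L L'(1) i by (intro mult_mono sum_mono sum_nonneg) (auto simp: cl_def clamp1_lip)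
    finally show ?thesis .
  qed
  have ccl: "continuous_on S (\<lambda>z. cl (g z))" if "continuous_on S g" for S and g :: "'z::topological_space \<Rightarrow> _"
    unfolding cl_def
  proof (rule continuous_on_coordinatewise_then_product)
    fix i show "continuous_on S (\<lambda>z. if i < n then clamp1 (z0 i) (2 * r) (g z i) else 0)"
      using continuous_on_clamp1[OF continuous_on_apply[OF that, of i]] by (cases "i < n") simp_all
  qed
  obtain X where X: "\<And>i. continuous_on UNIV (\<lambda>z. X i (fst z) (snd z))" "\<And>i p. X i 0 p = 0"
      "\<And>i t p. \<bar>t\<bar> < 3 \<Longrightarrow> ((\<lambda>t. X i t p) has_real_derivative f i t p (\<lambda>j. X j t p)) (at t)"
  \<comment> \<open>time \<open>3\<close> leaves room to compare two solutions up to time \<open>2\<close> after a shift by \<open>e \<le> 1\<close>\<close>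
  proof (rule ode_exists[of 3 L f M n])
    show "continuous_on UNIV (\<lambda>q. f i (fst q) (fst (snd q)) (snd (snd q)))" for i
    proof (cases "i < n")
      case True
      have A: "continuous_on UNIV (\<lambda>q::real \<times> (nat \<Rightarrow> real) \<times> (nat \<Rightarrow> real). cl (\<lambda>j. fst (snd q) j + snd (snd q) j))"
      proof (rule ccl, rule continuous_on_coordinatewise_then_product, rule continuous_on_add)
        fix j
        show "continuous_on UNIV (\<lambda>q::real \<times> (nat \<Rightarrow> real) \<times> (nat \<Rightarrow> real). fst (snd q) j)"
          by (intro continuous_on_apply[OF continuous_on_fst] continuous_on_snd continuous_on_id)
        show "continuous_on UNIV (\<lambda>q::real \<times> (nat \<Rightarrow> real) \<times> (nat \<Rightarrow> real). snd (snd q) j)"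
          by (intro continuous_on_apply[OF continuous_on_snd] continuous_on_snd continuous_on_id)
      qed
      have "continuous_on UNIV (\<lambda>q::real \<times> (nat \<Rightarrow> real) \<times> (nat \<Rightarrow> real). K i (cl (\<lambda>j. fst (snd q) j + snd (snd q) j)))"
        by (rule continuous_on_compose2[OF Kc[OF True] A]) (simp add: image_subset_iff clB)
      then show ?thesis using True by (simp add: f_def)
    qed (simp add: f_def)
    show "\<bar>f i t p (\<lambda>_. 0)\<bar> \<le> M" for i t p using M by (simp add: f_def)
    show "\<bar>f i t p x - f i t p y\<bar> \<le> L * (\<Sum>j<n. \<bar>x j - y j\<bar>)" for i t p x y
      using Klip[of i "\<lambda>j. p j + x j" "\<lambda>j. p j + y j"] L by (auto simp: f_def intro!: mult_nonneg_nonneg sum_nonneg)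
  qed (use L in auto)
  define \<phi> where "\<phi> t z = (\<lambda>i. if i < n then z i + X i t z else 0)" for t z
  have f\<phi>: "f i t p (\<lambda>j. X j t p) = K i (cl (\<phi> t p))" if "i < n" for i t p
    using that by (auto simp: f_def \<phi>_def cl_def intro!: arg_cong[where f = "K i"])
  have d\<phi>: "((\<lambda>t. \<phi> t z i) has_real_derivative K i (cl (\<phi> t z))) (at t)" if "\<bar>t\<bar> < 3" "i < n" for t z i
    using X(3)[OF that(1), of i z] that(2) by (auto simp: f\<phi> \<phi>_def intro!: derivative_eq_intros)
  \<comment> \<open>speed at most \<open>M\<close>, so points of the small cube stay in the cube of radius \<open>2 r\<close> up to time \<open>e\<close>\<close>
  define e where "e = min 1 (r / (M + 1))"
  have e: "e > 0" "e \<le> 1" using r M by (auto simp: e_def)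
  have Me: "M * e < r"
  proof -
    have "M * e \<le> M * (r / (M + 1))" using M by (intro mult_left_mono) (auto simp: e_def)
    also have "\<dots> < r" using M r by (simp add: field_simps)
    finally show ?thesis .
  qed
  have b\<phi>: "\<bar>\<phi> t z i - z i\<bar> \<le> M * \<bar>t\<bar>" if t: "\<bar>t\<bar> < 3" and i: "i < n" for t z i
  proof -
    have "norm (X i t z - X i 0 z) \<le> M * norm (t - 0)"
    proof (rule field_differentiable_bound[where S = "{-3<..<3}" and f' = "\<lambda>s. f i s z (\<lambda>j. X j s z)"])
      show "\<And>s. s \<in> {-3<..<3} \<Longrightarrow> ((\<lambda>t. X i t z) has_field_derivative f i s z (\<lambda>j. X j s z)) (at s within {-3<..<3})"
        using X(3) by (auto intro: has_field_derivative_at_within)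
      show "\<And>s. s \<in> {-3<..<3} \<Longrightarrow> norm (f i s z (\<lambda>j. X j s z)) \<le> M" using M i by (simp add: f\<phi>)
    qed (use t in auto)
    then show ?thesis using i by (simp add: \<phi>_def X(2))
  qed
  have in2r: "\<phi> t z \<in> cube n z0 (2 * r)" if t: "\<bar>t\<bar> < e" and z: "z \<in> cube n z0 r" for t z
  proof -
    have "\<bar>\<phi> t z i - z0 i\<bar> < 2 * r" if i: "i < n" for i
    proof -
      have "\<bar>\<phi> t z i - z i\<bar> \<le> M * \<bar>t\<bar>" using b\<phi>[OF _ i] t e by simp
      also have "\<dots> \<le> M * e" using M t by (intro mult_left_mono) auto
      finally show ?thesis using Me z i by (auto simp: cube_def)
    qed
    then show ?thesis by (auto simp: cube_def \<phi>_def euclid_def)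
  qed
  have \<phi>0: "\<phi> 0 z = z" if "z \<in> euclid n" for z
    using that by (auto simp: \<phi>_def X(2) euclid_def)
  have dK: "((\<lambda>t. \<phi> t z i) has_real_derivative K i (\<phi> t z)) (at t)"
    if "\<bar>t\<bar> < e" "z \<in> cube n z0 r" "i < n" for t z i
    using d\<phi>[of t i z] that e cl_id[OF in2r[OF that(1,2)]] by simp
  have ff: "flow_family n n (cube n z0 (2 * r)) K (cube n z0 r) e (\<lambda>i z. z i) \<phi>"
    unfolding flow_family_def
  proof (intro conjI allI impI ballI openin_cube box_convex_cube e(1) in2r dK)
    show "Cinf_on n (cube n z0 (2 * r)) (K i)" if "i < n" for i
      using Cinf_on_subset[OF KR[OF that] cube_mono] r by simp
    show "Cinf_on n (cube n z0 r) (\<lambda>z. z i)" for i by (rule Cinf_coord[OF openin_cube])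
    show "continuous_on ({- e<..<e} \<times> cube n z0 r) (\<lambda>z. \<phi> (fst z) (snd z) i)" if "i < n" for i
      using that continuous_on_add[OF continuous_on_apply[OF continuous_on_snd[OF continuous_on_id], of _ i] continuous_on_subset[OF X(1)[of i] subset_UNIV]]
      by (simp add: \<phi>_def)
    show "\<phi> 0 z i = z i" if "z \<in> cube n z0 r" for i z using \<phi>0[of z] that by (simp add: cube_def)
  qed
  have inv: "\<phi> (- t) (\<phi> t z) = z" if t: "\<bar>t\<bar> < e" and z: "z \<in> euclid n" for t z
  proof (rule euclid_eqI[OF _ z])
    show "\<phi> (- t) (\<phi> t z) \<in> euclid n" by (auto simp: \<phi>_def euclid_def)
    have \<phi>E: "\<phi> t z \<in> euclid n" by (auto simp: \<phi>_def euclid_def)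
    fix i assume i: "i < n"
    define D where "D i s = \<phi> (t + s) z i - \<phi> s (\<phi> t z) i" for i s
    have "D i (- t) = 0"
    proof (rule ode_zero[where D = D and i = i and t = "- t" and n = n and e = 2 and L = L and
          D' = "\<lambda>i s. K i (cl (\<phi> (t + s) z)) - K i (cl (\<phi> s (\<phi> t z)))"])
      fix i s assume i: "i < n" and s: "\<bar>s\<bar> < (2::real)"
      have ts: "\<bar>t + s\<bar> < 3" using t s e by linarith
      have "((\<lambda>s. \<phi> (t + s) z i) has_real_derivative K i (cl (\<phi> (t + s) z)) * 1) (at s)"
        by (rule DERIV_chain2[where f = "\<lambda>s. \<phi> s z i" and g = "\<lambda>s. t + s", OF d\<phi>[OF ts i]])
          (auto intro!: derivative_eq_intros)
      moreover have "((\<lambda>s. \<phi> s (\<phi> t z) i) has_real_derivative K i (cl (\<phi> s (\<phi> t z)))) (at s)"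
        using d\<phi>[OF _ i, of s] s by simp
      ultimately show "(D i has_real_derivative K i (cl (\<phi> (t + s) z)) - K i (cl (\<phi> s (\<phi> t z)))) (at s)"
        unfolding D_def by (auto intro!: derivative_eq_intros)
      show "\<bar>K i (cl (\<phi> (t + s) z)) - K i (cl (\<phi> s (\<phi> t z)))\<bar> \<le> L * (\<Sum>j<n. \<bar>D j s\<bar>)"
        using Klip[OF i] by (simp add: D_def)
    next
      show "D i 0 = 0" for i using \<phi>0[OF \<phi>E] by (simp add: D_def)
    qed (use L t e i in auto)
    then show "\<phi> (- t) (\<phi> t z) i = z i" using \<phi>0[OF z] by (simp add: D_def)
  qed
  show thesis
  proof (rule that[of r e M \<phi>])
    show "cube n z0 (2 * r) \<subseteq> V" using R(2) cube_mono[of "2 * r" R] r by force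
    show "\<bar>\<phi> t z i - z i\<bar> \<le> M * \<bar>t\<bar>" if "\<bar>t\<bar> < e" "i < n" for t z i
      using b\<phi>[of t i z] that e by simp
    show "\<phi> t z \<in> euclid n" for t z by (auto simp: \<phi>_def euclid_def)
    show "Cinf_on (Suc n) {z \<in> euclid (Suc n). z(n := 0) \<in> cube n z0 r \<and> \<bar>z n\<bar> < e}
        (\<lambda>z. \<phi> (z n) (z(n := 0)) i)" if "i < n" for i
      unfolding Cinf_on_def using flow_smooth[OF ff that] by blast
  qed (use r e M \<phi>0 in2r dK inv in auto)
qed

lemma openin_E_preimage:
  assumes W: "openin (Euclidean_space n) W" and V: "openin (Euclidean_space m) V"
    and g: "\<And>j. j < m \<Longrightarrow> Cinf_on n W (\<lambda>z. g z j)" and E: "\<And>z. z \<in> W \<Longrightarrow> g z \<in> euclid m"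
  shows "openin (Euclidean_space n) {z \<in> W. g z \<in> V}"
proof -
  have "continuous_on W g"
  proof (rule continuous_on_coordinatewise_then_product)
    fix i show "continuous_on W (\<lambda>z. g z i)"
    proof (cases "i < m")
      case True then show ?thesis using Ck_continuous[OF W Cinf_Ck[OF g]] by blast
    next
      case False
      then have "g z i = 0" if "z \<in> W" for z using E[OF that] by (simp add: euclid_def)
      then show ?thesis using continuous_on_const[of W "0::real"] by (simp cong: continuous_on_cong)
    qed
  qed
  then have "openin (top_of_set W) (W \<inter> g -` V)"
    using continuous_openin_preimage[of W g "euclid m" V] E V by (auto simp: Euclidean_space_eq)
  then have "openin (Euclidean_space n) (W \<inter> g -` V)"
    using W unfolding Euclidean_space_eq by (rule openin_trans)
  moreover have "W \<inter> g -` V = {z \<in> W. g z \<in> V}" by auto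
  ultimately show ?thesis by simp
qed

text \<open>Flow for time \<open>y\<^sub>m\<close> from the hyperplane of vanishing \<open>m\<close>-th coordinate:
  this is \<open>G\<close>. Since \<open>K\<^sub>m = 1\<close>, the \<open>m\<close>-th coordinate of the
  solution is the elapsed time, so the inverse \<open>F\<close> flows back for time
  \<open>z\<^sub>m\<close>. The last claim says that \<open>F\<close> carries \<open>K\<close> to the
  \<open>m\<close>-th coordinate field.\<close>

lemma flow_box:
  assumes n: "n = Suc m" and V: "openin (Euclidean_space n) V" and O: "(\<lambda>_. 0) \<in> V"
    and K: "\<And>i. i < n \<Longrightarrow> Cinf_on n V (K i)" and Km: "\<And>z. z \<in> V \<Longrightarrow> K m z = 1"
  shows "\<exists>F G \<rho>. \<rho> > 0 \<and> G ` cube n (\<lambda>_. 0) \<rho> \<subseteq> V \<and> openin (Euclidean_space n) (G ` cube n (\<lambda>_. 0) \<rho>) \<and>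
    (\<forall>i<n. Cinf_on n (cube n (\<lambda>_. 0) \<rho>) (\<lambda>y. G y i)) \<and>
    (\<forall>i<n. Cinf_on n (G ` cube n (\<lambda>_. 0) \<rho>) (\<lambda>z. F z i)) \<and>
    (\<forall>y\<in>cube n (\<lambda>_. 0) \<rho>. F (G y) = y) \<and> G (\<lambda>_. 0) = (\<lambda>_. 0) \<and>
    (\<forall>y\<in>cube n (\<lambda>_. 0) \<rho>. \<forall>a<n.
      (\<Sum>b<n. partial_deriv b (\<lambda>z. F z a) (G y) * K b (G y)) = (if a = m then 1 else 0))"
proof -
  let ?o = "\<lambda>_::nat. 0::real"
  obtain r e M \<phi> where r: "r > 0" and e: "e > 0" and M: "M \<ge> 0" and rV: "cube n ?o (2 * r) \<subseteq> V"
    and \<phi>E: "\<And>t z. \<phi> t z \<in> euclid n"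
    and \<phi>0: "\<And>z. z \<in> euclid n \<Longrightarrow> \<phi> 0 z = z"
    and \<phi>b: "\<And>t z i. \<bar>t\<bar> < e \<Longrightarrow> z \<in> cube n ?o r \<Longrightarrow> i < n \<Longrightarrow> \<bar>\<phi> t z i - z i\<bar> \<le> M * \<bar>t\<bar>"
    and \<phi>2: "\<And>t z. \<bar>t\<bar> < e \<Longrightarrow> z \<in> cube n ?o r \<Longrightarrow> \<phi> t z \<in> cube n ?o (2 * r)"
    and \<phi>d: "\<And>t z i. \<bar>t\<bar> < e \<Longrightarrow> z \<in> cube n ?o r \<Longrightarrow> i < n \<Longrightarrow>
        ((\<lambda>t. \<phi> t z i) has_real_derivative K i (\<phi> t z)) (at t)"
    and inv: "\<And>t z. \<bar>t\<bar> < e \<Longrightarrow> z \<in> euclid n \<Longrightarrow> \<phi> (- t) (\<phi> t z) = z"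
    and \<phi>C: "\<And>i. i < n \<Longrightarrow> Cinf_on (Suc n) {z \<in> euclid (Suc n). z(n := 0) \<in> cube n ?o r \<and> \<bar>z n\<bar> < e}
        (\<lambda>z. \<phi> (z n) (z(n := 0)) i)"
  proof (rule local_flow[of n V K ?o, OF V K O], goal_cases)
    case (1 i)
    show ?case by (fact 1(2))
  next
    case (2 r e M \<phi>)
    show ?case by (rule 2(1)) (fact 2)+
  qed
  let ?S = "{z \<in> euclid (Suc n). z(n := 0) \<in> cube n ?o r \<and> \<bar>z n\<bar> < e}"
  have S: "openin (Euclidean_space (Suc n)) ?S" by (rule openin_suspension[OF openin_cube])
  have \<phi>m: "\<phi> t z m = z m + t" if t: "\<bar>t\<bar> < e" and z: "z \<in> cube n ?o r" for t z
  proof -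
    have "\<exists>c. \<forall>s\<in>{-e<..<e}. \<phi> s z m - s = c"
    proof (rule has_field_derivative_zero_constant)
      fix s assume "s \<in> {-e<..<e}"
      then have s: "\<bar>s\<bar> < e" by auto
      have "\<phi> s z \<in> V" using \<phi>2[OF s z] rV by blast
      then have "((\<lambda>s. \<phi> s z m - s) has_real_derivative 0) (at s)"
        using \<phi>d[OF s z, of m] Km n by (auto intro!: derivative_eq_intros)
      then show "((\<lambda>s. \<phi> s z m - s) has_real_derivative 0) (at s within {-e<..<e})"
        by (rule has_field_derivative_at_within)
    qed simp
    then obtain c where c: "\<And>s. \<bar>s\<bar> < e \<Longrightarrow> \<phi> s z m - s = c" by (auto simp: abs_less_iff)
    have "z \<in> euclid n" using z by (simp add: cube_def)
    then show ?thesis using c[OF t] c[of 0] e \<phi>0 by simp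
  qed
  define r1 where "r1 = min r e"
  \<comment> \<open>starting in the cube of radius \<open>\<rho>\<close>, the flow moves by at most \<open>M \<rho>\<close> up to time \<open>\<rho>\<close>\<close>
  define \<rho> where "\<rho> = r1 / (M + 2)"
  have r1: "r1 > 0" using r e by (simp add: r1_def)
  have \<rho>: "\<rho> > 0" "\<rho> + M * \<rho> < r1"
  proof -
    show 1: "\<rho> > 0" using r1 M by (simp add: \<rho>_def)
    have "M + 2 \<noteq> 0" using M by linarith
    then have "\<rho> * (M + 2) = r1" unfolding \<rho>_def by (metis nonzero_eq_divide_eq)
    then show "\<rho> + M * \<rho> < r1" using 1 by (simp add: algebra_simps)
  qed
  have \<rho>r1: "\<rho> \<le> r1" using \<rho> M mult_nonneg_nonneg[of M \<rho>] by linarith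
  have r1r: "cube n ?o r1 \<subseteq> cube n ?o r" by (rule cube_mono) (simp add: r1_def)
  have me: "\<bar>z m\<bar> < e" if "z \<in> cube n ?o r1" for z using that n by (auto simp: cube_def r1_def)
  define G where "G y = \<phi> (y m) (y(m := 0))" for y :: "nat \<Rightarrow> real"
  define F where "F z = (\<phi> (- z m) z)(m := z m)" for z :: "nat \<Rightarrow> real"
  let ?C = "cube n ?o \<rho>"
  have Cr1: "?C \<subseteq> cube n ?o r1" by (rule cube_mono[OF \<rho>r1])
  have upd: "y(m := 0) \<in> ?C" if "y \<in> ?C" for y using that n by (auto simp: cube_def euclid_def)
  have updr: "y(m := 0) \<in> cube n ?o r" if "y \<in> ?C" for y using upd[OF that] Cr1 r1r by blast
  have ye: "\<bar>y m\<bar> < e" if "y \<in> ?C" for y using me Cr1 that by blast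
  have Gm: "G y m = y m" if "y \<in> ?C" for y
    using \<phi>m[OF ye[OF that] updr[OF that]] by (simp add: G_def)
  have Gr1: "G y \<in> cube n ?o r1" if y: "y \<in> ?C" for y
  proof -
    have "\<bar>G y i\<bar> < r1" if i: "i < n" for i
    proof -
      have "\<bar>G y i - (y(m := 0)) i\<bar> \<le> M * \<bar>y m\<bar>" unfolding G_def by (rule \<phi>b[OF ye[OF y] updr[OF y] i])
      also have "\<dots> \<le> M * \<rho>" using M y n by (intro mult_left_mono) (auto simp: cube_def less_imp_le)
      finally have 1: "\<bar>G y i - (y(m := 0)) i\<bar> \<le> M * \<rho>" .
      have "\<bar>(y(m := 0)) i\<bar> < \<rho>" using upd[OF y] i by (auto simp: cube_def)
      then show ?thesis using 1 \<rho>(2) by linarith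
    qed
    then show ?thesis using \<phi>E by (auto simp: cube_def G_def)
  qed
  have FG: "F (G y) = y" if y: "y \<in> ?C" for y
  proof -
    have "y(m := 0) \<in> euclid n" using upd[OF y] by (simp add: cube_def)
    then have "\<phi> (- G y m) (G y) = y(m := 0)"
      unfolding Gm[OF y] unfolding G_def by (rule inv[OF ye[OF y]])
    then show ?thesis by (simp add: F_def Gm[OF y])
  qed
  have GF: "G (F z) = z" if z: "z \<in> cube n ?o r1" for z
  proof -
    have zr: "z \<in> cube n ?o r" and zE: "z \<in> euclid n" using z r1r by (auto simp: cube_def)
    have "\<phi> (- z m) z m = 0" using \<phi>m[of "- z m" z] me[OF z] zr by simp
    then have "(F z)(m := 0) = \<phi> (- z m) z" by (auto simp: F_def fun_eq_iff)
    then show ?thesis using inv[of "- z m" z] me[OF z] zE by (simp add: G_def F_def)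
  qed
  have Fs: "Cinf_on n (cube n ?o r1) (\<lambda>z. F z i)" if i: "i < n" for i
  proof (cases "i = m")
    case True
    then show ?thesis using Cinf_coord[OF openin_cube, of n ?o r1 m] by (simp add: F_def)
  next
    case False
    have zz: "(z(n := - z m))(n := 0) = z" if "z \<in> cube n ?o r1" for z
      using that by (auto simp: cube_def euclid_def)
    have "Cinf_on n (cube n ?o r1) (\<lambda>z. (\<lambda>w. \<phi> (w n) (w(n := 0)) i) (z(n := - z m)))"
    proof (rule Cinf_compose[OF openin_cube S _ _ \<phi>C[OF i]])
      show "z(n := - z m) \<in> ?S" if "z \<in> cube n ?o r1" for z
        using that zz[OF that] me[OF that] r1r by (auto simp: cube_def euclid_def)
      show "Cinf_on n (cube n ?o r1) (\<lambda>z. (z(n := - z m)) j)" for j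
        by (cases "j = n") (auto intro!: Cinf_minus[OF openin_cube] Cinf_coord[OF openin_cube])
    qed
    then have "Cinf_on n (cube n ?o r1) (\<lambda>z. \<phi> (- z m) z i)"
      by (subst (asm) Cinf_on_cong[OF openin_cube, of _ _ _ _ "\<lambda>z. \<phi> (- z m) z i"]) (auto simp: zz[simplified])
    then show ?thesis using False by (simp add: F_def)
  qed
  have img: "G ` ?C = {z \<in> cube n ?o r1. F z \<in> ?C}"
  proof (intro equalityI subsetI)
    fix z assume "z \<in> {z \<in> cube n ?o r1. F z \<in> ?C}"
    then show "z \<in> G ` ?C" using GF[of z] by (metis (no_types, lifting) imageI mem_Collect_eq)
  qed (use Gr1 FG in auto)
  have imgO: "openin (Euclidean_space n) (G ` ?C)"
    unfolding img
    by (rule openin_E_preimage[OF openin_cube openin_cube Fs]) (use \<phi>E n in \<open>auto simp: F_def euclid_def\<close>)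
  have Gs: "Cinf_on n ?C (\<lambda>y. G y i)" if i: "i < n" for i
  proof -
    have zz: "((y(m := 0))(n := y m))(n := 0) = y(m := 0)" if "y \<in> ?C" for y
      using that n by (auto simp: cube_def euclid_def)
    have "Cinf_on n ?C (\<lambda>z. (\<lambda>w. \<phi> (w n) (w(n := 0)) i) ((z(m := 0))(n := z m)))"
    proof (rule Cinf_compose[OF openin_cube S _ _ \<phi>C[OF i]])
      fix y assume y: "y \<in> ?C"
      have "(y(m := 0))(n := y m) \<in> euclid (Suc n)" using y by (auto simp: cube_def euclid_def)
      moreover have "((y(m := 0))(n := y m))(n := 0) \<in> cube n ?o r" unfolding zz[OF y] by (rule updr[OF y])
      ultimately show "(y(m := 0))(n := y m) \<in> ?S" using ye[OF y] by simp
    next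
      fix j
      show "Cinf_on n ?C (\<lambda>z. ((z(m := 0))(n := z m)) j)"
        by (cases "j = n"; cases "j = m") (auto intro!: Cinf_const[OF openin_cube] Cinf_coord[OF openin_cube])
    qed
    moreover have "((z(m := 0))(n := z m)) n = z m" for z :: "nat \<Rightarrow> real" by simp
    ultimately show ?thesis
      unfolding G_def by (subst (asm) Cinf_on_cong[OF openin_cube, of _ _ _ _ "\<lambda>z. \<phi> (z m) (z(m := 0)) i"]) (simp_all only: zz)
  qed
  show ?thesis
  proof (rule exI[of _ F], rule exI[of _ G], rule exI[of _ \<rho>], intro conjI allI impI ballI \<rho>(1) imgO Gs FG)
    show "G ` ?C \<subseteq> V"
    proof -
      have "cube n ?o r \<subseteq> V" using rV cube_mono[of r "2 * r" n ?o] r by force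
      then show ?thesis using Gr1 r1r by blast
    qed
    show "Cinf_on n (G ` ?C) (\<lambda>z. F z i)" if "i < n" for i
      by (rule Cinf_on_subset[OF Fs[OF that]]) (use img in blast)
    have "(?o(m := 0)) = ?o" by auto
    then show "G ?o = ?o" using \<phi>0[of ?o] by (simp add: G_def euclid_def)
    fix y a assume y: "y \<in> ?C" and a: "a < n"
    have ev: "\<forall>\<^sub>F t in nhds (y m). y(m := t) \<in> ?C"
      by (rule eventually_slice[OF openin_cube y]) (simp add: n)
    have "((\<lambda>t. F (G (y(m := t))) a) has_real_derivative
      (\<Sum>b<n. partial_deriv b (\<lambda>z. F z a) (G (y(m := y m))) * K b (G y))) (at (y m))"
    proof (rule chain_rule_curve[OF imgO])
      show "Ck_on n (Suc 0) (G ` ?C) (\<lambda>z. F z a)"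
        by (rule Ck_on_subset[OF Cinf_Ck[OF Fs[OF a]]]) (use img in blast)
      show "G (y(m := y m)) \<in> G ` ?C" using y by simp
      show "\<forall>\<^sub>F t in at (y m). G (y(m := t)) \<in> euclid n" by (simp add: G_def \<phi>E)
      fix b assume b: "b < n"
      have "((\<lambda>t. \<phi> t (y(m := 0)) b) has_real_derivative K b (\<phi> (y m) (y(m := 0)))) (at (y m))"
        by (rule \<phi>d[OF ye[OF y] updr[OF y] b])
      then show "((\<lambda>t. G (y(m := t)) b) has_real_derivative K b (G y)) (at (y m))"
        by (simp add: G_def)
    qed
    moreover have "((\<lambda>t. F (G (y(m := t))) a) has_real_derivative (if a = m then 1 else 0)) (at (y m))"
    proof -
      have "((\<lambda>t. (y(m := t)) a) has_real_derivative (if a = m then 1 else 0)) (at (y m))"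
        by (auto intro!: derivative_eq_intros)
      moreover have e: "\<forall>\<^sub>F t in nhds (y m). (y(m := t)) a = F (G (y(m := t))) a"
        using ev by eventually_elim (use FG in metis)
      ultimately show ?thesis by (simp only: DERIV_cong_ev[OF refl e refl])
    qed
    ultimately show "(\<Sum>b<n. partial_deriv b (\<lambda>z. F z a) (G y) * K b (G y)) = (if a = m then 1 else 0)"
      using DERIV_unique by fastforce
  qed
qed

section \<open>Smooth bump functions on Euclidean space\<close>

text \<open>The derivatives of \<open>exp (- 1 / t)\<close>, extended by \<open>0\<close>, all have this form; the
  family is closed under differentiation.\<close>

definition smooth_step_deriv :: "real poly \<Rightarrow> real \<Rightarrow> real" where
  "smooth_step_deriv P t = (if t > 0 then poly P (inverse t) * exp (- inverse t) else 0)"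

lemma poly_exp_tendsto_0: "((\<lambda>s. poly P s * exp (- s)) \<longlongrightarrow> 0) at_top" for P :: "real poly"
proof -
  have "((\<lambda>s. \<Sum>i\<le>degree P. coeff P i * (s ^ i / exp s)) \<longlongrightarrow> (\<Sum>i\<le>degree P. coeff P i * 0)) at_top"
    by (intro tendsto_sum tendsto_mult tendsto_const tendsto_power_div_exp_0)
  then show ?thesis by (simp add: poly_altdef sum_distrib_right exp_minus field_simps sum_divide_distrib)
qed

lemma smooth_step_deriv_tendsto_0: "((\<lambda>t. smooth_step_deriv P t) \<longlongrightarrow> 0) (at 0)"
proof (rule tendsto_at_iff_tendsto_nhds_within[THEN iffD1, OF _] | rule filterlim_split_at)
  show "((\<lambda>t. smooth_step_deriv P t) \<longlongrightarrow> 0) (at_left 0)"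
    by (rule tendsto_eventually) (auto simp: eventually_at_left_field smooth_step_deriv_def intro!: exI[of _ "-1"])
  have "((\<lambda>t. poly P (inverse t) * exp (- inverse t)) \<longlongrightarrow> 0) (at_right 0)"
    by (rule filterlim_compose[OF poly_exp_tendsto_0 filterlim_inverse_at_top_right])
  then show "((\<lambda>t. smooth_step_deriv P t) \<longlongrightarrow> 0) (at_right 0)"
    by (rule Lim_transform_eventually) (auto simp: eventually_at_right_field smooth_step_deriv_def intro!: exI[of _ 1])
qed

lemma smooth_step_deriv_has_derivative:
  "(smooth_step_deriv P has_real_derivative smooth_step_deriv ([:0, 0, 1:] * (P - pderiv P)) t) (at t)"
proof -
  consider "t > 0" | "t = 0" | "t < 0" by linarith
  then show ?thesis
  proof cases
    case 1
    have "((\<lambda>t. poly P (inverse t) * exp (- inverse t)) has_real_derivative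
        smooth_step_deriv ([:0, 0, 1:] * (P - pderiv P)) t) (at t)"
      using 1 by (auto intro!: derivative_eq_intros DERIV_chain2[OF poly_DERIV]
          simp: smooth_step_deriv_def power2_eq_square algebra_simps)
    then show ?thesis
      by (rule has_field_derivative_transform_within_open[where S = "{0<..}"])
        (use 1 in \<open>auto simp: smooth_step_deriv_def\<close>)
  next
    case 2
    have "((\<lambda>h. smooth_step_deriv ([:0, 1:] * P) h) \<longlongrightarrow> 0) (at 0)" by (rule smooth_step_deriv_tendsto_0)
    then have "((\<lambda>h. (smooth_step_deriv P h - smooth_step_deriv P 0) / (h - 0)) \<longlongrightarrow> 0) (at 0)"
      by (rule Lim_transform_eventually) (auto simp: smooth_step_deriv_def eventually_at divide_inverse intro!: exI[of _ 1])
    then show ?thesis using 2 by (simp add: has_field_derivative_iff smooth_step_deriv_def)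
  next
    case 3
    have "((\<lambda>t. 0) has_real_derivative smooth_step_deriv ([:0, 0, 1:] * (P - pderiv P)) t) (at t)"
      using 3 by (simp add: smooth_step_deriv_def)
    then show ?thesis
      by (rule has_field_derivative_transform_within_open[where S = "{..<0}"])
        (use 3 in \<open>auto simp: smooth_step_deriv_def\<close>)
  qed
qed

definition smooth_step :: "real \<Rightarrow> real" where
  "smooth_step = smooth_step_deriv 1"

lemma smooth_step_pos: "t > 0 \<Longrightarrow> smooth_step t > 0" and smooth_step_0: "t \<le> 0 \<Longrightarrow> smooth_step t = 0"
  by (auto simp: smooth_step_def smooth_step_deriv_def)

lemma Cinf_smooth_step: "openin (Euclidean_space 1) W \<Longrightarrow> Cinf_on 1 W (\<lambda>y. smooth_step (y 0))"
proof -
  assume W: "openin (Euclidean_space 1) W"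
  have "Ck_on 1 k W (\<lambda>y. smooth_step_deriv P (y 0))" for k P
  proof (induction k arbitrary: P)
    have c: "continuous_on W (\<lambda>y. smooth_step_deriv P (y 0))" for P
      by (rule continuous_on_compose2[OF _ continuous_on_coord, of UNIV])
        (auto intro!: DERIV_continuous_on smooth_step_deriv_has_derivative)
    {
      case 0 show ?case using c by (simp only: Ck_0[OF W])
    next
      case (Suc k)
      show ?case
      proof (rule Ck_SucI[OF W c, where g = "\<lambda>_ y. smooth_step_deriv ([:0, 0, 1:] * (P - pderiv P)) (y 0)"])
        show "((\<lambda>t. smooth_step_deriv P ((x(i := t)) 0)) has_real_derivative
           smooth_step_deriv ([:0, 0, 1:] * (P - pderiv P)) (x 0)) (at (x i))" if "i < 1" for i :: nat and x :: "nat \<Rightarrow> real"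
        proof -
          have "i = 0" using that by simp
          then show ?thesis using smooth_step_deriv_has_derivative[of P "x 0"] by simp
        qed
      qed (rule Suc)
    }
  qed
  then show ?thesis by (simp add: Cinf_on_def smooth_step_def)
qed

lemma Cinf_smooth_step_compose:
  assumes W: "openin (Euclidean_space n) W" and f: "Cinf_on n W f"
  shows "Cinf_on n W (\<lambda>z. smooth_step (f z))"
proof -
  have O: "openin (Euclidean_space 1) (euclid 1)" by (simp add: Euclidean_space_eq)
  have "Cinf_on n W (\<lambda>z. (\<lambda>y :: nat \<Rightarrow> real. smooth_step (y 0)) (\<lambda>i. if i = 0 then f z else 0))"
    by (rule Cinf_compose[OF W O _ _ Cinf_smooth_step[OF O], where g = "\<lambda>z i. if i = 0 then f z else 0"])
      (auto simp: euclid_def f)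
  then show ?thesis by simp
qed

text \<open>A quotient of smooth steps in the squared Euclidean distance \<open>q\<close>: the numerator vanishes
  for \<open>q \<ge> (r / 2)\<^sup>2\<close>, and the second term of the denominator vanishes for \<open>q
  \<le> (r / 2)\<^sup>2 / 2\<close>, which holds on a small cube.\<close>

lemma bump_exists:
  assumes z0: "z0 \<in> euclid n" and r: "r > 0"
  obtains b s where "Cinf_on n (euclid n) b" "0 < s" "s < r"
    "\<And>z. z \<in> cube n z0 s \<Longrightarrow> b z = 1"
    "\<And>z. z \<in> euclid n \<Longrightarrow> (\<exists>i<n. \<bar>z i - z0 i\<bar> > r / 2) \<Longrightarrow> b z = 0"
proof -
  have E: "openin (Euclidean_space n) (euclid n)" by (simp add: Euclidean_space_eq)
  define q where "q z = (\<Sum>i<n. (z i + - z0 i) * (z i + - z0 i))" for z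
  define c where "c = (r / 2) * (r / 2)"
  have c: "c > 0" using r by (simp add: c_def)
  define b where "b z = smooth_step (c + - q z) * inverse (smooth_step (c + - q z) + smooth_step (q z + - (c / 2)))" for z
  have q: "Cinf_on n (euclid n) q" unfolding q_def[abs_def]
    by (intro Cinf_sum[OF E] Cinf_mult[OF E] Cinf_add[OF E] Cinf_coord[OF E] Cinf_const[OF E])
  have pos: "smooth_step (c + - q z) + smooth_step (q z + - (c / 2)) \<noteq> 0" for z
  proof (cases "q z < c")
    case True
    then have "smooth_step (c + - q z) > 0" by (intro smooth_step_pos) simp
    moreover have "smooth_step (q z + - (c / 2)) \<ge> 0"
      using smooth_step_pos[of "q z + - (c / 2)"] smooth_step_0[of "q z + - (c / 2)"] by linarith
    ultimately show ?thesis by linarith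
  next
    case False
    then have "smooth_step (q z + - (c / 2)) > 0" using c by (intro smooth_step_pos) simp
    moreover have "smooth_step (c + - q z) = 0" using False by (intro smooth_step_0) simp
    ultimately show ?thesis by linarith
  qed
  define s where "s = (r / 2) / (real n + 2)"
  have "r * 1 < r * (2 * (real n + 2))" using r by (intro mult_strict_left_mono) auto
  then have s: "0 < s" "s < r" using r by (auto simp: s_def divide_less_eq)
  show thesis
  proof (rule that[of b s, OF _ s])
    show "Cinf_on n (euclid n) b" unfolding b_def[abs_def]
      by (intro Cinf_mult[OF E] Cinf_inverse[OF E] Cinf_add[OF E] Cinf_smooth_step_compose[OF E]
          Cinf_minus[OF E] Cinf_const[OF E] q pos)
    show "b z = 1" if z: "z \<in> cube n z0 s" for z
    proof -
      have "q z \<le> (\<Sum>i<n. s * s)"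
        unfolding q_def
      proof (rule sum_mono)
        fix i assume "i \<in> {..<n}"
        then have "\<bar>z i - z0 i\<bar> \<le> s" using z by (auto simp: cube_def less_imp_le)
        then have "\<bar>z i - z0 i\<bar> * \<bar>z i - z0 i\<bar> \<le> s * s" by (intro mult_mono) auto
        then show "(z i + - z0 i) * (z i + - z0 i) \<le> s * s" by simp
      qed
      also have "\<dots> = real n * (s * s)" by simp
      also have "\<dots> \<le> c / 2"
      proof -
        have "real n + 2 \<noteq> 0" by linarith
        then have sn: "s * (real n + 2) = r / 2" unfolding s_def by (metis nonzero_eq_divide_eq)
        have "2 * real n \<le> (real n + 2) * (real n + 2)" by (simp add: algebra_simps add_nonneg_nonneg)
        then have "2 * real n * (s * s) \<le> (real n + 2) * (real n + 2) * (s * s)"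
          by (rule mult_right_mono) simp
        then have "2 * (real n * (s * s)) \<le> (real n + 2) * (real n + 2) * (s * s)" by (simp only: mult.assoc)
        also have "\<dots> = c" unfolding c_def sn[symmetric] by (simp add: algebra_simps)
        finally show ?thesis by simp
      qed
      finally have "smooth_step (q z + - (c / 2)) = 0" by (intro smooth_step_0) simp
      then show ?thesis using pos[of z] by (simp add: b_def)
    qed
    fix z assume "\<exists>i<n. \<bar>z i - z0 i\<bar> > r / 2"
    then obtain i where i: "i < n" "\<bar>z i - z0 i\<bar> > r / 2" by blast
    have "c \<le> \<bar>z i - z0 i\<bar> * \<bar>z i - z0 i\<bar>"
      unfolding c_def using i r by (intro mult_mono) auto
    also have "\<dots> = (z i + - z0 i) * (z i + - z0 i)" by simp
    also have "\<dots> \<le> q z" unfolding q_def using i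
      by (intro member_le_sum[where f = "\<lambda>i. (z i + - z0 i) * (z i + - z0 i)"]) auto
    finally show "b z = 0" unfolding b_def by (simp add: smooth_step_0)
  qed
qed

section \<open>Smooth functions on a manifold\<close>

lemma partial_deriv_lin:
  assumes "openin (Euclidean_space n) W" "Cinf_on n W f" "Cinf_on n W g" "z \<in> W" "i < n"
  shows "partial_deriv i (\<lambda>z. a * f z + b * g z) z = a * partial_deriv i f z + b * partial_deriv i g z"
    and "partial_deriv i (\<lambda>z. f z * g z) z = f z * partial_deriv i g z + g z * partial_deriv i f z"
proof -
  have d: "((\<lambda>t. f (z(i := t))) has_real_derivative partial_deriv i f z) (at (z i))"
    "((\<lambda>t. g (z(i := t))) has_real_derivative partial_deriv i g z) (at (z i))"
    using Ck_SucD(1)[OF assms(1) Cinf_Ck[OF assms(2)] assms(5,4)]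
      Ck_SucD(1)[OF assms(1) Cinf_Ck[OF assms(3)] assms(5,4)] .
  show "partial_deriv i (\<lambda>z. a * f z + b * g z) z = a * partial_deriv i f z + b * partial_deriv i g z"
    unfolding partial_deriv_def[of i "\<lambda>z. a * f z + b * g z"]
    by (intro DERIV_imp_deriv DERIV_add DERIV_cmult d)
  show "partial_deriv i (\<lambda>z. f z * g z) z = f z * partial_deriv i g z + g z * partial_deriv i f z"
    unfolding partial_deriv_def[of i "\<lambda>z. f z * g z"]
    by (rule DERIV_imp_deriv, rule DERIV_cong[OF DERIV_mult[OF d]]) simp
qed

lemma partial_deriv_coord: "partial_deriv i (\<lambda>z. z j) z = (if i = j then 1 else 0)"
proof -
  have "((\<lambda>t. (z(i := t)) j) has_real_derivative (if i = j then 1 else 0)) (at (z i))"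
    by (auto intro!: derivative_eq_intros)
  then show ?thesis unfolding partial_deriv_def by (rule DERIV_imp_deriv)
qed

lemma partial_deriv_cong:
  assumes "openin (Euclidean_space n) W" "\<And>z. z \<in> W \<Longrightarrow> f z = g z" "z \<in> W" "i < n"
  shows "partial_deriv i f z = partial_deriv i g z"
proof -
  have "\<forall>\<^sub>F t in nhds (z i). f (z(i := t)) = g (z(i := t))"
    using eventually_slice[OF assms(1,3,4)] by eventually_elim (rule assms(2))
  then show ?thesis unfolding partial_deriv_def by (rule deriv_cong_ev) simp
qed

locale manifold =
  fixes M :: "'a manifold"
  assumes M: "smooth_manifold M"
begin

lemma
  assumes "(D, \<phi>) \<in> charts M"
  shows chart_open: "openin (mtop M) D" and chart_inj: "inj_on \<phi> D"
    and chart_open_iff: "U \<subseteq> D \<Longrightarrow> openin (mtop M) U \<longleftrightarrow> openin (Euclidean_space (mdim M)) (\<phi> ` U)"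
proof -
  have *: "openin (mtop M) D \<and> openin (Euclidean_space (mdim M)) (\<phi> ` D) \<and>
        homeomorphic_map (subtopology (mtop M) D) (subtopology (Euclidean_space (mdim M)) (\<phi> ` D)) \<phi>"
  proof -
    have "\<forall>(D, \<phi>) \<in> charts M. openin (mtop M) D \<and> openin (Euclidean_space (mdim M)) (\<phi> ` D) \<and>
        homeomorphic_map (subtopology (mtop M) D) (subtopology (Euclidean_space (mdim M)) (\<phi> ` D)) \<phi>"
      using M unfolding smooth_manifold_def by (elim conjE)
    from bspec[OF this assms] show ?thesis by simp
  qed
  then show D: "openin (mtop M) D" by blast
  have ts: "topspace (subtopology (mtop M) D) = D" using D openin_subset by fastforce
  show "inj_on \<phi> D" using * homeomorphic_imp_injective_map ts by fastforce
  assume U: "U \<subseteq> D"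
  have "openin (subtopology (Euclidean_space (mdim M)) (\<phi> ` D)) (\<phi> ` U) \<longleftrightarrow> openin (subtopology (mtop M) D) U"
    using homeomorphic_map_openness[of _ _ \<phi> U] * U ts by metis
  then show "openin (mtop M) U \<longleftrightarrow> openin (Euclidean_space (mdim M)) (\<phi> ` U)"
    using * U by (simp add: openin_open_subtopology image_mono)
qed

lemma chart_at: "x \<in> topspace (mtop M) \<Longrightarrow> \<exists>D \<phi>. (D, \<phi>) \<in> charts M \<and> x \<in> D"
proof -
  assume "x \<in> topspace (mtop M)"
  moreover have "(\<Union>(D, \<phi>) \<in> charts M. D) = topspace (mtop M)"
    using M unfolding smooth_manifold_def by (elim conjE)
  ultimately obtain c where "c \<in> charts M" "x \<in> (case c of (D, \<phi>) \<Rightarrow> D)" by blast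
  then show ?thesis by (cases c) auto
qed

lemma chart_Int_open:
  "(D, \<phi>) \<in> charts M \<Longrightarrow> openin (mtop M) V \<Longrightarrow> openin (Euclidean_space (mdim M)) (\<phi> ` (D \<inter> V))"
  using chart_open_iff[of D \<phi> "D \<inter> V"] chart_open by blast

lemma smooth_onD:
  "smooth_on M V f \<Longrightarrow> (D, \<phi>) \<in> charts M \<Longrightarrow> Cinf_on (mdim M) (\<phi> ` (D \<inter> V)) (\<lambda>z. f (inv_into D \<phi> z))"
  unfolding smooth_on_def by blast

lemma smooth_on_open: "smooth_on M V f \<Longrightarrow> openin (mtop M) V"
  by (simp add: smooth_on_def)

lemma smooth_onI:
  "openin (mtop M) V \<Longrightarrow>
   (\<And>D \<phi>. (D, \<phi>) \<in> charts M \<Longrightarrow> Cinf_on (mdim M) (\<phi> ` (D \<inter> V)) (\<lambda>z. f (inv_into D \<phi> z))) \<Longrightarrow> smooth_on M V f"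
  unfolding smooth_on_def by blast

lemma smooth_on_cong:
  assumes "\<And>y. y \<in> V \<Longrightarrow> f y = g y" shows "smooth_on M V f \<longleftrightarrow> smooth_on M V g"
proof -
  have "smooth_on M V g" if f: "smooth_on M V f" and eq: "\<And>y. y \<in> V \<Longrightarrow> f y = g y" for f g
  proof (rule smooth_onI[OF smooth_on_open[OF f]])
    fix D \<phi> assume c: "(D, \<phi>) \<in> charts M"
    show "Cinf_on (mdim M) (\<phi> ` (D \<inter> V)) (\<lambda>z. g (inv_into D \<phi> z))"
      by (subst Cinf_on_cong[OF chart_Int_open[OF c smooth_on_open[OF f]], of _ "\<lambda>z. f (inv_into D \<phi> z)"])
        (use eq chart_inj[OF c] smooth_onD[OF f c] in auto)
  qed
  then show ?thesis using assms by metis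
qed

lemma smooth_on_subset: "smooth_on M V f \<Longrightarrow> openin (mtop M) V' \<Longrightarrow> V' \<subseteq> V \<Longrightarrow> smooth_on M V' f"
  by (rule smooth_onI) (auto intro: Cinf_on_subset dest: smooth_onD)

lemma smooth_on_local:
  assumes V: "openin (mtop M) V" and l: "\<And>y. y \<in> V \<Longrightarrow> \<exists>V'. y \<in> V' \<and> smooth_on M V' f"
  shows "smooth_on M V f"
proof (rule smooth_onI[OF V])
  fix D \<phi> assume c: "(D, \<phi>) \<in> charts M"
  show "Cinf_on (mdim M) (\<phi> ` (D \<inter> V)) (\<lambda>z. f (inv_into D \<phi> z))"
  proof (rule Cinf_local[OF chart_Int_open[OF c V]])
    fix z assume "z \<in> \<phi> ` (D \<inter> V)"
    then obtain y where y: "y \<in> D" "y \<in> V" "z = \<phi> y" by blast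
    obtain V' where V': "y \<in> V'" "smooth_on M V' f" using l[OF y(2)] by blast
    have "z \<in> \<phi> ` (D \<inter> V')" using y V'(1) by blast
    then show "\<exists>W. z \<in> W \<and> openin (Euclidean_space (mdim M)) W \<and> Cinf_on (mdim M) W (\<lambda>z. f (inv_into D \<phi> z))"
      using smooth_onD[OF V'(2) c] chart_Int_open[OF c smooth_on_open[OF V'(2)]] by (intro exI conjI)
  qed
qed

lemma
  assumes V: "openin (mtop M) V"
  shows smooth_on_const: "smooth_on M V (\<lambda>_. c)"
    and smooth_on_add: "smooth_on M V f \<Longrightarrow> smooth_on M V g \<Longrightarrow> smooth_on M V (\<lambda>y. f y + g y)"
    and smooth_on_mult: "smooth_on M V f \<Longrightarrow> smooth_on M V g \<Longrightarrow> smooth_on M V (\<lambda>y. f y * g y)"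
    and smooth_on_sum: "(\<And>i. i \<in> A \<Longrightarrow> smooth_on M V (h i)) \<Longrightarrow> smooth_on M V (\<lambda>y. \<Sum>i\<in>A. h i y)"
    and smooth_on_inverse: "smooth_on M V f \<Longrightarrow> (\<And>y. y \<in> V \<Longrightarrow> f y \<noteq> 0) \<Longrightarrow> smooth_on M V (\<lambda>y. inverse (f y))"
proof -
  note o = chart_Int_open[OF _ V]
  show "smooth_on M V (\<lambda>_. c)" by (intro smooth_onI[OF V] Cinf_const o)
  show "smooth_on M V f \<Longrightarrow> smooth_on M V g \<Longrightarrow> smooth_on M V (\<lambda>y. f y + g y)"
    by (rule smooth_onI[OF V], rule Cinf_add[OF o]) (auto dest: smooth_onD)
  show "smooth_on M V f \<Longrightarrow> smooth_on M V g \<Longrightarrow> smooth_on M V (\<lambda>y. f y * g y)"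
    by (rule smooth_onI[OF V], rule Cinf_mult[OF o]) (auto dest: smooth_onD)
  show "(\<And>i. i \<in> A \<Longrightarrow> smooth_on M V (h i)) \<Longrightarrow> smooth_on M V (\<lambda>y. \<Sum>i\<in>A. h i y)"
    by (rule smooth_onI[OF V], rule Cinf_sum[OF o]) (auto dest: smooth_onD)
  show "smooth_on M V f \<Longrightarrow> (\<And>y. y \<in> V \<Longrightarrow> f y \<noteq> 0) \<Longrightarrow> smooth_on M V (\<lambda>y. inverse (f y))"
    by (rule smooth_onI[OF V], rule Cinf_inverse[OF o]) (auto dest: smooth_onD simp: chart_inj)
qed

lemma smooth_on_diff: "smooth_on M V f \<Longrightarrow> smooth_on M V g \<Longrightarrow> smooth_on M V (\<lambda>y. f y - g y)"
  using smooth_on_add[of V f "\<lambda>y. (- 1) * g y"] smooth_on_mult[of V "\<lambda>_. - 1" g] smooth_on_const[of V "- 1"] smooth_on_open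
  by force

lemma smooth_on_imp_at: "smooth_on M V f \<Longrightarrow> y \<in> V \<Longrightarrow> smooth_at M y f"
  unfolding smooth_at_def by blast

lemma smooth_at_common:
  assumes "smooth_at M x f" "openin (mtop M) V" "x \<in> V"
  obtains V' where "x \<in> V'" "V' \<subseteq> V" "smooth_on M V' f" "openin (mtop M) V'"
proof -
  obtain W where "x \<in> W" "smooth_on M W f" using assms(1) unfolding smooth_at_def by blast
  then show thesis
    using that[of "W \<inter> V"] smooth_on_subset[of W f "W \<inter> V"] assms(2,3) smooth_on_open by blast
qed

lemma smooth_at_germ:
  assumes "openin (mtop M) V" "x \<in> V" "\<And>y. y \<in> V \<Longrightarrow> f y = g y"
  shows "smooth_at M x f \<longleftrightarrow> smooth_at M x g"
proof -
  have "smooth_at M x g" if f: "smooth_at M x f" and eq: "\<And>y. y \<in> V \<Longrightarrow> f y = g y" for f g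
  proof -
    obtain V' where "x \<in> V'" "V' \<subseteq> V" "smooth_on M V' f" using smooth_at_common[OF f assms(1,2)] .
    moreover then have "smooth_on M V' g" using smooth_on_cong[of V' f g] eq by blast
    ultimately show ?thesis unfolding smooth_at_def by blast
  qed
  then show ?thesis using assms(3) by metis
qed

lemma smooth_at_topspace: "smooth_at M x f \<Longrightarrow> x \<in> topspace (mtop M)"
  unfolding smooth_at_def using smooth_on_open openin_subset by blast

lemma smooth_at_const: "x \<in> topspace (mtop M) \<Longrightarrow> smooth_at M x (\<lambda>_. c)"
  using smooth_on_const[of "topspace (mtop M)"] smooth_on_imp_at by blast

lemma smooth_at_op:
  assumes "smooth_at M x f" "smooth_at M x g"
    and "\<And>V. smooth_on M V f \<Longrightarrow> smooth_on M V g \<Longrightarrow> smooth_on M V h"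
  shows "smooth_at M x h"
proof -
  obtain V where V: "x \<in> V" "smooth_on M V f" using assms(1) unfolding smooth_at_def by blast
  obtain W where W: "x \<in> W" "W \<subseteq> V" "smooth_on M W g"
    using smooth_at_common[OF assms(2) smooth_on_open[OF V(2)] V(1)] by metis
  show ?thesis
    by (rule smooth_on_imp_at[OF assms(3)[OF smooth_on_subset[OF V(2) smooth_on_open[OF W(3)] W(2)] W(3)] W(1)])
qed

lemma
  assumes "smooth_at M x f" "smooth_at M x g"
  shows smooth_at_add: "smooth_at M x (\<lambda>y. f y + g y)"
    and smooth_at_mult: "smooth_at M x (\<lambda>y. f y * g y)"
    and smooth_at_diff: "smooth_at M x (\<lambda>y. f y - g y)"
  by (rule smooth_at_op[OF assms], simp add: smooth_on_add smooth_on_mult smooth_on_diff smooth_on_open)+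

lemma smooth_at_sum:
  "x \<in> topspace (mtop M) \<Longrightarrow> (\<And>i. i \<in> A \<Longrightarrow> smooth_at M x (h i)) \<Longrightarrow> smooth_at M x (\<lambda>y. \<Sum>i\<in>A. h i y)"
  by (induction A rule: infinite_finite_induct) (auto intro: smooth_at_const smooth_at_add)

section \<open>Derivations\<close>

lemma tan_lin:
  "v \<in> tangent_space M x \<Longrightarrow> smooth_at M x f \<Longrightarrow> smooth_at M x g \<Longrightarrow> v (\<lambda>y. a * f y + b * g y) = a * v f + b * v g"
  by (simp add: tangent_space_def)

lemma tan_mult:
  "v \<in> tangent_space M x \<Longrightarrow> smooth_at M x f \<Longrightarrow> smooth_at M x g \<Longrightarrow> v (\<lambda>y. f y * g y) = f x * v g + g x * v f"
  by (simp add: tangent_space_def)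

lemma tan_nonsmooth: "v \<in> tangent_space M x \<Longrightarrow> \<not> smooth_at M x f \<Longrightarrow> v f = 0"
  by (simp add: tangent_space_def)

lemma tan_add: "v \<in> tangent_space M x \<Longrightarrow> smooth_at M x f \<Longrightarrow> smooth_at M x g \<Longrightarrow> v (\<lambda>y. f y + g y) = v f + v g"
  using tan_lin[of v x f g 1 1] by simp

lemma tan_diff: "v \<in> tangent_space M x \<Longrightarrow> smooth_at M x f \<Longrightarrow> smooth_at M x g \<Longrightarrow> v (\<lambda>y. f y - g y) = v f - v g"
  using tan_lin[of v x f g 1 "-1"] by simp

lemma tan_const:
  assumes "x \<in> topspace (mtop M)" "v \<in> tangent_space M x" shows "v (\<lambda>_. c) = 0"
proof -
  have 1: "v (\<lambda>_. 1) = 0"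
    using tan_mult[OF assms(2) smooth_at_const[OF assms(1), of 1] smooth_at_const[OF assms(1), of 1]] by simp
  show ?thesis
    using tan_lin[OF assms(2) smooth_at_const[OF assms(1), of 1] smooth_at_const[OF assms(1), of 1], of c 0] 1 by simp
qed

lemma tan_cmult: "v \<in> tangent_space M x \<Longrightarrow> smooth_at M x f \<Longrightarrow> v (\<lambda>y. c * f y) = c * v f"
  using tan_lin[of v x f f c 0] by simp

lemma tan_sum:
  assumes "x \<in> topspace (mtop M)" "v \<in> tangent_space M x"
  shows "(\<And>i. i \<in> A \<Longrightarrow> smooth_at M x (h i)) \<Longrightarrow> v (\<lambda>y. \<Sum>i\<in>A. h i y) = (\<Sum>i\<in>A. v (h i))"
  by (induction A rule: infinite_finite_induct)
    (auto simp: tan_const[OF assms] tan_add[OF assms(2)] smooth_at_sum[OF assms(1)])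

text \<open>Smoothness is required only near the point, so the characteristic function of the complement of a
  neighbourhood is an admissible factor. Multiplying a function that vanishes near the point by it changes
  nothing, and the product rule then gives \<open>0\<close>.\<close>

lemma tan_local:
  assumes v: "v \<in> tangent_space M x" and V: "openin (mtop M) V" "x \<in> V" and eq: "\<And>y. y \<in> V \<Longrightarrow> f y = g y"
  shows "v f = v g"
proof (cases "smooth_at M x f")
  case True
  then have g: "smooth_at M x g" using smooth_at_germ[OF V, of f g] eq by blast
  have x: "x \<in> topspace (mtop M)" using smooth_at_topspace[OF True] .
  define h where "h = (\<lambda>y. f y - g y)"
  define k where "k y = (if y \<in> V then 0 else 1 :: real)" for y
  have h: "smooth_at M x h" unfolding h_def by (rule smooth_at_diff[OF True g])
  have k: "smooth_at M x k"
    using smooth_at_germ[OF V, of k "\<lambda>_. 0"] smooth_at_const[OF x] by (simp add: k_def)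
  have "h = (\<lambda>y. h y * k y)" using eq by (auto simp: h_def k_def)
  then have "v h = h x * v k + k x * v h" using tan_mult[OF v h k] by metis
  then have "v h = 0" using V eq by (simp add: h_def k_def)
  then show ?thesis using tan_diff[OF v True g] by (simp add: h_def)
next
  case False
  moreover have "\<not> smooth_at M x g" using False smooth_at_germ[OF V, of f g] eq by blast
  ultimately show ?thesis by (simp add: tan_nonsmooth[OF v])
qed

lemma tangent_zero: "(\<lambda>_. 0) \<in> tangent_space M x"
  by (simp add: tangent_space_def)

lemma tangent_lin: "v \<in> tangent_space M x \<Longrightarrow> w \<in> tangent_space M x \<Longrightarrow> (\<lambda>f. a * v f + b * w f) \<in> tangent_space M x"
  unfolding tangent_space_def by (auto simp: algebra_simps)

lemma tangent_sum:
  "(\<And>i. i \<in> A \<Longrightarrow> w i \<in> tangent_space M x) \<Longrightarrow> (\<lambda>f. \<Sum>i\<in>A. c i * w i f) \<in> tangent_space M x"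
proof (induction A rule: infinite_finite_induct)
  case (insert i A)
  then show ?case using tangent_lin[of "w i" x "\<lambda>f. \<Sum>i\<in>A. c i * w i f" "c i" 1] by simp
qed (simp_all add: tangent_zero)

lemma cot_lin:
  "\<xi> \<in> cotangent_space M x \<Longrightarrow> v \<in> tangent_space M x \<Longrightarrow> w \<in> tangent_space M x \<Longrightarrow>
   \<xi> (\<lambda>f. a * v f + b * w f) = a * \<xi> v + b * \<xi> w"
  by (simp add: cotangent_space_def)

lemma cot_outside: "\<xi> \<in> cotangent_space M x \<Longrightarrow> v \<notin> tangent_space M x \<Longrightarrow> \<xi> v = 0"
  by (simp add: cotangent_space_def)

lemma cot_zero: "\<xi> \<in> cotangent_space M x \<Longrightarrow> \<xi> (\<lambda>_. 0) = 0"
  using cot_lin[of \<xi> x "\<lambda>_. 0" "\<lambda>_. 0" 0 0] tangent_zero by simp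

lemma cot_sum:
  assumes \<xi>: "\<xi> \<in> cotangent_space M x"
  shows "(\<And>i. i \<in> A \<Longrightarrow> w i \<in> tangent_space M x) \<Longrightarrow> \<xi> (\<lambda>f. \<Sum>i\<in>A. c i * w i f) = (\<Sum>i\<in>A. c i * \<xi> (w i))"
proof (induction A rule: infinite_finite_induct)
  case (insert i A)
  then show ?case
    using cot_lin[OF \<xi>, of "w i" "\<lambda>f. \<Sum>i\<in>A. c i * w i f" "c i" 1] tangent_sum[of A w x c] by simp
qed (simp_all add: cot_zero[OF \<xi>])

lemma cotangent_lin:
  "\<xi> \<in> cotangent_space M x \<Longrightarrow> \<zeta> \<in> cotangent_space M x \<Longrightarrow> (\<lambda>v. a * \<xi> v + b * \<zeta> v) \<in> cotangent_space M x"
  unfolding cotangent_space_def by (auto simp: algebra_simps)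

lemma cotangent_zero: "(\<lambda>_. 0) \<in> cotangent_space M x"
  by (simp add: cotangent_space_def)

lemma cotangent_sum:
  "(\<And>i. i \<in> A \<Longrightarrow> w i \<in> cotangent_space M x) \<Longrightarrow> (\<lambda>v. \<Sum>i\<in>A. c i * w i v) \<in> cotangent_space M x"
proof (induction A rule: infinite_finite_induct)
  case (insert i A)
  then show ?case using cotangent_lin[of "w i" x "\<lambda>v. \<Sum>i\<in>A. c i * w i v" "c i" 1] by simp
qed (simp_all add: cotangent_zero)

section \<open>Vector fields and one-forms\<close>

lemma vf_tangent: "vector_field M V u \<Longrightarrow> y \<in> V \<Longrightarrow> u y \<in> tangent_space M y"
  and vf_open: "vector_field M V u \<Longrightarrow> openin (mtop M) V"
  and vf_smooth: "vector_field M V u \<Longrightarrow> V' \<subseteq> V \<Longrightarrow> smooth_on M V' f \<Longrightarrow> smooth_on M V' (\<lambda>x. u x f)"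
  unfolding vector_field_def by blast+

lemma of_cotangent: "one_form M V \<alpha> \<Longrightarrow> y \<in> V \<Longrightarrow> \<alpha> y \<in> cotangent_space M y"
  and of_open: "one_form M V \<alpha> \<Longrightarrow> openin (mtop M) V"
  and of_smooth: "one_form M V \<alpha> \<Longrightarrow> V' \<subseteq> V \<Longrightarrow> vector_field M V' w \<Longrightarrow> smooth_on M V' (\<lambda>x. \<alpha> x (w x))"
  unfolding one_form_def by blast+

lemma vf_subset: "vector_field M V u \<Longrightarrow> openin (mtop M) V' \<Longrightarrow> V' \<subseteq> V \<Longrightarrow> vector_field M V' u"
  unfolding vector_field_def by blast

lemma of_subset: "one_form M V u \<Longrightarrow> openin (mtop M) V' \<Longrightarrow> V' \<subseteq> V \<Longrightarrow> one_form M V' u"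
  unfolding one_form_def by blast

lemma vf_local:
  assumes V: "openin (mtop M) V" and l: "\<And>y. y \<in> V \<Longrightarrow> \<exists>V'. y \<in> V' \<and> vector_field M V' u"
  shows "vector_field M V u"
  unfolding vector_field_def
proof (intro conjI V ballI allI impI)
  show "u y \<in> tangent_space M y" if "y \<in> V" for y using l[OF that] vf_tangent by blast
  fix W f assume W: "W \<subseteq> V" "smooth_on M W f"
  show "smooth_on M W (\<lambda>x. u x f)"
  proof (rule smooth_on_local[OF smooth_on_open[OF W(2)]])
    fix y assume y: "y \<in> W"
    obtain V' where V': "y \<in> V'" "vector_field M V' u" using l y W(1) by blast
    have "openin (mtop M) (W \<inter> V')" using smooth_on_open[OF W(2)] vf_open[OF V'(2)] by blast
    then have "smooth_on M (W \<inter> V') (\<lambda>x. u x f)"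
      by (intro vf_smooth[OF V'(2)] smooth_on_subset[OF W(2)]) auto
    then show "\<exists>V'. y \<in> V' \<and> smooth_on M V' (\<lambda>x. u x f)" using y V' by blast
  qed
qed

lemma of_local:
  assumes V: "openin (mtop M) V" and l: "\<And>y. y \<in> V \<Longrightarrow> \<exists>V'. y \<in> V' \<and> one_form M V' u"
  shows "one_form M V u"
  unfolding one_form_def
proof (intro conjI V ballI allI impI)
  show "u y \<in> cotangent_space M y" if "y \<in> V" for y using l[OF that] of_cotangent by blast
  fix W w assume W: "W \<subseteq> V" "vector_field M W w"
  show "smooth_on M W (\<lambda>x. u x (w x))"
  proof (rule smooth_on_local[OF vf_open[OF W(2)]])
    fix y assume y: "y \<in> W"
    obtain V' where V': "y \<in> V'" "one_form M V' u" using l y W(1) by blast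
    have "openin (mtop M) (W \<inter> V')" using vf_open[OF W(2)] of_open[OF V'(2)] by blast
    then have "smooth_on M (W \<inter> V') (\<lambda>x. u x (w x))"
      by (intro of_smooth[OF V'(2)] vf_subset[OF W(2)]) auto
    then show "\<exists>V'. y \<in> V' \<and> smooth_on M V' (\<lambda>x. u x (w x))" using y V' by blast
  qed
qed

lemma vf_cong: "vector_field M V u \<Longrightarrow> (\<And>y. y \<in> V \<Longrightarrow> u y = w y) \<Longrightarrow> vector_field M V w"
proof -
  assume u: "vector_field M V u" and eq: "\<And>y. y \<in> V \<Longrightarrow> u y = w y"
  show ?thesis
    unfolding vector_field_def
  proof (intro conjI vf_open[OF u] ballI allI impI)
    show "w x \<in> tangent_space M x" if "x \<in> V" for x using vf_tangent[OF u that] eq[OF that] by simp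
    fix W f assume W: "W \<subseteq> V" "smooth_on M W f"
    have "u y f = w y f" if "y \<in> W" for y using eq[of y] W(1) that by auto
    from smooth_on_cong[of W "\<lambda>y. u y f" "\<lambda>y. w y f", OF this]
    show "smooth_on M W (\<lambda>x. w x f)" using vf_smooth[OF u W] by simp
  qed
qed

lemma of_cong: "one_form M V u \<Longrightarrow> (\<And>y. y \<in> V \<Longrightarrow> u y = w y) \<Longrightarrow> one_form M V w"
proof -
  assume u: "one_form M V u" and eq: "\<And>y. y \<in> V \<Longrightarrow> u y = w y"
  show ?thesis
    unfolding one_form_def
  proof (intro conjI of_open[OF u] ballI allI impI)
    show "w x \<in> cotangent_space M x" if "x \<in> V" for x using of_cotangent[OF u that] eq[OF that] by simp
    fix W f assume W: "W \<subseteq> V" "vector_field M W f"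
    have "u y (f y) = w y (f y)" if "y \<in> W" for y using eq[of y] W(1) that by auto
    from smooth_on_cong[of W "\<lambda>y. u y (f y)" "\<lambda>y. w y (f y)", OF this]
    show "smooth_on M W (\<lambda>x. w x (f x))" using of_smooth[OF u W] by simp
  qed
qed

lemma vf_scale_sum:
  assumes V: "openin (mtop M) V" and w: "\<And>i. i \<in> A \<Longrightarrow> vector_field M V (w i)" and c: "\<And>i. i \<in> A \<Longrightarrow> smooth_on M V (c i)"
  shows "vector_field M V (\<lambda>y f. \<Sum>i\<in>A. c i y * w i y f)"
  unfolding vector_field_def
proof (intro conjI V ballI allI impI)
  show "(\<lambda>f. \<Sum>i\<in>A. c i y * w i y f) \<in> tangent_space M y" if "y \<in> V" for y
    by (rule tangent_sum) (use w vf_tangent that in blast)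
  fix W f assume W: "W \<subseteq> V" "smooth_on M W f"
  have o: "openin (mtop M) W" by (rule smooth_on_open[OF W(2)])
  show "smooth_on M W (\<lambda>x. \<Sum>i\<in>A. c i x * w i x f)"
    by (intro smooth_on_sum[OF o] smooth_on_mult[OF o] smooth_on_subset[OF c o W(1)] vf_smooth[OF w W])
qed

lemma of_scale_sum:
  assumes V: "openin (mtop M) V" and w: "\<And>i. i \<in> A \<Longrightarrow> one_form M V (w i)" and c: "\<And>i. i \<in> A \<Longrightarrow> smooth_on M V (c i)"
  shows "one_form M V (\<lambda>y f. \<Sum>i\<in>A. c i y * w i y f)"
  unfolding one_form_def
proof (intro conjI V ballI allI impI)
  show "(\<lambda>f. \<Sum>i\<in>A. c i y * w i y f) \<in> cotangent_space M y" if "y \<in> V" for y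
    by (rule cotangent_sum) (use w of_cotangent that in blast)
  fix W f assume W: "W \<subseteq> V" "vector_field M W f"
  have o: "openin (mtop M) W" by (rule vf_open[OF W(2)])
  show "smooth_on M W (\<lambda>x. \<Sum>i\<in>A. c i x * w i x (f x))"
    by (intro smooth_on_sum[OF o] smooth_on_mult[OF o] smooth_on_subset[OF c o W(1)] of_smooth[OF w W])
qed

lemma vf_smooth_at: "vector_field M V u \<Longrightarrow> x \<in> V \<Longrightarrow> smooth_at M x f \<Longrightarrow> smooth_at M x (\<lambda>y. u y f)"
proof -
  assume u: "vector_field M V u" and x: "x \<in> V" and f: "smooth_at M x f"
  obtain V' where "x \<in> V'" "V' \<subseteq> V" "smooth_on M V' f" using smooth_at_common[OF f vf_open[OF u] x] .
  then show ?thesis using smooth_on_imp_at[OF vf_smooth[OF u]] by blast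
qed

text \<open>Derivations are linear only on smooth functions, so the laws hold at all points where \<open>f\<close>
  and \<open>g\<close> are smooth, which is a neighbourhood of \<open>x\<close>.\<close>

lemma vf_lin_near:
  assumes u: "vector_field M V u" and x: "x \<in> V" and f: "smooth_at M x f" and g: "smooth_at M x g"
  shows "\<exists>W. openin (mtop M) W \<and> x \<in> W \<and> W \<subseteq> V \<and>
    (\<forall>y\<in>W. \<forall>a b. u y (\<lambda>z. a * f z + b * g z) = a * u y f + b * u y g) \<and>
    (\<forall>y\<in>W. u y (\<lambda>z. f z * g z) = f y * u y g + g y * u y f)"
proof -
  obtain W1 where W1: "x \<in> W1" "W1 \<subseteq> V" "smooth_on M W1 f" "openin (mtop M) W1"
    using smooth_at_common[OF f vf_open[OF u] x] .
  obtain W where W: "x \<in> W" "W \<subseteq> W1" "smooth_on M W g" "openin (mtop M) W"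
    using smooth_at_common[OF g W1(4,1)] .
  have y: "smooth_at M y f" "smooth_at M y g" "u y \<in> tangent_space M y" if "y \<in> W" for y
  proof -
    show "smooth_at M y g" by (rule smooth_on_imp_at[OF W(3) that])
    show "smooth_at M y f" by (rule smooth_on_imp_at[OF W1(3)]) (use that W in blast)
    show "u y \<in> tangent_space M y" by (rule vf_tangent[OF u]) (use that W W1 in blast)
  qed
  show ?thesis
  proof (intro exI[of _ W] conjI W(4,1) ballI allI)
    show "W \<subseteq> V" using W W1 by blast
    show "u y (\<lambda>z. a * f z + b * g z) = a * u y f + b * u y g" if "y \<in> W" for y a b
      by (rule tan_lin[OF y(3,1,2)[OF that]])
    show "u y (\<lambda>z. f z * g z) = f y * u y g + g y * u y f" if "y \<in> W" for y
      by (rule tan_mult[OF y(3,1,2)[OF that]])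
  qed
qed

lemma lie_bracket_tangent:
  assumes u: "vector_field M V u" and v: "vector_field M V v" and x: "x \<in> V"
  shows "lie_bracket M u v x \<in> tangent_space M x"
proof -
  have U: "u x \<in> tangent_space M x" "v x \<in> tangent_space M x" using vf_tangent u v x by auto
  have sm: "smooth_at M x (\<lambda>y. u y f)" "smooth_at M x (\<lambda>y. v y f)" if "smooth_at M x f" for f
    using vf_smooth_at[OF u x that] vf_smooth_at[OF v x that] .
  show ?thesis
    unfolding tangent_space_def mem_Collect_eq
  proof (intro conjI allI impI)
    fix f g a b assume f: "smooth_at M x f" and g: "smooth_at M x g"
    obtain W where W: "openin (mtop M) W" "x \<in> W" "W \<subseteq> V"
      "\<forall>y\<in>W. \<forall>a b. u y (\<lambda>z. a * f z + b * g z) = a * u y f + b * u y g"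
      "\<forall>y\<in>W. u y (\<lambda>z. f z * g z) = f y * u y g + g y * u y f"
      using vf_lin_near[OF u x f g] by (elim exE conjE)
    obtain W' where W': "openin (mtop M) W'" "x \<in> W'" "W' \<subseteq> V"
      "\<forall>y\<in>W'. \<forall>a b. v y (\<lambda>z. a * f z + b * g z) = a * v y f + b * v y g"
      "\<forall>y\<in>W'. v y (\<lambda>z. f z * g z) = f y * v y g + g y * v y f"
      using vf_lin_near[OF v x f g] by (elim exE conjE)
    have x': "x \<in> topspace (mtop M)" using smooth_at_topspace[OF f] .
    have sl: "smooth_at M x (\<lambda>y. a * f y + b * g y)"
      by (intro smooth_at_add smooth_at_mult smooth_at_const x' f g)
    have "u x (\<lambda>y. v y (\<lambda>z. a * f z + b * g z)) = u x (\<lambda>y. a * v y f + b * v y g)"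
      by (rule tan_local[OF U(1) W'(1,2)]) (use W'(4) in simp)
    moreover have "v x (\<lambda>y. u y (\<lambda>z. a * f z + b * g z)) = v x (\<lambda>y. a * u y f + b * u y g)"
      by (rule tan_local[OF U(2) W(1,2)]) (use W(4) in simp)
    ultimately show "lie_bracket M u v x (\<lambda>y. a * f y + b * g y) = a * lie_bracket M u v x f + b * lie_bracket M u v x g"
      using f g sl tan_lin[OF U(1) sm(2)[OF f] sm(2)[OF g]] tan_lin[OF U(2) sm(1)[OF f] sm(1)[OF g]]
      by (simp add: lie_bracket_def algebra_simps)
    have sp: "smooth_at M x (\<lambda>y. f y * g y)" by (rule smooth_at_mult[OF f g])
    have "u x (\<lambda>y. v y (\<lambda>z. f z * g z)) = u x (\<lambda>y. f y * v y g + g y * v y f)"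
      by (rule tan_local[OF U(1) W'(1,2)]) (use W'(5) in simp)
    moreover have "v x (\<lambda>y. u y (\<lambda>z. f z * g z)) = v x (\<lambda>y. f y * u y g + g y * u y f)"
      by (rule tan_local[OF U(2) W(1,2)]) (use W(5) in simp)
    ultimately show "lie_bracket M u v x (\<lambda>y. f y * g y) = f x * lie_bracket M u v x g + g x * lie_bracket M u v x f"
      using f g sp sm[OF f] sm[OF g]
      by (simp add: lie_bracket_def tan_add[OF U(1)] tan_add[OF U(2)] tan_mult[OF U(1)] tan_mult[OF U(2)] smooth_at_mult algebra_simps)
  qed (simp add: lie_bracket_def)
qed

end

section \<open>Coordinates\<close>

text \<open>A coordinate system on \<open>D\<close> with inverse \<open>\<kappa>\<close>, described by what it does
  rather than by membership in the atlas: the atlas is not maximal, and the straightened coordinates to be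
  constructed need not belong to it.\<close>

locale coords = manifold M for M :: "'a manifold" +
  fixes D :: "'a set" and \<psi> :: "'a \<Rightarrow> nat \<Rightarrow> real" and \<kappa> :: "(nat \<Rightarrow> real) \<Rightarrow> 'a"
  assumes D: "openin (mtop M) D"
    and inv: "y \<in> D \<Longrightarrow> \<kappa> (\<psi> y) = y"
    and open_iff: "V \<subseteq> D \<Longrightarrow> openin (mtop M) V \<longleftrightarrow> openin (Euclidean_space (mdim M)) (\<psi> ` V)"
    and smooth_iff: "V \<subseteq> D \<Longrightarrow> openin (mtop M) V \<Longrightarrow>
      smooth_on M V f \<longleftrightarrow> Cinf_on (mdim M) (\<psi> ` V) (\<lambda>z. f (\<kappa> z))"
begin

abbreviation n :: nat where "n \<equiv> mdim M"

lemma D_top: "x \<in> D \<Longrightarrow> x \<in> topspace (mtop M)"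
  using D openin_subset by blast

lemma img_open: "V \<subseteq> D \<Longrightarrow> openin (mtop M) V \<Longrightarrow> openin (Euclidean_space n) (\<psi> ` V)"
  using open_iff by simp

lemma psi_euclid: "y \<in> D \<Longrightarrow> \<psi> y \<in> euclid n"
  using openin_E_subset[OF img_open[OF order_refl D]] by auto

lemma psi_kappa: "z \<in> \<psi> ` D \<Longrightarrow> \<psi> (\<kappa> z) = z"
  by (auto simp: inv)

lemma kappa_mem: "V \<subseteq> D \<Longrightarrow> z \<in> \<psi> ` V \<Longrightarrow> \<kappa> z \<in> V"
  using inv by fastforce

lemma kappa_image:
  assumes "W \<subseteq> \<psi> ` D"
  shows "\<psi> ` \<kappa> ` W = W" "\<kappa> ` W \<subseteq> D"
proof -
  have "\<psi> (\<kappa> z) = z" if "z \<in> W" for z using psi_kappa assms that by blast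
  then show "\<psi> ` \<kappa> ` W = W" by force
  show "\<kappa> ` W \<subseteq> D" using assms kappa_mem[of D] by blast
qed

lemma kappa_open:
  assumes "W \<subseteq> \<psi> ` D" "openin (Euclidean_space n) W" shows "openin (mtop M) (\<kappa> ` W)"
  using open_iff[OF kappa_image(2)[OF assms(1)]] kappa_image(1)[OF assms(1)] assms(2) by simp

lemma smooth_psi: "V \<subseteq> D \<Longrightarrow> openin (mtop M) V \<Longrightarrow> smooth_on M V (\<lambda>y. \<psi> y a)"
proof -
  assume V: "V \<subseteq> D" "openin (mtop M) V"
  have "Cinf_on n (\<psi> ` V) (\<lambda>z. \<psi> (\<kappa> z) a)"
    by (subst Cinf_on_cong[OF img_open[OF V], of _ "\<lambda>z. z a"])
      (use V inv in \<open>auto intro!: Cinf_coord[OF img_open[OF V]] dest: subsetD\<close>)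
  then show ?thesis using smooth_iff[OF V] by simp
qed

lemma smooth_at_psi: "x \<in> D \<Longrightarrow> smooth_at M x (\<lambda>y. \<psi> y a)"
  by (rule smooth_on_imp_at[OF smooth_psi[OF order_refl D]])

lemma smooth_at_coords:
  assumes "smooth_at M x f" "x \<in> D"
  obtains V where "x \<in> V" "V \<subseteq> D" "openin (mtop M) V" "smooth_on M V f" "Cinf_on n (\<psi> ` V) (\<lambda>z. f (\<kappa> z))"
proof -
  obtain V where V: "x \<in> V" "V \<subseteq> D" "smooth_on M V f" "openin (mtop M) V"
    by (rule smooth_at_common[OF assms(1) D assms(2)])
  show thesis by (rule that[OF V(1,2,4,3)]) (use smooth_iff[OF V(2,4)] V(3) in simp)
qed

text \<open>\<open>\<partial>/\<partial>\<psi>\<^sub>a\<close>, with the value \<open>0\<close> that tangent vectors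
  have on functions that are not smooth.\<close>

definition coord_field :: "nat \<Rightarrow> 'a \<Rightarrow> 'a tvec" where
  "coord_field a x = (\<lambda>f. if smooth_at M x f then partial_deriv a (\<lambda>z. f (\<kappa> z)) (\<psi> x) else 0)"

lemma coord_field_tangent:
  assumes a: "a < n" and x: "x \<in> D"
  shows "coord_field a x \<in> tangent_space M x"
  unfolding tangent_space_def mem_Collect_eq
proof (intro conjI allI impI)
  fix f g s t assume f: "smooth_at M x f" and g: "smooth_at M x g"
  obtain V where V: "x \<in> V" "V \<subseteq> D" "openin (mtop M) V" "smooth_on M V f" "Cinf_on n (\<psi> ` V) (\<lambda>z. f (\<kappa> z))"
    by (rule smooth_at_coords[OF f x])
  obtain W where W: "x \<in> W" "W \<subseteq> D" "openin (mtop M) W" "smooth_on M W g" "Cinf_on n (\<psi> ` W) (\<lambda>z. g (\<kappa> z))"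
    by (rule smooth_at_coords[OF g x])
  let ?O = "\<psi> ` (V \<inter> W)"
  have O: "openin (Euclidean_space n) ?O" using V W by (intro img_open) auto
  have F: "Cinf_on n ?O (\<lambda>z. f (\<kappa> z))" by (rule Cinf_on_subset[OF V(5)]) auto
  have G: "Cinf_on n ?O (\<lambda>z. g (\<kappa> z))" by (rule Cinf_on_subset[OF W(5)]) auto
  have z: "\<psi> x \<in> ?O" using V W by auto
  have xt: "x \<in> topspace (mtop M)" by (rule D_top[OF x])
  have "smooth_at M x (\<lambda>y. s * f y + t * g y)"
    by (intro smooth_at_add smooth_at_mult smooth_at_const xt f g)
  then show "coord_field a x (\<lambda>y. s * f y + t * g y) = s * coord_field a x f + t * coord_field a x g"
    using partial_deriv_lin(1)[OF O F G z a] f g by (simp add: coord_field_def)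
  show "coord_field a x (\<lambda>y. f y * g y) = f x * coord_field a x g + g x * coord_field a x f"
    using partial_deriv_lin(2)[OF O F G z a] f g smooth_at_mult[OF f g] by (simp add: coord_field_def inv[OF x])
qed (simp add: coord_field_def)

lemma coord_field_psi:
  assumes "a < n" "x \<in> D"
  shows "coord_field a x (\<lambda>y. \<psi> y b) = (if a = b then 1 else 0)"
proof -
  have "partial_deriv a (\<lambda>z. \<psi> (\<kappa> z) b) (\<psi> x) = partial_deriv a (\<lambda>z. z b) (\<psi> x)"
    by (rule partial_deriv_cong[OF img_open[OF order_refl D] _ _ assms(1)]) (use psi_kappa assms in auto)
  then show ?thesis using smooth_at_psi[OF assms(2)] by (simp add: coord_field_def partial_deriv_coord)
qed

text \<open>By Hadamard's lemma \<open>f = f x + \<Sum>\<^sub>a (\<psi>\<^sub>a - \<psi>\<^sub>a(x))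
  g\<^sub>a\<close> near \<open>x\<close> with smooth \<open>g\<^sub>a\<close>, where
  \<open>g\<^sub>a(x)\<close> is the partial derivative of \<open>f\<close>. A derivation kills the
  constant and differentiates only the first factor of each product, since that factor vanishes at
  \<open>x\<close>.\<close>

lemma tan_expand:
  assumes v: "v \<in> tangent_space M x" and x: "x \<in> D" and f: "smooth_at M x f"
  shows "v f = (\<Sum>a<n. v (\<lambda>y. \<psi> y a) * coord_field a x f)"
proof -
  have xt: "x \<in> topspace (mtop M)" by (rule D_top[OF x])
  obtain V where V: "x \<in> V" "V \<subseteq> D" "openin (mtop M) V" "smooth_on M V f" "Cinf_on n (\<psi> ` V) (\<lambda>z. f (\<kappa> z))"
    by (rule smooth_at_coords[OF f x])
  have "\<psi> x \<in> \<psi> ` V" using V(1) by simp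
  then obtain r where r: "r > 0" "cube n (\<psi> x) r \<subseteq> \<psi> ` V"
    by (rule openin_E_cube[OF img_open[OF V(2,3)]])
  let ?C = "cube n (\<psi> x) r"
  let ?W = "\<kappa> ` ?C"
  have CD: "?C \<subseteq> \<psi> ` D" using r(2) V(2) by blast
  have W: "openin (mtop M) ?W" "?W \<subseteq> D" "\<psi> ` ?W = ?C"
    using kappa_open[OF CD openin_cube] kappa_image[OF CD] by auto
  have pC: "\<psi> x \<in> ?C" by (rule cube_self[OF psi_euclid[OF x] r(1)])
  have xW: "x \<in> ?W" using pC inv[OF x] by force
  define F where "F z = f (\<kappa> z)" for z
  have F: "Cinf_on n ?C F" unfolding F_def[abs_def] by (rule Cinf_on_subset[OF V(5) r(2)])
  define g where "g a y = hadamard F a (\<psi> x) (\<psi> y)" for a y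
  have sg: "smooth_on M ?W (g a)" if "a < n" for a
  proof -
    have "Cinf_on n ?C (\<lambda>z. g a (\<kappa> z))"
      by (subst Cinf_on_cong[OF openin_cube, of _ _ _ _ "hadamard F a (\<psi> x)"])
        (use psi_kappa CD Cinf_hadamard[OF F psi_euclid[OF x] r(1) that] in \<open>auto simp: g_def dest: subsetD\<close>)
    then show ?thesis using smooth_iff[OF W(2,1)] W(3) by simp
  qed
  have sga: "smooth_at M x (g a)" if "a < n" for a by (rule smooth_on_imp_at[OF sg[OF that] xW])
  have sp: "smooth_at M x (\<lambda>y. \<psi> y a - \<psi> x a)" for a
    by (intro smooth_at_diff smooth_at_psi x smooth_at_const xt)
  have eq: "f y = f x + (\<Sum>a<n. (\<psi> y a - \<psi> x a) * g a y)" if y: "y \<in> ?W" for y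
  proof -
    have "y \<in> D" using y W(2) by blast
    moreover have "\<psi> y \<in> ?C" using y W(3) by blast
    ultimately show ?thesis
      using hadamard_formula[OF openin_cube box_convex_cube Cinf_Ck[OF F] pC, of "\<psi> y"] x
      by (simp add: F_def g_def inv)
  qed
  have "v f = v (\<lambda>y. f x + (\<Sum>a<n. (\<psi> y a - \<psi> x a) * g a y))"
    by (rule tan_local[OF v W(1) xW eq])
  also have "\<dots> = v (\<lambda>_. f x) + v (\<lambda>y. \<Sum>a<n. (\<psi> y a - \<psi> x a) * g a y)"
    by (rule tan_add[OF v smooth_at_const[OF xt] smooth_at_sum[OF xt]]) (use sp sga smooth_at_mult in auto)
  also have "\<dots> = (\<Sum>a<n. v (\<lambda>y. (\<psi> y a - \<psi> x a) * g a y))"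
    by (subst tan_sum[OF xt v]) (use sp sga smooth_at_mult tan_const[OF xt v] in auto)
  also have "\<dots> = (\<Sum>a<n. v (\<lambda>y. \<psi> y a) * coord_field a x f)"
  proof (rule sum.cong[OF refl])
    fix a assume "a \<in> {..<n}"
    then have a: "a < n" by simp
    have "v (\<lambda>y. (\<psi> y a - \<psi> x a) * g a y) = g a x * v (\<lambda>y. \<psi> y a - \<psi> x a)"
      using tan_mult[OF v sp sga[OF a]] by simp
    also have "v (\<lambda>y. \<psi> y a - \<psi> x a) = v (\<lambda>y. \<psi> y a)"
      using tan_diff[OF v smooth_at_psi[OF x] smooth_at_const[OF xt]] tan_const[OF xt v] by simp
    also have "g a x = coord_field a x f"
      using f by (simp add: g_def hadamard_diag coord_field_def F_def[abs_def])
    finally show "v (\<lambda>y. (\<psi> y a - \<psi> x a) * g a y) = v (\<lambda>y. \<psi> y a) * coord_field a x f" by simp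
  qed
  finally show ?thesis .
qed

definition vec :: "(nat \<Rightarrow> real) \<Rightarrow> 'a \<Rightarrow> 'a tvec" where
  "vec c x = (\<lambda>f. \<Sum>a<n. c a * coord_field a x f)"

definition cov :: "(nat \<Rightarrow> real) \<Rightarrow> 'a \<Rightarrow> 'a covec" where
  "cov d x = (\<lambda>v. if v \<in> tangent_space M x then \<Sum>a<n. d a * v (\<lambda>y. \<psi> y a) else 0)"

lemma vec_tangent: "x \<in> D \<Longrightarrow> vec c x \<in> tangent_space M x"
  unfolding vec_def by (rule tangent_sum) (simp add: coord_field_tangent)

lemma vec_psi: "x \<in> D \<Longrightarrow> b < n \<Longrightarrow> vec c x (\<lambda>y. \<psi> y b) = c b"
  by (simp add: vec_def coord_field_psi if_distrib cong: if_cong)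

lemma tan_eqI:
  assumes "v \<in> tangent_space M x" "w \<in> tangent_space M x" "x \<in> D"
    and "\<And>a. a < n \<Longrightarrow> v (\<lambda>y. \<psi> y a) = w (\<lambda>y. \<psi> y a)"
  shows "v = w"
proof
  fix f show "v f = w f"
    using tan_expand[OF assms(1,3)] tan_expand[OF assms(2,3)] assms(4)
      tan_nonsmooth[OF assms(1)] tan_nonsmooth[OF assms(2)]
    by (cases "smooth_at M x f") simp_all
qed

lemma tan_vec: "v \<in> tangent_space M x \<Longrightarrow> x \<in> D \<Longrightarrow> v = vec (\<lambda>a. v (\<lambda>y. \<psi> y a)) x"
  by (rule tan_eqI) (auto simp: vec_tangent vec_psi)

lemma cov_cotangent: "cov d x \<in> cotangent_space M x"
proof -
  have "(\<Sum>a<n. d a * (s * v (\<lambda>y. \<psi> y a) + t * w (\<lambda>y. \<psi> y a))) =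
     s * (\<Sum>a<n. d a * v (\<lambda>y. \<psi> y a)) + t * (\<Sum>a<n. d a * w (\<lambda>y. \<psi> y a))" for s t and v w :: "'a tvec"
    by (simp add: sum_distrib_left sum.distrib algebra_simps)
  then show ?thesis unfolding cotangent_space_def cov_def using tangent_lin by auto
qed

lemma cov_apply: "v \<in> tangent_space M x \<Longrightarrow> cov d x v = (\<Sum>a<n. d a * v (\<lambda>y. \<psi> y a))"
  by (simp add: cov_def)

lemma cov_coord_field: "x \<in> D \<Longrightarrow> b < n \<Longrightarrow> cov d x (coord_field b x) = d b"
  by (simp add: cov_def coord_field_tangent coord_field_psi if_distrib cong: if_cong)

lemma cot_expand:
  assumes \<xi>: "\<xi> \<in> cotangent_space M x" and v: "v \<in> tangent_space M x" and x: "x \<in> D"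
  shows "\<xi> v = (\<Sum>a<n. v (\<lambda>y. \<psi> y a) * \<xi> (coord_field a x))"
proof -
  have "\<xi> v = \<xi> (\<lambda>f. \<Sum>a<n. v (\<lambda>y. \<psi> y a) * coord_field a x f)"
    using tan_vec[OF v x] by (simp add: vec_def)
  then show ?thesis using cot_sum[OF \<xi>, of "{..<n}" "\<lambda>a. coord_field a x"] coord_field_tangent x by simp
qed

lemma cot_eqI:
  assumes "\<xi> \<in> cotangent_space M x" "\<zeta> \<in> cotangent_space M x" "x \<in> D"
    and "\<And>a. a < n \<Longrightarrow> \<xi> (coord_field a x) = \<zeta> (coord_field a x)"
  shows "\<xi> = \<zeta>"
proof
  fix v show "\<xi> v = \<zeta> v"
    using cot_expand[OF assms(1) _ assms(3)] cot_expand[OF assms(2) _ assms(3)] assms(4)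
      cot_outside[OF assms(1)] cot_outside[OF assms(2)]
    by (cases "v \<in> tangent_space M x") simp_all
qed

lemma coord_field_smooth: "V \<subseteq> D \<Longrightarrow> smooth_on M V f \<Longrightarrow> a < n \<Longrightarrow> smooth_on M V (\<lambda>x. coord_field a x f)"
proof -
  assume V: "V \<subseteq> D" and f: "smooth_on M V f" and a: "a < n"
  have o: "openin (mtop M) V" by (rule smooth_on_open[OF f])
  have F: "Cinf_on n (\<psi> ` V) (\<lambda>z. f (\<kappa> z))" using f smooth_iff[OF V o] by simp
  have "Cinf_on n (\<psi> ` V) (\<lambda>z. coord_field a (\<kappa> z) f)"
  proof (subst Cinf_on_cong[OF img_open[OF V o]])
    show "Cinf_on n (\<psi> ` V) (partial_deriv a (\<lambda>z. f (\<kappa> z)))" by (rule Cinf_partial[OF F a])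
    fix z assume z: "z \<in> \<psi> ` V"
    then have "\<psi> (\<kappa> z) = z" using psi_kappa V by blast
    then show "coord_field a (\<kappa> z) f = partial_deriv a (\<lambda>z. f (\<kappa> z)) z"
      using smooth_on_imp_at[OF f kappa_mem[OF V z]] by (simp add: coord_field_def)
  qed
  then show ?thesis using smooth_iff[OF V o] by simp
qed

lemma coord_field_vf: "V \<subseteq> D \<Longrightarrow> openin (mtop M) V \<Longrightarrow> a < n \<Longrightarrow> vector_field M V (coord_field a)"
  unfolding vector_field_def using coord_field_tangent coord_field_smooth by blast

lemma vf_iff:
  assumes V: "V \<subseteq> D" "openin (mtop M) V"
  shows "vector_field M V u \<longleftrightarrow>
    (\<forall>x\<in>V. u x \<in> tangent_space M x) \<and> (\<forall>a<n. smooth_on M V (\<lambda>x. u x (\<lambda>y. \<psi> y a)))"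
proof
  assume u: "vector_field M V u"
  show "(\<forall>x\<in>V. u x \<in> tangent_space M x) \<and> (\<forall>a<n. smooth_on M V (\<lambda>x. u x (\<lambda>y. \<psi> y a)))"
    using vf_tangent[OF u] vf_smooth[OF u order_refl smooth_psi[OF V]] by simp
next
  assume u: "(\<forall>x\<in>V. u x \<in> tangent_space M x) \<and> (\<forall>a<n. smooth_on M V (\<lambda>x. u x (\<lambda>y. \<psi> y a)))"
  have "vector_field M V (\<lambda>x f. \<Sum>a\<in>{..<n}. u x (\<lambda>y. \<psi> y a) * coord_field a x f)"
    by (rule vf_scale_sum[OF V(2)]) (use u coord_field_vf[OF V] in auto)
  then show "vector_field M V u"
  proof (rule vf_cong)
    fix y assume y: "y \<in> V"
    then have "y \<in> D" "u y \<in> tangent_space M y" using V u by auto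
    from tan_vec[OF this(2,1)] show "(\<lambda>f. \<Sum>a\<in>{..<n}. u y (\<lambda>y. \<psi> y a) * coord_field a y f) = u y"
      by (simp add: vec_def)
  qed
qed

lemma of_iff:
  assumes V: "V \<subseteq> D" "openin (mtop M) V"
  shows "one_form M V \<alpha> \<longleftrightarrow>
    (\<forall>x\<in>V. \<alpha> x \<in> cotangent_space M x) \<and> (\<forall>a<n. smooth_on M V (\<lambda>x. \<alpha> x (coord_field a x)))"
proof
  assume u: "one_form M V \<alpha>"
  show "(\<forall>x\<in>V. \<alpha> x \<in> cotangent_space M x) \<and> (\<forall>a<n. smooth_on M V (\<lambda>x. \<alpha> x (coord_field a x)))"
    using of_cotangent[OF u] of_smooth[OF u order_refl coord_field_vf[OF V]] by simp
next
  assume a: "(\<forall>x\<in>V. \<alpha> x \<in> cotangent_space M x) \<and> (\<forall>a<n. smooth_on M V (\<lambda>x. \<alpha> x (coord_field a x)))"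
  show "one_form M V \<alpha>"
    unfolding one_form_def
  proof (intro conjI V(2) ballI allI impI)
    show "\<alpha> x \<in> cotangent_space M x" if "x \<in> V" for x using a that by blast
    fix W w assume W: "W \<subseteq> V" "vector_field M W w"
    have o: "openin (mtop M) W" by (rule vf_open[OF W(2)])
    have WD: "W \<subseteq> D" using W(1) V(1) by blast
    have s: "smooth_on M W (\<lambda>x. w x (\<lambda>y. \<psi> y a))" for a by (rule vf_smooth[OF W(2) order_refl smooth_psi[OF WD o]])
    have s': "smooth_on M W (\<lambda>x. \<alpha> x (coord_field b x))" if "b < n" for b
      by (rule smooth_on_subset[OF _ o W(1)]) (use a that in blast)
    have "smooth_on M W (\<lambda>x. \<Sum>a<n. w x (\<lambda>y. \<psi> y a) * \<alpha> x (coord_field a x))"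
      by (intro smooth_on_sum[OF o] smooth_on_mult[OF o] s s') simp
    moreover have "\<alpha> x (w x) = (\<Sum>a<n. w x (\<lambda>y. \<psi> y a) * \<alpha> x (coord_field a x))" if "x \<in> W" for x
      by (rule cot_expand) (use that a W WD vf_tangent[OF W(2)] in auto)
    ultimately show "smooth_on M W (\<lambda>x. \<alpha> x (w x))"
      using smooth_on_cong[of W "\<lambda>x. \<alpha> x (w x)"] by simp
  qed
qed

lemma vec_vf:
  assumes V: "V \<subseteq> D" "openin (mtop M) V" and c: "\<And>a. a < n \<Longrightarrow> smooth_on M V (\<lambda>y. c y a)"
  shows "vector_field M V (\<lambda>y. vec (c y) y)"
  unfolding vf_iff[OF V]
proof (intro conjI ballI allI impI)
  show "vec (c x) x \<in> tangent_space M x" if "x \<in> V" for x using that V vec_tangent by blast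
  fix a assume a: "a < n"
  have "vec (c x) x (\<lambda>y. \<psi> y a) = c x a" if "x \<in> V" for x using that V vec_psi a by blast
  then show "smooth_on M V (\<lambda>x. vec (c x) x (\<lambda>y. \<psi> y a))"
    using c[OF a] smooth_on_cong[of V "\<lambda>x. vec (c x) x (\<lambda>y. \<psi> y a)"] by simp
qed

lemma cov_of:
  assumes V: "V \<subseteq> D" "openin (mtop M) V" and c: "\<And>a. a < n \<Longrightarrow> smooth_on M V (\<lambda>y. c y a)"
  shows "one_form M V (\<lambda>y. cov (c y) y)"
  unfolding of_iff[OF V]
proof (intro conjI ballI allI impI)
  show "cov (c x) x \<in> cotangent_space M x" for x by (rule cov_cotangent)
  fix a assume a: "a < n"
  have "cov (c x) x (coord_field a x) = c x a" if "x \<in> V" for x using that V cov_coord_field a by blast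
  then show "smooth_on M V (\<lambda>x. cov (c x) x (coord_field a x))"
    using c[OF a] smooth_on_cong[of V "\<lambda>x. cov (c x) x (coord_field a x)"] by simp
qed

text \<open>Lie and exterior derivative are defined as the common value over all extensions of the argument vectors.
  The extension with constant coordinates shows that the condition is not vacuous, which is what makes the
  value unique.\<close>

lemma extends_vec_const:
  assumes w: "w \<in> tangent_space M x" and x: "x \<in> D"
  shows "extends_vec M x w (vec (\<lambda>a. w (\<lambda>y. \<psi> y a)))"
proof -
  have "vector_field M D (\<lambda>y. vec ((\<lambda>_ a. w (\<lambda>y. \<psi> y a)) y) y)"
    by (rule vec_vf[OF order_refl D]) (rule smooth_on_const[OF D])
  then show ?thesis unfolding extends_vec_def using x tan_vec[OF w x] by auto
qed

section \<open>Cartan calculus in coordinates\<close>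

lemma bracket_psi:
  assumes x: "x \<in> D"
  shows "lie_bracket M u v x (\<lambda>y. \<psi> y a) = u x (\<lambda>y. v y (\<lambda>y. \<psi> y a)) - v x (\<lambda>y. u y (\<lambda>y. \<psi> y a))"
  by (simp add: lie_bracket_def smooth_at_psi[OF x])

lemma smooth_at_form_coord_field:
  "one_form M V \<eta> \<Longrightarrow> x \<in> V \<Longrightarrow> x \<in> D \<Longrightarrow> a < n \<Longrightarrow> smooth_at M x (\<lambda>y. \<eta> y (coord_field a y))"
proof -
  assume \<eta>: "one_form M V \<eta>" and x: "x \<in> V" "x \<in> D" and a: "a < n"
  have "openin (mtop M) (V \<inter> D)" using of_open[OF \<eta>] D by blast
  then have "smooth_on M (V \<inter> D) (\<lambda>y. \<eta> y (coord_field a y))" by (intro of_smooth[OF \<eta>] coord_field_vf a) auto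
  then show ?thesis by (rule smooth_on_imp_at) (use x in auto)
qed

text \<open>Leibniz rule for \<open>\<eta>(W) = \<Sum>\<^sub>a W\<^sup>a \<eta>\<^sub>a\<close>; the derivatives of
  the components of \<open>W\<close> are what the bracket terms cancel in the two derivatives of forms.\<close>

lemma derive_contraction:
  assumes u: "u \<in> tangent_space M x" and \<eta>: "one_form M V \<eta>" and W: "vector_field M V' W"
    and x: "x \<in> V" "x \<in> V'" "x \<in> D"
  shows "u (\<lambda>y. \<eta> y (W y)) = (\<Sum>a<n. W x (\<lambda>y. \<psi> y a) * u (\<lambda>y. \<eta> y (coord_field a y)) +
      \<eta> x (coord_field a x) * u (\<lambda>y. W y (\<lambda>y. \<psi> y a)))"
proof -
  have xt: "x \<in> topspace (mtop M)" by (rule D_top[OF x(3)])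
  have o: "openin (mtop M) (V \<inter> V' \<inter> D)" using of_open[OF \<eta>] vf_open[OF W] D by blast
  have s1: "smooth_at M x (\<lambda>y. W y (\<lambda>y. \<psi> y a))" for a
    by (rule vf_smooth_at[OF W x(2) smooth_at_psi[OF x(3)]])
  have s2: "smooth_at M x (\<lambda>y. \<eta> y (coord_field a y))" if "a < n" for a
    by (rule smooth_at_form_coord_field[OF \<eta> x(1,3) that])
  have "u (\<lambda>y. \<eta> y (W y)) = u (\<lambda>y. \<Sum>a<n. W y (\<lambda>y. \<psi> y a) * \<eta> y (coord_field a y))"
  proof (rule tan_local[OF u o])
    fix y assume y: "y \<in> V \<inter> V' \<inter> D"
    show "\<eta> y (W y) = (\<Sum>a<n. W y (\<lambda>y. \<psi> y a) * \<eta> y (coord_field a y))"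
      by (rule cot_expand) (use y of_cotangent[OF \<eta>] vf_tangent[OF W] in auto)
  qed (use x in auto)
  also have "\<dots> = (\<Sum>a<n. u (\<lambda>y. W y (\<lambda>y. \<psi> y a) * \<eta> y (coord_field a y)))"
    by (rule tan_sum[OF xt u]) (use smooth_at_mult[OF s1 s2] in simp)
  also have "\<dots> = (\<Sum>a<n. W x (\<lambda>y. \<psi> y a) * u (\<lambda>y. \<eta> y (coord_field a y)) + \<eta> x (coord_field a x) * u (\<lambda>y. W y (\<lambda>y. \<psi> y a)))"
    by (rule sum.cong[OF refl]) (use tan_mult[OF u s1 s2] in simp)
  finally show ?thesis .
qed

text \<open>The derivatives of the components of the extension \<open>W\<close> cancel between
  \<open>u(\<eta>(W))\<close> and \<open>\<eta>([u, W])\<close>; hence all extensions give the same value.\<close>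

lemma lie_deriv_coords:
  assumes u: "vector_field M V u" and \<eta>: "one_form M V \<eta>" and x: "x \<in> V" "x \<in> D"
    and w: "w \<in> tangent_space M x"
  shows "lie_deriv M u \<eta> x w =
    (\<Sum>a<n. w (\<lambda>y. \<psi> y a) * u x (\<lambda>y. \<eta> y (coord_field a y)) + \<eta> x (coord_field a x) * w (\<lambda>y. u y (\<lambda>y. \<psi> y a)))"
    (is "_ = ?r")
proof -
  have ux: "u x \<in> tangent_space M x" by (rule vf_tangent[OF u x(1)])
  have formula: "u x (\<lambda>y. \<eta> y (W y)) - \<eta> x (lie_bracket M u W x) = ?r" if ext: "extends_vec M x w W" for W
  proof -
    obtain V' where V': "x \<in> V'" "vector_field M V' W" and Wx: "W x = w"
      using ext unfolding extends_vec_def by blast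
    have o: "openin (mtop M) (V \<inter> V')" using vf_open[OF u] vf_open[OF V'(2)] by blast
    have "lie_bracket M u W x \<in> tangent_space M x"
      by (rule lie_bracket_tangent[OF vf_subset[OF u o] vf_subset[OF V'(2) o]]) (use x V' in auto)
    from cot_expand[OF of_cotangent[OF \<eta> x(1)] this x(2)]
    have "\<eta> x (lie_bracket M u W x) =
      (\<Sum>a<n. (u x (\<lambda>y. W y (\<lambda>y. \<psi> y a)) - w (\<lambda>y. u y (\<lambda>y. \<psi> y a))) * \<eta> x (coord_field a x))"
      by (simp add: bracket_psi[OF x(2)] Wx)
    moreover have "u x (\<lambda>y. \<eta> y (W y)) = (\<Sum>a<n. w (\<lambda>y. \<psi> y a) * u x (\<lambda>y. \<eta> y (coord_field a y)) +
      \<eta> x (coord_field a x) * u x (\<lambda>y. W y (\<lambda>y. \<psi> y a)))"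
      using derive_contraction[OF ux \<eta> V'(2) x(1) V'(1) x(2)] by (simp add: Wx)
    ultimately show ?thesis by (simp add: sum_subtractf[symmetric] algebra_simps)
  qed
  have "(THE r. \<forall>W. extends_vec M x w W \<longrightarrow> r = u x (\<lambda>y. \<eta> y (W y)) - \<eta> x (lie_bracket M u W x)) = ?r"
  proof (rule the_equality)
    show "\<forall>W. extends_vec M x w W \<longrightarrow> ?r = u x (\<lambda>y. \<eta> y (W y)) - \<eta> x (lie_bracket M u W x)"
      by (intro allI impI) (rule formula[symmetric])
    fix r assume *: "\<forall>W. extends_vec M x w W \<longrightarrow> r = u x (\<lambda>y. \<eta> y (W y)) - \<eta> x (lie_bracket M u W x)"
    note ew = extends_vec_const[OF w x(2)]
    show "r = ?r" by (rule trans[OF *[rule_format, OF ew] formula[OF ew]])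
  qed
  then show ?thesis using w by (simp add: lie_deriv_def)
qed

text \<open>As for the Lie derivative, the derivatives of the components of both extensions cancel.\<close>

lemma ext_deriv_coords:
  assumes \<alpha>: "one_form M V \<alpha>" and x: "x \<in> V" "x \<in> D"
    and v: "v \<in> tangent_space M x" and w: "w \<in> tangent_space M x"
  shows "ext_deriv M \<alpha> x v w =
    (\<Sum>a<n. w (\<lambda>y. \<psi> y a) * v (\<lambda>y. \<alpha> y (coord_field a y)) - v (\<lambda>y. \<psi> y a) * w (\<lambda>y. \<alpha> y (coord_field a y)))"
    (is "_ = ?r")
proof -
  have formula: "X x (\<lambda>y. \<alpha> y (Y y)) - Y x (\<lambda>y. \<alpha> y (X y)) - \<alpha> x (lie_bracket M X Y x) = ?r"
    if ext: "extends_vec M x v X" "extends_vec M x w Y" for X Y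
  proof -
    obtain V1 where V1: "x \<in> V1" "vector_field M V1 X" and Xx: "X x = v"
      using ext unfolding extends_vec_def by blast
    obtain V2 where V2: "x \<in> V2" "vector_field M V2 Y" and Yx: "Y x = w"
      using ext unfolding extends_vec_def by blast
    have o: "openin (mtop M) (V1 \<inter> V2)" using vf_open[OF V1(2)] vf_open[OF V2(2)] by blast
    have "lie_bracket M X Y x \<in> tangent_space M x"
      by (rule lie_bracket_tangent[OF vf_subset[OF V1(2) o] vf_subset[OF V2(2) o]]) (use V1 V2 in auto)
    from cot_expand[OF of_cotangent[OF \<alpha> x(1)] this x(2)]
    have "\<alpha> x (lie_bracket M X Y x) =
      (\<Sum>a<n. (v (\<lambda>y. Y y (\<lambda>y. \<psi> y a)) - w (\<lambda>y. X y (\<lambda>y. \<psi> y a))) * \<alpha> x (coord_field a x))"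
      by (simp add: bracket_psi[OF x(2)] Xx Yx)
    moreover have "v (\<lambda>y. \<alpha> y (Y y)) = (\<Sum>a<n. w (\<lambda>y. \<psi> y a) * v (\<lambda>y. \<alpha> y (coord_field a y)) +
      \<alpha> x (coord_field a x) * v (\<lambda>y. Y y (\<lambda>y. \<psi> y a)))"
      using derive_contraction[OF v \<alpha> V2(2) x(1) V2(1) x(2)] by (simp add: Yx)
    moreover have "w (\<lambda>y. \<alpha> y (X y)) = (\<Sum>a<n. v (\<lambda>y. \<psi> y a) * w (\<lambda>y. \<alpha> y (coord_field a y)) +
      \<alpha> x (coord_field a x) * w (\<lambda>y. X y (\<lambda>y. \<psi> y a)))"
      using derive_contraction[OF w \<alpha> V1(2) x(1) V1(1) x(2)] by (simp add: Xx)
    ultimately show ?thesis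
      by (simp add: Xx Yx sum_subtractf[symmetric] algebra_simps)
  qed
  note ev = extends_vec_const[OF v x(2)] and ew = extends_vec_const[OF w x(2)]
  have "(THE r. \<forall>X Y. extends_vec M x v X \<longrightarrow> extends_vec M x w Y \<longrightarrow>
             r = X x (\<lambda>y. \<alpha> y (Y y)) - Y x (\<lambda>y. \<alpha> y (X y)) - \<alpha> x (lie_bracket M X Y x)) = ?r"
  proof (rule the_equality)
    show "\<forall>X Y. extends_vec M x v X \<longrightarrow> extends_vec M x w Y \<longrightarrow>
             ?r = X x (\<lambda>y. \<alpha> y (Y y)) - Y x (\<lambda>y. \<alpha> y (X y)) - \<alpha> x (lie_bracket M X Y x)"
      by (intro allI impI) (rule formula[symmetric])
    fix r assume *: "\<forall>X Y. extends_vec M x v X \<longrightarrow> extends_vec M x w Y \<longrightarrow>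
             r = X x (\<lambda>y. \<alpha> y (Y y)) - Y x (\<lambda>y. \<alpha> y (X y)) - \<alpha> x (lie_bracket M X Y x)"
    show "r = ?r" by (rule trans[OF *[rule_format, OF ev ew] formula[OF ev ew]])
  qed
  then show ?thesis using v w by (simp add: ext_deriv_def)
qed

lemma double_sectionD:
  "double_section M V s \<Longrightarrow> vector_field M V (\<lambda>x. fst (s x))"
  "double_section M V s \<Longrightarrow> one_form M V (\<lambda>x. snd (s x))"
  by (simp_all add: double_section_def)

lemma dorfman_fst: "fst (dorfman M s t x) = lie_bracket M (\<lambda>x. fst (s x)) (\<lambda>x. fst (t x)) x"
  by (simp add: dorfman_def Let_def)

lemma dorfman_snd_outside: "w \<notin> tangent_space M x \<Longrightarrow> snd (dorfman M s t x) w = 0"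
  by (simp add: dorfman_def Let_def lie_deriv_def ext_deriv_def)

text \<open>The coordinate formula that all later computations with the bracket use.\<close>

lemma dorfman_snd:
  assumes s: "double_section M V s" and t: "double_section M V t" and x: "x \<in> V" "x \<in> D"
    and w: "w \<in> tangent_space M x"
  shows "snd (dorfman M s t x) w =
    (\<Sum>a<n. w (\<lambda>y. \<psi> y a) * (fst (s x) (\<lambda>y. snd (t y) (coord_field a y)) - fst (t x) (\<lambda>y. snd (s y) (coord_field a y)))
        + snd (t x) (coord_field a x) * w (\<lambda>y. fst (s y) (\<lambda>y. \<psi> y a))
        + fst (t x) (\<lambda>y. \<psi> y a) * w (\<lambda>y. snd (s y) (coord_field a y)))"
proof -
  have "fst (t x) \<in> tangent_space M x" by (rule vf_tangent[OF double_sectionD(1)[OF t] x(1)])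
  then show ?thesis
    using lie_deriv_coords[OF double_sectionD(1)[OF s] double_sectionD(2)[OF t] x w]
      ext_deriv_coords[OF double_sectionD(2)[OF s] x _ w, of "fst (t x)"]
    by (simp add: dorfman_def Let_def sum_subtractf[symmetric] algebra_simps)
qed

end

section \<open>Constructing coordinates\<close>

lemma (in manifold) chart_transition:
  assumes "(D, \<phi>) \<in> charts M" "(E, \<epsilon>) \<in> charts M" "i < mdim M"
  shows "Cinf_on (mdim M) (\<phi> ` (D \<inter> E)) (\<lambda>z. \<epsilon> (inv_into D \<phi> z) i)"
proof -
  have "\<forall>(D, \<phi>) \<in> charts M. \<forall>(E, \<psi>) \<in> charts M. \<forall>i<mdim M.
        Cinf_on (mdim M) (\<phi> ` (D \<inter> E)) (\<lambda>z. \<psi> (inv_into D \<phi> z) i)"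
    using M unfolding smooth_manifold_def by (elim conjE)
  from bspec[OF this assms(1)] have "\<forall>(E, \<psi>) \<in> charts M. \<forall>i<mdim M.
        Cinf_on (mdim M) (\<phi> ` (D \<inter> E)) (\<lambda>z. \<psi> (inv_into D \<phi> z) i)" by simp
  from bspec[OF this assms(2)] show ?thesis using assms(3) by simp
qed

lemma (in manifold) coords_of_chart:
  assumes c: "(D, \<phi>) \<in> charts M"
  shows "coords M D \<phi> (inv_into D \<phi>)"
proof (unfold_locales)
  show D: "openin (mtop M) D" by (rule chart_open[OF c])
  show "inv_into D \<phi> (\<phi> y) = y" if "y \<in> D" for y using chart_inj[OF c] that by simp
  show "openin (mtop M) V \<longleftrightarrow> openin (Euclidean_space (mdim M)) (\<phi> ` V)" if "V \<subseteq> D" for V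
    by (rule chart_open_iff[OF c that])
  fix V f assume V: "V \<subseteq> D" "openin (mtop M) V"
  have DV: "D \<inter> V = V" using V(1) by blast
  show "smooth_on M V f \<longleftrightarrow> Cinf_on (mdim M) (\<phi> ` V) (\<lambda>z. f (inv_into D \<phi> z))"
  proof
    assume "smooth_on M V f"
    from smooth_onD[OF this c] show "Cinf_on (mdim M) (\<phi> ` V) (\<lambda>z. f (inv_into D \<phi> z))" by (simp add: DV)
  next
    assume f: "Cinf_on (mdim M) (\<phi> ` V) (\<lambda>z. f (inv_into D \<phi> z))"
    show "smooth_on M V f"
    proof (rule smooth_onI[OF V(2)])
      fix E \<epsilon> assume e: "(E, \<epsilon>) \<in> charts M"
      have O: "openin (Euclidean_space (mdim M)) (\<epsilon> ` (E \<inter> V))" by (rule chart_Int_open[OF e V(2)])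
      have O': "openin (Euclidean_space (mdim M)) (\<phi> ` V)" using chart_open_iff[OF c V(1)] V(2) by simp
      have ie: "inv_into E \<epsilon> z \<in> V" if "z \<in> \<epsilon> ` (E \<inter> V)" for z
        using that chart_inj[OF e] by auto
      have "Cinf_on (mdim M) (\<epsilon> ` (E \<inter> V)) (\<lambda>z. (\<lambda>w. f (inv_into D \<phi> w)) (\<phi> (inv_into E \<epsilon> z)))"
      proof (rule Cinf_compose[OF O O' _ _ f])
        show "\<phi> (inv_into E \<epsilon> z) \<in> \<phi> ` V" if "z \<in> \<epsilon> ` (E \<inter> V)" for z using ie[OF that] by simp
        show "Cinf_on (mdim M) (\<epsilon> ` (E \<inter> V)) (\<lambda>z. \<phi> (inv_into E \<epsilon> z) j)" if "j < mdim M" for j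
          by (rule Cinf_on_subset[OF chart_transition[OF e c that]]) (use V in auto)
      qed
      moreover have "f (inv_into D \<phi> (\<phi> (inv_into E \<epsilon> z))) = f (inv_into E \<epsilon> z)" if "z \<in> \<epsilon> ` (E \<inter> V)" for z
        using ie[OF that] V(1) chart_inj[OF c] by (simp add: subsetD)
      ultimately show "Cinf_on (mdim M) (\<epsilon> ` (E \<inter> V)) (\<lambda>z. f (inv_into E \<epsilon> z))"
        using Cinf_on_cong[OF O, of "\<lambda>z. f (inv_into D \<phi> (\<phi> (inv_into E \<epsilon> z)))" "\<lambda>z. f (inv_into E \<epsilon> z)"] by simp
    qed
  qed
qed

lemma (in manifold) coords_at:
  assumes "x \<in> topspace (mtop M)"
  obtains D \<psi> \<kappa> where "coords M D \<psi> \<kappa>" "x \<in> D"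
  using chart_at[OF assms] coords_of_chart by blast

lemma (in coords) coords_restrict:
  assumes D': "D' \<subseteq> D" "openin (mtop M) D'" shows "coords M D' \<psi> \<kappa>"
proof (unfold_locales)
  show "openin (mtop M) D'" by (rule D')
  show "\<kappa> (\<psi> y) = y" if "y \<in> D'" for y using inv D' that by blast
  show "openin (mtop M) V \<longleftrightarrow> openin (Euclidean_space n) (\<psi> ` V)" if "V \<subseteq> D'" for V
    using open_iff D'(1) that by blast
  show "smooth_on M V f \<longleftrightarrow> Cinf_on n (\<psi> ` V) (\<lambda>z. f (\<kappa> z))" if "V \<subseteq> D'" "openin (mtop M) V" for V f
    by (rule smooth_iff) (use D'(1) that in auto)
qed

lemma (in coords) coords_compose:
  assumes S: "S \<subseteq> \<psi> ` D" "openin (Euclidean_space n) S" and T: "openin (Euclidean_space n) (F ` S)"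
    and GF: "\<And>z. z \<in> S \<Longrightarrow> G (F z) = z"
    and F: "\<And>i. i < n \<Longrightarrow> Cinf_on n S (\<lambda>z. F z i)" and G: "\<And>i. i < n \<Longrightarrow> Cinf_on n (F ` S) (\<lambda>w. G w i)"
  shows "coords M (\<kappa> ` S) (\<lambda>y. F (\<psi> y)) (\<lambda>w. \<kappa> (G w))"
proof (unfold_locales)
  show "openin (mtop M) (\<kappa> ` S)" by (rule kappa_open[OF S])
  have pS: "\<psi> y \<in> S" "y \<in> D" if "y \<in> \<kappa> ` S" for y
    using that kappa_image[OF S(1)] by blast+
  show "\<kappa> (G (F (\<psi> y))) = y" if "y \<in> \<kappa> ` S" for y
    using GF[OF pS(1)[OF that]] inv[OF pS(2)[OF that]] by simp
  have FE: "F z \<in> euclid n" if "z \<in> S" for z using openin_E_subset[OF T] that by blast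
  have SE: "z \<in> euclid n" if "z \<in> S" for z using openin_E_subset[OF S(2)] that by blast
  fix V assume V: "V \<subseteq> \<kappa> ` S"
  have VD: "V \<subseteq> D" using V pS(2) by blast
  have A: "\<psi> ` V \<subseteq> S" using V pS(1) by blast
  have FA: "(\<lambda>y. F (\<psi> y)) ` V = F ` \<psi> ` V" by auto
  have iff: "openin (Euclidean_space n) (\<psi> ` V) \<longleftrightarrow> openin (Euclidean_space n) (F ` \<psi> ` V)"
  proof
    assume o: "openin (Euclidean_space n) (\<psi> ` V)"
    have "F ` \<psi> ` V = {w \<in> F ` S. G w \<in> \<psi> ` V}" using A GF by force
    moreover have "openin (Euclidean_space n) {w \<in> F ` S. G w \<in> \<psi> ` V}"
      by (rule openin_E_preimage[OF T o G]) (use GF SE in auto)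
    ultimately show "openin (Euclidean_space n) (F ` \<psi> ` V)" by simp
  next
    assume o: "openin (Euclidean_space n) (F ` \<psi> ` V)"
    have "\<psi> ` V = {z \<in> S. F z \<in> F ` \<psi> ` V}"
    proof (intro equalityI subsetI)
      fix z assume "z \<in> {z \<in> S. F z \<in> F ` \<psi> ` V}"
      then obtain w where w: "z \<in> S" "w \<in> \<psi> ` V" "F z = F w" by blast
      then have "z = w" using GF[of z] GF[of w] A by auto
      then show "z \<in> \<psi> ` V" using w by simp
    qed (use A in auto)
    moreover have "openin (Euclidean_space n) {z \<in> S. F z \<in> F ` \<psi> ` V}"
      by (rule openin_E_preimage[OF S(2) o F]) (use FE in auto)
    ultimately show "openin (Euclidean_space n) (\<psi> ` V)" by simp
  qed
  then show "openin (mtop M) V \<longleftrightarrow> openin (Euclidean_space n) ((\<lambda>y. F (\<psi> y)) ` V)"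
    unfolding FA using open_iff[OF VD] by simp
  fix f assume o: "openin (mtop M) V"
  have o1: "openin (Euclidean_space n) (\<psi> ` V)" by (rule img_open[OF VD o])
  have o2: "openin (Euclidean_space n) (F ` \<psi> ` V)" using iff o1 by simp
  show "smooth_on M V f \<longleftrightarrow> Cinf_on n ((\<lambda>y. F (\<psi> y)) ` V) (\<lambda>z. f (\<kappa> (G z)))"
    unfolding FA
  proof
    assume "smooth_on M V f"
    then have f: "Cinf_on n (\<psi> ` V) (\<lambda>z. f (\<kappa> z))" using smooth_iff[OF VD o] by simp
    show "Cinf_on n (F ` \<psi> ` V) (\<lambda>z. f (\<kappa> (G z)))"
    proof (rule Cinf_compose[OF o2 o1 _ _ f])
      show "G z \<in> \<psi> ` V" if "z \<in> F ` \<psi> ` V" for z using that GF A by auto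
      show "Cinf_on n (F ` \<psi> ` V) (\<lambda>z. G z j)" if "j < n" for j
        by (rule Cinf_on_subset[OF G[OF that]]) (use A in blast)
    qed
  next
    assume f: "Cinf_on n (F ` \<psi> ` V) (\<lambda>z. f (\<kappa> (G z)))"
    have "Cinf_on n (\<psi> ` V) (\<lambda>z. (\<lambda>w. f (\<kappa> (G w))) (F z))"
    proof (rule Cinf_compose[OF o1 o2 _ _ f])
      show "Cinf_on n (\<psi> ` V) (\<lambda>z. F z j)" if "j < n" for j by (rule Cinf_on_subset[OF F[OF that] A])
    qed simp
    moreover have "f (\<kappa> (G (F z))) = f (\<kappa> z)" if "z \<in> \<psi> ` V" for z
      by (simp only: GF[OF subsetD[OF A that]])
    ultimately have "Cinf_on n (\<psi> ` V) (\<lambda>z. f (\<kappa> z))"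
      using Cinf_on_cong[OF o1, of "\<lambda>z. f (\<kappa> (G (F z)))" "\<lambda>z. f (\<kappa> z)"] by simp
    then show "smooth_on M V f" using smooth_iff[OF VD o] by simp
  qed
qed

section \<open>Involutivity for local sections\<close>

lemma (in coords) kappa_continuous:
  "continuous_map (subtopology (Euclidean_space n) (\<psi> ` D)) (mtop M) \<kappa>"
  unfolding continuous_map
proof (intro conjI allI impI)
  have ts: "topspace (subtopology (Euclidean_space n) (\<psi> ` D)) = \<psi> ` D"
    using psi_euclid by (auto simp: Euclidean_space_eq)
  show "\<kappa> ` topspace (subtopology (Euclidean_space n) (\<psi> ` D)) \<subseteq> topspace (mtop M)"
    unfolding ts using inv D_top by auto
  fix U assume U: "openin (mtop M) U"
  have "{z \<in> \<psi> ` D. \<kappa> z \<in> U} = \<psi> ` (U \<inter> D)" using inv by auto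
  moreover have "openin (Euclidean_space n) (\<psi> ` (U \<inter> D))" by (rule img_open) (use U D in auto)
  ultimately show "openin (subtopology (Euclidean_space n) (\<psi> ` D)) {z \<in> topspace (subtopology (Euclidean_space n) (\<psi> ` D)). \<kappa> z \<in> U}"
    unfolding ts using openin_subtopology[of "Euclidean_space n" "\<psi> ` D"] by (metis (no_types, lifting) Int_absorb2 mem_Collect_eq subsetI)
qed

text \<open>The support is compact, hence closed in \<open>M\<close>. Here the Hausdorff property of
  \<open>M\<close> enters: it makes the extension by \<open>0\<close> smooth on all of \<open>M\<close>.\<close>

lemma (in coords) bump:
  assumes x: "x \<in> V" and V: "V \<subseteq> D" "openin (mtop M) V"
  obtains b V' C where "smooth_on M (topspace (mtop M)) b" "openin (mtop M) V'" "x \<in> V'" "V' \<subseteq> V"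
    "\<forall>y\<in>V'. b y = 1" "closedin (mtop M) C" "C \<subseteq> V" "\<forall>y\<in>topspace (mtop M) - C. b y = 0"
proof -
  have xD: "x \<in> D" using x V by blast
  have pV: "\<psi> x \<in> \<psi> ` V" using x by simp
  have oV: "openin (Euclidean_space n) (\<psi> ` V)" by (rule img_open[OF V])
  obtain r where r: "r > 0" "cube n (\<psi> x) r \<subseteq> \<psi> ` V" by (rule openin_E_cube[OF oV pV])
  obtain b0 s where b0: "Cinf_on n (euclid n) b0" and s: "0 < s" "s < r"
    and b1: "\<And>z. z \<in> cube n (\<psi> x) s \<Longrightarrow> b0 z = 1"
    and b2: "\<And>z. z \<in> euclid n \<Longrightarrow> (\<exists>i<n. \<bar>z i - \<psi> x i\<bar> > r / 2) \<Longrightarrow> b0 z = 0"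
    using bump_exists[OF psi_euclid[OF xD] r(1)] by metis
  define K where "K = {z. \<forall>i. z i \<in> (if i < n then {\<psi> x i - r / 2..\<psi> x i + r / 2} else {0})}"
  have Kc: "compact K" unfolding K_def by (rule compact_fun_box) auto
  have Kmem: "z \<in> K \<longleftrightarrow> z \<in> euclid n \<and> (\<forall>i<n. \<bar>z i - \<psi> x i\<bar> \<le> r / 2)" for z
  proof -
    have "z i \<in> (if i < n then {\<psi> x i - r / 2..\<psi> x i + r / 2} else {0}) \<longleftrightarrow>
       (i \<ge> n \<longrightarrow> z i = 0) \<and> (i < n \<longrightarrow> \<bar>z i - \<psi> x i\<bar> \<le> r / 2)" for i
    proof -
      have "z i \<in> {\<psi> x i - r / 2..\<psi> x i + r / 2} \<longleftrightarrow> \<bar>z i - \<psi> x i\<bar> \<le> r / 2"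
        unfolding atLeastAtMost_iff abs_diff_le_iff ..
      then show ?thesis by (cases "i < n") simp_all
    qed
    then show ?thesis unfolding K_def euclid_def mem_Collect_eq by auto
  qed
  have KV: "K \<subseteq> \<psi> ` V"
  proof
    fix z assume "z \<in> K"
    then have "z \<in> cube n (\<psi> x) r" using r(1) unfolding Kmem cube_def by auto
    then show "z \<in> \<psi> ` V" using r(2) by blast
  qed
  have KD: "K \<subseteq> \<psi> ` D" using KV V by blast

  have "compactin (subtopology (Euclidean_space n) (\<psi> ` D)) K"
    using Kc KD Kmem by (auto simp: compactin_subtopology Euclidean_space_eq)
  from image_compactin[OF this kappa_continuous] have "compactin (mtop M) (\<kappa> ` K)" .
  moreover have "Hausdorff_space (mtop M)" using M unfolding smooth_manifold_def by (elim conjE)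
  ultimately have Ccl: "closedin (mtop M) (\<kappa> ` K)" by (rule compactin_imp_closedin[rotated])
  define b where "b y = (if y \<in> D then b0 (\<psi> y) else 0)" for y
  have zero: "b y = 0" if y: "y \<notin> \<kappa> ` K" for y
  proof (cases "y \<in> D")
    case True
    have "\<psi> y \<notin> K" using y inv[OF True] by (metis imageI)
    then obtain i where "i < n" "\<not> \<bar>\<psi> y i - \<psi> x i\<bar> \<le> r / 2" using Kmem psi_euclid[OF True] by blast
    then have "b0 (\<psi> y) = 0" by (intro b2 psi_euclid[OF True]) auto
    then show ?thesis by (simp add: b_def)
  qed (simp add: b_def)
  have sD: "smooth_on M D b"
  proof -
    have "Cinf_on n (\<psi> ` D) (\<lambda>z. b (\<kappa> z))"
      by (subst Cinf_on_cong[OF img_open[OF order_refl D], of _ b0])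
        (use inv psi_euclid in \<open>auto simp: b_def intro: Cinf_on_subset[OF b0]\<close>)
    then show ?thesis using smooth_iff[OF order_refl D] by simp
  qed
  have oC: "openin (mtop M) (topspace (mtop M) - \<kappa> ` K)" using Ccl by blast
  have sC: "smooth_on M (topspace (mtop M) - \<kappa> ` K) b"
    using smooth_on_cong[of "topspace (mtop M) - \<kappa> ` K" b "\<lambda>_. 0"] smooth_on_const[OF oC, of 0] zero by simp
  have kK: "\<kappa> ` K \<subseteq> V" using KV kappa_mem[OF V(1)] by blast
  have sM: "smooth_on M (topspace (mtop M)) b"
  proof (rule smooth_on_local[OF openin_topspace])
    fix y assume "y \<in> topspace (mtop M)"
    then have "y \<in> D \<or> y \<in> topspace (mtop M) - \<kappa> ` K" using kK V(1) by blast
    then show "\<exists>V'. y \<in> V' \<and> smooth_on M V' b" using sD sC by meson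
  qed
  have cs: "cube n (\<psi> x) s \<subseteq> \<psi> ` V" using cube_mono[of s r n "\<psi> x"] s r(2) by (meson less_imp_le subset_trans)
  then have csD: "cube n (\<psi> x) s \<subseteq> \<psi> ` D" using V by blast
  show thesis
  proof (rule that[OF sM kappa_open[OF csD openin_cube] _ _ _ Ccl kK])
    have "\<psi> x \<in> cube n (\<psi> x) s" by (rule cube_self[OF psi_euclid[OF xD] s(1)])
    then show "x \<in> \<kappa> ` cube n (\<psi> x) s" using inv[OF xD] by force
    show "\<kappa> ` cube n (\<psi> x) s \<subseteq> V" using cs kappa_mem[OF V(1)] by blast
    show "\<forall>y\<in>\<kappa> ` cube n (\<psi> x) s. b y = 1"
    proof
      fix y assume y: "y \<in> \<kappa> ` cube n (\<psi> x) s"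
      then have "y \<in> D" "\<psi> y \<in> cube n (\<psi> x) s" using kappa_image[OF csD] by blast+
      then show "b y = 1" using b1 by (simp add: b_def)
    qed
    show "\<forall>y\<in>topspace (mtop M) - \<kappa> ` K. b y = 0" using zero by blast
  qed
qed

context manifold begin

lemma vf_zero: "openin (mtop M) V \<Longrightarrow> vector_field M V (\<lambda>_ _. 0)"
  by (simp add: vector_field_def tangent_zero smooth_on_const smooth_on_open)

lemma of_zero: "openin (mtop M) V \<Longrightarrow> one_form M V (\<lambda>_ _. 0)"
  unfolding one_form_def using cotangent_zero smooth_on_const vf_open by blast

lemma double_section_subset:
  "double_section M V s \<Longrightarrow> openin (mtop M) V' \<Longrightarrow> V' \<subseteq> V \<Longrightarrow> double_section M V' s"
  unfolding double_section_def using vf_subset of_subset by blast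

lemma double_section_cong:
  assumes s: "double_section M V s" and eq: "\<And>y. y \<in> V \<Longrightarrow> s y = t y"
  shows "double_section M V t"
  unfolding double_section_def
proof
  show "vector_field M V (\<lambda>x. fst (t x))"
    by (rule vf_cong[OF conjunct1[OF s[unfolded double_section_def]]]) (simp add: eq)
  show "one_form M V (\<lambda>x. snd (t x))"
    by (rule of_cong[OF conjunct2[OF s[unfolded double_section_def]]]) (simp add: eq)
qed

lemma double_section_local:
  assumes V: "openin (mtop M) V" and l: "\<And>y. y \<in> V \<Longrightarrow> \<exists>V'. y \<in> V' \<and> double_section M V' s"
  shows "double_section M V s"
  unfolding double_section_def
proof
  show "vector_field M V (\<lambda>x. fst (s x))"
    by (rule vf_local[OF V]) (use l in \<open>unfold double_section_def, blast\<close>)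
  show "one_form M V (\<lambda>x. snd (s x))"
    by (rule of_local[OF V]) (use l in \<open>unfold double_section_def, blast\<close>)
qed

lemma double_section_sum:
  assumes V: "openin (mtop M) V" and s: "\<And>i. i \<in> A \<Longrightarrow> double_section M V (s i)"
    and c: "\<And>i. i \<in> A \<Longrightarrow> smooth_on M V (c i)"
  shows "double_section M V (\<lambda>y. (\<lambda>f. \<Sum>i\<in>A. c i y * fst (s i y) f, \<lambda>v. \<Sum>i\<in>A. c i y * snd (s i y) v))"
  unfolding double_section_def fst_conv snd_conv
proof
  show "vector_field M V (\<lambda>y f. \<Sum>i\<in>A. c i y * fst (s i y) f)"
    by (rule vf_scale_sum[OF V _ c]) (use s in \<open>auto simp: double_section_def\<close>)
  show "one_form M V (\<lambda>y v. \<Sum>i\<in>A. c i y * snd (s i y) v)"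
    by (rule of_scale_sum[OF V _ c]) (use s in \<open>auto simp: double_section_def\<close>)
qed

text \<open>Multiply by a bump function. The last claim records that all values are multiples of values of the given
  section, so the extension remains in any family of subspaces that contains the latter.\<close>

lemma section_extend:
  assumes s: "double_section M V s" and x: "x \<in> V"
  obtains s' V' where "double_section M (topspace (mtop M)) s'" "openin (mtop M) V'" "x \<in> V'" "V' \<subseteq> V"
    "\<forall>y\<in>V'. s' y = s y"
    "\<forall>y. (\<exists>c. y \<in> V \<and> s' y = (\<lambda>f. c * fst (s y) f, \<lambda>v. c * snd (s y) v)) \<or> s' y = (\<lambda>_. 0, \<lambda>_. 0)"
proof -
  have Vo: "openin (mtop M) V" using s vf_open unfolding double_section_def by blast
  have "x \<in> topspace (mtop M)" using Vo x openin_subset by blast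
  then obtain D \<psi> \<kappa> where c: "coords M D \<psi> \<kappa>" and xD: "x \<in> D" by (rule coords_at)
  interpret c: coords M D \<psi> \<kappa> by (rule c)
  have o: "openin (mtop M) (V \<inter> D)" using Vo c.D by blast
  have xVD: "x \<in> V \<inter> D" using x xD by blast
  obtain b V' C where b: "smooth_on M (topspace (mtop M)) b" and V': "openin (mtop M) V'" "x \<in> V'" "V' \<subseteq> V \<inter> D"
    and b1: "\<forall>y\<in>V'. b y = 1" and C: "closedin (mtop M) C" "C \<subseteq> V \<inter> D" and b0: "\<forall>y\<in>topspace (mtop M) - C. b y = 0"
    using c.bump[OF xVD _ o] by (metis Int_lower2)
  define s' where "s' y = (if y \<in> V \<inter> D then (\<lambda>f. b y * fst (s y) f, \<lambda>v. b y * snd (s y) v) else (\<lambda>_. 0, \<lambda>_. 0))" for y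
  have d1: "double_section M (V \<inter> D) s'"
  proof (rule double_section_cong)
    show "double_section M (V \<inter> D) (\<lambda>y. (\<lambda>f. \<Sum>i\<in>{()}. b y * fst (s y) f, \<lambda>v. \<Sum>i\<in>{()}. b y * snd (s y) v))"
      by (rule double_section_sum[OF o]) (use double_section_subset[OF s o] smooth_on_subset[OF b o] openin_subset[OF o] in auto)
  qed (simp add: s'_def)
  have oC: "openin (mtop M) (topspace (mtop M) - C)" using C(1) by blast
  have d2: "double_section M (topspace (mtop M) - C) s'"
  proof (rule double_section_cong)
    show "double_section M (topspace (mtop M) - C) (\<lambda>_. (\<lambda>_. 0, \<lambda>_. 0))"
      using vf_zero[OF oC] of_zero[OF oC] by (simp add: double_section_def)
  qed (use b0 in \<open>simp add: s'_def\<close>)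
  have "double_section M (topspace (mtop M)) s'"
  proof (rule double_section_local[OF openin_topspace])
    fix y assume "y \<in> topspace (mtop M)"
    then have "y \<in> V \<inter> D \<or> y \<in> topspace (mtop M) - C" using C(2) by blast
    then show "\<exists>V'. y \<in> V' \<and> double_section M V' s'" using d1 d2 by meson
  qed
  then show thesis
  proof (rule that[OF _ V'(1,2)])
    show "V' \<subseteq> V" using V'(3) by blast
    show "\<forall>y\<in>V'. s' y = s y" using b1 V'(3) by (auto simp: s'_def)
    show "\<forall>y. (\<exists>c. y \<in> V \<and> s' y = (\<lambda>f. c * fst (s y) f, \<lambda>v. c * snd (s y) v)) \<or> s' y = (\<lambda>_. 0, \<lambda>_. 0)"
      by (auto simp: s'_def)
  qed
qed

text \<open>The bracket differentiates its arguments, and derivations are local.\<close>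

lemma dorfman_cong:
  assumes V: "openin (mtop M) V" and x: "x \<in> V"
    and s: "double_section M V s" and t: "double_section M V t"
    and s': "double_section M V s'" and t': "double_section M V t'"
    and eq: "\<And>y. y \<in> V \<Longrightarrow> s y = s' y" "\<And>y. y \<in> V \<Longrightarrow> t y = t' y"
  shows "dorfman M s t x = dorfman M s' t' x"
proof (rule prod_eqI)
  have "x \<in> topspace (mtop M)" using V x openin_subset by blast
  then obtain D \<psi> \<kappa> where c: "coords M D \<psi> \<kappa>" and xD: "x \<in> D" by (rule coords_at)
  interpret c: coords M D \<psi> \<kappa> by (rule c)
  have ts: "fst (s x) \<in> tangent_space M x" "fst (t x) \<in> tangent_space M x"
    using s t x vf_tangent unfolding double_section_def by blast+
  show "fst (dorfman M s t x) = fst (dorfman M s' t' x)"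
  proof
    fix f
    have "fst (s x) (\<lambda>y. fst (t y) f) = fst (s x) (\<lambda>y. fst (t' y) f)"
      by (rule tan_local[OF ts(1) V x]) (simp add: eq)
    moreover have "fst (t x) (\<lambda>y. fst (s y) f) = fst (t x) (\<lambda>y. fst (s' y) f)"
      by (rule tan_local[OF ts(2) V x]) (simp add: eq)
    ultimately show "fst (dorfman M s t x) f = fst (dorfman M s' t' x) f"
      by (simp add: c.dorfman_fst lie_bracket_def eq[OF x])
  qed
  show "snd (dorfman M s t x) = snd (dorfman M s' t' x)"
  proof
    fix w
    show "snd (dorfman M s t x) w = snd (dorfman M s' t' x) w"
    proof (cases "w \<in> tangent_space M x")
      case True
      have "fst (s x) (\<lambda>y. snd (t y) (c.coord_field a y)) = fst (s x) (\<lambda>y. snd (t' y) (c.coord_field a y))" for a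
        by (rule tan_local[OF ts(1) V x]) (simp add: eq)
      moreover have "fst (t x) (\<lambda>y. snd (s y) (c.coord_field a y)) = fst (t x) (\<lambda>y. snd (s' y) (c.coord_field a y))" for a
        by (rule tan_local[OF ts(2) V x]) (simp add: eq)
      moreover have "w (\<lambda>y. fst (s y) (\<lambda>y. \<psi> y a)) = w (\<lambda>y. fst (s' y) (\<lambda>y. \<psi> y a))" for a
        by (rule tan_local[OF True V x]) (simp add: eq)
      moreover have "w (\<lambda>y. snd (s y) (c.coord_field a y)) = w (\<lambda>y. snd (s' y) (c.coord_field a y))" for a
        by (rule tan_local[OF True V x]) (simp add: eq)
      ultimately show ?thesis
        unfolding c.dorfman_snd[OF s t x xD True] c.dorfman_snd[OF s' t' x xD True] eq[OF x] by simp
    qed (simp add: c.dorfman_snd_outside)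
  qed
qed

text \<open>A family of sets that are their own orthogonal spaces has linear fibres, because pairing with a fixed
  element is linear.\<close>

lemma orthogonal_lin:
  assumes S: "S = orthogonal_space M x S" and a: "(u, \<xi>) \<in> S" and b: "(v, \<zeta>) \<in> S"
  shows "(\<lambda>f. s * u f + t * v f, \<lambda>w. s * \<xi> w + t * \<zeta> w) \<in> S"
proof -
  have mem: "e \<in> double_space M x \<and> (\<forall>e'\<in>S. pairing e e' = 0)" if "e \<in> S" for e
    using S that unfolding orthogonal_space_def by blast
  have T: "u \<in> tangent_space M x" "v \<in> tangent_space M x" "\<xi> \<in> cotangent_space M x" "\<zeta> \<in> cotangent_space M x"
    using mem[OF a] mem[OF b] by (auto simp: double_space_def)
  have "pairing (\<lambda>f. s * u f + t * v f, \<lambda>w. s * \<xi> w + t * \<zeta> w) e' = 0" if e': "e' \<in> S" for e'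
  proof -
    obtain w \<eta> where e: "e' = (w, \<eta>)" by (cases e')
    have "\<eta> \<in> cotangent_space M x" using mem[OF e'] e by (simp add: double_space_def)
    from cot_lin[OF this T(1,2)]
    have "pairing (\<lambda>f. s * u f + t * v f, \<lambda>w. s * \<xi> w + t * \<zeta> w) e' = s * pairing (u, \<xi>) e' + t * pairing (v, \<zeta>) e'"
      by (simp add: pairing_def e algebra_simps)
    then show ?thesis using mem[OF a] mem[OF b] e' by simp
  qed
  then have "(\<lambda>f. s * u f + t * v f, \<lambda>w. s * \<xi> w + t * \<zeta> w) \<in> orthogonal_space M x S"
    using tangent_lin[OF T(1,2)] cotangent_lin[OF T(3,4)] by (simp add: orthogonal_space_def double_space_def)
  then show ?thesis using S by simp
qed

lemma orthogonal_zero: "S = orthogonal_space M x S \<Longrightarrow> (\<lambda>_. 0, \<lambda>_. 0) \<in> S"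
proof -
  assume S: "S = orthogonal_space M x S"
  have "\<eta> (\<lambda>_. 0) = 0" if "(w, \<eta>) \<in> S" for w \<eta>
  proof -
    have "(w, \<eta>) \<in> orthogonal_space M x S" using S that by simp
    then have "\<eta> \<in> cotangent_space M x" by (simp add: orthogonal_space_def double_space_def)
    then show ?thesis by (rule cot_zero)
  qed
  then have "(\<lambda>_. 0, \<lambda>_. 0) \<in> orthogonal_space M x S"
    by (auto simp: orthogonal_space_def double_space_def pairing_def tangent_zero cotangent_zero)
  then show ?thesis using S by simp
qed

text \<open>Extend both sections by bump functions to global sections of \<open>L\<close> that agree with them near
  \<open>x\<close>.\<close>

lemma dirac_involutive_local:
  assumes L: "dirac_structure M L" and s: "double_section M V s" and t: "double_section M V t"
    and sL: "\<And>y. y \<in> V \<Longrightarrow> s y \<in> L y" and tL: "\<And>y. y \<in> V \<Longrightarrow> t y \<in> L y" and x: "x \<in> V"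
  shows "dorfman M s t x \<in> L x"
proof -
  have orth: "L y = orthogonal_space M y (L y)" if "y \<in> topspace (mtop M)" for y
    using L that unfolding dirac_structure_def by blast
  have scale: "(\<lambda>f. c * fst e f, \<lambda>v. c * snd e v) \<in> L y" if "y \<in> topspace (mtop M)" "e \<in> L y" for c e y
    using orthogonal_lin[OF orth[OF that(1)], of "fst e" "snd e" "fst e" "snd e" c 0] that(2) by simp
  have glob: "\<exists>s' V'. s' \<in> sections M L \<and> openin (mtop M) V' \<and> x \<in> V' \<and> V' \<subseteq> V \<and> (\<forall>y\<in>V'. s' y = s y)"
    if s: "double_section M V s" and sL: "\<And>y. y \<in> V \<Longrightarrow> s y \<in> L y" for s
  proof -
    obtain s' V' where *: "double_section M (topspace (mtop M)) s'" "openin (mtop M) V'" "x \<in> V'" "V' \<subseteq> V"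
      "\<forall>y\<in>V'. s' y = s y"
      and sc: "\<forall>y. (\<exists>c. y \<in> V \<and> s' y = (\<lambda>f. c * fst (s y) f, \<lambda>v. c * snd (s y) v)) \<or> s' y = (\<lambda>_. 0, \<lambda>_. 0)"
      by (rule section_extend[OF s x])
    have "s' y \<in> L y" if y: "y \<in> topspace (mtop M)" for y
    proof (cases "s' y = (\<lambda>_. 0, \<lambda>_. 0)")
      case True then show ?thesis using orthogonal_zero[OF orth[OF y]] by simp
    next
      case False
      then obtain c where "y \<in> V" "s' y = (\<lambda>f. c * fst (s y) f, \<lambda>v. c * snd (s y) v)" using sc by blast
      then show ?thesis using scale[OF y sL] by simp
    qed
    then have "s' \<in> sections M L" using * by (simp add: sections_def)
    then show ?thesis using * by (intro exI conjI)
  qed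
  obtain s' V1 where s': "s' \<in> sections M L" "openin (mtop M) V1" "x \<in> V1" "V1 \<subseteq> V" "\<forall>y\<in>V1. s' y = s y"
    using glob[of s] s sL by blast
  obtain t' V2 where t': "t' \<in> sections M L" "openin (mtop M) V2" "x \<in> V2" "V2 \<subseteq> V" "\<forall>y\<in>V2. t' y = t y"
    using glob[of t] t tL by blast
  let ?W = "V1 \<inter> V2"
  have o: "openin (mtop M) ?W" using s' t' by blast
  have xt: "x \<in> topspace (mtop M)" using o s'(3) t'(3) openin_subset by blast
  have "dorfman M s t x = dorfman M s' t' x"
  proof (rule dorfman_cong[OF o])
    show "double_section M ?W s" "double_section M ?W t"
      using double_section_subset[OF s o] double_section_subset[OF t o] s' by auto
    show "double_section M ?W s'" "double_section M ?W t'"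
      using s'(1) t'(1) double_section_subset[OF _ o] openin_subset[OF o] by (auto simp: sections_def)
  qed (use s' t' in auto)
  moreover have "dorfman M s' t' \<in> sections M L"
    using L s'(1) t'(1) unfolding dirac_structure_def by blast
  ultimately show ?thesis using xt by (simp add: sections_def)
qed

section \<open>Smooth inverses of matrix functions\<close>

lemma smooth_nonzero:
  assumes f: "smooth_on M V f" and x: "x \<in> V" "f x \<noteq> 0"
  obtains V' where "openin (mtop M) V'" "x \<in> V'" "V' \<subseteq> V" "\<forall>y\<in>V'. f y \<noteq> 0"
proof -
  have Vo: "openin (mtop M) V" by (rule smooth_on_open[OF f])
  have "x \<in> topspace (mtop M)" using Vo x openin_subset by blast
  then obtain D \<psi> \<kappa> where c: "coords M D \<psi> \<kappa>" and xD: "x \<in> D" by (rule coords_at)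
  interpret c: coords M D \<psi> \<kappa> by (rule c)
  have o: "openin (mtop M) (V \<inter> D)" using Vo c.D by blast
  have "Cinf_on c.n (\<psi> ` (V \<inter> D)) (\<lambda>z. f (\<kappa> z))"
    using c.smooth_iff[OF _ o] smooth_on_subset[OF f o] by simp
  then have cont: "continuous_on (\<psi> ` (V \<inter> D)) (\<lambda>z. f (\<kappa> z))"
    by (rule Ck_continuous[OF c.img_open[OF _ o] Cinf_Ck, rotated]) simp
  let ?W = "\<psi> ` (V \<inter> D) \<inter> (\<lambda>z. f (\<kappa> z)) -` (- {0})"
  have "openin (top_of_set (\<psi> ` (V \<inter> D))) ?W"
    by (rule continuous_openin_preimage_gen[OF cont]) auto
  then have W: "openin (Euclidean_space c.n) ?W"
    using c.img_open[OF _ o] unfolding Euclidean_space_eq by (metis Int_lower2 openin_trans)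
  have WD: "?W \<subseteq> \<psi> ` D" by blast
  show thesis
  proof (rule that[OF c.kappa_open[OF WD W]])
    show "x \<in> \<kappa> ` ?W" using x xD c.inv[OF xD] by (intro image_eqI[of _ _ "\<psi> x"]) auto
    show "\<kappa> ` ?W \<subseteq> V" using c.inv by auto
    show "\<forall>y\<in>\<kappa> ` ?W. f y \<noteq> 0" by auto
  qed
qed

text \<open>Let the rows of the \<open>k \<times> r\<close> matrix \<open>P\<close> be independent at
  \<open>x\<close>. Induction on the number of rows, by Gaussian elimination: subtract from the new row
  the combination \<open>q\<close> of the old ones that makes it vanish on the columns of the old right
  inverse. The remainder \<open>w\<close> is nonzero at \<open>x\<close>, so it has an entry without zeros
  near \<open>x\<close> to divide by.\<close>

lemma smooth_right_inverse:
  fixes P :: "nat \<Rightarrow> nat \<Rightarrow> 'a \<Rightarrow> real"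
  assumes x: "x \<in> V" and V: "openin (mtop M) V"
  shows "(\<And>b i. b < k \<Longrightarrow> i < r \<Longrightarrow> smooth_on M V (P b i)) \<Longrightarrow>
    (\<And>d. (\<And>i. i < r \<Longrightarrow> (\<Sum>b<k. d b * P b i x) = 0) \<Longrightarrow> (\<And>b. b < k \<Longrightarrow> d b = 0)) \<Longrightarrow>
    \<exists>V' R. openin (mtop M) V' \<and> x \<in> V' \<and> V' \<subseteq> V \<and> (\<forall>i<r. \<forall>b<k. smooth_on M V' (R i b)) \<and>
      (\<forall>y\<in>V'. \<forall>a<k. \<forall>b<k. (\<Sum>i<r. P a i y * R i b y) = (if a = b then 1 else 0))"
proof (induction k)
  case 0
  then show ?case using x V by (intro exI[of _ V]) auto
next
  case (Suc k)
  have "\<exists>V' R. openin (mtop M) V' \<and> x \<in> V' \<and> V' \<subseteq> V \<and> (\<forall>i<r. \<forall>b<k. smooth_on M V' (R i b)) \<and>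
      (\<forall>y\<in>V'. \<forall>a<k. \<forall>b<k. (\<Sum>i<r. P a i y * R i b y) = (if a = b then 1 else 0))"
  proof (rule Suc.IH)
    show "smooth_on M V (P b i)" if "b < k" "i < r" for b i using Suc.prems(1) that by simp
    fix d b assume d: "\<And>i. i < r \<Longrightarrow> (\<Sum>b<k. d b * P b i x) = 0" and b: "b < k"
    have "(\<lambda>b. if b < k then d b else 0) b = 0"
      by (rule Suc.prems(2)[of "\<lambda>b. if b < k then d b else 0"]) (use d b in auto)
    then show "d b = 0" using b by simp
  qed
  then obtain V' R where V': "openin (mtop M) V'" "x \<in> V'" "V' \<subseteq> V"
    and R': "\<forall>i<r. \<forall>b<k. smooth_on M V' (R i b)"
    and PR': "\<forall>y\<in>V'. \<forall>a<k. \<forall>b<k. (\<Sum>i<r. P a i y * R i b y) = (if a = b then 1 else 0)"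
    by (elim exE conjE)
  have R: "smooth_on M V' (R i b)" if "i < r" "b < k" for i b using R' that by simp
  have PR: "(\<Sum>i<r. P a i y * R i b y) = (if a = b then 1 else 0)" if "y \<in> V'" "a < k" "b < k" for y a b
    using PR' that by simp
  \<comment> \<open>the old right inverse \<open>R\<close> applied to the new row\<close>
  define q where "q a y = (\<Sum>j<r. P k j y * R j a y)" for a y
  define w where "w i y = P k i y - (\<Sum>a<k. q a y * P a i y)" for i y
  have P': "smooth_on M V' (P b i)" if "b < Suc k" "i < r" for b i
    by (rule smooth_on_subset[OF Suc.prems(1)[OF that] V'(1,3)])
  have sq: "smooth_on M V' (q a)" if "a < k" for a
    unfolding q_def[abs_def] using that
    by (intro smooth_on_sum[OF V'(1)] smooth_on_mult[OF V'(1)] P' R) auto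
  have sw: "smooth_on M V' (w i)" if "i < r" for i
    unfolding w_def[abs_def] using that
    by (intro smooth_on_diff smooth_on_sum[OF V'(1)] smooth_on_mult[OF V'(1)] P' sq) auto
  have "\<exists>i<r. w i x \<noteq> 0"
  proof (rule ccontr)
    assume "\<not> (\<exists>i<r. w i x \<noteq> 0)"
    then have w0: "w i x = 0" if "i < r" for i using that by blast
    have "(\<lambda>b. if b = k then 1 else - q b x) k = 0"
    proof (rule Suc.prems(2)[of "\<lambda>b. if b = k then 1 else - q b x" k])
      fix i assume i: "i < r"
      have "(\<Sum>b<Suc k. (if b = k then 1 else - q b x) * P b i x) = w i x"
        by (simp add: w_def sum_negf)
      then show "(\<Sum>b<Suc k. (if b = k then 1 else - q b x) * P b i x) = 0" using w0[OF i] by simp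
    qed simp
    then show False by simp
  qed
  then obtain i0 where i0: "i0 < r" "w i0 x \<noteq> 0" by blast
  obtain V2 where V2: "openin (mtop M) V2" "x \<in> V2" "V2 \<subseteq> V'" and wn: "\<forall>y\<in>V2. w i0 y \<noteq> 0"
    by (rule smooth_nonzero[OF sw[OF i0(1)] V'(2) i0(2)])
  \<comment> \<open>the \<open>i0\<close>-th unit vector, projected to the kernel of the old rows and scaled\<close>
  define Rk where "Rk i y = ((if i = i0 then 1 else 0) - (\<Sum>a<k. R i a y * P a i0 y)) * inverse (w i0 y)" for i y
  define R' where "R' i b y = (if b < k then R i b y - Rk i y * q b y else Rk i y)" for i b y
  have R2: "smooth_on M V2 (R i b)" if "i < r" "b < k" for i b by (rule smooth_on_subset[OF R[OF that] V2(1,3)])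
  have P2: "smooth_on M V2 (P b i)" if "b < Suc k" "i < r" for b i by (rule smooth_on_subset[OF P'[OF that] V2(1,3)])
  have sRk: "smooth_on M V2 (Rk i)" if "i < r" for i
    unfolding Rk_def[abs_def] using that i0(1) wn
    by (intro smooth_on_diff smooth_on_sum[OF V2(1)] smooth_on_mult[OF V2(1)] smooth_on_inverse[OF V2(1)]
        smooth_on_const[OF V2(1)] smooth_on_subset[OF sw V2(1,3)] R2 P2) auto
  have sR': "smooth_on M V2 (R' i b)" if "i < r" "b < Suc k" for i b
  proof (cases "b < k")
    case True
    have "smooth_on M V2 (\<lambda>y. R i b y - Rk i y * q b y)"
      by (intro smooth_on_diff smooth_on_mult[OF V2(1)] sRk R2 that True smooth_on_subset[OF sq V2(1,3)])
    then show ?thesis using True by (simp add: R'_def[abs_def])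
  qed (use sRk that in \<open>simp add: R'_def[abs_def]\<close>)
  have sumRk: "(\<Sum>i<r. P a i y * Rk i y) = (if a = k then 1 else 0)" if y: "y \<in> V2" and a: "a < Suc k" for a y
  proof -
    have yV': "y \<in> V'" using y V2 by blast
    have "(\<Sum>i<r. P a i y * ((if i = i0 then 1 else 0) - (\<Sum>c<k. R i c y * P c i0 y))) =
        P a i0 y - (\<Sum>c<k. (\<Sum>i<r. P a i y * R i c y) * P c i0 y)"
    proof -
      have "(\<Sum>i<r. P a i y * (\<Sum>c<k. R i c y * P c i0 y)) = (\<Sum>c<k. (\<Sum>i<r. P a i y * R i c y) * P c i0 y)"
        unfolding sum_distrib_left sum_distrib_right by (subst sum.swap) (simp add: mult.assoc)
      moreover have "(\<Sum>i<r. P a i y * (if i = i0 then 1 else 0)) = P a i0 y" using i0(1) by (simp add: if_distrib cong: if_cong)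
      ultimately show ?thesis by (simp add: right_diff_distrib sum_subtractf)
    qed
    also have "\<dots> = (if a = k then w i0 y else 0)"
    proof (cases "a = k")
      case True then show ?thesis by (simp add: w_def q_def)
    next
      case False
      then have "a < k" using a by simp
      then have "(\<Sum>c<k. (\<Sum>i<r. P a i y * R i c y) * P c i0 y) = (\<Sum>c<k. if a = c then P c i0 y else 0)"
        by (intro sum.cong) (auto simp: PR[OF yV'])
      then show ?thesis using False \<open>a < k\<close> by simp
    qed
    finally have "(\<Sum>i<r. P a i y * ((if i = i0 then 1 else 0) - (\<Sum>c<k. R i c y * P c i0 y))) * inverse (w i0 y)
        = (if a = k then 1 else 0)" using wn y by simp
    then show ?thesis unfolding Rk_def sum_distrib_right by (simp only: mult.assoc)
  qed
  have fin: "(\<Sum>i<r. P a i y * R' i b y) = (if a = b then 1 else 0)"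
    if y: "y \<in> V2" and a: "a < Suc k" and b: "b < Suc k" for y a b
  proof (cases "b < k")
    case True
    have yV': "y \<in> V'" using y V2 by blast
    have "(\<Sum>i<r. P a i y * R' i b y) = (\<Sum>i<r. P a i y * R i b y) - (\<Sum>i<r. P a i y * Rk i y) * q b y"
      using True by (simp add: R'_def right_diff_distrib sum_subtractf sum_distrib_right mult.assoc)
    also have "\<dots> = (if a = b then 1 else 0)"
    proof (cases "a = k")
      case True2: True
      then show ?thesis using True sumRk[OF y a] by (simp add: q_def)
    next
      case False
      then show ?thesis using True sumRk[OF y a] a PR[OF yV', of a b] by simp
    qed
    finally show ?thesis .
  next
    case False
    then show ?thesis using b sumRk[OF y a] by (auto simp: R'_def)
  qed
  show ?case
    by (rule exI[of _ V2], rule exI[of _ R']) (use V2 V' sR' fin in auto)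
qed

end

section \<open>Constant two-forms and gauge transformations\<close>

context coords begin

text \<open>Contraction of \<open>u\<close> with the two-form whose coefficients in these coordinates are the
  constants \<open>B\<close>.\<close>

definition const_form :: "(nat \<Rightarrow> nat \<Rightarrow> real) \<Rightarrow> 'a \<Rightarrow> 'a tvec \<Rightarrow> 'a covec" where
  "const_form B x u = cov (\<lambda>b. \<Sum>a<n. B a b * u (\<lambda>y. \<psi> y a)) x"

lemma const_form_cot: "const_form B x u \<in> cotangent_space M x"
  unfolding const_form_def by (rule cov_cotangent)

lemma const_form_apply: "v \<in> tangent_space M x \<Longrightarrow>
    const_form B x u v = (\<Sum>b<n. \<Sum>a<n. B a b * u (\<lambda>y. \<psi> y a) * v (\<lambda>y. \<psi> y b))"
  by (simp add: const_form_def cov_apply sum_distrib_right)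

lemma const_form_skew:
  assumes B: "\<forall>a b. B a b = - B b a" and u: "u \<in> tangent_space M x" and v: "v \<in> tangent_space M x"
  shows "const_form B x u v = - const_form B x v u"
proof -
  have "const_form B x v u = (\<Sum>b<n. \<Sum>a<n. B b a * v (\<lambda>y. \<psi> y b) * u (\<lambda>y. \<psi> y a))"
    unfolding const_form_apply[OF u] by (rule sum.swap)
  also have "\<dots> = (\<Sum>b<n. \<Sum>a<n. - (B a b * u (\<lambda>y. \<psi> y a) * v (\<lambda>y. \<psi> y b)))"
  proof (intro sum.cong refl)
    fix b a
    have "B b a = - B a b" using B by blast
    then show "B b a * v (\<lambda>y. \<psi> y b) * u (\<lambda>y. \<psi> y a) = - (B a b * u (\<lambda>y. \<psi> y a) * v (\<lambda>y. \<psi> y b))"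
      by (simp add: mult_ac)
  qed
  finally show ?thesis by (simp add: const_form_apply[OF v] sum_negf)
qed

lemma const_form_outside: "v \<notin> tangent_space M x \<Longrightarrow> const_form B x u v = 0"
  by (simp add: const_form_def cov_def)

lemma const_form_lin: "const_form B x (\<lambda>f. s * u f + t * v f) = (\<lambda>w. s * const_form B x u w + t * const_form B x v w)"
proof
  fix w show "const_form B x (\<lambda>f. s * u f + t * v f) w = s * const_form B x u w + t * const_form B x v w"
  proof (cases "w \<in> tangent_space M x")
    case True
    show ?thesis unfolding const_form_apply[OF True]
      by (simp add: sum_distrib_left sum.distrib[symmetric] algebra_simps)
  qed (simp add: const_form_outside)
qed

lemma const_form_zero: "const_form B x (\<lambda>_. 0) = (\<lambda>_. 0)"
  by (auto simp: const_form_def cov_def)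

text \<open>A potential of the two-form with constant coefficients \<open>B\<close>: its contraction with the Euler
  vector field, halved.\<close>

definition const_pot :: "(nat \<Rightarrow> nat \<Rightarrow> real) \<Rightarrow> 'a \<Rightarrow> 'a covec" where
  "const_pot B y = cov (\<lambda>a. \<Sum>c<n. B c a / 2 * \<psi> y c) y"

lemma const_pot_one_form: "one_form M D (const_pot B)"
  unfolding const_pot_def[abs_def]
  by (rule cov_of[OF order_refl D])
    (intro smooth_on_sum[OF D] smooth_on_mult[OF D] smooth_on_const[OF D] smooth_psi[OF order_refl D])

lemma ext_deriv_const_pot:
  assumes B: "\<forall>a b. B a b = - B b a" and x: "x \<in> D" and v: "v \<in> tangent_space M x" and w: "w \<in> tangent_space M x"
  shows "ext_deriv M (const_pot B) x v w = const_form B x v w"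
proof -
  have xt: "x \<in> topspace (mtop M)" by (rule D_top[OF x])
  have d: "u (\<lambda>y. const_pot B y (coord_field a y)) = (\<Sum>c<n. B c a / 2 * u (\<lambda>y. \<psi> y c))"
    if u: "u \<in> tangent_space M x" and a: "a < n" for u a
  proof -
    have "u (\<lambda>y. const_pot B y (coord_field a y)) = u (\<lambda>y. \<Sum>c<n. B c a / 2 * \<psi> y c)"
      by (rule tan_local[OF u D x]) (simp add: const_pot_def cov_coord_field a)
    also have "\<dots> = (\<Sum>c<n. u (\<lambda>y. B c a / 2 * \<psi> y c))"
      by (rule tan_sum[OF xt u]) (intro smooth_at_mult smooth_at_const xt smooth_at_psi x)
    also have "\<dots> = (\<Sum>c<n. B c a / 2 * u (\<lambda>y. \<psi> y c))"
      by (rule sum.cong[OF refl], rule tan_cmult[OF u smooth_at_psi[OF x]])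
    finally show ?thesis .
  qed
  have "ext_deriv M (const_pot B) x v w =
    (\<Sum>a<n. w (\<lambda>y. \<psi> y a) * (\<Sum>c<n. B c a / 2 * v (\<lambda>y. \<psi> y c)) - v (\<lambda>y. \<psi> y a) * (\<Sum>c<n. B c a / 2 * w (\<lambda>y. \<psi> y c)))"
    unfolding ext_deriv_coords[OF const_pot_one_form x x v w] by (rule sum.cong[OF refl]) (simp add: d[OF v] d[OF w])
  also have "\<dots> = const_form B x v w / 2 - const_form B x w v / 2"
    unfolding const_form_apply[OF w] const_form_apply[OF v] sum_divide_distrib sum_subtractf[symmetric]
    by (simp add: sum_distrib_left sum_subtractf[symmetric] mult_ac)
  also have "\<dots> = const_form B x v w" using const_form_skew[OF B w v] by simp
  finally show ?thesis .
qed

text \<open>If the kernel contains two independent vectors \<open>u\<^sub>1, u\<^sub>2\<close>, dual to two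
  coordinates \<open>i, j\<close> up to factors, adding \<open>d\<psi>\<^sub>i \<and>
  d\<psi>\<^sub>j\<close> to the two-form cuts the kernel down to its vectors with vanishing
  \<open>i\<close>-th and \<open>j\<close>-th coordinate: pair a new kernel element with
  \<open>u\<^sub>1\<close> and \<open>u\<^sub>2\<close>. So a two-form for which the kernel sees as few
  coordinates as possible has kernel of dimension at most one. The size of a kernel is measured by the set
  \<open>Z\<close> of coordinates that do not vanish on it.\<close>

lemma minimal_kernel:
  assumes S: "S = orthogonal_space M x S" and x: "x \<in> D"
  obtains B where "\<forall>a b. B a b = - B b a"
    "(\<forall>u. (u, const_form B x u) \<in> S \<longrightarrow> u = (\<lambda>_. 0)) \<or>
     (\<exists>k i. (k, const_form B x k) \<in> S \<and> i < n \<and> k (\<lambda>y. \<psi> y i) \<noteq> 0 \<and>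
        (\<forall>u. (u, const_form B x u) \<in> S \<longrightarrow> u (\<lambda>y. \<psi> y i) = 0 \<longrightarrow> u = (\<lambda>_. 0)))"
proof -
  define ker where "ker B = {u. (u, const_form B x u) \<in> S}" for B
  define Z where "Z B = {i. i < n \<and> (\<exists>u\<in>ker B. u (\<lambda>y. \<psi> y i) \<noteq> 0)}" for B
  define skew where "skew B \<longleftrightarrow> (\<forall>a b. B a b = - B b a)" for B :: "nat \<Rightarrow> nat \<Rightarrow> real"
  have "skew (\<lambda>_ _. 0)" by (simp add: skew_def)
  then obtain B where B: "skew B" and least: "\<And>B'. skew B' \<Longrightarrow> card (Z B) \<le> card (Z B')"
    using ex_has_least_nat[of skew "\<lambda>_ _. 0" "\<lambda>B. card (Z B)"] by metis
  have memS: "e \<in> orthogonal_space M x S" if "e \<in> S" for e using that by (subst (asm) S)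
  have SD: "e \<in> double_space M x" if "e \<in> S" for e
    using memS[OF that] by (simp add: orthogonal_space_def)
  have iso: "pairing e e' = 0" if "e \<in> S" "e' \<in> S" for e e'
    using memS[OF that(1)] that(2) by (simp add: orthogonal_space_def)
  have kerT: "u \<in> tangent_space M x" if "u \<in> ker B'" for u B'
    using SD that by (force simp: ker_def double_space_def)
  have ker_lin: "(\<lambda>f. s * u f + t * v f) \<in> ker B" if "u \<in> ker B" "v \<in> ker B" for s t u v
    using orthogonal_lin[OF S, of u "const_form B x u" v "const_form B x v" s t] that by (simp add: ker_def const_form_lin)
  have nz: "\<exists>j<n. u (\<lambda>y. \<psi> y j) \<noteq> 0" if "u \<in> ker B" "u \<noteq> (\<lambda>_. 0)" for u
    using tan_eqI[OF kerT[OF that(1)] tangent_zero x] that(2) by blast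
  have "(\<forall>u\<in>ker B. u = (\<lambda>_. 0)) \<or>
     (\<exists>k\<in>ker B. \<exists>i<n. k (\<lambda>y. \<psi> y i) \<noteq> 0 \<and> (\<forall>u\<in>ker B. u (\<lambda>y. \<psi> y i) = 0 \<longrightarrow> u = (\<lambda>_. 0)))"
  proof (rule ccontr)
    assume neg: "\<not> ?thesis"
    then obtain u where u: "u \<in> ker B" "u \<noteq> (\<lambda>_. 0)" by blast
    obtain i where i: "i < n" "u (\<lambda>y. \<psi> y i) \<noteq> 0" using nz[OF u] by blast
    obtain u2 where u2: "u2 \<in> ker B" "u2 (\<lambda>y. \<psi> y i) = 0" "u2 \<noteq> (\<lambda>_. 0)" using neg u(1) i by blast
    obtain j where j: "j < n" "u2 (\<lambda>y. \<psi> y j) \<noteq> 0" using nz[OF u2(1,3)] by blast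
    \<comment> \<open>now \<open>u1, u2\<close> have \<open>i\<close>-th and \<open>j\<close>-th coordinates \<open>(*, 0)\<close> and \<open>(0, *)\<close> with nonzero entries\<close>
    define u1 where "u1 = (\<lambda>f. 1 * u f + (- (u (\<lambda>y. \<psi> y j) / u2 (\<lambda>y. \<psi> y j))) * u2 f)"
    have u1: "u1 \<in> ker B" unfolding u1_def by (rule ker_lin[OF u(1) u2(1)])
    have u1c: "u1 (\<lambda>y. \<psi> y i) \<noteq> 0" "u1 (\<lambda>y. \<psi> y j) = 0"
      using i j u2(2) by (simp_all add: u1_def)
    have ij: "i \<noteq> j" using u2(2) j(2) by auto
    define B' where "B' a b = B a b + (if a = i \<and> b = j then 1 else 0) - (if a = j \<and> b = i then 1 else 0)" for a b
    have B': "skew B'"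
      unfolding skew_def
    proof (intro allI)
      fix a b
      have 1: "B a b = - B b a" by (rule B[unfolded skew_def, rule_format])
      have 2: "B' a b + B' b a = B a b + B b a" unfolding B'_def by (simp add: conj_commute)
      show "B' a b = - B' b a" using 1 2 by linarith
    qed
    have const_form': "const_form B' x c w = const_form B x c w + (c (\<lambda>y. \<psi> y i) * w (\<lambda>y. \<psi> y j) - c (\<lambda>y. \<psi> y j) * w (\<lambda>y. \<psi> y i))"
      if w: "w \<in> tangent_space M x" for c w
    proof -
      have "(\<Sum>a<n. B' a b * c (\<lambda>y. \<psi> y a)) = (\<Sum>a<n. B a b * c (\<lambda>y. \<psi> y a)) +
        ((if b = j then c (\<lambda>y. \<psi> y i) else 0) - (if b = i then c (\<lambda>y. \<psi> y j) else 0))" for b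
      proof -
        have "(\<Sum>a<n. B' a b * c (\<lambda>y. \<psi> y a)) = (\<Sum>a<n. B a b * c (\<lambda>y. \<psi> y a)) +
           (\<Sum>a<n. if a = i then (if b = j then c (\<lambda>y. \<psi> y i) else 0) else 0) -
           (\<Sum>a<n. if a = j then (if b = i then c (\<lambda>y. \<psi> y j) else 0) else 0)"
          unfolding sum.distrib[symmetric] sum_subtractf[symmetric]
          by (rule sum.cong) (auto simp: B'_def algebra_simps)
        then show ?thesis using i j by simp
      qed
      then have "const_form B' x c w = (\<Sum>b<n. ((\<Sum>a<n. B a b * c (\<lambda>y. \<psi> y a)) +
        ((if b = j then c (\<lambda>y. \<psi> y i) else 0) - (if b = i then c (\<lambda>y. \<psi> y j) else 0))) * w (\<lambda>y. \<psi> y b))"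
        unfolding const_form_def cov_apply[OF w] by simp
      also have "\<dots> = const_form B x c w + ((\<Sum>b<n. if b = j then c (\<lambda>y. \<psi> y i) * w (\<lambda>y. \<psi> y j) else 0)
          - (\<Sum>b<n. if b = i then c (\<lambda>y. \<psi> y j) * w (\<lambda>y. \<psi> y i) else 0))"
        unfolding const_form_def cov_apply[OF w] sum_subtractf[symmetric] sum.distrib[symmetric]
        by (rule sum.cong) (auto simp: algebra_simps)
      finally show ?thesis using i j by simp
    qed
    have sub: "c \<in> ker B \<and> c (\<lambda>y. \<psi> y i) = 0" if c: "c \<in> ker B'" for c
    proof -
      have key: "c (\<lambda>y. \<psi> y i) * w (\<lambda>y. \<psi> y j) - c (\<lambda>y. \<psi> y j) * w (\<lambda>y. \<psi> y i) = 0" if w: "w \<in> ker B" for w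
      proof -
        have "pairing (c, const_form B' x c) (w, const_form B x w) = 0" using c w by (intro iso) (auto simp: ker_def)
        then have "const_form B' x c w + const_form B x w c = 0" by (simp add: pairing_def)
        then show ?thesis
          using const_form'[OF kerT[OF w], of c] const_form_skew[OF B[unfolded skew_def] kerT[OF w] kerT[OF c]] by simp
      qed
      have cj: "c (\<lambda>y. \<psi> y j) = 0" using key[OF u1] u1c by simp
      have ci: "c (\<lambda>y. \<psi> y i) = 0" using key[OF u2(1)] u2(2) j(2) by simp
      have "const_form B' x c = const_form B x c"
      proof
        fix w show "const_form B' x c w = const_form B x c w"
          using const_form'[of w c] ci cj by (cases "w \<in> tangent_space M x") (simp_all add: const_form_outside)
      qed
      then show ?thesis using c ci by (simp add: ker_def)
    qed
    have "Z B' \<subseteq> Z B - {i}" using sub by (auto simp: Z_def)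
    moreover have "i \<in> Z B" using i u(1) by (auto simp: Z_def)
    moreover have "finite (Z B)" by (simp add: Z_def)
    ultimately have "card (Z B') < card (Z B)" by (meson card_Diff1_less card_mono finite_Diff le_less_trans)
    then show False using least[OF B'] by simp
  qed
  then show thesis
    using that[of B] B unfolding skew_def ker_def by blast
qed

text \<open>The gauge transformation by minus the constant two-form; it undoes the gauge transformation by the
  differential of \<open>const_pot B\<close>.\<close>

definition ungauge :: "(nat \<Rightarrow> nat \<Rightarrow> real) \<Rightarrow> 'a \<Rightarrow> 'a dvec \<Rightarrow> 'a dvec" where
  "ungauge B y = (\<lambda>(u, \<xi>). (u, \<lambda>v. \<xi> v - const_form B y u v))"

lemma ungauge_simps [simp]: "fst (ungauge B y e) = fst e" "snd (ungauge B y e) = (\<lambda>v. snd e v - const_form B y (fst e) v)"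
  by (simp_all add: ungauge_def case_prod_beta)

lemma ungauge_double_space: "e \<in> double_space M y \<Longrightarrow> ungauge B y e \<in> double_space M y"
  using cotangent_lin[of "snd e" y "const_form B y (fst e)" 1 "- 1"] const_form_cot by (auto simp: double_space_def mem_Times_iff)

text \<open>Gauge transformations by two-forms preserve the pairing and are invertible.\<close>

lemma orthogonal_ungauge:
  assumes B: "\<forall>a b. B a b = - B b a" and S: "S = orthogonal_space M y S"
  shows "ungauge B y ` S = orthogonal_space M y (ungauge B y ` S)"
proof -
  have SD: "e \<in> S \<Longrightarrow> e \<in> double_space M y" for e
    using S unfolding orthogonal_space_def by blast
  have proj: "pairing (ungauge B y e) (ungauge B y e') = pairing e e'" if "e \<in> double_space M y" "e' \<in> double_space M y" for e e'
    using const_form_skew[OF B, of "fst e" y "fst e'"] that by (auto simp: pairing_def double_space_def)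
  define gt where "gt = (\<lambda>e. (fst e, \<lambda>v. snd e v + const_form B y (fst e) v))"
  have gt: "ungauge B y (gt e) = e" for e by (simp add: gt_def ungauge_def)
  have gtD: "gt e \<in> double_space M y" if "e \<in> double_space M y" for e
    using that cotangent_lin[of "snd e" y "const_form B y (fst e)" 1 1] const_form_cot by (auto simp: double_space_def gt_def)
  show ?thesis
  proof (intro equalityI subsetI)
    fix e assume "e \<in> ungauge B y ` S"
    then obtain s where s: "s \<in> S" "e = ungauge B y s" by blast
    have "pairing e (ungauge B y s') = 0" if "s' \<in> S" for s'
      using proj[OF SD[OF s(1)] SD[OF that]] S s(1) that by (auto simp: s(2) orthogonal_space_def)
    then show "e \<in> orthogonal_space M y (ungauge B y ` S)"
      using ungauge_double_space[OF SD[OF s(1)]] by (auto simp: orthogonal_space_def s(2))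
  next
    fix e assume e: "e \<in> orthogonal_space M y (ungauge B y ` S)"
    then have eD: "e \<in> double_space M y" and e0: "\<And>s. s \<in> S \<Longrightarrow> pairing e (ungauge B y s) = 0"
      by (auto simp: orthogonal_space_def)
    have "pairing (gt e) s = 0" if "s \<in> S" for s
      using proj[OF gtD[OF eD] SD[OF that]] e0[OF that] by (simp add: gt)
    then have "gt e \<in> orthogonal_space M y S" using gtD[OF eD] by (auto simp: orthogonal_space_def)
    then have "gt e \<in> S" using S by simp
    then show "e \<in> ungauge B y ` S" using gt by (metis imageI)
  qed
qed

lemma const_form_one_form:
  assumes V: "V \<subseteq> D" and u: "vector_field M V u"
  shows "one_form M V (\<lambda>y. const_form B y (u y))"
proof -
  have o: "openin (mtop M) V" by (rule vf_open[OF u])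
  show ?thesis unfolding const_form_def
    by (rule cov_of[OF V o])
      (intro smooth_on_sum[OF o] smooth_on_mult[OF o] smooth_on_const[OF o] vf_smooth[OF u order_refl smooth_psi[OF V o]])
qed

lemma double_section_ungauge:
  assumes V: "V \<subseteq> D" and s: "double_section M V s"
  shows "double_section M V (\<lambda>y. ungauge B y (s y))"
proof -
  have u: "vector_field M V (\<lambda>y. fst (s y))" and \<xi>: "one_form M V (\<lambda>y. snd (s y))"
    using s by (simp_all add: double_section_def)
  have o: "openin (mtop M) V" by (rule vf_open[OF u])
  have "one_form M V (\<lambda>y v. \<Sum>i\<in>{True, False}. (if i then 1 else - 1) * (if i then snd (s y) else const_form B y (fst (s y))) v)"
  proof (rule of_scale_sum[OF o])
    show "one_form M V (\<lambda>y. if i then snd (s y) else const_form B y (fst (s y)))" for i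
      using \<xi> const_form_one_form[OF V u] by (cases i) simp_all
  qed (rule smooth_on_const[OF o])
  then show ?thesis using u by (simp add: double_section_def)
qed

text \<open>Gauge transformations by closed two-forms are automorphisms of the Dorfman bracket. With constant
  coefficients closedness shows in the coordinate formula: no derivative of \<open>B\<close> appears, and
  the terms with derivatives of the components of the two sections either assemble to the contraction of
  the bracket or cancel by skew symmetry.\<close>

lemma dorfman_ungauge:
  assumes B: "\<forall>a b. B a b = - B b a" and V: "V \<subseteq> D"
    and s: "double_section M V s" and t: "double_section M V t" and x: "x \<in> V"
  shows "dorfman M (\<lambda>y. ungauge B y (s y)) (\<lambda>y. ungauge B y (t y)) x = ungauge B x (dorfman M s t x)"
proof (rule prod_eqI)
  have xD: "x \<in> D" and xt: "x \<in> topspace (mtop M)" using x V D_top by auto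
  have u: "vector_field M V (\<lambda>y. fst (s y))" and v: "vector_field M V (\<lambda>y. fst (t y))"
    and \<xi>: "one_form M V (\<lambda>y. snd (s y))" and \<eta>: "one_form M V (\<lambda>y. snd (t y))"
    using s t by (simp_all add: double_section_def)
  have o: "openin (mtop M) V" by (rule vf_open[OF u])
  have T: "fst (s x) \<in> tangent_space M x" "fst (t x) \<in> tangent_space M x" using vf_tangent u v x by auto
  show fst_eq: "fst (dorfman M (\<lambda>y. ungauge B y (s y)) (\<lambda>y. ungauge B y (t y)) x) = fst (ungauge B x (dorfman M s t x))"
    by (simp add: dorfman_fst)
  show "snd (dorfman M (\<lambda>y. ungauge B y (s y)) (\<lambda>y. ungauge B y (t y)) x) = snd (ungauge B x (dorfman M s t x))"
  proof
    fix w
    show "snd (dorfman M (\<lambda>y. ungauge B y (s y)) (\<lambda>y. ungauge B y (t y)) x) w = snd (ungauge B x (dorfman M s t x)) w"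
    proof (cases "w \<in> tangent_space M x")
      case True
      have const_form_coord_field: "const_form B y p (coord_field a y) = (\<Sum>c<n. B c a * p (\<lambda>y. \<psi> y c))" if "y \<in> D" "a < n" for y p a
        by (simp add: const_form_def cov_coord_field that)
      have sm: "smooth_at M x (\<lambda>y. X y (\<lambda>y. \<psi> y c))" if "vector_field M V X" for X c
        by (rule vf_smooth_at[OF that x smooth_at_psi[OF xD]])
      \<comment> \<open>derivative of a component of the transformed covector\<close>
      have d: "p (\<lambda>y. \<zeta> y (coord_field a y) - const_form B y (X y) (coord_field a y)) = p (\<lambda>y. \<zeta> y (coord_field a y)) - (\<Sum>c<n. B c a * p (\<lambda>y. X y (\<lambda>y. \<psi> y c)))"
        if p: "p \<in> tangent_space M x" and X: "vector_field M V X" and \<zeta>: "one_form M V \<zeta>" and a: "a < n" for p X \<zeta> a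
      proof -
        have "p (\<lambda>y. \<zeta> y (coord_field a y) - const_form B y (X y) (coord_field a y)) = p (\<lambda>y. \<zeta> y (coord_field a y) - (\<Sum>c<n. B c a * X y (\<lambda>y. \<psi> y c)))"
          by (rule tan_local[OF p o x]) (use V const_form_coord_field a in auto)
        also have "\<dots> = p (\<lambda>y. \<zeta> y (coord_field a y)) - p (\<lambda>y. \<Sum>c<n. B c a * X y (\<lambda>y. \<psi> y c))"
          by (rule tan_diff[OF p smooth_at_form_coord_field[OF \<zeta> x xD a]])
            (intro smooth_at_sum smooth_at_mult smooth_at_const sm X xt)
        also have "p (\<lambda>y. \<Sum>c<n. B c a * X y (\<lambda>y. \<psi> y c)) = (\<Sum>c<n. p (\<lambda>y. B c a * X y (\<lambda>y. \<psi> y c)))"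
          by (rule tan_sum[OF xt p]) (intro smooth_at_mult smooth_at_const sm X xt)
        also have "\<dots> = (\<Sum>c<n. B c a * p (\<lambda>y. X y (\<lambda>y. \<psi> y c)))"
          by (rule sum.cong[OF refl], rule tan_cmult[OF p sm[OF X]])
        finally show ?thesis .
      qed
      define u' where "u' c = w (\<lambda>y. fst (s y) (\<lambda>y. \<psi> y c))" for c
      define v' where "v' c = fst (t x) (\<lambda>y. \<psi> y c)" for c
      define w' where "w' c = w (\<lambda>y. \<psi> y c)" for c
      define uv where "uv c = fst (s x) (\<lambda>y. fst (t y) (\<lambda>y. \<psi> y c))" for c
      define vu where "vu c = fst (t x) (\<lambda>y. fst (s y) (\<lambda>y. \<psi> y c))" for c
      define E where "E a = w' a * (fst (s x) (\<lambda>y. snd (t y) (coord_field a y)) - fst (t x) (\<lambda>y. snd (s y) (coord_field a y)))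
        + snd (t x) (coord_field a x) * u' a + v' a * w (\<lambda>y. snd (s y) (coord_field a y))" for a
      \<comment> \<open>skew symmetry of \<open>B\<close>\<close>
      have canc: "(\<Sum>a<n. (\<Sum>c<n. B c a * v' c) * u' a + v' a * (\<Sum>c<n. B c a * u' c)) = 0"
      proof -
        have "(\<Sum>a<n. v' a * (\<Sum>c<n. B c a * u' c)) = (\<Sum>c<n. \<Sum>a<n. v' a * (B c a * u' c))"
          unfolding sum_distrib_left by (rule sum.swap)
        also have "\<dots> = (\<Sum>a<n. \<Sum>c<n. - (B c a * v' c * u' a))"
        proof (intro sum.cong refl)
          fix a c
          have "B a c = - B c a" using B by blast
          then show "v' c * (B a c * u' a) = - (B c a * v' c * u' a)" by simp
        qed
        finally show ?thesis by (simp add: sum.distrib sum_negf sum_distrib_right)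
      qed
      have "snd (dorfman M (\<lambda>y. ungauge B y (s y)) (\<lambda>y. ungauge B y (t y)) x) w =
        (\<Sum>a<n. E a - w' a * (\<Sum>c<n. B c a * (uv c - vu c)) - ((\<Sum>c<n. B c a * v' c) * u' a + v' a * (\<Sum>c<n. B c a * u' c)))"
        unfolding dorfman_snd[OF double_section_ungauge[OF V s] double_section_ungauge[OF V t] x xD True] ungauge_simps
      proof (rule sum.cong[OF refl])
        fix a assume "a \<in> {..<n}"
        then have a: "a < n" by simp
        have e: "(\<Sum>c<n. B c a * (uv c - vu c)) = (\<Sum>c<n. B c a * uv c) - (\<Sum>c<n. B c a * vu c)"
          by (simp add: right_diff_distrib sum_subtractf)
        show "w (\<lambda>y. \<psi> y a) * (fst (s x) (\<lambda>y. snd (t y) (coord_field a y) - const_form B y (fst (t y)) (coord_field a y)) -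
             fst (t x) (\<lambda>y. snd (s y) (coord_field a y) - const_form B y (fst (s y)) (coord_field a y))) +
          (snd (t x) (coord_field a x) - const_form B x (fst (t x)) (coord_field a x)) * w (\<lambda>y. fst (s y) (\<lambda>y. \<psi> y a)) +
          fst (t x) (\<lambda>y. \<psi> y a) * w (\<lambda>y. snd (s y) (coord_field a y) - const_form B y (fst (s y)) (coord_field a y)) =
          E a - w' a * (\<Sum>c<n. B c a * (uv c - vu c)) - ((\<Sum>c<n. B c a * v' c) * u' a + v' a * (\<Sum>c<n. B c a * u' c))"
          unfolding d[OF T(1) v \<eta> a] d[OF T(2) u \<xi> a] d[OF True u \<xi> a] const_form_coord_field[OF xD a] e
          by (simp add: E_def w'_def u'_def v'_def uv_def vu_def algebra_simps)
      qed
      also have "\<dots> = (\<Sum>a<n. E a) - (\<Sum>a<n. w' a * (\<Sum>c<n. B c a * (uv c - vu c)))"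
        using canc by (simp add: sum_subtractf)
      also have "(\<Sum>a<n. E a) = snd (dorfman M s t x) w"
        unfolding dorfman_snd[OF s t x xD True] E_def w'_def u'_def v'_def ..
      also have "(\<Sum>a<n. w' a * (\<Sum>c<n. B c a * (uv c - vu c))) = const_form B x (fst (dorfman M s t x)) w"
        unfolding const_form_def cov_apply[OF True] dorfman_fst bracket_psi[OF xD] w'_def uv_def vu_def
        by (simp add: mult.commute)
      finally show ?thesis by simp
    qed (simp add: dorfman_snd_outside const_form_outside)
  qed
qed

end

section \<open>Local Dirac structures\<close>

text \<open>Dirac structures over an open set, with involutivity for sections over smaller open sets. This notion
  can be restricted and gauge transformed in coordinates that do not cover \<open>M\<close>.\<close>

definition (in manifold) local_dirac :: "'a set \<Rightarrow> ('a \<Rightarrow> 'a dvec set) \<Rightarrow> bool" where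
  "local_dirac V0 L \<longleftrightarrow> openin (mtop M) V0 \<and>
     (\<forall>y\<in>V0. L y = orthogonal_space M y (L y)) \<and>
     (\<forall>V s t y. V \<subseteq> V0 \<longrightarrow> double_section M V s \<longrightarrow> double_section M V t \<longrightarrow>
        (\<forall>y\<in>V. s y \<in> L y \<and> t y \<in> L y) \<longrightarrow> y \<in> V \<longrightarrow> dorfman M s t y \<in> L y) \<and>
     (\<forall>x\<in>V0. \<exists>V r s. x \<in> V \<and> V \<subseteq> V0 \<and> openin (mtop M) V \<and> (\<forall>i<r. double_section M V (s i)) \<and>
        (\<forall>y\<in>V. L y = range (\<lambda>c. lin_comb r c (\<lambda>i. s i y)) \<and>
                (\<forall>c. lin_comb r c (\<lambda>i. s i y) = (\<lambda>_. 0, \<lambda>_. 0) \<longrightarrow> (\<forall>i<r. c i = 0))))"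

context manifold begin

lemma local_diracD:
  assumes "local_dirac V0 L"
  shows "openin (mtop M) V0" "y \<in> V0 \<Longrightarrow> L y = orthogonal_space M y (L y)"
    "V \<subseteq> V0 \<Longrightarrow> double_section M V s \<Longrightarrow> double_section M V t \<Longrightarrow>
        (\<And>y. y \<in> V \<Longrightarrow> s y \<in> L y) \<Longrightarrow> (\<And>y. y \<in> V \<Longrightarrow> t y \<in> L y) \<Longrightarrow> y \<in> V \<Longrightarrow> dorfman M s t y \<in> L y"
    "y \<in> V0 \<Longrightarrow> \<exists>V r s. y \<in> V \<and> V \<subseteq> V0 \<and> openin (mtop M) V \<and> (\<forall>i<r. double_section M V (s i)) \<and>
        (\<forall>y\<in>V. L y = range (\<lambda>c. lin_comb r c (\<lambda>i. s i y)) \<and>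
                (\<forall>c. lin_comb r c (\<lambda>i. s i y) = (\<lambda>_. 0, \<lambda>_. 0) \<longrightarrow> (\<forall>i<r. c i = 0)))"
  using assms unfolding local_dirac_def by simp_all

lemma dirac_local:
  assumes L: "dirac_structure M L" shows "local_dirac (topspace (mtop M)) L"
  unfolding local_dirac_def
proof (intro conjI ballI allI impI openin_topspace)
  show "L y = orthogonal_space M y (L y)" if "y \<in> topspace (mtop M)" for y
    using L that unfolding dirac_structure_def by blast
  show "dorfman M s t y \<in> L y"
    if "double_section M V s" "double_section M V t" "\<forall>y\<in>V. s y \<in> L y \<and> t y \<in> L y" "y \<in> V" for V s t y
    by (rule dirac_involutive_local[OF L that(1,2) _ _ that(4)]) (use that(3) in auto)
  fix x assume x: "x \<in> topspace (mtop M)"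
  have "subbundle M L" using L unfolding dirac_structure_def by blast
  from this[unfolded subbundle_def, rule_format, OF x]
  obtain V r s where "x \<in> V" "openin (mtop M) V" "\<forall>i<r. double_section M V (s i)"
        "\<forall>y\<in>V. L y = range (\<lambda>c. lin_comb r c (\<lambda>i. s i y)) \<and>
                (\<forall>c. lin_comb r c (\<lambda>i. s i y) = (\<lambda>_. 0, \<lambda>_. 0) \<longrightarrow> (\<forall>i<r. c i = 0))"
    by (elim exE conjE)
  then show "\<exists>V r s. x \<in> V \<and> V \<subseteq> topspace (mtop M) \<and> openin (mtop M) V \<and> (\<forall>i<r. double_section M V (s i)) \<and>
        (\<forall>y\<in>V. L y = range (\<lambda>c. lin_comb r c (\<lambda>i. s i y)) \<and>
                (\<forall>c. lin_comb r c (\<lambda>i. s i y) = (\<lambda>_. 0, \<lambda>_. 0) \<longrightarrow> (\<forall>i<r. c i = 0)))"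
    by (intro exI conjI openin_subset)
qed

end

lemma (in coords) ungauge_lin_comb:
  "ungauge B y (lin_comb r c e) = lin_comb r c (\<lambda>i. ungauge B y (e i))"
proof -
  have "const_form B y (\<lambda>f. \<Sum>i\<in>A. c i * fst (e i) f) = (\<lambda>v. \<Sum>i\<in>A. c i * const_form B y (fst (e i)) v)" if "finite A" for A
    using that
  proof (induction A)
    case empty then show ?case by (simp add: const_form_zero)
  next
    case (insert i A)
    then show ?case
      using const_form_lin[of B y "c i" "fst (e i)" 1 "\<lambda>f. \<Sum>i\<in>A. c i * fst (e i) f"] by simp
  qed
  then show ?thesis by (simp add: ungauge_def lin_comb_def right_diff_distrib sum_subtractf case_prod_beta)
qed

lemma (in coords) local_dirac_ungauge:
  assumes B: "\<forall>a b. B a b = - B b a" and L: "local_dirac V0 L"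
  shows "local_dirac (V0 \<inter> D) (\<lambda>y. ungauge B y ` L y)"
  unfolding local_dirac_def
proof (intro conjI ballI allI impI)
  show "openin (mtop M) (V0 \<inter> D)" using local_diracD(1)[OF L] D by blast
  show "ungauge B y ` L y = orthogonal_space M y (ungauge B y ` L y)" if "y \<in> V0 \<inter> D" for y
    by (rule orthogonal_ungauge[OF B local_diracD(2)[OF L]]) (use that in simp)
  have inv: "ungauge (\<lambda>a b. - B a b) y (ungauge B y e) = e" for y e
  proof -
    have "const_form (\<lambda>a b. - B a b) y u v = - const_form B y u v" for u v
      by (simp add: const_form_def cov_def sum_negf)
    then show ?thesis by (simp add: ungauge_def case_prod_beta)
  qed
  have inv': "ungauge B y (ungauge (\<lambda>a b. - B a b) y e) = e" for y e
  proof -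
    have "const_form (\<lambda>a b. - B a b) y u v = - const_form B y u v" for u v
      by (simp add: const_form_def cov_def sum_negf)
    then show ?thesis by (simp add: ungauge_def case_prod_beta)
  qed
  show "dorfman M s t y \<in> ungauge B y ` L y"
    if V: "V \<subseteq> V0 \<inter> D" and s: "double_section M V s" and t: "double_section M V t"
      and st: "\<forall>y\<in>V. s y \<in> ungauge B y ` L y \<and> t y \<in> ungauge B y ` L y" and y: "y \<in> V" for V s t y
  proof -
    have VD: "V \<subseteq> D" using V by blast
    define s' where "s' y = ungauge (\<lambda>a b. - B a b) y (s y)" for y
    define t' where "t' y = ungauge (\<lambda>a b. - B a b) y (t y)" for y
    have s': "double_section M V s'" "double_section M V t'"
      unfolding s'_def[abs_def] t'_def[abs_def] by (intro double_section_ungauge VD s t)+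
    have mem: "s' y \<in> L y" "t' y \<in> L y" if "y \<in> V" for y
      using st that inv by (auto simp: s'_def t'_def dest!: bspec)
    have "dorfman M s' t' y \<in> L y"
      by (rule local_diracD(3)[OF L _ s' mem y]) (use V in blast)
    then have "dorfman M (\<lambda>y. ungauge B y (s' y)) (\<lambda>y. ungauge B y (t' y)) y \<in> ungauge B y ` L y"
      using dorfman_ungauge[OF B VD s' y] by simp
    then show ?thesis by (simp add: s'_def t'_def inv')
  qed
  fix x assume "x \<in> V0 \<inter> D"
  then have x: "x \<in> V0" "x \<in> D" by auto
  obtain V r s where V: "x \<in> V" "V \<subseteq> V0" "openin (mtop M) V" "\<forall>i<r. double_section M V (s i)"
        and fr: "\<forall>y\<in>V. L y = range (\<lambda>c. lin_comb r c (\<lambda>i. s i y)) \<and>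
                (\<forall>c. lin_comb r c (\<lambda>i. s i y) = (\<lambda>_. 0, \<lambda>_. 0) \<longrightarrow> (\<forall>i<r. c i = 0))"
    using local_diracD(4)[OF L x(1)] by (elim exE conjE)
  have o: "openin (mtop M) (V \<inter> D)" using V(3) D by blast
  have "\<forall>i<r. double_section M (V \<inter> D) (\<lambda>y. ungauge B y (s i y))"
    using V(4) double_section_ungauge[OF Int_lower2] double_section_subset[OF _ o Int_lower1] by blast
  moreover have "\<forall>y\<in>V \<inter> D. ungauge B y ` L y = range (\<lambda>c. lin_comb r c (\<lambda>i. ungauge B y (s i y))) \<and>
                (\<forall>c. lin_comb r c (\<lambda>i. ungauge B y (s i y)) = (\<lambda>_. 0, \<lambda>_. 0) \<longrightarrow> (\<forall>i<r. c i = 0))"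
  proof (intro ballI conjI allI impI)
    fix y assume y: "y \<in> V \<inter> D"
    have "L y = range (\<lambda>c. lin_comb r c (\<lambda>i. s i y))" using fr y by blast
    then show "ungauge B y ` L y = range (\<lambda>c. lin_comb r c (\<lambda>i. ungauge B y (s i y)))"
      unfolding ungauge_lin_comb[symmetric] by auto
    fix c i assume c: "lin_comb r c (\<lambda>i. ungauge B y (s i y)) = (\<lambda>_. 0, \<lambda>_. 0)" and i: "i < r"
    then have "ungauge B y (lin_comb r c (\<lambda>i. s i y)) = (\<lambda>_. 0, \<lambda>_. 0)" by (simp only: ungauge_lin_comb)
    then have "lin_comb r c (\<lambda>i. s i y) = ungauge (\<lambda>a b. - B a b) y (\<lambda>_. 0, \<lambda>_. 0)" using inv by metis
    also have "\<dots> = (\<lambda>_. 0, \<lambda>_. 0)" by (simp add: ungauge_def const_form_zero)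
    finally show "c i = 0" using fr y i by blast
  qed
  ultimately show "\<exists>V r s. x \<in> V \<and> V \<subseteq> V0 \<inter> D \<and> openin (mtop M) V \<and> (\<forall>i<r. double_section M V (s i)) \<and>
        (\<forall>y\<in>V. ungauge B y ` L y = range (\<lambda>c. lin_comb r c (\<lambda>i. s i y)) \<and>
                (\<forall>c. lin_comb r c (\<lambda>i. s i y) = (\<lambda>_. 0, \<lambda>_. 0) \<longrightarrow> (\<forall>i<r. c i = 0)))"
    using x V(1,2) o
    by (intro exI[of _ "V \<inter> D"] exI[of _ r] exI[of _ "\<lambda>i y. ungauge B y (s i y)"]) auto
qed

section \<open>Adapted frames\<close>

context coords begin

text \<open>For each \<open>m\<close>, the pairings with the basis \<open>\<partial>\<^sub>a\<close> (\<open>a <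
  m\<close>), \<open>d\<psi>\<^sub>a\<close> (\<open>a \<ge> m\<close>) of a coordinate Lagrangian. They
  are coordinates on every Lagrangian transverse to it.\<close>

definition lag_coord :: "nat \<Rightarrow> nat \<Rightarrow> 'a \<Rightarrow> 'a dvec \<Rightarrow> real" where
  "lag_coord m a y e = (if a < m then snd e (coord_field a y) else fst e (\<lambda>y. \<psi> y a))"

lemma lag_coord_lin_comb: "lag_coord m a y (lin_comb r c e) = (\<Sum>i<r. c i * lag_coord m a y (e i))"
  by (simp add: lag_coord_def lin_comb_def)

lemma lag_coord_smooth:
  assumes s: "double_section M V s" and V: "V \<subseteq> D" and a: "a < n"
  shows "smooth_on M V (\<lambda>y. lag_coord m a y (s y))"
proof (cases "a < m")
  case True
  have "vector_field M V (coord_field a)" by (rule coord_field_vf[OF V vf_open[OF double_sectionD(1)[OF s]] a])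
  from of_smooth[OF double_sectionD(2)[OF s] order_refl this] show ?thesis using True by (simp add: lag_coord_def)
next
  case False
  have "smooth_on M V (\<lambda>y. \<psi> y a)" by (rule smooth_psi[OF V vf_open[OF double_sectionD(1)[OF s]]])
  from vf_smooth[OF double_sectionD(1)[OF s] order_refl this] show ?thesis using False by (simp add: lag_coord_def)
qed

text \<open>Let \<open>t\<close> be a local frame of \<open>L\<close> and \<open>P\<close> the matrix of the
  pairings of \<open>t\<close> with the coordinate Lagrangian \<open>\<Lambda>\<close>. If
  \<open>L\<^sub>x\<close> meets \<open>\<Lambda>\<close> only in zero, the rows and the columns of
  \<open>P\<close> are independent at \<open>x\<close>: a relation between the columns is an element of
  \<open>L\<^sub>x \<inter> \<Lambda>\<^sup>\<bottom>\<close>, and one between the rows is an element of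
  \<open>\<Lambda> \<inter> L\<^sub>x\<^sup>\<bottom>\<close>, and both spaces are \<open>L\<^sub>x
  \<inter> \<Lambda>\<close>. A smooth right inverse of \<open>P\<close> turns \<open>t\<close> into the
  dual frame, and one of the transpose shows that transversality persists near \<open>x\<close>.\<close>

lemma adapted_frame:
  assumes L: "local_dirac V0 L" and x: "x \<in> V0" "x \<in> D"
    and nondeg: "\<And>e. e \<in> L x \<Longrightarrow> (\<And>a. a < n \<Longrightarrow> lag_coord m a x e = 0) \<Longrightarrow> e = (\<lambda>_. 0, \<lambda>_. 0)"
  obtains V s where "openin (mtop M) V" "x \<in> V" "V \<subseteq> V0" "V \<subseteq> D" "\<forall>b<n. double_section M V (s b)"
    "\<forall>y\<in>V. \<forall>b<n. s b y \<in> L y" "\<forall>y\<in>V. \<forall>a<n. \<forall>b<n. lag_coord m a y (s b y) = (if a = b then 1 else 0)"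
    "\<forall>y\<in>V. \<forall>e\<in>L y. (\<forall>a<n. lag_coord m a y e = 0) \<longrightarrow> e = (\<lambda>_. 0, \<lambda>_. 0)"
proof -
  obtain V1 r t where V1: "x \<in> V1" "V1 \<subseteq> V0" "openin (mtop M) V1" "\<forall>i<r. double_section M V1 (t i)"
        and fr: "\<forall>y\<in>V1. L y = range (\<lambda>c. lin_comb r c (\<lambda>i. t i y)) \<and>
                (\<forall>c. lin_comb r c (\<lambda>i. t i y) = (\<lambda>_. 0, \<lambda>_. 0) \<longrightarrow> (\<forall>i<r. c i = 0))"
    using local_diracD(4)[OF L x(1)] by (elim exE conjE)
  define V where "V = V1 \<inter> D"
  have V: "openin (mtop M) V" "x \<in> V" "V \<subseteq> D" "V \<subseteq> V1" using V1 D x by (auto simp: V_def)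
  have t: "double_section M V (t i)" if "i < r" for i
    using V1(4) that double_section_subset[OF _ V(1,4)] by blast
  have Ly: "L y = range (\<lambda>c. lin_comb r c (\<lambda>i. t i y))" if "y \<in> V" for y using fr that V(4) by blast
  define P where "P b i y = lag_coord m b y (t i y)" for b i y
  have P: "smooth_on M V (P b i)" if "b < n" "i < r" for b i
    unfolding P_def[abs_def] by (rule lag_coord_smooth[OF t[OF that(2)] V(3) that(1)])
  have rows: "d b = 0" if d: "\<And>i. i < r \<Longrightarrow> (\<Sum>b<n. d b * P b i x) = 0" and b: "b < n" for d b
  proof -
    define c where "c a = (if a < m then d a else 0)" for a
    define c' where "c' a = (if a < m then 0 else d a)" for a
    \<comment> \<open>the element of \<open>\<Lambda>\<close> with coefficients \<open>d\<close>; it is orthogonal to \<open>L\<^sub>x\<close>\<close>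
    let ?e = "(vec c x, cov c' x)"
    have "pairing ?e e = 0" if e: "e \<in> L x" for e
    proof -
      have eD: "fst e \<in> tangent_space M x" "snd e \<in> cotangent_space M x"
      proof -
        have "e \<in> orthogonal_space M x (L x)" using e local_diracD(2)[OF L x(1)] by simp
        then show "fst e \<in> tangent_space M x" "snd e \<in> cotangent_space M x"
          by (auto simp: orthogonal_space_def double_space_def)
      qed
      have "pairing ?e e = (\<Sum>a<n. d a * lag_coord m a x e)"
        unfolding pairing_def fst_conv snd_conv cov_apply[OF eD(1)] cot_expand[OF eD(2) vec_tangent[OF x(2)] x(2)]
          sum.distrib[symmetric]
        by (rule sum.cong) (auto simp: vec_psi[OF x(2)] c_def c'_def lag_coord_def)
      also obtain q where "e = lin_comb r q (\<lambda>i. t i x)" using e Ly[OF V(2)] by blast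
      then have "(\<Sum>a<n. d a * lag_coord m a x e) = (\<Sum>a<n. \<Sum>i<r. q i * (d a * P a i x))"
        by (simp add: lag_coord_lin_comb sum_distrib_left P_def mult_ac)
      also have "\<dots> = (\<Sum>i<r. q i * (\<Sum>a<n. d a * P a i x))"
        unfolding sum_distrib_left by (rule sum.swap)
      also have "\<dots> = 0" using d by simp
      finally show ?thesis .
    qed
    then have "?e \<in> orthogonal_space M x (L x)"
      using vec_tangent[OF x(2)] cov_cotangent by (simp add: orthogonal_space_def double_space_def)
    then have eL: "?e \<in> L x" using local_diracD(2)[OF L x(1)] by simp
    have "?e = (\<lambda>_. 0, \<lambda>_. 0)"
      by (rule nondeg[OF eL]) (auto simp: lag_coord_def cov_coord_field[OF x(2)] vec_psi[OF x(2)] c_def c'_def)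
    then have "vec c x (\<lambda>y. \<psi> y b) = 0" "cov c' x (coord_field b x) = 0" by auto
    then show "d b = 0" using b by (auto simp: vec_psi[OF x(2)] cov_coord_field[OF x(2)] c_def c'_def split: if_splits)
  qed
  have cols: "c i = 0" if c: "\<And>b. b < n \<Longrightarrow> (\<Sum>i<r. c i * P b i x) = 0" and i: "i < r" for c i
  proof -
    have "lin_comb r c (\<lambda>i. t i x) \<in> L x" using Ly[OF V(2)] by blast
    then have "lin_comb r c (\<lambda>i. t i x) = (\<lambda>_. 0, \<lambda>_. 0)"
      by (rule nondeg) (use c in \<open>simp add: lag_coord_lin_comb P_def\<close>)
    then show "c i = 0" using fr V1(1) i by blast
  qed
  have "\<exists>V' R. openin (mtop M) V' \<and> x \<in> V' \<and> V' \<subseteq> V \<and> (\<forall>i<r. \<forall>b<n. smooth_on M V' (R i b)) \<and>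
      (\<forall>y\<in>V'. \<forall>a<n. \<forall>b<n. (\<Sum>i<r. P a i y * R i b y) = (if a = b then 1 else 0))"
    by (rule smooth_right_inverse[OF V(2,1)]) (fact P, fact rows)
  then obtain V2 R where V2: "openin (mtop M) V2" "x \<in> V2" "V2 \<subseteq> V"
    and R: "\<forall>i<r. \<forall>b<n. smooth_on M V2 (R i b)"
    and PR: "\<forall>y\<in>V2. \<forall>a<n. \<forall>b<n. (\<Sum>i<r. P a i y * R i b y) = (if a = b then 1 else 0)"
    by (elim exE conjE)
  have "\<exists>V' R. openin (mtop M) V' \<and> x \<in> V' \<and> V' \<subseteq> V \<and> (\<forall>i<n. \<forall>b<r. smooth_on M V' (R i b)) \<and>
      (\<forall>y\<in>V'. \<forall>a<r. \<forall>b<r. (\<Sum>i<n. P i a y * R i b y) = (if a = b then 1 else 0))"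
    by (rule smooth_right_inverse[OF V(2,1), where P = "\<lambda>i b. P b i"]) (rule P, assumption, assumption, fact cols)
  then obtain V3 R' where V3: "openin (mtop M) V3" "x \<in> V3" "V3 \<subseteq> V"
    and PR': "\<forall>y\<in>V3. \<forall>a<r. \<forall>b<r. (\<Sum>i<n. P i a y * R' i b y) = (if a = b then 1 else 0)"
    by (elim exE conjE)
  define W where "W = V2 \<inter> V3"
  have W: "openin (mtop M) W" "x \<in> W" "W \<subseteq> V" "W \<subseteq> V2" "W \<subseteq> V3" using V2 V3 by (auto simp: W_def)
  define s where "s b y = lin_comb r (\<lambda>i. R i b y) (\<lambda>i. t i y)" for b y
  show thesis
  proof (rule that[OF W(1,2)])
    show "W \<subseteq> V0" "W \<subseteq> D" using W(3) V V1 by auto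
    show "\<forall>b<n. double_section M W (s b)"
    proof (intro allI impI)
      fix b assume b: "b < n"
      have "double_section M W (\<lambda>y. (\<lambda>f. \<Sum>i\<in>{..<r}. R i b y * fst (t i y) f, \<lambda>v. \<Sum>i\<in>{..<r}. R i b y * snd (t i y) v))"
        by (rule double_section_sum[OF W(1)])
          (use b R double_section_subset[OF t W(1,3)] smooth_on_subset[OF _ W(1,4)] in auto)
      then show "double_section M W (s b)" by (simp add: s_def[abs_def] lin_comb_def)
    qed
    show "\<forall>y\<in>W. \<forall>b<n. s b y \<in> L y" using Ly W(3) by (auto simp: s_def)
    show "\<forall>y\<in>W. \<forall>a<n. \<forall>b<n. lag_coord m a y (s b y) = (if a = b then 1 else 0)"
    proof (intro ballI allI impI)
      fix y a b assume y: "y \<in> W" and ab: "a < n" "b < n"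
      have "lag_coord m a y (s b y) = (\<Sum>i<r. P a i y * R i b y)" by (simp add: s_def lag_coord_lin_comb P_def mult.commute)
      then show "lag_coord m a y (s b y) = (if a = b then 1 else 0)" using PR y W(4) ab by auto
    qed
    show "\<forall>y\<in>W. \<forall>e\<in>L y. (\<forall>a<n. lag_coord m a y e = 0) \<longrightarrow> e = (\<lambda>_. 0, \<lambda>_. 0)"
    proof (intro ballI impI)
      fix y e assume y: "y \<in> W" and e: "e \<in> L y" and z: "\<forall>a<n. lag_coord m a y e = 0"
      obtain c where c: "e = lin_comb r c (\<lambda>i. t i y)" using e Ly W(3) y by blast
      have "c j = 0" if j: "j < r" for j
      proof -
        have y3: "y \<in> V3" using y W(5) by blast
        have "c j = (\<Sum>i<r. if i = j then c i else 0)" using j by simp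
        also have "\<dots> = (\<Sum>i<r. c i * (\<Sum>b<n. P b i y * R' b j y))"
          by (rule sum.cong) (use PR' y3 j in auto)
        also have "\<dots> = (\<Sum>b<n. (\<Sum>i<r. c i * P b i y) * R' b j y)"
          unfolding sum_distrib_left sum_distrib_right by (subst sum.swap) (simp add: mult.assoc)
        also have "\<dots> = 0" using z by (simp add: c lag_coord_lin_comb P_def)
        finally show ?thesis .
      qed
      then show "e = (\<lambda>_. 0, \<lambda>_. 0)" by (simp add: c lin_comb_def)
    qed
  qed
qed

text \<open>Translation, and the transposition of the coordinates \<open>i\<close> and \<open>m\<close>. The case
  \<open>i = m\<close> is pure translation and makes sense in dimension zero, too.\<close>

lemma centered:
  assumes x: "x \<in> D" and im: "i = m \<or> (i < n \<and> m < n)"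
  obtains \<psi>' \<kappa>' where "coords M D \<psi>' \<kappa>'" "\<psi>' x = (\<lambda>_. 0)" "m < n \<Longrightarrow> \<forall>y\<in>D. \<psi>' y m = \<psi> y i - \<psi> x i"
proof -
  \<comment> \<open>the transposition of \<open>i\<close> and \<open>m\<close>\<close>
  define \<sigma> where "\<sigma> j = (if j = i then m else if j = m then i else j)" for j
  have \<sigma>\<sigma>: "\<sigma> (\<sigma> j) = j" for j by (simp add: \<sigma>_def)
  have \<sigma>n: "\<sigma> j < n" if "j < n" for j using that im by (auto simp: \<sigma>_def)
  define F where "F z = (\<lambda>j. if j < n then z (\<sigma> j) - \<psi> x (\<sigma> j) else 0)" for z
  define G where "G w = (\<lambda>j. if j < n then w (\<sigma> j) + \<psi> x j else 0)" for w
  have GF: "G (F z) = z" if "z \<in> \<psi> ` D" for z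
    using that psi_euclid by (auto simp: F_def G_def fun_eq_iff \<sigma>\<sigma> \<sigma>n euclid_def)
  have FG: "F (G w) = w" if "w \<in> euclid n" for w
    using that by (auto simp: F_def G_def fun_eq_iff \<sigma>\<sigma> \<sigma>n euclid_def)
  have E: "openin (Euclidean_space n) (euclid n)" by (simp add: Euclidean_space_eq)
  have o: "openin (Euclidean_space n) (\<psi> ` D)" by (rule img_open[OF order_refl D])
  have Fs: "Cinf_on n W (\<lambda>z. F z j)" if W: "openin (Euclidean_space n) W" "j < n" for j W
    using Cinf_add[OF W(1) Cinf_coord[OF W(1), of "\<sigma> j"] Cinf_const[OF W(1), of "- \<psi> x (\<sigma> j)"]] W(2)
    by (simp add: F_def)
  have Gs: "Cinf_on n W (\<lambda>z. G z j)" if W: "openin (Euclidean_space n) W" "j < n" for j W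
    using Cinf_add[OF W(1) Cinf_coord[OF W(1), of "\<sigma> j"] Cinf_const[OF W(1), of "\<psi> x j"]] W(2)
    by (simp add: G_def)
  have img: "F ` \<psi> ` D = {w \<in> euclid n. G w \<in> \<psi> ` D}"
  proof (intro equalityI subsetI)
    fix w assume "w \<in> {w \<in> euclid n. G w \<in> \<psi> ` D}"
    then show "w \<in> F ` \<psi> ` D" using FG[of w] by (metis (no_types, lifting) imageI mem_Collect_eq)
  next
    fix w assume "w \<in> F ` \<psi> ` D"
    then obtain z where z: "z \<in> \<psi> ` D" "w = F z" by blast
    then show "w \<in> {w \<in> euclid n. G w \<in> \<psi> ` D}" using GF[OF z(1)] by (auto simp: F_def euclid_def)
  qed
  have T: "openin (Euclidean_space n) (F ` \<psi> ` D)"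
    unfolding img by (rule openin_E_preimage[OF E o Gs[OF E]]) (auto simp: G_def euclid_def)
  have "\<kappa> ` \<psi> ` D = D" using inv by force
  then have "coords M D (\<lambda>y. F (\<psi> y)) (\<lambda>w. \<kappa> (G w))"
    using coords_compose[OF order_refl o T GF Fs[OF o] Gs[OF T]] by simp
  then show thesis
    by (rule that) (auto simp: F_def \<sigma>_def)
qed

lemma shrink_to_cube:
  assumes x: "x \<in> V" and V: "V \<subseteq> D" "openin (mtop M) V" and x0: "\<psi> x = (\<lambda>_. 0)"
  obtains \<rho> U where "\<rho> > 0" "U \<subseteq> V" "x \<in> U" "openin (mtop M) U" "\<psi> ` U = cube n (\<lambda>_. 0) \<rho>" "coords M U \<psi> \<kappa>"
proof -
  have "(\<lambda>_. 0) \<in> \<psi> ` V" using x x0 by (metis imageI)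
  then obtain r where r: "r > 0" "cube n (\<lambda>_. 0) r \<subseteq> \<psi> ` V" by (rule openin_E_cube[OF img_open[OF V]])
  let ?C = "cube n (\<lambda>_. 0) r"
  have CD: "?C \<subseteq> \<psi> ` D" using r(2) V(1) by blast
  have sub: "\<kappa> ` ?C \<subseteq> V" using r(2) kappa_mem[OF V(1)] by blast
  have oU: "openin (mtop M) (\<kappa> ` ?C)" by (rule kappa_open[OF CD openin_cube])
  have "\<psi> x \<in> ?C" unfolding x0 by (rule cube_self[OF _ r(1)]) (simp add: euclid_def)
  then have "x \<in> \<kappa> ` ?C" using inv[of x] x V(1) by (metis imageI subsetD)
  then show thesis
    by (rule that[OF r(1) sub _ oU kappa_image(1)[OF CD] coords_restrict[OF kappa_image(2)[OF CD] oU]])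
qed

text \<open>An element of \<open>L\<^sub>x\<close> in the Lagrangian spanned by \<open>\<partial>\<^sub>a\<close>
  (\<open>a < m\<close>) and \<open>d\<psi>\<^sub>m\<close> pairs to zero with the line spanned by
  \<open>k\<close>. As \<open>k\<close> has nonzero last coordinate, its covector part vanishes. So the
  element lies on the line, and its last coordinate vanishes.\<close>

lemma nondeg_line:
  assumes S: "S = orthogonal_space M x S" and x: "x \<in> D" and n: "n = Suc m"
    and k: "(k, \<lambda>_. 0) \<in> S" "k (\<lambda>y. \<psi> y m) \<noteq> 0"
    and line: "\<And>u. (u, \<lambda>_. 0) \<in> S \<Longrightarrow> \<exists>c. u = (\<lambda>f. c * k f)"
    and e: "e \<in> S" "\<And>a. a < n \<Longrightarrow> lag_coord m a x e = 0"
  shows "e = (\<lambda>_. 0, \<lambda>_. 0)"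
proof -
  have memS: "e \<in> orthogonal_space M x S" if "e \<in> S" for e using that by (subst (asm) S)
  have eT: "fst e \<in> tangent_space M x" "snd e \<in> cotangent_space M x" and kT: "k \<in> tangent_space M x"
    using memS[OF e(1)] memS[OF k(1)] by (auto simp: orthogonal_space_def double_space_def)
  have z: "snd e (coord_field a x) = 0" if "a < m" for a using e(2)[of a] that n by (simp add: lag_coord_def)
  have um: "fst e (\<lambda>y. \<psi> y m) = 0" using e(2)[of m] n by (simp add: lag_coord_def)
  have "pairing e (k, \<lambda>_. 0) = 0" using memS[OF e(1)] k(1) by (simp add: orthogonal_space_def)
  then have "snd e k = 0" by (simp add: pairing_def)
  then have "k (\<lambda>y. \<psi> y m) * snd e (coord_field m x) = 0"
    using cot_expand[OF eT(2) kT x] z n by simp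
  then have zm: "snd e (coord_field m x) = 0" using k(2) by simp
  have s0: "snd e = (\<lambda>_. 0)"
    by (rule cot_eqI[OF eT(2) cotangent_zero x]) (use z zm n in \<open>auto simp: less_Suc_eq\<close>)
  then have "(fst e, \<lambda>_. 0) \<in> S" using e(1) by (metis prod.collapse)
  then obtain c where c: "fst e = (\<lambda>f. c * k f)" using line by blast
  then have "c = 0" using um k(2) by simp
  then have "fst e = (\<lambda>_. 0)" using c by simp
  then show ?thesis using s0 by (simp add: prod_eq_iff)
qed

end

section \<open>Charts adapted to a Dirac structure\<close>

text \<open>Coordinates on a cube in which \<open>L \<inter> TM\<close> is spanned by the coordinate fields
  \<open>\<partial>\<^sub>b\<close> with \<open>b \<ge> m\<close>. The frame \<open>s\<close> of
  \<open>L\<close> is dual to the coordinate Lagrangian of \<open>lag_coord\<close>.\<close>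

locale dirac_chart = coords M D \<psi> \<kappa> for M :: "'a manifold" and D \<psi> \<kappa> +
  fixes L :: "'a \<Rightarrow> 'a dvec set" and m :: nat and \<rho> :: real and s :: "nat \<Rightarrow> 'a \<Rightarrow> 'a dvec"
  assumes \<rho>: "\<rho> > 0" and cube: "\<psi> ` D = cube (mdim M) (\<lambda>_. 0) \<rho>" and m: "m \<le> mdim M"
    and dirac: "local_dirac D L"
    and frame: "b < mdim M \<Longrightarrow> double_section M D (s b)"
    and frame_mem: "y \<in> D \<Longrightarrow> b < mdim M \<Longrightarrow> s b y \<in> L y"
    and frame_dual: "y \<in> D \<Longrightarrow> a < mdim M \<Longrightarrow> b < mdim M \<Longrightarrow> lag_coord m a y (s b y) = (if a = b then 1 else 0)"
    and frame_kernel: "y \<in> D \<Longrightarrow> m \<le> b \<Longrightarrow> b < mdim M \<Longrightarrow> s b y = (coord_field b y, \<lambda>_. 0)"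

context manifold begin

lemma local_dirac_subset:
  assumes L: "local_dirac V0 L" and V: "openin (mtop M) V" "V \<subseteq> V0"
  shows "local_dirac V L"
  unfolding local_dirac_def
proof (intro conjI ballI allI impI V(1))
  show "L y = orthogonal_space M y (L y)" if "y \<in> V" for y using local_diracD(2)[OF L] V that by blast
  show "dorfman M s t y \<in> L y"
    if "W \<subseteq> V" "double_section M W s" "double_section M W t" "\<forall>y\<in>W. s y \<in> L y \<and> t y \<in> L y" "y \<in> W" for W s t y
    by (rule local_diracD(3)[OF L _ that(2,3) _ _ that(5)]) (use that V in auto)
  fix x assume x: "x \<in> V"
  then have x0: "x \<in> V0" using V by blast
  obtain W r s where W: "x \<in> W" "W \<subseteq> V0" "openin (mtop M) W" "\<forall>i<r. double_section M W (s i)"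
        and fr: "\<forall>y\<in>W. L y = range (\<lambda>c. lin_comb r c (\<lambda>i. s i y)) \<and>
                (\<forall>c. lin_comb r c (\<lambda>i. s i y) = (\<lambda>_. 0, \<lambda>_. 0) \<longrightarrow> (\<forall>i<r. c i = 0))"
    using local_diracD(4)[OF L x0] by (elim exE conjE)
  have o: "openin (mtop M) (W \<inter> V)" using W(3) V(1) by blast
  have "\<forall>i<r. double_section M (W \<inter> V) (s i)" using W(4) double_section_subset[OF _ o Int_lower1] by blast
  then show "\<exists>W r s. x \<in> W \<and> W \<subseteq> V \<and> openin (mtop M) W \<and> (\<forall>i<r. double_section M W (s i)) \<and>
        (\<forall>y\<in>W. L y = range (\<lambda>c. lin_comb r c (\<lambda>i. s i y)) \<and>
                (\<forall>c. lin_comb r c (\<lambda>i. s i y) = (\<lambda>_. 0, \<lambda>_. 0) \<longrightarrow> (\<forall>i<r. c i = 0)))"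
    using x W(1) o fr by (intro exI[of _ "W \<inter> V"] exI[of _ r] exI[of _ s]) auto
qed

text \<open>The case \<open>m = n\<close>: trivial intersection with \<open>T\<^sub>xM\<close> is transversality to
  the Lagrangian spanned by all coordinate vectors.\<close>

lemma dirac_chart_graph:
  assumes L: "local_dirac V0 L" and x: "x \<in> V0" and k: "\<And>u. (u, \<lambda>_. 0) \<in> L x \<Longrightarrow> u = (\<lambda>_. 0)"
  shows "\<exists>D \<psi> \<kappa> m \<rho> s. dirac_chart M D \<psi> \<kappa> L m \<rho> s \<and> x \<in> D \<and> D \<subseteq> V0"
proof -
  have xt: "x \<in> topspace (mtop M)" using local_diracD(1)[OF L] x openin_subset by blast
  then obtain D \<psi>0 \<kappa>0 where c: "coords M D \<psi>0 \<kappa>0" and xD: "x \<in> D" by (rule coords_at)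
  obtain \<psi> \<kappa> where c1: "coords M D \<psi> \<kappa>" and x0: "\<psi> x = (\<lambda>_. 0)"
    by (rule coords.centered[OF c xD, of 0 0]) simp_all
  interpret c: coords M D \<psi> \<kappa> by (rule c1)
  have nd: "e = (\<lambda>_. 0, \<lambda>_. 0)" if e: "e \<in> L x" and z: "\<And>a. a < c.n \<Longrightarrow> c.lag_coord c.n a x e = 0" for e
  proof -
    have "e \<in> orthogonal_space M x (L x)" using e local_diracD(2)[OF L x] by simp
    then have "snd e \<in> cotangent_space M x" by (auto simp: orthogonal_space_def double_space_def)
    then have s0: "snd e = (\<lambda>_. 0)"
      by (rule c.cot_eqI[OF _ cotangent_zero xD]) (use z in \<open>simp add: c.lag_coord_def\<close>)
    then have "(fst e, \<lambda>_. 0) \<in> L x" using e by (metis prod.collapse)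
    then show ?thesis using k s0 by (simp add: prod_eq_iff)
  qed
  obtain V s where V: "openin (mtop M) V" "x \<in> V" "V \<subseteq> V0" "V \<subseteq> D" and s: "\<forall>b<c.n. double_section M V (s b)"
    "\<forall>y\<in>V. \<forall>b<c.n. s b y \<in> L y" "\<forall>y\<in>V. \<forall>a<c.n. \<forall>b<c.n. c.lag_coord c.n a y (s b y) = (if a = b then 1 else 0)"
    "\<forall>y\<in>V. \<forall>e\<in>L y. (\<forall>a<c.n. c.lag_coord c.n a y e = 0) \<longrightarrow> e = (\<lambda>_. 0, \<lambda>_. 0)"
    by (rule c.adapted_frame[OF L x xD nd])
  obtain \<rho> U where U: "\<rho> > 0" "U \<subseteq> V" "x \<in> U" "openin (mtop M) U" "\<psi> ` U = cube c.n (\<lambda>_. 0) \<rho>" and cU: "coords M U \<psi> \<kappa>"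
    by (rule c.shrink_to_cube[OF V(2,4,1) x0])
  interpret U: coords M U \<psi> \<kappa> by (rule cU)
  have "dirac_chart M U \<psi> \<kappa> L c.n \<rho> s"
  proof (unfold_locales)
    show "local_dirac U L" by (rule local_dirac_subset[OF L U(4)]) (use U V in blast)
    show "double_section M U (s b)" if "b < c.n" for b
      using double_section_subset[OF _ U(4,2)] s(1) that by blast
    show "s b y \<in> L y" if "y \<in> U" "b < c.n" for y b using s(2) U(2) that by blast
    show "U.lag_coord c.n a y (s b y) = (if a = b then 1 else 0)" if "y \<in> U" "a < c.n" "b < c.n" for y a b
      using s(3) U(2) that by blast
  qed (use U in auto)
  then show ?thesis using U V by blast
qed

text \<open>The case \<open>m = n - 1\<close>. An adapted frame is used twice: in the first coordinates its last
  member is a vector field spanning \<open>L \<inter> TM\<close>; after this field has been straightened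
  by a flow box, the adapted frame of the new coordinates is the one sought.\<close>

lemma dirac_chart_line:
  assumes L: "local_dirac V0 L" and x: "x \<in> V0" and k: "(k, \<lambda>_. 0) \<in> L x" "k \<noteq> (\<lambda>_. 0)"
    and line: "\<And>u. (u, \<lambda>_. 0) \<in> L x \<Longrightarrow> \<exists>c. u = (\<lambda>f. c * k f)"
  shows "\<exists>D \<psi> \<kappa> m \<rho> s. dirac_chart M D \<psi> \<kappa> L m \<rho> s \<and> x \<in> D \<and> D \<subseteq> V0"
proof -
  have xt: "x \<in> topspace (mtop M)" using local_diracD(1)[OF L] x openin_subset by blast
  then obtain D \<psi>0 \<kappa>0 where c0: "coords M D \<psi>0 \<kappa>0" and xD: "x \<in> D" by (rule coords_at)
  interpret c0: coords M D \<psi>0 \<kappa>0 by (rule c0)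
  have orth: "L y = orthogonal_space M y (L y)" if "y \<in> V0" for y by (rule local_diracD(2)[OF L that])
  have memL: "e \<in> orthogonal_space M y (L y)" if "e \<in> L y" "y \<in> V0" for e y
    using that orth by blast
  have kT: "k \<in> tangent_space M x" using memL[OF k(1) x] by (simp add: orthogonal_space_def double_space_def)
  obtain i where i: "i < c0.n" "k (\<lambda>y. \<psi>0 y i) \<noteq> 0"
    using c0.tan_eqI[OF kT tangent_zero xD] k(2) by blast
  define m where "m = c0.n - 1"
  have n: "mdim M = Suc m" using i by (simp add: m_def)
  have mn: "m < mdim M" by (simp add: n)
  obtain \<psi>1 \<kappa>1 where c1: "coords M D \<psi>1 \<kappa>1" and x1: "\<psi>1 x = (\<lambda>_. 0)" and p1: "\<forall>y\<in>D. \<psi>1 y m = \<psi>0 y i - \<psi>0 x i"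
    using c0.centered[OF xD, of i m] i(1) mn by metis
  interpret c1: coords M D \<psi>1 \<kappa>1 by (rule c1)
  have "k (\<lambda>y. \<psi>1 y m) = k (\<lambda>y. \<psi>0 y i - \<psi>0 x i)"
    by (rule tan_local[OF kT c0.D xD]) (use p1 in blast)
  also have "\<dots> = k (\<lambda>y. \<psi>0 y i)"
    using tan_diff[OF kT c0.smooth_at_psi[OF xD] smooth_at_const[OF xt]] tan_const[OF xt kT] by simp
  finally have k1: "k (\<lambda>y. \<psi>1 y m) \<noteq> 0" using i(2) by simp
  obtain V s where V: "openin (mtop M) V" "x \<in> V" "V \<subseteq> V0" "V \<subseteq> D" and s: "\<forall>b<c1.n. double_section M V (s b)"
    "\<forall>y\<in>V. \<forall>b<c1.n. s b y \<in> L y" "\<forall>y\<in>V. \<forall>a<c1.n. \<forall>b<c1.n. c1.lag_coord m a y (s b y) = (if a = b then 1 else 0)"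
    "\<forall>y\<in>V. \<forall>e\<in>L y. (\<forall>a<c1.n. c1.lag_coord m a y e = 0) \<longrightarrow> e = (\<lambda>_. 0, \<lambda>_. 0)"
    by (rule c1.adapted_frame[OF L x xD c1.nondeg_line[OF orth[OF x] xD n k(1) k1 line]])
  define kf where "kf y = fst (s m y)" for y
  have kfv: "vector_field M V kf"
    unfolding kf_def[abs_def] using s(1) mn c1.double_sectionD(1) by blast
  have kfT: "kf y \<in> tangent_space M y" if "y \<in> V" for y by (rule vf_tangent[OF kfv that])
  have kfm: "kf y (\<lambda>y. \<psi>1 y m) = 1" if "y \<in> V" for y
    using s(3)[rule_format, OF that mn mn] by (simp add: c1.lag_coord_def kf_def)
  \<comment> \<open>the last frame section has no covector part, because it pairs to zero with itself\<close>
  have kfL: "(kf y, \<lambda>_. 0) \<in> L y" if y: "y \<in> V" for y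
  proof -
    have yD: "y \<in> D" and y0: "y \<in> V0" using y V by auto
    have mem: "s m y \<in> L y" using s(2) y mn by blast
    have sc: "snd (s m y) \<in> cotangent_space M y" using memL[OF mem y0] by (auto simp: orthogonal_space_def double_space_def)
    have z: "snd (s m y) (c1.coord_field a y) = 0" if "a < m" for a
      using s(3)[rule_format, OF y _ mn, of a] that n by (simp add: c1.lag_coord_def)
    have "pairing (s m y) (s m y) = 0" using memL[OF mem y0] mem by (simp add: orthogonal_space_def)
    then have "snd (s m y) (kf y) = 0" by (simp add: pairing_def kf_def)
    then have "snd (s m y) (c1.coord_field m y) = 0"
      using c1.cot_expand[OF sc kfT[OF y] yD] z n kfm[OF y] by simp
    then have "snd (s m y) = (\<lambda>_. 0)"
      by (intro c1.cot_eqI[OF sc cotangent_zero yD]) (use z n in \<open>auto simp: less_Suc_eq\<close>)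
    then show ?thesis using mem by (metis kf_def prod.collapse)
  qed
  define K where "K b z = kf (\<kappa>1 z) (\<lambda>y. \<psi>1 y b)" for b z
  have oV: "openin (Euclidean_space c1.n) (\<psi>1 ` V)" by (rule c1.img_open[OF V(4,1)])
  have KC: "Cinf_on c1.n (\<psi>1 ` V) (K b)" for b
    unfolding K_def[abs_def]
    using c1.smooth_iff[OF V(4,1)] vf_smooth[OF kfv order_refl c1.smooth_psi[OF V(4,1)]] by simp
  have Km: "K m z = 1" if "z \<in> \<psi>1 ` V" for z
    unfolding K_def by (rule kfm[OF c1.kappa_mem[OF V(4) that]])
  have o0: "(\<lambda>_. 0) \<in> \<psi>1 ` V" using V(2) x1 by (metis imageI)
  have "\<exists>F G r. r > 0 \<and> G ` cube c1.n (\<lambda>_. 0) r \<subseteq> \<psi>1 ` V \<and> openin (Euclidean_space c1.n) (G ` cube c1.n (\<lambda>_. 0) r) \<and>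
    (\<forall>i<c1.n. Cinf_on c1.n (cube c1.n (\<lambda>_. 0) r) (\<lambda>y. G y i)) \<and>
    (\<forall>i<c1.n. Cinf_on c1.n (G ` cube c1.n (\<lambda>_. 0) r) (\<lambda>z. F z i)) \<and>
    (\<forall>y\<in>cube c1.n (\<lambda>_. 0) r. F (G y) = y) \<and> G (\<lambda>_. 0) = (\<lambda>_. 0) \<and>
    (\<forall>y\<in>cube c1.n (\<lambda>_. 0) r. \<forall>a<c1.n.
      (\<Sum>b<c1.n. partial_deriv b (\<lambda>z. F z a) (G y) * K b (G y)) = (if a = m then 1 else 0))"
    by (rule flow_box[OF n oV o0]) (rule KC, erule Km)
  then obtain F G r where r: "r > 0" and GV: "G ` cube c1.n (\<lambda>_. 0) r \<subseteq> \<psi>1 ` V" and oG: "openin (Euclidean_space c1.n) (G ` cube c1.n (\<lambda>_. 0) r)"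
    and Gs': "\<forall>i<c1.n. Cinf_on c1.n (cube c1.n (\<lambda>_. 0) r) (\<lambda>y. G y i)"
    and Fs': "\<forall>i<c1.n. Cinf_on c1.n (G ` cube c1.n (\<lambda>_. 0) r) (\<lambda>z. F z i)"
    and FG': "\<forall>y\<in>cube c1.n (\<lambda>_. 0) r. F (G y) = y" and G0: "G (\<lambda>_. 0) = (\<lambda>_. 0)"
    and FK': "\<forall>y\<in>cube c1.n (\<lambda>_. 0) r. \<forall>a<c1.n.
      (\<Sum>b<c1.n. partial_deriv b (\<lambda>z. F z a) (G y) * K b (G y)) = (if a = m then 1 else 0)"
    by (elim exE conjE)
  have Gs: "Cinf_on c1.n (cube c1.n (\<lambda>_. 0) r) (\<lambda>y. G y i)"
    and Fs: "Cinf_on c1.n (G ` cube c1.n (\<lambda>_. 0) r) (\<lambda>z. F z i)" if "i < c1.n" for i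
    using Gs' Fs' that by simp_all
  have FG: "F (G y) = y" if "y \<in> cube c1.n (\<lambda>_. 0) r" for y using FG' that by simp
  have FK: "(\<Sum>b<c1.n. partial_deriv b (\<lambda>z. F z a) (G y) * K b (G y)) = (if a = m then 1 else 0)"
    if "y \<in> cube c1.n (\<lambda>_. 0) r" "a < c1.n" for y a using FK' that by simp
  let ?C = "cube c1.n (\<lambda>_. 0) r"
  let ?S = "G ` ?C"
  have SD: "?S \<subseteq> \<psi>1 ` D" using GV V(4) by blast
  have FS: "F ` ?S = ?C" using FG by force
  define D2 where "D2 = \<kappa>1 ` ?S"
  define \<psi>2 where "\<psi>2 = (\<lambda>y. F (\<psi>1 y))"
  define \<kappa>2 where "\<kappa>2 = (\<lambda>w. \<kappa>1 (G w))"
  have c2: "coords M D2 \<psi>2 \<kappa>2"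
    unfolding D2_def \<psi>2_def \<kappa>2_def
  proof (rule c1.coords_compose[OF SD oG])
    show "openin (Euclidean_space c1.n) (F ` ?S)" unfolding FS by (rule openin_cube)
    show "G (F z) = z" if "z \<in> ?S" for z using that FG by auto
    show "Cinf_on c1.n (F ` ?S) (\<lambda>w. G w i)" if "i < c1.n" for i unfolding FS by (rule Gs[OF that])
  qed (rule Fs)
  interpret c2: coords M D2 \<psi>2 \<kappa>2 by (rule c2)
  have D2V: "D2 \<subseteq> V" unfolding D2_def using GV c1.kappa_mem[OF V(4)] by blast
  have C0: "(\<lambda>_. 0) \<in> ?C" by (rule cube_self[OF _ r]) (simp add: euclid_def)
  have xD2: "x \<in> D2"
  proof -
    have "\<psi>1 x \<in> ?S" using C0 G0 x1 by (metis imageI)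
    then show ?thesis unfolding D2_def using c1.inv[OF xD] by (metis imageI)
  qed
  have x2: "\<psi>2 x = (\<lambda>_. 0)" using FG[OF C0] by (simp add: \<psi>2_def x1 G0)
  have kf2: "kf y (\<lambda>y. \<psi>2 y a) = (if a = m then 1 else 0)" if y: "y \<in> D2" and a: "a < c1.n" for y a
  proof -
    have yV: "y \<in> V" and yD: "y \<in> D" using y D2V V by auto
    have yS: "\<psi>1 y \<in> ?S" using y c1.kappa_image(1)[OF SD] by (metis D2_def imageI)
    then obtain w where w: "w \<in> ?C" "\<psi>1 y = G w" by blast
    have sa: "smooth_at M y (\<lambda>y. \<psi>2 y a)" by (rule c2.smooth_at_psi[OF y])
    have "c1.coord_field b y (\<lambda>y. \<psi>2 y a) = partial_deriv b (\<lambda>z. F z a) (G w)" if b: "b < c1.n" for b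
    proof -
      have "partial_deriv b (\<lambda>z. \<psi>2 (\<kappa>1 z) a) (\<psi>1 y) = partial_deriv b (\<lambda>z. F z a) (\<psi>1 y)"
        by (rule partial_deriv_cong[OF oG _ yS b]) (use c1.psi_kappa SD in \<open>auto simp: \<psi>2_def dest: subsetD\<close>)
      then show ?thesis using sa w(2) by (simp add: c1.coord_field_def)
    qed
    moreover have "kf y (\<lambda>y. \<psi>1 y b) = K b (G w)" for b
      using w(2) c1.inv[OF yD] by (simp add: K_def)
    ultimately show ?thesis
      using c1.tan_expand[OF kfT[OF yV] yD sa] FK[OF w(1) a] by (simp add: mult.commute)
  qed
  have kfbas: "kf y = c2.coord_field m y" if y: "y \<in> D2" for y
  proof (rule c2.tan_eqI[OF _ c2.coord_field_tangent[OF mn y] y])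
    show "kf y \<in> tangent_space M y" using kfT D2V y by blast
    show "kf y (\<lambda>y. \<psi>2 y a) = c2.coord_field m y (\<lambda>y. \<psi>2 y a)" if "a < c1.n" for a
      using kf2[OF y that] c2.coord_field_psi[OF mn y] by auto
  qed
  have k2: "k (\<lambda>y. \<psi>2 y m) \<noteq> 0"
  proof -
    obtain c where "kf x = (\<lambda>f. c * k f)" using line[OF kfL[OF V(2)]] by blast
    then show ?thesis using kf2[OF xD2 mn] by auto
  qed
  obtain W t where W: "openin (mtop M) W" "x \<in> W" "W \<subseteq> V0" "W \<subseteq> D2" and t: "\<forall>b<c1.n. double_section M W (t b)"
    "\<forall>y\<in>W. \<forall>b<c1.n. t b y \<in> L y" "\<forall>y\<in>W. \<forall>a<c1.n. \<forall>b<c1.n. c2.lag_coord m a y (t b y) = (if a = b then 1 else 0)"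
    and tdet: "\<forall>y\<in>W. \<forall>e\<in>L y. (\<forall>a<c1.n. c2.lag_coord m a y e = 0) \<longrightarrow> e = (\<lambda>_. 0, \<lambda>_. 0)"
    by (rule c2.adapted_frame[OF L x xD2 c2.nondeg_line[OF orth[OF x] xD2 n k(1) k2 line]])
  have tm: "t m y = (c2.coord_field m y, \<lambda>_. 0)" if y: "y \<in> W" for y
  proof -
    have yV: "y \<in> V" and yD2: "y \<in> D2" and y0: "y \<in> V0" using y W D2V V by auto
    have "(c2.coord_field m y, \<lambda>_. 0) \<in> L y" using kfL[OF yV] kfbas[OF yD2] by simp
    moreover have "t m y \<in> L y" using t(2) y mn by blast
    ultimately have "(\<lambda>f. 1 * fst (t m y) f + (- 1) * c2.coord_field m y f, \<lambda>v. 1 * snd (t m y) v + (- 1) * 0) \<in> L y"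
      by (intro orthogonal_lin[OF orth[OF y0]]) simp_all
    moreover have "c2.lag_coord m a y (\<lambda>f. 1 * fst (t m y) f + (- 1) * c2.coord_field m y f, \<lambda>v. 1 * snd (t m y) v + (- 1) * 0) = 0"
      if a: "a < c1.n" for a
      using t(3)[rule_format, OF y a mn] a n c2.coord_field_psi[OF mn yD2, of a]
      by (auto simp: c2.lag_coord_def less_Suc_eq split: if_splits)
    ultimately have "(\<lambda>f. 1 * fst (t m y) f + (- 1) * c2.coord_field m y f, \<lambda>v. 1 * snd (t m y) v + (- 1) * 0) = (\<lambda>_. 0, \<lambda>_. 0)"
      using tdet y by blast
    then show ?thesis by (auto simp: prod_eq_iff fun_eq_iff)
  qed
  obtain \<rho> U where U: "\<rho> > 0" "U \<subseteq> W" "x \<in> U" "openin (mtop M) U" "\<psi>2 ` U = cube c1.n (\<lambda>_. 0) \<rho>" and cU: "coords M U \<psi>2 \<kappa>2"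
    by (rule c2.shrink_to_cube[OF W(2,4,1) x2])
  interpret U: coords M U \<psi>2 \<kappa>2 by (rule cU)
  have "dirac_chart M U \<psi>2 \<kappa>2 L m \<rho> t"
  proof (unfold_locales)
    show "local_dirac U L" by (rule local_dirac_subset[OF L U(4)]) (use U W in blast)
    show "double_section M U (t b)" if "b < c1.n" for b
      using double_section_subset[OF _ U(4,2)] t(1) that by blast
    show "t b y \<in> L y" if "y \<in> U" "b < c1.n" for y b using t(2) U(2) that by blast
    show "U.lag_coord m a y (t b y) = (if a = b then 1 else 0)" if "y \<in> U" "a < c1.n" "b < c1.n" for y a b
      using t(3) U(2) that by blast
    show "t b y = (U.coord_field b y, \<lambda>_. 0)" if "y \<in> U" "m \<le> b" "b < c1.n" for y b
    proof -
      have "b = m" using that n by simp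
      then show ?thesis using tm U(2) that(1) by auto
    qed
  qed (use U n in auto)
  then show ?thesis using U W by blast
qed

end

section \<open>Manifolds with a single chart\<close>

text \<open>Euclidean spaces of different dimension consist of functions on the same index set, so the inclusion of
  a coordinate subspace is the identity and restriction is all that happens.\<close>

lemma Ck_lower_dim:
  assumes W: "openin (Euclidean_space n) W" and W': "openin (Euclidean_space m) W'" "W' \<subseteq> W" and mn: "m \<le> n"
  shows "Ck_on n k W f \<Longrightarrow> Ck_on m k W' f"
proof (induction k arbitrary: f)
  case 0
  have "continuous_on W f" using 0 W by (simp only: Ck_0)
  then have "continuous_on W' f" using W'(2) by (rule continuous_on_subset)
  then show ?case using W'(1) by (simp only: Ck_0)
next
  case (Suc k)
  show ?case
  proof (rule Ck_SucI[OF W'(1), where g = "\<lambda>i. partial_deriv i f"])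
    show "continuous_on W' f" using Ck_continuous[OF W Suc.prems] W'(2) by (rule continuous_on_subset)
    show "((\<lambda>t. f (x(i := t))) has_real_derivative partial_deriv i f x) (at (x i))" if "i < m" "x \<in> W'" for i x
      by (rule Ck_SucD(1)[OF W Suc.prems]) (use that W' mn in auto)
    show "Ck_on m k W' (partial_deriv i f)" if "i < m" for i
      by (rule Suc.IH[OF Ck_SucD(2)[OF W Suc.prems]]) (use that mn in auto)
  qed
qed

lemma single_chart_manifold:
  assumes T: "Hausdorff_space T" "second_countable T"
    and o: "openin (Euclidean_space m) (\<psi> ` topspace T)"
    and h: "homeomorphic_maps T (subtopology (Euclidean_space m) (\<psi> ` topspace T)) \<psi> \<kappa>"
  shows "smooth_manifold \<lparr>mtop = T, mdim = m, charts = {(topspace T, \<psi>)}\<rparr>" (is "smooth_manifold ?N")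
    and "coords \<lparr>mtop = T, mdim = m, charts = {(topspace T, \<psi>)}\<rparr> (topspace T) \<psi> \<kappa>"
proof -
  have inj: "inj_on \<psi> (topspace T)"
    using h by (metis homeomorphic_maps_map homeomorphic_imp_injective_map)
  have "Cinf_on m (\<psi> ` topspace T) (\<lambda>z. \<psi> (inv_into (topspace T) \<psi> z) i)" for i
    by (subst Cinf_on_cong[OF o, of _ "\<lambda>z. z i"]) (auto simp: f_inv_into_f Cinf_coord[OF o])
  moreover have "homeomorphic_map T (subtopology (Euclidean_space m) (\<psi> ` topspace T)) \<psi>"
    using h homeomorphic_maps_map by blast
  ultimately show sm: "smooth_manifold ?N"
    using T o by (auto simp: smooth_manifold_def subtopology_topspace)
  interpret N: manifold ?N by (unfold_locales) (rule sm)
  interpret c: coords ?N "topspace T" \<psi> "inv_into (topspace T) \<psi>"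
    by (rule N.coords_of_chart) simp
  have \<kappa>: "\<kappa> (\<psi> y) = y" if "y \<in> topspace T" for y
    using h that by (simp add: homeomorphic_maps_def)
  show "coords ?N (topspace T) \<psi> \<kappa>"
  proof (unfold_locales)
    show "openin (mtop ?N) (topspace T)" by (rule c.D)
    show "openin (mtop ?N) V \<longleftrightarrow> openin (Euclidean_space (mdim ?N)) (\<psi> ` V)" if "V \<subseteq> topspace T" for V
      by (rule c.open_iff[OF that])
    fix V f assume V: "V \<subseteq> topspace T" "openin (mtop ?N) V"
    have "Cinf_on (mdim ?N) (\<psi> ` V) (\<lambda>z. f (inv_into (topspace T) \<psi> z)) \<longleftrightarrow> Cinf_on (mdim ?N) (\<psi> ` V) (\<lambda>z. f (\<kappa> z))"
    proof (rule Cinf_on_cong[OF c.img_open[OF V]])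
      fix z assume "z \<in> \<psi> ` V"
      then obtain y where "y \<in> V" "z = \<psi> y" by blast
      then have "y \<in> topspace T" "z = \<psi> y" using V(1) by auto
      then show "f (inv_into (topspace T) \<psi> z) = f (\<kappa> z)" using \<kappa> inj by simp
    qed
    then show "smooth_on ?N V f \<longleftrightarrow> Cinf_on (mdim ?N) (\<psi> ` V) (\<lambda>z. f (\<kappa> z))"
      using c.smooth_iff[OF V] by simp
  qed (rule \<kappa>)
qed

lemma (in coords) homeomorphic_maps_chart:
  "homeomorphic_maps (subtopology (mtop M) D) (subtopology (Euclidean_space n) (\<psi> ` D)) \<psi> \<kappa>"
  unfolding homeomorphic_maps_def
proof (intro conjI ballI)
  have tD: "topspace (subtopology (mtop M) D) = D" using D openin_subset by fastforce
  have tI: "topspace (subtopology (Euclidean_space n) (\<psi> ` D)) = \<psi> ` D"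
    using psi_euclid by (auto simp: Euclidean_space_eq)
  have "continuous_map (subtopology (mtop M) D) (Euclidean_space n) \<psi>"
    unfolding continuous_map tD
  proof (intro conjI allI impI)
    show "\<psi> ` D \<subseteq> topspace (Euclidean_space n)" using psi_euclid by (auto simp: Euclidean_space_eq)
    fix U assume U: "openin (Euclidean_space n) U"
    have "{y \<in> D. \<psi> y \<in> U} = \<kappa> ` (\<psi> ` D \<inter> U)" using inv by force
    moreover have "openin (mtop M) (\<kappa> ` (\<psi> ` D \<inter> U))"
      by (rule kappa_open) (use U img_open[OF order_refl D] in auto)
    ultimately show "openin (subtopology (mtop M) D) {y \<in> D. \<psi> y \<in> U}"
      using D by (auto simp: openin_open_subtopology)
  qed
  then show "continuous_map (subtopology (mtop M) D) (subtopology (Euclidean_space n) (\<psi> ` D)) \<psi>"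
    by (simp add: continuous_map_in_subtopology tD)
  show "continuous_map (subtopology (Euclidean_space n) (\<psi> ` D)) (subtopology (mtop M) D) \<kappa>"
    using kappa_continuous inv by (auto simp: continuous_map_in_subtopology tI)
  show "\<kappa> (\<psi> y) = y" if "y \<in> topspace (subtopology (mtop M) D)" for y using that tD inv by auto
  show "\<psi> (\<kappa> z) = z" if "z \<in> topspace (subtopology (Euclidean_space n) (\<psi> ` D))" for z
    using that tI psi_kappa by auto
qed

section \<open>The coefficients of the Poisson bivector\<close>

context dirac_chart begin

lemma orth: "y \<in> D \<Longrightarrow> L y = orthogonal_space M y (L y)"
  by (rule local_diracD(2)[OF dirac])

lemma mem_orth: "y \<in> D \<Longrightarrow> e \<in> L y \<Longrightarrow> e \<in> orthogonal_space M y (L y)"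
  using orth by blast

lemma mem_double: "y \<in> D \<Longrightarrow> e \<in> L y \<Longrightarrow> fst e \<in> tangent_space M y \<and> snd e \<in> cotangent_space M y"
  by (drule (1) mem_orth) (auto simp: orthogonal_space_def double_space_def)

lemma isotropic: "y \<in> D \<Longrightarrow> e \<in> L y \<Longrightarrow> e' \<in> L y \<Longrightarrow> pairing e e' = 0"
  using mem_orth by (simp add: orthogonal_space_def)

text \<open>\<open>L\<close> is isotropic and contains \<open>\<partial>\<^sub>b\<close>.\<close>

lemma covector_vanishes:
  assumes y: "y \<in> D" and e: "e \<in> L y" and b: "m \<le> b" "b < n"
  shows "snd e (coord_field b y) = 0"
proof -
  have "(coord_field b y, \<lambda>_. 0) \<in> L y" using frame_mem[OF y b(2)] frame_kernel[OF y b] by simp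
  from isotropic[OF y e this] show ?thesis by (simp add: pairing_def)
qed

definition pi_coeff :: "nat \<Rightarrow> nat \<Rightarrow> 'a \<Rightarrow> real" where
  "pi_coeff a b y = fst (s a y) (\<lambda>y. \<psi> y b)"

text \<open>So the frame member \<open>s\<^sub>a\<close> is \<open>\<Sum>\<^sub>b \<pi>\<^sub>a\<^sub>b
  \<partial>\<^sub>b + d\<psi>\<^sub>a\<close>.\<close>

lemma frame_covector:
  assumes y: "y \<in> D" and a: "a < m" and v: "v \<in> tangent_space M y"
  shows "snd (s a y) v = v (\<lambda>y. \<psi> y a)"
proof -
  have an: "a < n" using a m by simp
  have coord_field: "snd (s a y) (coord_field c y) = (if c = a then 1 else 0)" if c: "c < n" for c
  proof (cases "c < m")
    case True then show ?thesis using frame_dual[OF y c an] by (simp add: lag_coord_def)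
  next
    case False
    then show ?thesis using covector_vanishes[OF y frame_mem[OF y an] _ c] a by auto
  qed
  have "snd (s a y) v = (\<Sum>c<n. v (\<lambda>y. \<psi> y c) * snd (s a y) (coord_field c y))"
    using cot_expand[OF _ v y] mem_double[OF y frame_mem[OF y an]] by blast
  also have "\<dots> = (\<Sum>c<n. if c = a then v (\<lambda>y. \<psi> y c) else 0)" by (rule sum.cong) (simp_all add: coord_field)
  finally show ?thesis using an by simp
qed

lemma frame_tangent: "y \<in> D \<Longrightarrow> a < n \<Longrightarrow> fst (s a y) \<in> tangent_space M y"
  using mem_double frame_mem by blast

lemma pi_coeff_skew: "y \<in> D \<Longrightarrow> a < m \<Longrightarrow> b < m \<Longrightarrow> pi_coeff a b y = - pi_coeff b a y"
proof -
  assume y: "y \<in> D" and ab: "a < m" "b < m"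
  have n: "a < n" "b < n" using ab m by auto
  have "pairing (s a y) (s b y) = 0" by (rule isotropic[OF y frame_mem[OF y n(1)] frame_mem[OF y n(2)]])
  then show ?thesis
    using frame_covector[OF y ab(1) frame_tangent[OF y n(2)]] frame_covector[OF y ab(2) frame_tangent[OF y n(1)]]
    by (simp add: pairing_def pi_coeff_def)
qed

lemma pi_coeff_smooth: "a < n \<Longrightarrow> smooth_on M D (pi_coeff a b)"
  unfolding pi_coeff_def[abs_def]
  by (rule vf_smooth[OF double_sectionD(1)[OF frame] order_refl smooth_psi[OF order_refl D]])

lemma frame_vector_0: "y \<in> D \<Longrightarrow> a < m \<Longrightarrow> m \<le> b \<Longrightarrow> b < n \<Longrightarrow> pi_coeff a b y = 0"
  using frame_dual[of y b a] m by (auto simp: lag_coord_def pi_coeff_def)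

text \<open>One direction pairs an element of \<open>L\<close> with the frame. Conversely, an element satisfying the
  equations pairs to zero with all elements of \<open>L\<close>, since these satisfy the equations too and
  \<open>\<pi>\<close> is skew; and \<open>L\<close> is its own orthogonal space.\<close>

lemma mem_L_iff:
  assumes y: "y \<in> D"
  shows "(u, \<xi>) \<in> L y \<longleftrightarrow> u \<in> tangent_space M y \<and> \<xi> \<in> cotangent_space M y \<and>
    (\<forall>b. m \<le> b \<longrightarrow> b < n \<longrightarrow> \<xi> (coord_field b y) = 0) \<and>
    (\<forall>b<m. u (\<lambda>y. \<psi> y b) = (\<Sum>a<m. pi_coeff a b y * \<xi> (coord_field a y)))" (is "?l \<longleftrightarrow> ?r u \<xi>")
proof -
  have split: "(\<Sum>c<n. F c) = (\<Sum>c<m. F c)" if "\<And>c. m \<le> c \<Longrightarrow> c < n \<Longrightarrow> F c = 0" for F :: "nat \<Rightarrow> real"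
    by (rule sum.mono_neutral_right) (use m that in auto)
  have nec: "?r u \<xi>" if e: "(u, \<xi>) \<in> L y" for u \<xi>
  proof (intro conjI allI impI)
    show u: "u \<in> tangent_space M y" and \<xi>: "\<xi> \<in> cotangent_space M y" using mem_double[OF y e] by auto
    show "\<xi> (coord_field b y) = 0" if "m \<le> b" "b < n" for b using covector_vanishes[OF y e that] by simp
    fix b assume b: "b < m"
    then have bn: "b < n" using m by simp
    have "pairing (u, \<xi>) (s b y) = 0" by (rule isotropic[OF y e frame_mem[OF y bn]])
    then have "\<xi> (fst (s b y)) + u (\<lambda>y. \<psi> y b) = 0"
      using frame_covector[OF y b u] by (simp add: pairing_def)
    moreover have "\<xi> (fst (s b y)) = (\<Sum>c<m. pi_coeff b c y * \<xi> (coord_field c y))"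
      unfolding cot_expand[OF \<xi> frame_tangent[OF y bn] y] pi_coeff_def[symmetric]
      by (rule split) (use covector_vanishes[OF y e] in simp)
    moreover have "(\<Sum>c<m. pi_coeff b c y * \<xi> (coord_field c y)) = - (\<Sum>c<m. pi_coeff c b y * \<xi> (coord_field c y))"
      unfolding sum_negf[symmetric] by (rule sum.cong) (use pi_coeff_skew[OF y b] in auto)
    ultimately show "u (\<lambda>y. \<psi> y b) = (\<Sum>a<m. pi_coeff a b y * \<xi> (coord_field a y))" by simp
  qed
  have "(u, \<xi>) \<in> L y" if r: "?r u \<xi>"
  proof -
    have "pairing (u, \<xi>) e' = 0" if e': "e' \<in> L y" for e'
    proof -
      obtain u' \<xi>' where e: "e' = (u', \<xi>')" by (cases e')
      have r': "?r u' \<xi>'" by (rule nec) (use e' e in simp)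
      have "\<xi> u' = (\<Sum>c<m. (\<Sum>a<m. pi_coeff a c y * \<xi>' (coord_field a y)) * \<xi> (coord_field c y))"
      proof -
        have "\<xi> u' = (\<Sum>c<n. u' (\<lambda>y. \<psi> y c) * \<xi> (coord_field c y))"
          by (rule cot_expand) (use r r' y in blast)+
        also have "\<dots> = (\<Sum>c<m. u' (\<lambda>y. \<psi> y c) * \<xi> (coord_field c y))" by (rule split) (use r in simp)
        finally have "\<xi> u' = (\<Sum>c<m. u' (\<lambda>y. \<psi> y c) * \<xi> (coord_field c y))" .
        then show ?thesis using r' by simp
      qed
      also have "\<dots> = (\<Sum>a<m. \<Sum>c<m. pi_coeff a c y * \<xi>' (coord_field a y) * \<xi> (coord_field c y))"
        unfolding sum_distrib_right by (rule sum.swap)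
      also have "\<dots> = - (\<Sum>a<m. \<Sum>c<m. pi_coeff c a y * \<xi> (coord_field c y) * \<xi>' (coord_field a y))"
        unfolding sum_negf[symmetric] by (intro sum.cong refl) (subst pi_coeff_skew[OF y]; simp add: mult_ac)
      also have "(\<Sum>a<m. \<Sum>c<m. pi_coeff c a y * \<xi> (coord_field c y) * \<xi>' (coord_field a y)) = \<xi>' u"
      proof -
        have "\<xi>' u = (\<Sum>a<n. u (\<lambda>y. \<psi> y a) * \<xi>' (coord_field a y))"
          by (rule cot_expand) (use r r' y in blast)+
        also have "\<dots> = (\<Sum>a<m. u (\<lambda>y. \<psi> y a) * \<xi>' (coord_field a y))" by (rule split) (use r' in simp)
        finally have "\<xi>' u = (\<Sum>a<m. u (\<lambda>y. \<psi> y a) * \<xi>' (coord_field a y))" .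
        then show ?thesis using r by (simp add: sum_distrib_right)
      qed
      finally show ?thesis by (simp add: pairing_def e)
    qed
    then have "(u, \<xi>) \<in> orthogonal_space M y (L y)" using r by (simp add: orthogonal_space_def double_space_def)
    then show ?thesis using orth[OF y] by simp
  qed
  then show ?thesis using nec by blast
qed

text \<open>The covector parts of the frame have constant coefficients, which removes most terms from the Dorfman
  bracket of two frame members.\<close>

lemma frame_coord_field_const:
  assumes p: "p \<in> tangent_space M y" and y: "y \<in> D" and a: "a < n" and e: "e < n"
  shows "p (\<lambda>y. snd (s a y) (coord_field e y)) = 0"
proof -
  have c: "snd (s a z) (coord_field e z) = (if a = e \<and> a < m then 1 else 0)" if z: "z \<in> D" for z
  proof (cases "a < m")
    case True
    then show ?thesis using frame_covector[OF z True coord_field_tangent[OF e z]] coord_field_psi[OF e z] by auto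
  next
    case False then show ?thesis using frame_kernel[OF z _ a] by simp
  qed
  have "p (\<lambda>y. snd (s a y) (coord_field e y)) = p (\<lambda>_. if a = e \<and> a < m then 1 else 0)"
    by (rule tan_local[OF p D y c])
  then show ?thesis using tan_const[OF D_top[OF y] p] by simp
qed

text \<open>The bracket of \<open>s\<^sub>a\<close> and \<open>s\<^sub>b\<close> is a section of \<open>L\<close>,
  hence pairs to zero with \<open>s\<^sub>c\<close>. The case distinction covers frame members
  \<open>s\<^sub>a = \<partial>\<^sub>a\<close> without covector part.\<close>

lemma frame_dorfman:
  assumes y: "y \<in> D" and a: "a < n" and b: "b < m" and c: "c < m"
  shows "(if a < m then fst (s c y) (pi_coeff a b) else 0) + fst (s a y) (pi_coeff b c) - fst (s b y) (\<lambda>y. fst (s a y) (\<lambda>y. \<psi> y c)) = 0"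
proof -
  have bn: "b < n" and cn: "c < n" using b c m by auto
  let ?w = "fst (s c y)"
  have w: "?w \<in> tangent_space M y" by (rule frame_tangent[OF y cn])
  have T: "fst (s a y) \<in> tangent_space M y" "fst (s b y) \<in> tangent_space M y"
    using frame_tangent[OF y] a bn by auto
  have mem: "dorfman M (s a) (s b) y \<in> L y"
    by (rule local_diracD(3)[OF dirac order_refl frame[OF a] frame[OF bn] frame_mem[OF _ a] frame_mem[OF _ bn] y])
  have T': "fst (dorfman M (s a) (s b) y) \<in> tangent_space M y" using mem_double[OF y mem] by blast
  have "snd (dorfman M (s a) (s b) y) ?w = (\<Sum>e<n. snd (s b y) (coord_field e y) * ?w (\<lambda>y. fst (s a y) (\<lambda>y. \<psi> y e)))"
    unfolding dorfman_snd[OF frame[OF a] frame[OF bn] y y w]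
    by (rule sum.cong[OF refl]) (simp add: frame_coord_field_const[OF _ y] T w a bn)
  also have "\<dots> = (\<Sum>e<n. if e = b then ?w (\<lambda>y. fst (s a y) (\<lambda>y. \<psi> y b)) else 0)"
    by (rule sum.cong[OF refl]) (auto simp: frame_covector[OF y b] coord_field_tangent[OF _ y] coord_field_psi[OF _ y])
  also have "\<dots> = (if a < m then ?w (pi_coeff a b) else 0)"
  proof (cases "a < m")
    case True then show ?thesis using bn by (simp add: pi_coeff_def[abs_def])
  next
    case False
    have "?w (\<lambda>y. fst (s a y) (\<lambda>y. \<psi> y b)) = ?w (\<lambda>_. 0)"
      by (rule tan_local[OF w D y]) (use False a b frame_kernel coord_field_psi in auto)
    then show ?thesis using False tan_const[OF D_top[OF y] w] by simp
  qed
  finally have 1: "snd (dorfman M (s a) (s b) y) ?w = (if a < m then ?w (pi_coeff a b) else 0)" .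
  have 2: "snd (s c y) (fst (dorfman M (s a) (s b) y)) =
      fst (s a y) (pi_coeff b c) - fst (s b y) (\<lambda>y. fst (s a y) (\<lambda>y. \<psi> y c))"
    unfolding frame_covector[OF y c T'] unfolding dorfman_fst bracket_psi[OF y] by (simp add: pi_coeff_def[abs_def])
  have "pairing (dorfman M (s a) (s b) y) (s c y) = 0" by (rule isotropic[OF y mem frame_mem[OF y cn]])
  then show ?thesis using 1 2 by (simp add: pairing_def)
qed

text \<open>Involutivity tested on \<open>\<partial>\<^sub>d, s\<^sub>a, s\<^sub>b\<close>: only the derivative of
  \<open>\<pi>\<^sub>a\<^sub>b\<close> along \<open>\<partial>\<^sub>d\<close> survives.\<close>

lemma pi_coeff_basic:
  assumes y: "y \<in> D" and d: "m \<le> d" "d < n" and ab: "a < m" "b < m"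
  shows "coord_field d y (pi_coeff a b) = 0"
proof -
  have an: "a < n" using ab m by simp
  have T: "fst (s a y) \<in> tangent_space M y" by (rule frame_tangent[OF y an])
  have "fst (s a y) (\<lambda>y. fst (s d y) (\<lambda>y. \<psi> y b)) = fst (s a y) (\<lambda>_. 0)"
    by (rule tan_local[OF T D y]) (use d ab frame_kernel coord_field_psi in auto)
  then show ?thesis
    using frame_dorfman[OF y d(2) ab] frame_kernel[OF y d] tan_const[OF D_top[OF y] T] d by simp
qed

text \<open>Involutivity tested on \<open>s\<^sub>a, s\<^sub>b, s\<^sub>c\<close>: what remains are the derivatives
  of the coefficients along the vector parts of the three frame members.\<close>

lemma pi_coeff_jacobi:
  assumes y: "y \<in> D" and abc: "a < m" "b < m" "c < m"
  shows "(\<Sum>d<m. pi_coeff a d y * coord_field d y (pi_coeff b c)) + (\<Sum>d<m. pi_coeff b d y * coord_field d y (pi_coeff c a)) + (\<Sum>d<m. pi_coeff c d y * coord_field d y (pi_coeff a b)) = 0"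
proof -
  have n: "a < n" "b < n" "c < n" using abc m by auto
  have ex: "fst (s p y) (pi_coeff q r) = (\<Sum>d<m. pi_coeff p d y * coord_field d y (pi_coeff q r))" if "p < m" "q < m" "r < m" for p q r
  proof -
    have pn: "p < n" and qn: "q < n" using that m by auto
    have "fst (s p y) (pi_coeff q r) = (\<Sum>d<n. pi_coeff p d y * coord_field d y (pi_coeff q r))"
      unfolding pi_coeff_def[of p _ y]
      by (rule tan_expand[OF frame_tangent[OF y pn] y smooth_on_imp_at[OF pi_coeff_smooth[OF qn] y]])
    also have "\<dots> = (\<Sum>d<m. pi_coeff p d y * coord_field d y (pi_coeff q r))"
      by (rule sum.mono_neutral_right) (use m frame_vector_0[OF y that(1)] in auto)
    finally show ?thesis .
  qed
  have Tb: "fst (s b y) \<in> tangent_space M y" by (rule frame_tangent[OF y n(2)])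
  have "fst (s b y) (\<lambda>y. fst (s a y) (\<lambda>y. \<psi> y c)) = fst (s b y) (\<lambda>y. (- 1) * pi_coeff c a y)"
    by (rule tan_local[OF Tb D y]) (use pi_coeff_skew[OF _ abc(1,3)] in \<open>simp add: pi_coeff_def\<close>)
  also have "\<dots> = (- 1) * fst (s b y) (pi_coeff c a)"
    by (rule tan_cmult[OF Tb smooth_on_imp_at[OF pi_coeff_smooth[OF n(3)] y]])
  finally show ?thesis
    using frame_dorfman[OF y n(1) abc(2,3)] abc(1) ex abc by simp
qed

section \<open>The quotient map\<close>

definition trunc :: "(nat \<Rightarrow> real) \<Rightarrow> nat \<Rightarrow> real" where
  "trunc w = (\<lambda>i. if i < m then w i else 0)"

text \<open>The slice of \<open>D\<close> that represents the quotient; \<open>proj\<close> sets the other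
  coordinates to zero.\<close>

definition P :: "'a set" where
  "P = {y \<in> D. \<forall>i\<ge>m. \<psi> y i = 0}"

definition proj :: "'a \<Rightarrow> 'a" where
  "proj y = \<kappa> (trunc (\<psi> y))"

definition Q :: "'a manifold" where
  "Q = \<lparr>mtop = subtopology (mtop M) P, mdim = m, charts = {(P, \<psi>)}\<rparr>"

lemma trunc_cube: "w \<in> cube n (\<lambda>_. 0) \<rho> \<Longrightarrow> trunc w \<in> cube m (\<lambda>_. 0) \<rho>"
  using m by (auto simp: cube_def euclid_def trunc_def)

lemma cube_sub: "cube m (\<lambda>_. 0) \<rho> \<subseteq> cube n (\<lambda>_. 0) \<rho>"
  using m \<rho> by (auto simp: cube_def euclid_def) (metis abs_zero not_less)

lemma psi_cube: "y \<in> D \<Longrightarrow> \<psi> y \<in> cube n (\<lambda>_. 0) \<rho>"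
  using cube by blast

lemma trunc_img: "y \<in> D \<Longrightarrow> trunc (\<psi> y) \<in> \<psi> ` D"
  using trunc_cube[OF psi_cube] cube_sub cube by blast

lemma proj_D: "y \<in> D \<Longrightarrow> proj y \<in> D"
  unfolding proj_def by (rule kappa_mem[OF order_refl trunc_img])

lemma psi_proj: "y \<in> D \<Longrightarrow> \<psi> (proj y) = trunc (\<psi> y)"
  unfolding proj_def by (rule psi_kappa[OF trunc_img])

lemma proj_P: "y \<in> D \<Longrightarrow> proj y \<in> P"
  using proj_D psi_proj by (simp add: P_def trunc_def)

lemma P_D: "P \<subseteq> D" by (auto simp: P_def)

lemma psi_P: "\<psi> ` P = cube m (\<lambda>_. 0) \<rho>"
proof (intro equalityI subsetI)
  fix z assume "z \<in> \<psi> ` P"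
  then obtain y where y: "y \<in> P" "z = \<psi> y" by blast
  then have "trunc z = z" by (auto simp: P_def trunc_def fun_eq_iff)
  then show "z \<in> cube m (\<lambda>_. 0) \<rho>" using trunc_cube[OF psi_cube[of y]] y P_D by auto
next
  fix z assume z: "z \<in> cube m (\<lambda>_. 0) \<rho>"
  then have zD: "z \<in> \<psi> ` D" using cube_sub cube by blast
  have "\<kappa> z \<in> P" using kappa_mem[OF order_refl zD] psi_kappa[OF zD] z by (auto simp: P_def cube_def euclid_def)
  then show "z \<in> \<psi> ` P" using psi_kappa[OF zD] by (metis imageI)
qed

lemma proj_id: "y \<in> P \<Longrightarrow> proj y = y"
proof -
  assume y: "y \<in> P"
  then have "trunc (\<psi> y) = \<psi> y" by (auto simp: P_def trunc_def fun_eq_iff)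
  then show ?thesis using inv y P_D by (auto simp: proj_def)
qed

lemma proj_image: "proj ` D = P"
  using proj_P proj_id P_D by force

lemma topspace_P: "topspace (subtopology (mtop M) P) = P"
  using openin_subset[OF D] P_D by (simp add: Int_absorb1)

lemma Q_coords: "smooth_manifold Q" "coords Q P \<psi> \<kappa>"
proof -
  have Hc: "Hausdorff_space (mtop M)" "second_countable (mtop M)"
    using M by (simp_all add: smooth_manifold_def)
  have "homeomorphic_maps (subtopology (subtopology (mtop M) D) P) (subtopology (subtopology (Euclidean_space n) (\<psi> ` D)) (\<psi> ` P)) \<psi> \<kappa>"
    by (rule homeomorphic_maps_subtopologies[OF homeomorphic_maps_chart])
      (use P_D D_top psi_euclid in \<open>auto simp: Euclidean_space_eq\<close>)
  moreover have "subtopology (subtopology (mtop M) D) P = subtopology (mtop M) P"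
    using P_D by (simp add: subtopology_subtopology Int_absorb1)
  moreover have "subtopology (subtopology (Euclidean_space n) (\<psi> ` D)) (\<psi> ` P) = subtopology (Euclidean_space m) (\<psi> ` P)"
  proof -
    have "euclid n \<inter> \<psi> ` D \<inter> \<psi> ` P = euclid m \<inter> \<psi> ` P"
      using psi_euclid P_D by (auto simp: psi_P[symmetric] P_def euclid_def)
    then show ?thesis by (simp add: Euclidean_space_eq subtopology_subtopology Int_assoc)
  qed
  ultimately have h: "homeomorphic_maps (subtopology (mtop M) P) (subtopology (Euclidean_space m) (\<psi> ` topspace (subtopology (mtop M) P))) \<psi> \<kappa>"
    unfolding topspace_P by simp
  have o: "openin (Euclidean_space m) (\<psi> ` topspace (subtopology (mtop M) P))"
    unfolding topspace_P psi_P by (rule openin_cube)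
  note sc = single_chart_manifold[OF Hausdorff_space_subtopology[OF Hc(1)] second_countable_subtopology[OF Hc(2)] o h, unfolded topspace_P]
  show "smooth_manifold Q" "coords Q P \<psi> \<kappa>" unfolding Q_def by (rule sc)+
qed

lemma Q_simps: "mtop Q = subtopology (mtop M) P" "mdim Q = m" "topspace (mtop Q) = P"
  using topspace_P by (simp_all add: Q_def del: topspace_subtopology)

sublocale N: coords Q P \<psi> \<kappa>
  by (rule Q_coords(2))

lemma proj_preimage_open:
  assumes U: "openin (mtop M) U" shows "openin (mtop M) {y \<in> D. proj y \<in> U}"
proof -
  have o: "openin (Euclidean_space n) (\<psi> ` D)" by (rule img_open[OF order_refl D])
  have oU: "openin (Euclidean_space n) (\<psi> ` (U \<inter> D))" by (rule img_open) (use U D in auto)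
  let ?W = "{z \<in> \<psi> ` D. trunc z \<in> \<psi> ` (U \<inter> D)}"
  have W: "openin (Euclidean_space n) ?W"
  proof (rule openin_E_preimage[OF o oU])
    show "Cinf_on n (\<psi> ` D) (\<lambda>z. trunc z j)" for j
      by (cases "j < m") (simp_all add: trunc_def Cinf_coord[OF o] Cinf_const[OF o])
    show "trunc z \<in> euclid n" for z using m by (auto simp: trunc_def euclid_def)
  qed
  have "{y \<in> D. proj y \<in> U} = \<kappa> ` ?W"
  proof (intro equalityI subsetI)
    fix y assume y: "y \<in> {y \<in> D. proj y \<in> U}"
    then have "trunc (\<psi> y) \<in> \<psi> ` (U \<inter> D)" using psi_proj proj_D by (metis (no_types, lifting) IntI imageI mem_Collect_eq)
    then have "\<psi> y \<in> ?W" using y by auto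
    then show "y \<in> \<kappa> ` ?W" using inv[of y] y by (metis (no_types, lifting) imageI mem_Collect_eq)
  next
    fix y assume "y \<in> \<kappa> ` ?W"
    then obtain z where z: "z \<in> \<psi> ` D" "trunc z \<in> \<psi> ` (U \<inter> D)" "y = \<kappa> z" by blast
    have yD: "y \<in> D" and pz: "\<psi> y = z" using kappa_mem[OF order_refl z(1)] psi_kappa[OF z(1)] z(3) by auto
    have "proj y \<in> U \<inter> D" unfolding proj_def pz by (rule kappa_mem[OF _ z(2)]) auto
    then show "y \<in> {y \<in> D. proj y \<in> U}" using yD by simp
  qed
  then show ?thesis using kappa_open[OF _ W] by auto
qed

lemma proj_preimage_openQ: "openin (mtop Q) U \<Longrightarrow> openin (mtop M) {y \<in> D. proj y \<in> U}"
proof -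
  assume "openin (mtop Q) U"
  then obtain T where T: "openin (mtop M) T" "U = T \<inter> P" by (auto simp: Q_simps openin_subtopology)
  have "{y \<in> D. proj y \<in> U} = {y \<in> D. proj y \<in> T}" using proj_P T(2) by auto
  then show ?thesis using proj_preimage_open[OF T(1)] by simp
qed

lemma smooth_proj:
  assumes g: "smooth_on Q U g"
  shows "smooth_on M {y \<in> D. proj y \<in> U} (\<lambda>y. g (proj y))"
proof -
  have Uo: "openin (mtop Q) U" by (rule N.smooth_on_open[OF g])
  have UP: "U \<subseteq> P" using openin_subset[OF Uo] Q_simps by simp
  let ?V = "{y \<in> D. proj y \<in> U}"
  have V: "?V \<subseteq> D" "openin (mtop M) ?V" using proj_preimage_openQ[OF Uo] by auto
  have gU: "Cinf_on m (\<psi> ` U) (\<lambda>z. g (\<kappa> z))" using N.smooth_iff[OF UP Uo] g by (simp add: Q_simps)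
  have o: "openin (Euclidean_space n) (\<psi> ` ?V)" by (rule img_open[OF V])
  have oU: "openin (Euclidean_space m) (\<psi> ` U)" using N.img_open[OF UP Uo] by (simp add: Q_simps)
  have "Cinf_on n (\<psi> ` ?V) (\<lambda>z. (\<lambda>w. g (\<kappa> w)) (trunc z))"
  proof (rule Cinf_compose[OF o oU _ _ gU])
    show "trunc z \<in> \<psi> ` U" if "z \<in> \<psi> ` ?V" for z using that psi_proj by (force simp: image_iff)
    show "Cinf_on n (\<psi> ` ?V) (\<lambda>z. trunc z j)" for j
      by (cases "j < m") (simp_all add: trunc_def Cinf_coord[OF o] Cinf_const[OF o])
  qed
  moreover have "g (\<kappa> (trunc z)) = g (proj (\<kappa> z))" if "z \<in> \<psi> ` ?V" for z
    using that inv by (auto simp: proj_def)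
  ultimately have "Cinf_on n (\<psi> ` ?V) (\<lambda>z. g (proj (\<kappa> z)))"
    using Cinf_on_cong[OF o, of "\<lambda>z. g (\<kappa> (trunc z))" "\<lambda>z. g (proj (\<kappa> z))"] by simp
  then show ?thesis using smooth_iff[OF V] by simp
qed

lemma smooth_at_proj: "smooth_at Q (proj y) g \<Longrightarrow> y \<in> D \<Longrightarrow> smooth_at M y (\<lambda>y. g (proj y))"
proof -
  assume "smooth_at Q (proj y) g" and y: "y \<in> D"
  then obtain U where U: "proj y \<in> U" "smooth_on Q U g" unfolding smooth_at_def by blast
  show ?thesis by (rule smooth_on_imp_at[OF smooth_proj[OF U(2)]]) (use y U in simp)
qed

lemma push_tangent:
  assumes y: "y \<in> D" and v: "v \<in> tangent_space M y"
  shows "push_vec Q proj y v \<in> tangent_space Q (proj y)"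
  unfolding tangent_space_def[of Q] mem_Collect_eq
proof (intro conjI allI impI)
  fix f g a b assume f: "smooth_at Q (proj y) f" and g: "smooth_at Q (proj y) g"
  have t: "proj y \<in> topspace (mtop Q)" unfolding Q_simps(3) by (rule proj_P[OF y])
  have "smooth_at Q (proj y) (\<lambda>y. a * f y + b * g y)"
    by (intro N.smooth_at_add N.smooth_at_mult N.smooth_at_const t f g)
  then show "push_vec Q proj y v (\<lambda>y. a * f y + b * g y) = a * push_vec Q proj y v f + b * push_vec Q proj y v g"
    using f g tan_lin[OF v smooth_at_proj[OF f y] smooth_at_proj[OF g y]] by (simp add: push_vec_def)
  show "push_vec Q proj y v (\<lambda>y. f y * g y) = f (proj y) * push_vec Q proj y v g + g (proj y) * push_vec Q proj y v f"
    using f g N.smooth_at_mult[OF f g] tan_mult[OF v smooth_at_proj[OF f y] smooth_at_proj[OF g y]] by (simp add: push_vec_def)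
qed (simp add: push_vec_def)

lemma push_psi:
  assumes y: "y \<in> D" and v: "v \<in> tangent_space M y" and a: "a < m"
  shows "push_vec Q proj y v (\<lambda>y. \<psi> y a) = v (\<lambda>y. \<psi> y a)"
proof -
  have "v (\<lambda>y. \<psi> (proj y) a) = v (\<lambda>y. \<psi> y a)"
    by (rule tan_local[OF v D y]) (simp add: psi_proj trunc_def a)
  then show ?thesis using N.smooth_at_psi[OF proj_P[OF y]] by (simp add: push_vec_def)
qed

lemma proj_submersion: "surjective_submersion M D Q proj"
  unfolding surjective_submersion_def smooth_map_on_def
proof (intro conjI ballI)
  show "openin (mtop M) D" by (rule D)
  show "proj ` D = topspace (mtop Q)" unfolding Q_simps(3) by (rule proj_image)
  have tD: "topspace (subtopology (mtop M) D) = D" using D openin_subset by fastforce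
  show "continuous_map (subtopology (mtop M) D) (mtop Q) proj"
    unfolding continuous_map tD
  proof (intro conjI allI impI)
    show "proj ` D \<subseteq> topspace (mtop Q)" unfolding Q_simps(3) proj_image ..
    fix U assume "openin (mtop Q) U"
    from proj_preimage_openQ[OF this] show "openin (subtopology (mtop M) D) {x \<in> D. proj x \<in> U}"
      using D by (auto simp: openin_open_subtopology)
  qed
  show "case c of (D', \<phi>) \<Rightarrow> \<forall>(E, \<epsilon>)\<in>charts Q. \<forall>i<mdim Q.
        Cinf_on (mdim M) (\<phi> ` {x \<in> D' \<inter> D. proj x \<in> E}) (\<lambda>z. \<epsilon> (proj (inv_into D' \<phi> z)) i)" if c: "c \<in> charts M" for c
  proof -
    obtain D' \<phi> where c': "c = (D', \<phi>)" by (cases c)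
    have "smooth_on M D (\<lambda>y. \<psi> (proj y) i)" if "i < m" for i
    proof -
      have "\<psi> (proj y) i = \<psi> y i" if "y \<in> D" for y using that psi_proj \<open>i < m\<close> by (simp add: trunc_def)
      then show ?thesis using smooth_psi[OF order_refl D, of i] smooth_on_cong[of D "\<lambda>y. \<psi> (proj y) i" "\<lambda>y. \<psi> y i"] by simp
    qed
    then have "Cinf_on n (\<phi> ` (D' \<inter> D)) (\<lambda>z. \<psi> (proj (inv_into D' \<phi> z)) i)" if "i < m" for i
      using smooth_onD[of D "\<lambda>y. \<psi> (proj y) i" D' \<phi>] c c' that by blast
    moreover have "{x \<in> D' \<inter> D. proj x \<in> P} = D' \<inter> D" using proj_P by auto
    ultimately show ?thesis by (simp add: c' Q_def)
  qed
  fix y assume y: "y \<in> D"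
  show "push_vec Q proj y ` tangent_space M y = tangent_space Q (proj y)"
  proof (intro equalityI subsetI)
    fix w assume w: "w \<in> tangent_space Q (proj y)"
    define v where "v = vec (\<lambda>a. if a < m then w (\<lambda>y. \<psi> y a) else 0) y"
    have v: "v \<in> tangent_space M y" unfolding v_def by (rule vec_tangent[OF y])
    have "push_vec Q proj y v = w"
    proof (rule N.tan_eqI[OF push_tangent[OF y v] w proj_P[OF y]])
      fix a assume "a < mdim Q"
      then have a: "a < m" "a < n" using m by (auto simp: Q_simps)
      show "push_vec Q proj y v (\<lambda>y. \<psi> y a) = w (\<lambda>y. \<psi> y a)"
        unfolding push_psi[OF y v a(1)] unfolding v_def vec_psi[OF y a(2)] using a by simp
    qed
    then show "w \<in> push_vec Q proj y ` tangent_space M y" using v by blast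
  qed (use push_tangent[OF y] in auto)
qed

text \<open>In coordinates a fibre is a product of a point with a cube, and every point of it is joined to the point
  of the slice by a segment.\<close>

lemma proj_fibres:
  assumes y: "y \<in> P" shows "connectedin (mtop M) {z \<in> D. proj z = y}"
proof -
  let ?A = "{w \<in> cube n (\<lambda>_. 0) \<rho>. trunc w = \<psi> y}"
  have eq: "{z \<in> D. proj z = y} = \<kappa> ` ?A"
  proof (intro equalityI subsetI)
    fix z assume z: "z \<in> {z \<in> D. proj z = y}"
    then have "\<psi> z \<in> ?A" using psi_cube psi_proj by auto
    then show "z \<in> \<kappa> ` ?A" using inv z by (metis (no_types, lifting) imageI mem_Collect_eq)
  next
    fix z assume "z \<in> \<kappa> ` ?A"
    then obtain w where w: "w \<in> \<psi> ` D" "trunc w = \<psi> y" "z = \<kappa> w" using cube by blast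
    have "z \<in> D" "\<psi> z = w" using kappa_mem[OF order_refl w(1)] psi_kappa[OF w(1)] w(3) by auto
    then show "z \<in> {z \<in> D. proj z = y}" using w(2) inv y P_D by (auto simp: proj_def)
  qed
  define \<gamma> where "\<gamma> w t = (\<lambda>i. \<psi> y i + t * (w i - \<psi> y i))" for w :: "nat \<Rightarrow> real" and t :: real
  have yA: "\<psi> y \<in> ?A" using psi_cube y P_D by (auto simp: P_def trunc_def fun_eq_iff)
  have cube_eq: "v \<in> cube n (\<lambda>_. 0) \<rho> \<longleftrightarrow> v \<in> euclid n \<and> (\<forall>i<n. \<bar>v i\<bar> < \<rho>)" for v by (simp add: cube_def)
  have \<gamma>A: "\<gamma> w t \<in> ?A" if w: "w \<in> ?A" and t: "t \<in> {0..1}" for w t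
  proof -
    have e: "\<gamma> w t \<in> euclid n"
      using w yA by (auto simp: cube_eq euclid_def \<gamma>_def)
    have "\<gamma> w t \<in> cube n (\<lambda>_. 0) \<rho>"
    proof (rule box_convexD[OF box_convex_cube _ _ e])
      show "\<psi> y \<in> cube n (\<lambda>_. 0) \<rho>" "w \<in> cube n (\<lambda>_. 0) \<rho>" using yA w by auto
      show "min (\<psi> y i) (w i) \<le> \<gamma> w t i \<and> \<gamma> w t i \<le> max (\<psi> y i) (w i)" for i
        unfolding \<gamma>_def by (rule convex_comb_between) (use t in auto)
    qed
    moreover have "trunc (\<gamma> w t) = \<psi> y"
    proof
      fix i
      have "trunc w i = \<psi> y i" "trunc (\<psi> y) i = \<psi> y i" using w yA by auto
      then show "trunc (\<gamma> w t) i = \<psi> y i" by (auto simp: trunc_def \<gamma>_def split: if_splits)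
    qed
    ultimately show ?thesis by simp
  qed
  have "?A = (\<Union>w\<in>?A. \<gamma> w ` {0..1})"
  proof (intro equalityI subsetI)
    fix w assume w: "w \<in> ?A"
    have "w = \<gamma> w 1" by (simp add: \<gamma>_def)
    then show "w \<in> (\<Union>w\<in>?A. \<gamma> w ` {0..1})" using w by (metis (no_types, lifting) UN_iff atLeastAtMost_iff imageI order_refl zero_le_one)
  qed (use \<gamma>A in blast)
  moreover have "connected (\<Union>w\<in>?A. \<gamma> w ` {0..1})"
  proof (rule connected_Union)
    fix S assume "S \<in> (\<lambda>w. \<gamma> w ` {0..1}) ` ?A"
    then obtain w where "S = \<gamma> w ` {0..1}" by blast
    moreover have "continuous_on {0..1} (\<gamma> w)"
      unfolding \<gamma>_def by (intro continuous_on_coordinatewise_then_product continuous_intros)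
    ultimately show "connected S" using connected_continuous_image connected_Icc by blast
  next
    have "\<psi> y = \<gamma> w 0" for w by (simp add: \<gamma>_def)
    then have "\<psi> y \<in> \<gamma> w ` {0..1}" for w by (metis atLeastAtMost_iff imageI order_refl zero_le_one)
    then show "\<Inter> ((\<lambda>w. \<gamma> w ` {0..1}) ` ?A) \<noteq> {}" by blast
  qed
  ultimately have "connected ?A" by simp
  then have "connectedin (subtopology (Euclidean_space n) (\<psi> ` D)) ?A"
    using cube by (auto simp: Euclidean_space_eq subtopology_subtopology connectedin_subtopology cube_def)
  from connectedin_continuous_map_image[OF kappa_continuous this] show ?thesis unfolding eq .
qed

text \<open>By \<open>pi_coeff_basic\<close> the partial derivatives in the directions from \<open>m\<close> on
  vanish on a cube; Hadamard's decomposition turns this into constancy along the fibres.\<close>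

lemma pi_coeff_proj:
  assumes y: "y \<in> D" and ab: "a < m" "b < m" shows "pi_coeff a b (proj y) = pi_coeff a b y"
proof -
  have an: "a < n" using ab m by simp
  let ?h = "\<lambda>z. pi_coeff a b (\<kappa> z)"
  let ?C = "cube n (\<lambda>_. 0) \<rho>"
  have h: "Cinf_on n ?C ?h" using smooth_iff[OF order_refl D] pi_coeff_smooth[OF an] cube by simp
  have zero: "partial_deriv d ?h z = 0" if d: "m \<le> d" "d < n" and z: "z \<in> ?C" for d z
  proof -
    have zD: "z \<in> \<psi> ` D" using z cube by simp
    have "coord_field d (\<kappa> z) (pi_coeff a b) = 0" by (rule pi_coeff_basic[OF kappa_mem[OF order_refl zD] d ab])
    then show ?thesis
      using smooth_on_imp_at[OF pi_coeff_smooth[OF an] kappa_mem[OF order_refl zD]] psi_kappa[OF zD] by (simp add: coord_field_def)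
  qed
  have c: "\<psi> y \<in> ?C" "trunc (\<psi> y) \<in> ?C" using psi_cube[OF y] trunc_cube[OF psi_cube[OF y]] cube_sub by auto
  have "?h (\<psi> y) - ?h (trunc (\<psi> y)) = (\<Sum>j<n. (\<psi> y j - trunc (\<psi> y) j) * hadamard ?h j (trunc (\<psi> y)) (\<psi> y))"
    by (rule hadamard_formula[OF openin_cube box_convex_cube Cinf_Ck[OF h] c(2,1)])
  also have "\<dots> = 0"
  proof (rule sum.neutral, rule ballI)
    fix j assume "j \<in> {..<n}"
    then have j: "j < n" by simp
    show "(\<psi> y j - trunc (\<psi> y) j) * hadamard ?h j (trunc (\<psi> y)) (\<psi> y) = 0"
    proof (cases "j < m")
      case True then show ?thesis by (simp add: trunc_def)
    next
      case False
      have "hadamard ?h j (trunc (\<psi> y)) (\<psi> y) = integral {0..1} (\<lambda>_::real. 0::real)"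
        unfolding hadamard_def
      proof (rule integral_cong)
        fix t :: real assume t: "t \<in> {0..1}"
        show "partial_deriv j ?h (staircase j (trunc (\<psi> y)) (\<psi> y) t) = 0"
          by (rule zero[OF _ j staircase_in[OF box_convex_cube openin_E_subset[OF openin_cube] c(2,1) j t]]) (use False in simp)
      qed
      then show ?thesis by simp
    qed
  qed
  finally show ?thesis using inv[OF y] by (simp add: proj_def)
qed

section \<open>The Poisson structure on the quotient\<close>

definition bivec :: "'a \<Rightarrow> 'a covec \<Rightarrow> 'a covec \<Rightarrow> real" where
  "bivec y \<xi> \<eta> = (\<Sum>a<m. \<Sum>b<m. pi_coeff a b y * \<xi> (N.coord_field a y) * \<eta> (N.coord_field b y))"

lemma pi_coeff_smoothQ:
  assumes ab: "a < m" "b < m" shows "smooth_on Q P (pi_coeff a b)"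
proof -
  have an: "a < n" using ab m by simp
  have "Cinf_on n (\<psi> ` D) (\<lambda>z. pi_coeff a b (\<kappa> z))" using smooth_iff[OF order_refl D] pi_coeff_smooth[OF an] by simp
  then have "Cinf_on m (\<psi> ` P) (\<lambda>z. pi_coeff a b (\<kappa> z))"
    unfolding Cinf_on_def
    using Ck_lower_dim[OF img_open[OF order_refl D] _ image_mono[OF P_D] m] N.img_open[OF order_refl N.D]
    by (simp add: Q_simps)
  then show ?thesis using N.smooth_iff[OF order_refl N.D] by (simp add: Q_simps)
qed

lemma N_coord_field_pi_coeff:
  assumes y: "y \<in> P" and ab: "a < m" "b < m"
  shows "N.coord_field d y (pi_coeff a b) = coord_field d y (pi_coeff a b)"
proof -
  have an: "a < n" using ab m by simp
  have yD: "y \<in> D" using y P_D by blast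
  show ?thesis
    using N.smooth_on_imp_at[OF pi_coeff_smoothQ[OF ab] y] smooth_on_imp_at[OF pi_coeff_smooth[OF an] yD]
    by (simp add: N.coord_field_def coord_field_def)
qed

lemma bivec_skew: "y \<in> P \<Longrightarrow> bivec y \<xi> \<eta> = - bivec y \<eta> \<xi>"
proof -
  assume "y \<in> P"
  then have yD: "y \<in> D" using P_D by blast
  have "bivec y \<xi> \<eta> = (\<Sum>b<m. \<Sum>a<m. pi_coeff a b y * \<xi> (N.coord_field a y) * \<eta> (N.coord_field b y))"
    unfolding bivec_def by (rule sum.swap)
  also have "\<dots> = - bivec y \<eta> \<xi>"
    unfolding bivec_def sum_negf[symmetric] by (intro sum.cong refl) (subst pi_coeff_skew[OF yD]; simp add: mult_ac)
  finally show ?thesis .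
qed

lemma bivector_bivec: "bivector_field Q bivec"
  unfolding bivector_field_def Q_simps(3)
proof (intro conjI ballI allI impI)
  fix y \<xi> \<zeta> \<eta> assume y: "y \<in> P"
  show "bivec y (\<lambda>v. a * \<xi> v + b * \<zeta> v) \<eta> = a * bivec y \<xi> \<eta> + b * bivec y \<zeta> \<eta>" for a b
    unfolding bivec_def sum_distrib_left sum.distrib[symmetric] by (intro sum.cong refl) (simp add: distrib_left distrib_right mult.assoc mult.left_commute)
  show "bivec y \<xi> \<eta> = - bivec y \<eta> \<xi>" by (rule bivec_skew[OF y])
next
  fix V \<xi> \<eta> assume \<xi>: "one_form Q V \<xi>" and \<eta>: "one_form Q V \<eta>"
  have o: "openin (mtop Q) V" by (rule N.of_open[OF \<xi>])
  have VP: "V \<subseteq> P" using openin_subset[OF o] Q_simps by simp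
  have bv: "vector_field Q V (N.coord_field a)" if "a < m" for a
    by (rule N.coord_field_vf[OF VP o]) (simp add: Q_simps that)
  show "smooth_on Q V (\<lambda>x. bivec x (\<xi> x) (\<eta> x))"
    unfolding bivec_def
    by (intro N.smooth_on_sum[OF o] N.smooth_on_mult[OF o] N.smooth_on_subset[OF pi_coeff_smoothQ o VP]
        N.of_smooth[OF \<xi> order_refl bv] N.of_smooth[OF \<eta> order_refl bv]) auto
qed

definition hamiltonian :: "('a \<Rightarrow> real) \<Rightarrow> 'a \<Rightarrow> 'a tvec" where
  "hamiltonian f y = N.vec (\<lambda>b. \<Sum>a<m. pi_coeff a b y * N.coord_field a y f) y"

lemma N_coord_field_tangent: "a < m \<Longrightarrow> y \<in> P \<Longrightarrow> N.coord_field a y \<in> tangent_space Q y"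
  by (rule N.coord_field_tangent) (simp_all add: Q_simps)

lemma bracket_hamiltonian: "y \<in> P \<Longrightarrow> poisson_bracket Q bivec f g y = hamiltonian f y g"
proof -
  assume y: "y \<in> P"
  have "poisson_bracket Q bivec f g y = (\<Sum>a<m. \<Sum>b<m. pi_coeff a b y * N.coord_field a y f * N.coord_field b y g)"
    unfolding poisson_bracket_def bivec_def differential_def
    by (intro sum.cong refl) (use N_coord_field_tangent y in auto)
  also have "\<dots> = (\<Sum>b<m. \<Sum>a<m. pi_coeff a b y * N.coord_field a y f * N.coord_field b y g)" by (rule sum.swap)
  finally show "poisson_bracket Q bivec f g y = hamiltonian f y g" by (simp add: hamiltonian_def N.vec_def Q_simps sum_distrib_right)
qed

lemma hamiltonian_vf: "smooth_on Q P f \<Longrightarrow> vector_field Q P (hamiltonian f)"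
proof -
  assume f: "smooth_on Q P f"
  have o: "openin (mtop Q) P" by (rule N.D)
  show ?thesis
    unfolding hamiltonian_def[abs_def]
  proof (rule N.vec_vf[OF order_refl o])
    fix b assume "b < mdim Q"
    then have b: "b < m" by (simp add: Q_simps)
    show "smooth_on Q P (\<lambda>y. \<Sum>a<m. pi_coeff a b y * N.coord_field a y f)"
      by (intro N.smooth_on_sum[OF o] N.smooth_on_mult[OF o] pi_coeff_smoothQ N.coord_field_smooth[OF order_refl f])
        (use b in \<open>auto simp: Q_simps\<close>)
  qed
qed

text \<open>The Jacobiator is a derivation in its last argument, being \<open>[X\<^sub>f, X\<^sub>g] -
  X\<^sub>{\<^sub>f\<^sub>,\<^sub>g\<^sub>}\<close> applied to it, and it is invariant under cyclic
  permutations; hence it is a derivation in each argument and determined by its values on coordinate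
  functions, where \<open>pi_coeff_jacobi\<close> applies.\<close>

lemma poisson_bivec: "poisson_structure Q bivec"
  unfolding poisson_structure_def Q_simps(3)
proof (intro conjI bivector_bivec allI impI ballI)
  let ?br = "poisson_bracket Q bivec"
  define J where "J f g h y = ?br f (?br g h) y + ?br g (?br h f) y + ?br h (?br f g) y" for f g h y
  have o: "openin (mtop Q) P" by (rule N.D)
  have sbr: "smooth_on Q P (?br f g)" if f: "smooth_on Q P f" and g: "smooth_on Q P g" for f g
  proof -
    have "smooth_on Q P (\<lambda>y. hamiltonian f y g)" by (rule N.vf_smooth[OF hamiltonian_vf[OF f] order_refl g])
    then show ?thesis using N.smooth_on_cong[of P "?br f g" "\<lambda>y. hamiltonian f y g"] bracket_hamiltonian by simp
  qed
  have skew: "?br f g y = - ?br g f y" if "y \<in> P" for f g y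
    unfolding poisson_bracket_def by (rule bivec_skew[OF that])
  have cyc: "J f g h y = J g h f y" for f g h y by (simp add: J_def)
  have der: "J f g h y = (\<Sum>c<m. J f g (\<lambda>y. \<psi> y c) y * N.coord_field c y h)"
    if f: "smooth_on Q P f" and g: "smooth_on Q P g" and h: "smooth_on Q P h" and y: "y \<in> P" for f g h y
  proof -
    \<comment> \<open>\<open>[X\<^sub>f, X\<^sub>g] - X\<^sub>{\<^sub>f\<^sub>,\<^sub>g\<^sub>}\<close>, a tangent vector\<close>
    define X where "X = (\<lambda>h. 1 * lie_bracket Q (hamiltonian f) (hamiltonian g) y h + (- 1) * hamiltonian (?br f g) y h)"
    have hv: "vector_field Q P (hamiltonian f)" "vector_field Q P (hamiltonian g)" "vector_field Q P (hamiltonian (?br f g))"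
      using hamiltonian_vf f g sbr by auto
    have T: "hamiltonian f y \<in> tangent_space Q y" "hamiltonian g y \<in> tangent_space Q y" "hamiltonian (?br f g) y \<in> tangent_space Q y"
      using N.vf_tangent hv y by blast+
    have X: "X \<in> tangent_space Q y"
      unfolding X_def by (rule N.tangent_lin[OF N.lie_bracket_tangent[OF hv(1,2) y] T(3)])
    have XJ: "X h = J f g h y" if h: "smooth_on Q P h" for h
    proof -
      have sh: "smooth_at Q y h" by (rule N.smooth_on_imp_at[OF h y])
      have 1: "hamiltonian f y (\<lambda>y. hamiltonian g y h) = ?br f (?br g h) y"
        unfolding bracket_hamiltonian[OF y] by (rule N.tan_local[OF T(1) o y]) (simp add: bracket_hamiltonian)
      have "hamiltonian g y (\<lambda>y. hamiltonian f y h) = hamiltonian g y (\<lambda>y. (- 1) * ?br h f y)"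
      proof (rule N.tan_local[OF T(2) o y])
        fix z assume z: "z \<in> P"
        show "hamiltonian f z h = (- 1) * ?br h f z" using bracket_hamiltonian[OF z, of f h] skew[OF z, of f h] by simp
      qed
      also have "\<dots> = (- 1) * hamiltonian g y (?br h f)"
        by (rule N.tan_cmult[OF T(2) N.smooth_on_imp_at[OF sbr[OF h f] y]])
      finally have 2: "hamiltonian g y (\<lambda>y. hamiltonian f y h) = - ?br g (?br h f) y" by (simp add: bracket_hamiltonian[OF y])
      have 3: "hamiltonian (?br f g) y h = - ?br h (?br f g) y"
        using bracket_hamiltonian[OF y, of "?br f g" h] skew[OF y, of "?br f g" h] by simp
      show ?thesis using sh 1 2 3 by (simp add: X_def lie_bracket_def J_def)
    qed
    have "X h = (\<Sum>c<m. X (\<lambda>y. \<psi> y c) * N.coord_field c y h)"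
      using N.tan_expand[OF X y N.smooth_on_imp_at[OF h y]] by (simp add: Q_simps)
    then show ?thesis using XJ[OF h] XJ[OF N.smooth_psi[OF order_refl o]] by simp
  qed
  have coord: "J (\<lambda>y. \<psi> y a) (\<lambda>y. \<psi> y b) (\<lambda>y. \<psi> y c) y = 0" if abc: "a < m" "b < m" "c < m" and y: "y \<in> P" for a b c y
  proof -
    have hp: "hamiltonian (\<lambda>y. \<psi> y a) y h = (\<Sum>d<m. pi_coeff a d y * N.coord_field d y h)" if a: "a < m" and y: "y \<in> P" for a h y
    proof -
      have "(\<Sum>p<m. pi_coeff p b y * N.coord_field p y (\<lambda>y. \<psi> y a)) = pi_coeff a b y" for b
      proof -
        have "(\<Sum>p<m. pi_coeff p b y * N.coord_field p y (\<lambda>y. \<psi> y a)) = (\<Sum>p<m. if p = a then pi_coeff p b y else 0)"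
          by (rule sum.cong) (use N.coord_field_psi y in \<open>auto simp: Q_simps\<close>)
        then show ?thesis using a by simp
      qed
      then show ?thesis by (simp add: hamiltonian_def N.vec_def Q_simps)
    qed
    have br2: "?br (\<lambda>y. \<psi> y b) (\<lambda>y. \<psi> y c) z = pi_coeff b c z" if z: "z \<in> P" and bc: "b < m" "c < m" for b c z
    proof -
      have "?br (\<lambda>y. \<psi> y b) (\<lambda>y. \<psi> y c) z = (\<Sum>d<m. pi_coeff b d z * N.coord_field d z (\<lambda>y. \<psi> y c))"
        using bracket_hamiltonian[OF z] hp[OF bc(1) z] by simp
      also have "\<dots> = (\<Sum>d<m. if d = c then pi_coeff b d z else 0)"
        by (rule sum.cong) (use N.coord_field_psi z in \<open>auto simp: Q_simps\<close>)
      finally show ?thesis using bc by simp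
    qed
    have br3: "?br (\<lambda>y. \<psi> y a) (?br (\<lambda>y. \<psi> y b) (\<lambda>y. \<psi> y c)) y = (\<Sum>d<m. pi_coeff a d y * coord_field d y (pi_coeff b c))"
      if abc: "a < m" "b < m" "c < m" for a b c
    proof -
      have T: "hamiltonian (\<lambda>y. \<psi> y a) y \<in> tangent_space Q y"
        by (rule N.vf_tangent[OF hamiltonian_vf[OF N.smooth_psi[OF order_refl o]] y])
      have "?br (\<lambda>y. \<psi> y a) (?br (\<lambda>y. \<psi> y b) (\<lambda>y. \<psi> y c)) y = hamiltonian (\<lambda>y. \<psi> y a) y (pi_coeff b c)"
        unfolding bracket_hamiltonian[OF y] by (rule N.tan_local[OF T o y]) (use br2 abc bracket_hamiltonian in auto)
      then show ?thesis using hp[OF abc(1) y] N_coord_field_pi_coeff[OF y abc(2,3)] by simp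
    qed
    have yD: "y \<in> D" using y P_D by blast
    show ?thesis unfolding J_def using br3 abc pi_coeff_jacobi[OF yD abc] by simp
  qed
  fix f g h y assume f: "smooth_on Q P f" and g: "smooth_on Q P g" and h: "smooth_on Q P h" and y: "y \<in> P"
  have sp: "smooth_on Q P (\<lambda>y. \<psi> y a)" for a by (rule N.smooth_psi[OF order_refl o])
  have "J (\<lambda>y. \<psi> y a) (\<lambda>y. \<psi> y b) h y = 0" if "a < m" "b < m" "smooth_on Q P h" for a b h
    using der[OF sp sp that(3) y] coord[OF that(1,2) _ y] by simp
  then have J1: "J h (\<lambda>y. \<psi> y a) (\<lambda>y. \<psi> y b) y = 0" if "smooth_on Q P h" "a < m" "b < m" for a b h
    using cyc that by metis
  have J2: "J h (\<lambda>y. \<psi> y a) k y = 0" if "smooth_on Q P h" "smooth_on Q P k" "a < m" for a h k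
    using der[OF that(1) sp that(2) y] J1[OF that(1,3)] by simp
  have "J g h (\<lambda>y. \<psi> y a) y = 0" if "a < m" for a
    using J2[OF h g that] cyc by metis
  then have "J g h f y = 0" using der[OF g h f y] by simp
  then have "J f g h y = 0" using cyc by metis
  then show "?br f (?br g h) y + ?br g (?br h f) y + ?br h (?br f g) y = 0" by (simp add: J_def)
qed

lemma sharp_vec:
  assumes y: "y \<in> P" shows "sharp Q bivec y \<eta> = N.vec (\<lambda>b. \<Sum>a<m. pi_coeff a b y * \<eta> (N.coord_field a y)) y"
proof
  fix f
  show "sharp Q bivec y \<eta> f = N.vec (\<lambda>b. \<Sum>a<m. pi_coeff a b y * \<eta> (N.coord_field a y)) y f"
  proof (cases "smooth_at Q y f")
    case True
    have "bivec y \<eta> (differential Q f y) = (\<Sum>a<m. \<Sum>b<m. pi_coeff a b y * \<eta> (N.coord_field a y) * N.coord_field b y f)"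
      unfolding bivec_def differential_def by (intro sum.cong refl) (use N_coord_field_tangent y in auto)
    also have "\<dots> = (\<Sum>b<m. \<Sum>a<m. pi_coeff a b y * \<eta> (N.coord_field a y) * N.coord_field b y f)" by (rule sum.swap)
    finally show ?thesis using True by (simp add: sharp_def N.vec_def Q_simps sum_distrib_right)
  next
    case False then show ?thesis by (simp add: sharp_def N.vec_def N.coord_field_def)
  qed
qed

text \<open>By \<open>mem_L_iff\<close>, membership in \<open>L\<close> says that the covector vanishes along the
  fibres, i.e. is the pullback of some \<open>\<eta>\<close>, and that the projected vector is
  \<open>\<pi>\<^sup>\<sharp> \<eta>\<close>.\<close>

lemma L_pullback:
  assumes y: "y \<in> D" shows "L y = pullback M Q proj (graph Q bivec) y"
proof -
  have py: "proj y \<in> P" by (rule proj_P[OF y])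
  have sharp_eq: "push_vec Q proj y u = sharp Q bivec (proj y) \<eta> \<longleftrightarrow>
      (\<forall>b<m. u (\<lambda>y. \<psi> y b) = (\<Sum>a<m. pi_coeff a b y * \<eta> (N.coord_field a (proj y))))"
    if u: "u \<in> tangent_space M y" for u \<eta>
  proof -
    have c: "sharp Q bivec (proj y) \<eta> (\<lambda>y. \<psi> y b) = (\<Sum>a<m. pi_coeff a b y * \<eta> (N.coord_field a (proj y)))" if b: "b < m" for b
      unfolding sharp_vec[OF py] using N.vec_psi[OF py, of b] b pi_coeff_proj[OF y _ b] by (simp add: Q_simps)
    have T: "sharp Q bivec (proj y) \<eta> \<in> tangent_space Q (proj y)"
      unfolding sharp_vec[OF py] by (rule N.vec_tangent[OF py])
    show ?thesis
    proof
      assume "push_vec Q proj y u = sharp Q bivec (proj y) \<eta>"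
      then show "\<forall>b<m. u (\<lambda>y. \<psi> y b) = (\<Sum>a<m. pi_coeff a b y * \<eta> (N.coord_field a (proj y)))"
        using push_psi[OF y u] c by metis
    next
      assume *: "\<forall>b<m. u (\<lambda>y. \<psi> y b) = (\<Sum>a<m. pi_coeff a b y * \<eta> (N.coord_field a (proj y)))"
      show "push_vec Q proj y u = sharp Q bivec (proj y) \<eta>"
        by (rule N.tan_eqI[OF push_tangent[OF y u] T py]) (use * c push_psi[OF y u] in \<open>simp add: Q_simps\<close>)
    qed
  qed
  have pull: "pull_covec M Q proj y \<eta> = cov (\<lambda>a. if a < m then \<eta> (N.coord_field a (proj y)) else 0) y"
    if \<eta>: "\<eta> \<in> cotangent_space Q (proj y)" for \<eta>
  proof
    fix v
    show "pull_covec M Q proj y \<eta> v = cov (\<lambda>a. if a < m then \<eta> (N.coord_field a (proj y)) else 0) y v"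
    proof (cases "v \<in> tangent_space M y")
      case True
      have "\<eta> (push_vec Q proj y v) = (\<Sum>a<m. push_vec Q proj y v (\<lambda>y. \<psi> y a) * \<eta> (N.coord_field a (proj y)))"
        using N.cot_expand[OF \<eta> push_tangent[OF y True] py] by (simp add: Q_simps)
      also have "\<dots> = (\<Sum>a<m. (if a < m then \<eta> (N.coord_field a (proj y)) else 0) * v (\<lambda>y. \<psi> y a))"
        by (rule sum.cong) (simp_all add: push_psi[OF y True])
      also have "\<dots> = (\<Sum>a<n. (if a < m then \<eta> (N.coord_field a (proj y)) else 0) * v (\<lambda>y. \<psi> y a))"
        by (rule sum.mono_neutral_left) (use m in auto)
      finally show ?thesis using True by (simp add: pull_covec_def cov_apply)
    qed (simp add: pull_covec_def cov_def)
  qed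
  show ?thesis
  proof (intro equalityI subsetI)
    fix e assume e: "e \<in> L y"
    obtain u \<xi> where e': "e = (u, \<xi>)" by (cases e)
    have r: "u \<in> tangent_space M y" "\<xi> \<in> cotangent_space M y" "\<forall>b. m \<le> b \<longrightarrow> b < n \<longrightarrow> \<xi> (coord_field b y) = 0"
      "\<forall>b<m. u (\<lambda>y. \<psi> y b) = (\<Sum>a<m. pi_coeff a b y * \<xi> (coord_field a y))"
      using mem_L_iff[OF y, of u \<xi>] e e' by auto
    define \<eta> where "\<eta> = N.cov (\<lambda>a. \<xi> (coord_field a y)) (proj y)"
    have \<eta>: "\<eta> \<in> cotangent_space Q (proj y)" unfolding \<eta>_def by (rule N.cov_cotangent)
    have \<eta>b: "\<eta> (N.coord_field a (proj y)) = \<xi> (coord_field a y)" if "a < m" for a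
      unfolding \<eta>_def by (rule N.cov_coord_field[OF py]) (simp add: Q_simps that)
    have "pull_covec M Q proj y \<eta> = \<xi>"
      unfolding pull[OF \<eta>]
      by (rule cot_eqI[OF cov_cotangent r(2) y]) (use r(3) \<eta>b in \<open>auto simp: cov_coord_field[OF y]\<close>)
    moreover have "push_vec Q proj y u = sharp Q bivec (proj y) \<eta>"
      unfolding sharp_eq[OF r(1)] using r(4) \<eta>b by simp
    ultimately show "e \<in> pullback M Q proj (graph Q bivec) y"
      using e' r(1) \<eta> unfolding pullback_def graph_def by blast
  next
    fix e assume "e \<in> pullback M Q proj (graph Q bivec) y"
    then obtain u \<eta> where e: "e = (u, pull_covec M Q proj y \<eta>)" and u: "u \<in> tangent_space M y"
      and \<eta>: "\<eta> \<in> cotangent_space Q (proj y)" and g: "push_vec Q proj y u = sharp Q bivec (proj y) \<eta>"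
      unfolding pullback_def graph_def by auto
    have "pull_covec M Q proj y \<eta> (coord_field a y) = (if a < m then \<eta> (N.coord_field a (proj y)) else 0)" if "a < n" for a
      unfolding pull[OF \<eta>] by (rule cov_coord_field[OF y that])
    moreover have "pull_covec M Q proj y \<eta> \<in> cotangent_space M y" unfolding pull[OF \<eta>] by (rule cov_cotangent)
    ultimately show "e \<in> L y"
      unfolding e mem_L_iff[OF y] using u g[unfolded sharp_eq[OF u]] m by auto
  qed
qed

end

section \<open>Local normal form of Dirac structures\<close>

theorem theoremC:
  fixes M :: "'a manifold" and L :: "'a \<Rightarrow> 'a dvec set" and x :: 'a
  assumes "smooth_manifold M"
    and "dirac_structure M L"
    and "x \<in> topspace (mtop M)"
  shows "\<exists>U (N :: 'a manifold) p \<pi> \<alpha>.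
     openin (mtop M) U \<and> x \<in> U \<and>
     smooth_manifold N \<and>
     surjective_submersion M U N p \<and>
     (\<forall>y \<in> topspace (mtop N). connectedin (mtop M) {z \<in> U. p z = y}) \<and>
     poisson_structure N \<pi> \<and>
     one_form M U \<alpha> \<and>
     (\<forall>z\<in>U. L z = gauge_transform (ext_deriv M \<alpha>) z ` pullback M N p (graph N \<pi>) z)"
proof -
  interpret manifold M by (unfold_locales) (rule assms(1))
  have L: "local_dirac (topspace (mtop M)) L" by (rule dirac_local[OF assms(2)])
  obtain D \<psi> \<kappa> where c: "coords M D \<psi> \<kappa>" and xD: "x \<in> D" by (rule coords_at[OF assms(3)])
  interpret c: coords M D \<psi> \<kappa> by (rule c)
  have orth: "L x = orthogonal_space M x (L x)" by (rule local_diracD(2)[OF L assms(3)])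
  obtain B where B: "\<forall>a b. B a b = - B b a"
    and ker: "(\<forall>u. (u, c.const_form B x u) \<in> L x \<longrightarrow> u = (\<lambda>_. 0)) \<or>
     (\<exists>k i. (k, c.const_form B x k) \<in> L x \<and> i < c.n \<and> k (\<lambda>y. \<psi> y i) \<noteq> 0 \<and>
        (\<forall>u. (u, c.const_form B x u) \<in> L x \<longrightarrow> u (\<lambda>y. \<psi> y i) = 0 \<longrightarrow> u = (\<lambda>_. 0)))"
    by (rule c.minimal_kernel[OF orth xD])
  \<comment> \<open>the gauge transformation of \<open>L\<close> by minus the constant form; its intersection with \<open>T\<^sub>xM\<close> is at most a line\<close>
  define L' where "L' y = c.ungauge B y ` L y" for y
  have "topspace (mtop M) \<inter> D = D" using c.D openin_subset by blast
  then have L': "local_dirac D L'"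
    using c.local_dirac_ungauge[OF B L] unfolding L'_def[abs_def] by simp
  have ker': "(u, \<lambda>_. 0) \<in> L' x \<longleftrightarrow> (u, c.const_form B x u) \<in> L x" for u
  proof
    assume "(u, \<lambda>_. 0) \<in> L' x"
    then obtain u' \<xi> where e: "(u', \<xi>) \<in> L x" "(u, \<lambda>_. 0) = c.ungauge B x (u', \<xi>)"
      unfolding L'_def by (elim imageE) (metis surj_pair)
    then have u: "u' = u" and \<xi>: "(\<lambda>v. \<xi> v - c.const_form B x u' v) = (\<lambda>_. 0)" by (simp_all add: c.ungauge_def)
    have "\<xi> v = c.const_form B x u v" for v using fun_cong[OF \<xi>, of v] u by simp
    then have "\<xi> = c.const_form B x u" by (rule ext)
    then show "(u, c.const_form B x u) \<in> L x" using e(1) u by simp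
  next
    assume "(u, c.const_form B x u) \<in> L x"
    then have "c.ungauge B x (u, c.const_form B x u) \<in> L' x" unfolding L'_def by (rule imageI)
    then show "(u, \<lambda>_. 0) \<in> L' x" by (simp add: c.ungauge_def)
  qed
  have orth': "L' x = orthogonal_space M x (L' x)" by (rule local_diracD(2)[OF L' xD])
  have "\<exists>U \<psi>' \<kappa>' m \<rho> s. dirac_chart M U \<psi>' \<kappa>' L' m \<rho> s \<and> x \<in> U \<and> U \<subseteq> D"
    using ker
  proof
    assume "\<forall>u. (u, c.const_form B x u) \<in> L x \<longrightarrow> u = (\<lambda>_. 0)"
    then show ?thesis by (intro dirac_chart_graph[OF L' xD]) (simp add: ker')
  next
    assume "\<exists>k i. (k, c.const_form B x k) \<in> L x \<and> i < c.n \<and> k (\<lambda>y. \<psi> y i) \<noteq> 0 \<and>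
        (\<forall>u. (u, c.const_form B x u) \<in> L x \<longrightarrow> u (\<lambda>y. \<psi> y i) = 0 \<longrightarrow> u = (\<lambda>_. 0))"
    then obtain k i where k: "(k, \<lambda>_. 0) \<in> L' x" "k (\<lambda>y. \<psi> y i) \<noteq> 0"
      and u0: "\<And>u. (u, \<lambda>_. 0) \<in> L' x \<Longrightarrow> u (\<lambda>y. \<psi> y i) = 0 \<Longrightarrow> u = (\<lambda>_. 0)"
      unfolding ker'[symmetric] by blast
    show ?thesis
    proof (rule dirac_chart_line[OF L' xD k(1)])
      show "k \<noteq> (\<lambda>_. 0)" using k(2) by auto
      fix u assume u: "(u, \<lambda>_. 0) \<in> L' x"
      define c where "c = u (\<lambda>y. \<psi> y i) / k (\<lambda>y. \<psi> y i)"
      have "(\<lambda>f. 1 * u f + (- c) * k f, \<lambda>w. 1 * 0 + (- c) * 0) \<in> L' x"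
        by (rule orthogonal_lin[OF orth' u k(1)])
      then have "(\<lambda>f. 1 * u f + (- c) * k f) = (\<lambda>_. 0)"
        by (intro u0) (use k(2) in \<open>simp_all add: c_def\<close>)
      then have "u f - c * k f = 0" for f by (simp add: fun_eq_iff)
      then show "\<exists>c. u = (\<lambda>f. c * k f)" by (intro exI[of _ c] ext) (simp add: algebra_simps)
    qed
  qed
  then obtain U \<psi>' \<kappa>' m \<rho> s where dc: "dirac_chart M U \<psi>' \<kappa>' L' m \<rho> s" and U: "x \<in> U" "U \<subseteq> D"
    by (elim exE conjE)
  interpret d: dirac_chart M U \<psi>' \<kappa>' L' m \<rho> s by (rule dc)
  have gauge: "L z = gauge_transform (ext_deriv M (c.const_pot B)) z ` L' z" if z: "z \<in> U" for z
  proof -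
    have zD: "z \<in> D" using z U by blast
    have inv: "gauge_transform (ext_deriv M (c.const_pot B)) z (c.ungauge B z e) = e" if e: "e \<in> L z" for e
    proof -
      have "L z = orthogonal_space M z (L z)" by (rule local_diracD(2)[OF L c.D_top[OF zD]])
      then have "e \<in> orthogonal_space M z (L z)" using e by blast
      then have T: "fst e \<in> tangent_space M z" by (auto simp: orthogonal_space_def double_space_def)
      have "ext_deriv M (c.const_pot B) z (fst e) v = c.const_form B z (fst e) v" for v
        using c.ext_deriv_const_pot[OF B zD T, of v] c.const_form_outside[of v z B "fst e"]
        by (cases "v \<in> tangent_space M z") (auto simp: ext_deriv_def)
      then show ?thesis by (simp add: gauge_transform_def c.ungauge_def case_prod_beta)
    qed
    then show ?thesis unfolding L'_def image_image by (simp cong: image_cong)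
  qed
  show ?thesis
  proof (rule exI[of _ U], rule exI[of _ d.Q], rule exI[of _ d.proj], rule exI[of _ d.bivec], rule exI[of _ "c.const_pot B"], intro conjI)
    show "openin (mtop M) U" by (rule d.D)
    show "x \<in> U" by (rule U(1))
    show "smooth_manifold d.Q" by (rule d.Q_coords(1))
    show "surjective_submersion M U d.Q d.proj" by (rule d.proj_submersion)
    show "\<forall>y\<in>topspace (mtop d.Q). connectedin (mtop M) {z \<in> U. d.proj z = y}"
      using d.proj_fibres by (simp add: d.Q_simps)
    show "poisson_structure d.Q d.bivec" by (rule d.poisson_bivec)
    show "one_form M U (c.const_pot B)" by (rule of_subset[OF c.const_pot_one_form d.D U(2)])
    show "\<forall>z\<in>U. L z = gauge_transform (ext_deriv M (c.const_pot B)) z ` pullback M d.Q d.proj (graph d.Q d.bivec) z"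
      using gauge d.L_pullback by simp
  qed
qed

end
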